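(* Assume that there exists $\delta\in(0,\infty)$ such that $P$-a.s. for all $t\in[0,T]$, $\eta_t\ge\delta\,\mathrm{Id}$; that for all $0\le s\le t\le T$ it holds $E[\|\eta_t\|]<\infty$ and $E[\|\eta_s^{-1}\eta_t\|]<\infty$; that $$E\Big[\|\eta_T\|^2+\int_0^T\big(\|\eta_r\|^2+\|\eta_r^{-1}\|\big)dr\Big]<\infty ;$$ and that $\eta$ has uncorrelated multiplicative increments. Let $(Y,Z)$ be the supersolution of the singular BSDE $dY_t=Y_t\eta_t^{-1}Y_t\,dt+Z_tdW_t$, $t\in[0,T)$, $Y_T=\infty\mathbf 1_{C^c}+\theta\mathbf 1_C$ with $C=\{0\}$, whose first component is $$Y_t=\Big(\int_t^T\big(E[\eta_s|\mathcal F_t]\big)^{-1}ds\Big)^{-1},\quad t\in[0,T).$$ Then: (i) Let $x\in\mathbb R^d$, $t\in[0,T)$, and let $u_s=(E[\eta_s])^{-1}\big(\int_t^T(E[\eta_r])^{-1}dr\big)^{-1}x$ for $s\in[t,T)$. Then $u$ is the unique optimal control for $v(t,x)$, and $v(t,x)=\langle x,Y_tx\rangle$. (ii) $(Y,Z)$ is the minimal supersolution of the singular BSDE.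
   Context: Setting: $d\in\mathbb N$, $T\in(0,\infty)$, $(\Omega,\mathcal F,P)$ is a probability space supporting a one-dimensional Brownian motion $W$, $(\mathcal F_t)_{t\in[0,T]}$ is the completed filtration generated by $W$. $\mathbb S^d,\mathbb S^d_+,\mathbb S^d_{++}$ are the sets of symmetric, symmetric positive semidefinite, symmetric positive definite real $d\times d$ matrices; $\|\cdot\|$ is the Frobenius norm of a matrix (Euclidean norm of a vector); for symmetric matrices $M\ge N$ means $M-N$ is positive semidefinite. $\eta:[0,T]\times\Omega\to\mathbb S^d_{++}$ is progressively measurable and $\theta$ is an $\mathcal F_T$-measurable $\mathbb S^d_+$-valued random variable. (This is the case of the general problem in which the state cost $\lambda$, the cross cost $\phi$ and the drift matrix $A$ vanish and the terminal constraint subspace is $C=\{0\}$.) $\eta$ has uncorrelated multiplicative increments if for all $0\le s\le t\le T$, $E[\eta_s^{-1}\eta_t\,|\,\mathcal F_s]=E[\eta_s^{-1}\eta_t]$. Control problem: $\mathcal A_0(t,x)$ is the set of progressively measurable $u:[t,T]\times\Omega\to\mathbb R^d$ with $u\in L^1([t,T])$ $P$-a.s. whose state process $X^u_s=x-\int_t^su_rdr$, $s\in[t,T]$, satisfies $X^u_T=0$ $P$-a.s.; $J(t,x,u)=E[\int_t^T\langle u_s,\eta_su_s\rangle ds+\langle X^u_T,\theta X^u_T\rangle\,|\,\mathcal F_t]$; $v(t,x)=\operatorname{ess\,inf}_{u\in\mathcal A_0(t,x)}J(t,x,u)$. A control is optimal if it attains $v(t,x)$; uniqueness is up to $\mathrm{Leb}\otimes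 P$-null sets. Supersolution: a pair of progressively measurable processes $(Y,Z):[0,T)\times\Omega\to\mathbb S^d_+\times\mathbb S^d$ such that for all $t\in[0,T)$ $E[\sup_{s\in[0,t]}\|Y_s\|^2+\int_0^t\|Z_s\|^2ds]<\infty$; $P$-a.s. for all $0\le s\le t<T$, $Y_t-Y_s=\int_s^tY_r\eta_r^{-1}Y_rdr+\int_s^tZ_rdW_r$; and for any $\mathbb R^d$-valued process $(\psi_t)_{t\in[0,T]}$ whose paths are $P$-a.s. left-continuous at $T$ it holds $P$-a.s. that $\liminf_{t\to T}\langle\psi_t,Y_t\psi_t\rangle=\infty$ if $\psi_T\ne0$ and $\liminf_{t\to T}\langle\psi_t,Y_t\psi_t\rangle\ge\langle\psi_T,\theta\psi_T\rangle=0$ if $\psi_T=0$. A supersolution $(Y,Z)$ is minimal if every supersolution $(Y',Z')$ satisfies $P$-a.s. $Y'_t\ge Y_t$ for all $t\in[0,T)$. *)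

theory Defs
  imports "HOL-Probability.Probability"
begin

section \<open>Symmetric matrices\<close>

text \<open>The order on \<^typ>\<open>real^'n^'n\<close> provided by the library is componentwise, hence the separate
  Loewner order below. The library norm on this type is the Frobenius norm.\<close>

definition sym_mat :: "real^'n^'n \<Rightarrow> bool" where
  "sym_mat A \<longleftrightarrow> transpose A = A"

definition psd :: "real^'n^'n \<Rightarrow> bool" where
  "psd A \<longleftrightarrow> sym_mat A \<and> (\<forall>x. 0 \<le> x \<bullet> (A *v x))"

definition spd :: "real^'n^'n \<Rightarrow> bool" where
  "spd A \<longleftrightarrow> sym_mat A \<and> (\<forall>x. x \<noteq> 0 \<longrightarrow> 0 < x \<bullet> (A *v x))"

definition loewner_le :: "real^'n^'n \<Rightarrow> real^'n^'n \<Rightarrow> bool" where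
  "loewner_le A B \<longleftrightarrow> psd (B - A)"


section \<open>Brownian motion, its completed filtration, progressive measurability\<close>

definition brownian_motion :: "'a measure \<Rightarrow> real \<Rightarrow> (real \<Rightarrow> 'a \<Rightarrow> real) \<Rightarrow> bool" where
  "brownian_motion M T W \<longleftrightarrow>
     (\<forall>t\<in>{0..T}. W t \<in> borel_measurable M) \<and>
     (AE \<omega> in M. W 0 \<omega> = 0) \<and>
     (AE \<omega> in M. continuous_on {0..T} (\<lambda>t. W t \<omega>)) \<and>
     (\<forall>s t. 0 \<le> s \<and> s < t \<and> t \<le> T \<longrightarrow>
        distributed M lborel (\<lambda>\<omega>. W t \<omega> - W s \<omega>) (normal_density 0 (sqrt (t - s)))) \<and>
     (\<forall>(n::nat) \<tau>. 0 \<le> \<tau> 0 \<and> (\<forall>i<n. \<tau> i < \<tau> (Suc i)) \<and> \<tau> n \<le> T \<longrightarrow>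
        prob_space.indep_vars M (\<lambda>_. borel) (\<lambda>i \<omega>. W (\<tau> (Suc i)) \<omega> - W (\<tau> i) \<omega>) {..<n})"

text \<open>For a complete \<open>M\<close> this is the usual completion of the filtration generated by \<open>W\<close>.\<close>

definition bm_filtration :: "'a measure \<Rightarrow> (real \<Rightarrow> 'a \<Rightarrow> real) \<Rightarrow> real \<Rightarrow> 'a measure" where
  "bm_filtration M W t =
     sigma (space M)
       ({W s -` B \<inter> space M | s B. 0 \<le> s \<and> s \<le> t \<and> B \<in> sets borel} \<union> null_sets M)"

definition prog_measurable ::
    "(real \<Rightarrow> 'a measure) \<Rightarrow> real set \<Rightarrow> (real \<Rightarrow> 'a \<Rightarrow> 'b::topological_space) \<Rightarrow> bool" where
  "prog_measurable F I X \<longleftrightarrow>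
     (\<forall>t\<in>I. (\<lambda>(s, \<omega>). X s \<omega>) \<in> borel_measurable (restrict_space borel (I \<inter> {..t}) \<Otimes>\<^sub>M F t))"


section \<open>The Ito integral\<close>

text \<open>The triple \<open>(n, \<tau>, \<xi>)\<close> encodes the simple process
  \<open>\<Sum>i<n. \<xi> i \<cdot> indicator (\<tau> i, \<tau> (i+1)]\<close> on \<open>[0, t]\<close>.\<close>

definition simple_process ::
    "(real \<Rightarrow> 'a measure) \<Rightarrow> real \<Rightarrow> nat \<Rightarrow> (nat \<Rightarrow> real) \<Rightarrow> (nat \<Rightarrow> 'a \<Rightarrow> 'b::euclidean_space) \<Rightarrow> bool"
  where
  "simple_process F t n \<tau> \<xi> \<longleftrightarrow>
     0 \<le> \<tau> 0 \<and> (\<forall>i<n. \<tau> i \<le> \<tau> (Suc i)) \<and> \<tau> n \<le> t \<and>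
     (\<forall>i<n. \<xi> i \<in> borel_measurable (F (\<tau> i)) \<and> bounded (\<xi> i ` space (F (\<tau> i))))"

definition simple_val ::
    "nat \<Rightarrow> (nat \<Rightarrow> real) \<Rightarrow> (nat \<Rightarrow> 'a \<Rightarrow> 'b::euclidean_space) \<Rightarrow> real \<Rightarrow> 'a \<Rightarrow> 'b" where
  "simple_val n \<tau> \<xi> r \<omega> = (\<Sum>i<n. indicator {\<tau> i<..\<tau> (Suc i)} r *\<^sub>R \<xi> i \<omega>)"

definition simple_integral_dW ::
    "(real \<Rightarrow> 'a \<Rightarrow> real) \<Rightarrow> nat \<Rightarrow> (nat \<Rightarrow> real) \<Rightarrow> (nat \<Rightarrow> 'a \<Rightarrow> 'b::euclidean_space) \<Rightarrow> 'a \<Rightarrow> 'b" where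
  "simple_integral_dW W n \<tau> \<xi> \<omega> = (\<Sum>i<n. (W (\<tau> (Suc i)) \<omega> - W (\<tau> i) \<omega>) *\<^sub>R \<xi> i \<omega>)"

text \<open>\<open>I\<close> is a continuous version of the process \<open>\<integral>\<^sub>0\<^sup>t Z dW\<close>, \<open>t \<in> [0, T)\<close>: for each \<open>t\<close>, \<open>I t\<close> is
  the \<open>L\<^sup>2\<close>-limit of integrals of simple processes that converge to \<open>Z\<close> in \<open>L\<^sup>2([0, t] \<times> \<Omega>)\<close>.
  This determines \<open>I\<close> up to indistinguishability.\<close>

definition ito_integral ::
    "'a measure \<Rightarrow> (real \<Rightarrow> 'a \<Rightarrow> real) \<Rightarrow> real \<Rightarrow> (real \<Rightarrow> 'a \<Rightarrow> 'b::euclidean_space)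
      \<Rightarrow> (real \<Rightarrow> 'a \<Rightarrow> 'b) \<Rightarrow> bool" where
  "ito_integral M W T Z I \<longleftrightarrow>
     (\<forall>t\<in>{0..<T}. I t \<in> borel_measurable (bm_filtration M W t)) \<and>
     (AE \<omega> in M. continuous_on {0..<T} (\<lambda>t. I t \<omega>)) \<and>
     (\<forall>t\<in>{0..<T}. \<exists>n \<tau> \<xi>.
        (\<forall>k::nat. simple_process (bm_filtration M W) t (n k) (\<tau> k) (\<xi> k)) \<and>
        (\<lambda>k. \<integral>\<^sup>+\<omega>. (\<integral>\<^sup>+r\<in>{0..t}. ennreal ((norm (simple_val (n k) (\<tau> k) (\<xi> k) r \<omega> - Z r \<omega>))\<^sup>2) \<partial>lborel) \<partial>M)
          \<longlonglongrightarrow> 0 \<and>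
        (\<lambda>k. \<integral>\<^sup>+\<omega>. ennreal ((norm (simple_integral_dW W (n k) (\<tau> k) (\<xi> k) \<omega> - I t \<omega>))\<^sup>2) \<partial>M)
          \<longlonglongrightarrow> 0)"


section \<open>Conditional expectations and uncorrelated multiplicative increments\<close>

definition mat_cond_exp ::
    "'a measure \<Rightarrow> 'a measure \<Rightarrow> ('a \<Rightarrow> real^'n^'n) \<Rightarrow> 'a \<Rightarrow> real^'n^'n" where
  "mat_cond_exp M G X \<omega> = (\<chi> i j. real_cond_exp M G (\<lambda>\<omega>'. X \<omega>' $ i $ j) \<omega>)"

definition uncorrelated_mult_increments ::
    "'a measure \<Rightarrow> (real \<Rightarrow> 'a \<Rightarrow> real) \<Rightarrow> real \<Rightarrow> (real \<Rightarrow> 'a \<Rightarrow> real^'n^'n) \<Rightarrow> bool" where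
  "uncorrelated_mult_increments M W T \<eta> \<longleftrightarrow>
     (\<forall>s t. 0 \<le> s \<and> s \<le> t \<and> t \<le> T \<longrightarrow>
        (AE \<omega> in M. mat_cond_exp M (bm_filtration M W s) (\<lambda>\<omega>'. matrix_inv (\<eta> s \<omega>') ** \<eta> t \<omega>') \<omega>
                  = (LINT \<omega>'|M. matrix_inv (\<eta> s \<omega>') ** \<eta> t \<omega>')))"

text \<open>\<open>Y t = (\<integral>\<^sub>t\<^sup>T (E[\<eta> s | F t])\<^sup>-\<^sup>1 ds)\<^sup>-\<^sup>1\<close> almost surely, for each \<open>t \<in> [0, T)\<close>. Conditional expectations are
  fixed only up to null sets for each single \<open>s\<close>, so the pathwise integral over \<open>s\<close> is taken for a
  version \<open>m s\<close> of \<open>E[\<eta> s | F t]\<close> that is jointly measurable in \<open>(s, \<omega>)\<close>; by Fubini, the integral does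
  not depend on that version, up to null sets.\<close>

definition inv_int_inv_cond_exp ::
    "'a measure \<Rightarrow> (real \<Rightarrow> 'a \<Rightarrow> real) \<Rightarrow> real \<Rightarrow> (real \<Rightarrow> 'a \<Rightarrow> real^'n^'n) \<Rightarrow> (real \<Rightarrow> 'a \<Rightarrow> real^'n^'n) \<Rightarrow> bool"
  where
  "inv_int_inv_cond_exp M W T \<eta> Y \<longleftrightarrow>
     (\<forall>t\<in>{0..<T}. \<exists>m.
        (\<lambda>(s, \<omega>). m s \<omega>) \<in> borel_measurable (restrict_space borel {t..T} \<Otimes>\<^sub>M bm_filtration M W t) \<and>
        (\<forall>s\<in>{t..T}. AE \<omega> in M. m s \<omega> = mat_cond_exp M (bm_filtration M W t) (\<eta> s) \<omega>) \<and>
        (AE \<omega> in M. Y t \<omega> = matrix_inv (LINT s:{t..T}|lborel. matrix_inv (m s \<omega>))))"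


section \<open>The control problem\<close>

definition state_process ::
    "real \<Rightarrow> real^'n \<Rightarrow> (real \<Rightarrow> 'a \<Rightarrow> real^'n) \<Rightarrow> real \<Rightarrow> 'a \<Rightarrow> real^'n" where
  "state_process t x u s \<omega> = x - (LINT r:{t..s}|lborel. u r \<omega>)"

definition admissible ::
    "'a measure \<Rightarrow> (real \<Rightarrow> 'a \<Rightarrow> real) \<Rightarrow> real \<Rightarrow> real \<Rightarrow> real^'n \<Rightarrow> (real \<Rightarrow> 'a \<Rightarrow> real^'n) set" where
  "admissible M W T t x =
     {u. prog_measurable (bm_filtration M W) {t..T} u \<and>
         (AE \<omega> in M. set_integrable lborel {t..T} (\<lambda>s. u s \<omega>)) \<and>
         (AE \<omega> in M. state_process t x u T \<omega> = 0)}"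

definition cost ::
    "'a measure \<Rightarrow> (real \<Rightarrow> 'a \<Rightarrow> real) \<Rightarrow> real \<Rightarrow> (real \<Rightarrow> 'a \<Rightarrow> real^'n^'n) \<Rightarrow> ('a \<Rightarrow> real^'n^'n)
      \<Rightarrow> real \<Rightarrow> real^'n \<Rightarrow> (real \<Rightarrow> 'a \<Rightarrow> real^'n) \<Rightarrow> 'a \<Rightarrow> ennreal" where
  "cost M W T \<eta> \<theta> t x u =
     nn_cond_exp M (bm_filtration M W t)
       (\<lambda>\<omega>. (\<integral>\<^sup>+s\<in>{t..T}. ennreal (u s \<omega> \<bullet> (\<eta> s \<omega> *v u s \<omega>)) \<partial>lborel)
           + ennreal (state_process t x u T \<omega> \<bullet> (\<theta> \<omega> *v state_process t x u T \<omega>)))"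

definition is_ess_inf :: "'a measure \<Rightarrow> ('a \<Rightarrow> ennreal) set \<Rightarrow> ('a \<Rightarrow> ennreal) \<Rightarrow> bool" where
  "is_ess_inf M A f \<longleftrightarrow>
     f \<in> borel_measurable M \<and>
     (\<forall>g\<in>A. AE \<omega> in M. f \<omega> \<le> g \<omega>) \<and>
     (\<forall>h\<in>borel_measurable M. (\<forall>g\<in>A. AE \<omega> in M. h \<omega> \<le> g \<omega>) \<longrightarrow> (AE \<omega> in M. h \<omega> \<le> f \<omega>))"

text \<open>The essential infimum is determined up to null sets; \<open>SOME\<close> picks one version.\<close>

definition ess_inf :: "'a measure \<Rightarrow> ('a \<Rightarrow> ennreal) set \<Rightarrow> 'a \<Rightarrow> ennreal" where
  "ess_inf M A = (SOME f. is_ess_inf M A f)"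

lemma ess_inf_unique:
  assumes "is_ess_inf M A f"
  shows "AE \<omega> in M. ess_inf M A \<omega> = f \<omega>"
proof -
  have e: "is_ess_inf M A (ess_inf M A)"
    unfolding ess_inf_def by (rule someI[of "is_ess_inf M A", OF assms])
  have "AE \<omega> in M. ess_inf M A \<omega> \<le> f \<omega>" "AE \<omega> in M. f \<omega> \<le> ess_inf M A \<omega>"
    using e assms unfolding is_ess_inf_def by blast+
  then show ?thesis by eventually_elim (rule antisym)
qed

definition value_fn ::
    "'a measure \<Rightarrow> (real \<Rightarrow> 'a \<Rightarrow> real) \<Rightarrow> real \<Rightarrow> (real \<Rightarrow> 'a \<Rightarrow> real^'n^'n) \<Rightarrow> ('a \<Rightarrow> real^'n^'n)
      \<Rightarrow> real \<Rightarrow> real^'n \<Rightarrow> 'a \<Rightarrow> ennreal" where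
  "value_fn M W T \<eta> \<theta> t x = ess_inf M (cost M W T \<eta> \<theta> t x ` admissible M W T t x)"

definition optimal_control ::
    "'a measure \<Rightarrow> (real \<Rightarrow> 'a \<Rightarrow> real) \<Rightarrow> real \<Rightarrow> (real \<Rightarrow> 'a \<Rightarrow> real^'n^'n) \<Rightarrow> ('a \<Rightarrow> real^'n^'n)
      \<Rightarrow> real \<Rightarrow> real^'n \<Rightarrow> (real \<Rightarrow> 'a \<Rightarrow> real^'n) \<Rightarrow> bool" where
  "optimal_control M W T \<eta> \<theta> t x u \<longleftrightarrow>
     u \<in> admissible M W T t x \<and>
     (AE \<omega> in M. cost M W T \<eta> \<theta> t x u \<omega> = value_fn M W T \<eta> \<theta> t x \<omega>)"

definition unique_optimal_control ::
    "'a measure \<Rightarrow> (real \<Rightarrow> 'a \<Rightarrow> real) \<Rightarrow> real \<Rightarrow> (real \<Rightarrow> 'a \<Rightarrow> real^'n^'n) \<Rightarrow> ('a \<Rightarrow> real^'n^'n)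
      \<Rightarrow> real \<Rightarrow> real^'n \<Rightarrow> (real \<Rightarrow> 'a \<Rightarrow> real^'n) \<Rightarrow> bool" where
  "unique_optimal_control M W T \<eta> \<theta> t x u \<longleftrightarrow>
     optimal_control M W T \<eta> \<theta> t x u \<and>
     (\<forall>u'. optimal_control M W T \<eta> \<theta> t x u' \<longrightarrow>
        (AE (s, \<omega>) in restrict_space lborel {t..T} \<Otimes>\<^sub>M M. u' s \<omega> = u s \<omega>))"


section \<open>The singular BSDE with terminal constraint \<open>C = {0}\<close>\<close>

text \<open>Integrability of the drift is stated explicitly because the library integral of a
  non-integrable function is \<open>0\<close>.\<close>

definition supersolution ::
    "'a measure \<Rightarrow> (real \<Rightarrow> 'a \<Rightarrow> real) \<Rightarrow> real \<Rightarrow> (real \<Rightarrow> 'a \<Rightarrow> real^'n^'n) \<Rightarrow> ('a \<Rightarrow> real^'n^'n)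
      \<Rightarrow> (real \<Rightarrow> 'a \<Rightarrow> real^'n^'n) \<Rightarrow> (real \<Rightarrow> 'a \<Rightarrow> real^'n^'n) \<Rightarrow> bool" where
  "supersolution M W T \<eta> \<theta> Y Z \<longleftrightarrow>
     prog_measurable (bm_filtration M W) {0..<T} Y \<and>
     prog_measurable (bm_filtration M W) {0..<T} Z \<and>
     (\<forall>t\<in>{0..<T}. \<forall>\<omega>\<in>space M. psd (Y t \<omega>) \<and> sym_mat (Z t \<omega>)) \<and>
     (\<forall>t\<in>{0..<T}.
        (\<integral>\<^sup>+\<omega>. (SUP s\<in>{0..t}. ennreal ((norm (Y s \<omega>))\<^sup>2))
            + (\<integral>\<^sup>+s\<in>{0..t}. ennreal ((norm (Z s \<omega>))\<^sup>2) \<partial>lborel) \<partial>M) < \<infinity>) \<and>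
     (\<exists>I. ito_integral M W T Z I \<and>
        (AE \<omega> in M. \<forall>s t. 0 \<le> s \<and> s \<le> t \<and> t < T \<longrightarrow>
           set_integrable lborel {s..t} (\<lambda>r. Y r \<omega> ** matrix_inv (\<eta> r \<omega>) ** Y r \<omega>) \<and>
           Y t \<omega> - Y s \<omega> = (LINT r:{s..t}|lborel. Y r \<omega> ** matrix_inv (\<eta> r \<omega>) ** Y r \<omega>)
                            + (I t \<omega> - I s \<omega>))) \<and>
     (\<forall>\<psi>. (\<forall>t\<in>{0..T}. \<psi> t \<in> borel_measurable M) \<and>
          (AE \<omega> in M. ((\<lambda>t. \<psi> t \<omega>) \<longlongrightarrow> \<psi> T \<omega>) (at_left T)) \<longrightarrow>
        (AE \<omega> in M.
           (\<psi> T \<omega> \<noteq> 0 \<longrightarrow>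
              Liminf (at_left T) (\<lambda>t. ereal (\<psi> t \<omega> \<bullet> (Y t \<omega> *v \<psi> t \<omega>))) = \<infinity>) \<and>
           (\<psi> T \<omega> = 0 \<longrightarrow>
              Liminf (at_left T) (\<lambda>t. ereal (\<psi> t \<omega> \<bullet> (Y t \<omega> *v \<psi> t \<omega>)))
                \<ge> ereal (\<psi> T \<omega> \<bullet> (\<theta> \<omega> *v \<psi> T \<omega>)))))"

definition minimal_supersolution ::
    "'a measure \<Rightarrow> (real \<Rightarrow> 'a \<Rightarrow> real) \<Rightarrow> real \<Rightarrow> (real \<Rightarrow> 'a \<Rightarrow> real^'n^'n) \<Rightarrow> ('a \<Rightarrow> real^'n^'n)
      \<Rightarrow> (real \<Rightarrow> 'a \<Rightarrow> real^'n^'n) \<Rightarrow> (real \<Rightarrow> 'a \<Rightarrow> real^'n^'n) \<Rightarrow> bool" where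
  "minimal_supersolution M W T \<eta> \<theta> Y Z \<longleftrightarrow>
     supersolution M W T \<eta> \<theta> Y Z \<and>
     (\<forall>Y' Z'. supersolution M W T \<eta> \<theta> Y' Z' \<longrightarrow>
        (AE \<omega> in M. \<forall>t\<in>{0..<T}. loewner_le (Y t \<omega>) (Y' t \<omega>)))"

end

theory Submission
  imports Defs
begin

text \<open>
The proof rests on one martingale. Write \<open>G(t) = \<integral>\<^sub>t\<^sup>T E[\<eta>\<^sub>r]\<^sup>-\<^sup>1 dr\<close>. If \<open>\<eta>\<close> has uncorrelated multiplicative
increments, then \<open>D\<^sub>t = \<eta>\<^sub>t E[\<eta>\<^sub>t]\<^sup>-\<^sup>1\<close> is a martingale (\<open>D_martingale\<close>). Hence \<open>E[\<eta>\<^sub>s | F\<^sub>t] = D\<^sub>t E[\<eta>\<^sub>s]\<close>, and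
the formula for \<open>Y\<close> becomes \<open>Y\<^sub>t = D\<^sub>t G(t)\<^sup>-\<^sup>1\<close> (\<open>inv_int_inv_cond_exp_eq\<close>).

Optimal control. Put \<open>y = G(t)\<^sup>-\<^sup>1 x\<close>. The control \<open>u\<^sub>s = E[\<eta>\<^sub>s]\<^sup>-\<^sup>1 y\<close> satisfies \<open>\<eta>\<^sub>s u\<^sub>s = D\<^sub>s y\<close>, a martingale
with square integrable terminal value \<open>D\<^sub>T y\<close>. Another admissible control of finite cost is \<open>u + h\<close>
with \<open>\<integral>\<^sub>t\<^sup>T h\<^sub>s ds = 0\<close>, so that for every event \<open>A\<close> of \<open>F\<^sub>t\<close>
\<open>E[1\<^sub>A \<integral>\<^sub>t\<^sup>T \<langle>h\<^sub>s, \<eta>\<^sub>s u\<^sub>s\<rangle> ds] = E[1\<^sub>A \<langle>\<integral>\<^sub>t\<^sup>T h\<^sub>s ds, D\<^sub>T y\<rangle>] = 0\<close>.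
The costs of \<open>u\<close> and \<open>h\<close> therefore add up (\<open>energy_decomposition\<close>), which gives optimality and
uniqueness. The cost of \<open>u\<close> itself is \<open>\<langle>x, D\<^sub>t y\<rangle> = \<langle>x, Y\<^sub>t x\<rangle>\<close>.

Minimality. Let \<open>Y'\<close> be a supersolution. The argument uses the representation
\<open>\<langle>v, R\<^sup>-\<^sup>1 v\<rangle> = sup\<^sub>p (2\<langle>p, v\<rangle> - \<langle>p, R p\<rangle>)\<close>. Let \<open>V\<close> be a bounded random vector, \<open>N\<^sub>s = E[V | F\<^sub>s]\<close> and
\<open>\<phi>(s) = E[1\<^sub>A \<langle>N\<^sub>s, Y'\<^sub>s\<^sup>-\<^sup>1 N\<^sub>s\<rangle>]\<close>. A direction \<open>p\<close> that is known at time \<open>s\<close> can be kept fixed after \<open>s\<close>: then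
\<open>\<langle>p, N\<rangle>\<close> is a martingale and \<open>\<langle>p, Y' p\<rangle>\<close> grows in mean by its drift alone (\<open>expected_growth\<close>). With the
maximiser \<open>p = Y'\<^sub>s\<^sup>-\<^sup>1 N\<^sub>s\<close> on ever shorter intervals this shows that \<open>\<phi>\<close> decreases at most at the rate
\<open>E[1\<^sub>A \<langle>N\<^sub>r, \<eta>\<^sub>r\<^sup>-\<^sup>1 N\<^sub>r\<rangle>]\<close>. The explosion of \<open>Y'\<close> at \<open>T\<close> forces \<open>\<phi>(s) \<rightarrow> 0\<close> as \<open>s \<rightarrow> T\<close>, and so
\<open>\<phi>(t) \<le> \<integral>\<^sub>t\<^sup>T E[1\<^sub>A \<langle>N\<^sub>r, \<eta>\<^sub>r\<^sup>-\<^sup>1 N\<^sub>r\<rangle>] dr\<close> (\<open>dual_inequality\<close>). Now let \<open>V\<close> approach \<open>D\<^sub>T y\<close>, so that \<open>N\<^sub>r\<close>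
approaches \<open>D\<^sub>r y\<close>. The right-hand side tends to \<open>\<integral>\<^sub>t\<^sup>T E[1\<^sub>A \<langle>D\<^sub>r y, E[\<eta>\<^sub>r]\<^sup>-\<^sup>1 y\<rangle>] dr = E[1\<^sub>A \<langle>x, Y\<^sub>t x\<rangle>]\<close>,
and the left-hand side is at least \<open>E[1\<^sub>A (2\<langle>x, D\<^sub>t y\<rangle> - \<langle>x, Y'\<^sub>t x\<rangle>)] = E[1\<^sub>A (2\<langle>x, Y\<^sub>t x\<rangle> - \<langle>x, Y'\<^sub>t x\<rangle>)]\<close>
in the limit. Hence \<open>E[1\<^sub>A \<langle>x, Y\<^sub>t x\<rangle>] \<le> E[1\<^sub>A \<langle>x, Y'\<^sub>t x\<rangle>]\<close> for all \<open>x\<close>, \<open>t\<close> and \<open>A\<close>.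

That \<open>Y'\<close> is invertible, with an inverse bounded uniformly in time, comes from the same inequality,
applied to \<open>Y' + \<epsilon> Id\<close> and a constant \<open>V\<close> (\<open>Y_coercive\<close>).
\<close>

section \<open>Matrices as quadratic forms\<close>

lemma matrix_inv_right: "invertible (A::real^'n^'n) \<Longrightarrow> A ** matrix_inv A = mat 1"
  and matrix_inv_left: "invertible A \<Longrightarrow> matrix_inv A ** A = mat 1"
  unfolding invertible_def matrix_inv_def
  by (metis (mono_tags, lifting) someI_ex)+

lemma matrix_inv_unique:
  fixes A B :: "real^'n^'n"
  assumes "A ** B = mat 1"
  shows "matrix_inv A = B"
proof -
  have "invertible A" using assms invertible_right_inverse by blast
  then have "matrix_inv A ** (A ** B) = B"
    by (simp add: matrix_mul_assoc matrix_inv_left)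
  then show ?thesis using assms by simp
qed

text \<open>Cramer's rule exhibits the entries of the inverse as quotients of determinants, which are
  measurable functions of the matrix.\<close>

lemma matrix_inv_entry:
  fixes A :: "real^'n^'n"
  assumes "det A \<noteq> 0"
  shows "matrix_inv A = (\<chi> i j. det (\<chi> a b. if b = i then axis j 1 $ a else A $ a $ b) / det A)"
proof -
  have inv: "A ** matrix_inv A = mat 1" using assms by (simp add: invertible_det_nz matrix_inv_right)
  have "(matrix_inv A) $ i $ j = det (\<chi> a b. if b = i then axis j 1 $ a else A $ a $ b) / det A" for i j
  proof -
    have "A *v (matrix_inv A *v axis j 1) = axis j 1"
      by (simp add: matrix_vector_mul_assoc inv)
    then have "matrix_inv A *v axis j 1 = (\<chi> k. det (\<chi> a b. if b = k then axis j 1 $ a else A $ a $ b) / det A)"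
      using cramer[OF assms] by blast
    then show ?thesis
      by (metis (no_types, lifting) matrix_vector_mult_basis column_def vec_lambda_beta)
  qed
  then show ?thesis by (simp add: vec_eq_iff)
qed

lemma borel_measurable_vecI:
  fixes f :: "'a \<Rightarrow> ('b::euclidean_space)^'n"
  assumes "\<And>i. (\<lambda>x. f x $ i) \<in> borel_measurable M"
  shows "f \<in> borel_measurable M"
proof -
  show ?thesis
  proof (rule borel_measurable_euclidean_space[THEN iffD2], rule ballI)
    fix b :: "'b^'n" assume "b \<in> Basis"
    then obtain j u where b: "b = axis j u" unfolding Basis_vec_def by auto
    show "(\<lambda>x. f x \<bullet> b) \<in> borel_measurable M"
      unfolding b inner_axis by (rule borel_measurable_inner[OF assms borel_measurable_const])
  qed
qed

lemma borel_measurable_vec_nth [measurable (raw)]: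
  fixes f :: "'a \<Rightarrow> ('b::euclidean_space)^'n"
  assumes "f \<in> borel_measurable M"
  shows "(\<lambda>x. f x $ i) \<in> borel_measurable M"
  by (rule measurable_compose[OF assms])
     (intro borel_measurable_continuous_onI continuous_intros)

lemma borel_measurable_det [measurable (raw)]:
  assumes [measurable]: "f \<in> borel_measurable M"
  shows "(\<lambda>x. det (f x :: real^'n^'n)) \<in> borel_measurable M"
  unfolding det_def
  by (intro borel_measurable_sum borel_measurable_times borel_measurable_prod
      borel_measurable_const borel_measurable_vec_nth assms)

lemma borel_measurable_mult_vec [measurable (raw)]:
  fixes f :: "'a \<Rightarrow> real^'n^'m"
  assumes [measurable]: "f \<in> borel_measurable M" "g \<in> borel_measurable M"
  shows "(\<lambda>x. f x *v g x) \<in> borel_measurable M"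
proof (intro borel_measurable_vecI)
  fix i
  show "(\<lambda>x. (f x *v g x) $ i) \<in> borel_measurable M"
    unfolding matrix_vector_mult_def vec_lambda_beta
    by (intro borel_measurable_sum borel_measurable_times borel_measurable_vec_nth assms)
qed

lemma borel_measurable_mult_matrix [measurable (raw)]:
  fixes f :: "'a \<Rightarrow> real^'n^'m" and g :: "'a \<Rightarrow> real^'k^'n"
  assumes [measurable]: "f \<in> borel_measurable M" "g \<in> borel_measurable M"
  shows "(\<lambda>x. f x ** g x) \<in> borel_measurable M"
proof (intro borel_measurable_vecI)
  fix i j
  show "(\<lambda>x. (f x ** g x) $ i $ j) \<in> borel_measurable M"
    unfolding matrix_matrix_mult_def vec_lambda_beta
    by (intro borel_measurable_sum borel_measurable_times borel_measurable_vec_nth assms)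
qed

lemma borel_measurable_matrix_inv [measurable (raw)]:
  fixes f :: "'a \<Rightarrow> real^'n^'n"
  assumes [measurable]: "f \<in> borel_measurable M"
  shows "(\<lambda>x. matrix_inv (f x)) \<in> borel_measurable M"
proof -
  \<comment> \<open>All singular matrices have the same, unspecified, inverse.\<close>
  have singular: "matrix_inv A = (SOME B. False)" if "det A = 0" for A :: "real^'n^'n"
  proof -
    have "\<not> invertible A" using that by (simp add: invertible_det_nz)
    then have "(\<lambda>B. A ** B = mat 1 \<and> B ** A = mat 1) = (\<lambda>B. False)"
      unfolding invertible_def by auto
    then show ?thesis unfolding matrix_inv_def by presburger
  qed
  have eq: "matrix_inv (f x) = (if det (f x) = 0 then (SOME B. False) else
      (\<chi> i j. det (\<chi> a b. if b = i then axis j 1 $ a else f x $ a $ b) / det (f x)))" for x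
    using singular[of "f x"] matrix_inv_entry[of "f x"] by simp
  have "(\<lambda>x. (if b = i then axis j 1 $ a else f x $ a $ b) :: real) \<in> borel_measurable M" for i j a b :: 'n
    by (cases "b = i") (simp_all add: borel_measurable_vec_nth assms)
  then have "(\<lambda>x. (\<chi> a b. if b = i then axis j 1 $ a else f x $ a $ b) :: real^'n^'n) \<in> borel_measurable M" for i j :: 'n
    by (intro borel_measurable_vecI) (simp only: vec_lambda_beta)
  then have "(\<lambda>x. (\<chi> i j. det (\<chi> a b. if b = i then axis j 1 $ a else f x $ a $ b) / det (f x)) :: real^'n^'n) \<in> borel_measurable M"
    by (intro borel_measurable_vecI)
       (simp only: vec_lambda_beta borel_measurable_divide borel_measurable_det assms)
  moreover have "Measurable.pred M (\<lambda>x. det (f x) = 0)"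
    using borel_measurable_det[OF assms] by simp
  ultimately show ?thesis unfolding eq by simp
qed

lemma sym_mat_inner: "sym_mat A \<Longrightarrow> x \<bullet> (A *v y) = (A *v x) \<bullet> y"
  by (metis dot_lmul_matrix sym_mat_def transpose_matrix_vector)

lemma sym_mat_iff_inner: "sym_mat A \<longleftrightarrow> (\<forall>x y. x \<bullet> (A *v y) = (A *v x) \<bullet> y)"
proof
  assume *: "\<forall>x y. x \<bullet> (A *v y) = (A *v x) \<bullet> y"
  have "A $ i $ j = A $ j $ i" for i j
    using *[rule_format, of "axis i 1" "axis j 1"]
    by (simp add: matrix_vector_mult_basis inner_axis inner_axis' column_def)
  then show "sym_mat A" by (simp add: sym_mat_def transpose_def vec_eq_iff)
qed (simp add: sym_mat_inner)

lemma spd_invertible: "spd A \<Longrightarrow> invertible A"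
  unfolding spd_def invertible_left_inverse matrix_left_invertible_ker
  by (metis inner_zero_right less_irrefl)

lemma spd_mult_inv [simp]:
  assumes "spd A"
  shows "A *v (matrix_inv A *v x) = x" "matrix_inv A *v (A *v x) = x"
  using spd_invertible[OF assms]
  by (simp_all add: matrix_vector_mul_assoc matrix_inv_left matrix_inv_right)

lemma spd_imp_psd: "spd A \<Longrightarrow> psd A"
  unfolding spd_def psd_def by (metis inner_zero_left less_imp_le order_refl)

lemma spd_sym: "spd A \<Longrightarrow> sym_mat A"
  by (simp add: spd_def)

lemma spd_matrix_inv:
  assumes "spd A"
  shows "spd (matrix_inv A)"
  unfolding spd_def
proof (intro conjI allI impI)
  show "sym_mat (matrix_inv A)" unfolding sym_mat_iff_inner
    by (metis spd_mult_inv(1) spd_sym sym_mat_inner assms)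
  fix x :: "real^'a" assume x: "x \<noteq> 0"
  define y where "y = matrix_inv A *v x"
  have xy: "x = A *v y" by (simp add: y_def assms)
  then have "y \<noteq> 0" using x by auto
  then have "0 < y \<bullet> (A *v y)" using assms by (simp add: spd_def)
  then show "0 < x \<bullet> (matrix_inv A *v x)"
    by (simp add: y_def[symmetric] xy[symmetric] inner_commute)
qed

lemma psd_quad_nonneg: "psd A \<Longrightarrow> 0 \<le> x \<bullet> (A *v x)"
  by (simp add: psd_def)

text \<open>Young's inequality in the seminorm of a positive semidefinite form.\<close>

lemma psd_young:
  assumes A: "psd A" and k: "0 < k"
  shows "(a + b) \<bullet> (A *v (a + b)) \<le> (1 + k) * (a \<bullet> (A *v a)) + (1 + 1/k) * (b \<bullet> (A *v b))"
proof -
  have "0 \<le> (k *\<^sub>R a - b) \<bullet> (A *v (k *\<^sub>R a - b))" by (rule psd_quad_nonneg[OF A])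
  moreover have "b \<bullet> (A *v a) = a \<bullet> (A *v b)"
    using A by (metis psd_def sym_mat_inner inner_commute)
  ultimately have "2 * k * (a \<bullet> (A *v b)) \<le> k * k * (a \<bullet> (A *v a)) + b \<bullet> (A *v b)"
    by (simp add: matrix_vector_mult_diff_distrib matrix_vector_mult_scaleR inner_diff_left inner_diff_right algebra_simps)
  then have "2 * (a \<bullet> (A *v b)) \<le> k * (a \<bullet> (A *v a)) + (1/k) * (b \<bullet> (A *v b))"
    using k by (simp add: field_simps)
  then show ?thesis
    using \<open>b \<bullet> (A *v a) = a \<bullet> (A *v b)\<close>
    by (simp add: matrix_vector_right_distrib inner_add_left inner_add_right algebra_simps)
qed

text \<open>The Legendre transform of a quadratic form is the form of the inverse matrix. The bound holds for
  every \<open>p\<close>, so that a direction chosen for one pair \<open>(v, R)\<close> can be tested on another.\<close>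

lemma spd_legendre:
  assumes R: "spd R"
  shows "2 * (p \<bullet> v) - p \<bullet> (R *v p) \<le> v \<bullet> (matrix_inv R *v v)"
proof -
  define q where "q = matrix_inv R *v v"
  have v: "R *v q = v" by (simp add: q_def R)
  have "0 \<le> (p - q) \<bullet> (R *v (p - q))" by (rule psd_quad_nonneg[OF spd_imp_psd[OF R]])
  moreover have "q \<bullet> (R *v p) = p \<bullet> v"
    by (metis v R spd_sym sym_mat_inner inner_commute)
  ultimately show ?thesis
    by (simp add: matrix_vector_mult_diff_distrib v inner_diff_left inner_diff_right
        q_def[symmetric] inner_commute)
qed

lemma spd_legendre_attained:
  assumes "spd R" "p = matrix_inv R *v v"
  shows "v \<bullet> (matrix_inv R *v v) = 2 * (p \<bullet> v) - p \<bullet> (R *v p)"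
  using assms by (simp add: inner_commute)

definition coercive :: "real \<Rightarrow> real^'n^'n \<Rightarrow> bool" where
  "coercive c A \<longleftrightarrow> sym_mat A \<and> (\<forall>x. c * (norm x)\<^sup>2 \<le> x \<bullet> (A *v x))"

lemma coercive_spd: "0 < c \<Longrightarrow> coercive c A \<Longrightarrow> spd (A::real^'n^'n)"
  unfolding coercive_def spd_def
proof (intro conjI allI impI)
  fix x :: "real^'n"
  assume c: "0 < c" and A: "sym_mat A \<and> (\<forall>x. c * (norm x)\<^sup>2 \<le> x \<bullet> (A *v x))" and x: "x \<noteq> 0"
  have "0 < c * (norm x)\<^sup>2" using c x by simp
  also have "\<dots> \<le> x \<bullet> (A *v x)" using A by blast
  finally show "0 < x \<bullet> (A *v x)" .
qed blast

lemma loewner_le_coercive: "sym_mat A \<Longrightarrow> loewner_le (c *\<^sub>R mat 1) A \<Longrightarrow> coercive c A"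
  unfolding coercive_def loewner_le_def psd_def
  by (simp add: matrix_vector_mult_diff_rdistrib inner_diff_right scaleR_matrix_vector_assoc[symmetric]
      power2_norm_eq_inner)

lemma coercive_norm_inv:
  assumes c: "0 < c" and A: "coercive c A"
  shows "norm (matrix_inv A *v v) \<le> norm v / c"
proof (cases "matrix_inv A *v v = 0")
  case False
  define p where "p = matrix_inv A *v v"
  have v: "A *v p = v" using coercive_spd[OF c A] by (simp add: p_def)
  have "c * (norm p)\<^sup>2 \<le> p \<bullet> v" using A v by (metis coercive_def)
  also have "\<dots> \<le> norm p * norm v" by (rule norm_cauchy_schwarz)
  finally have "norm p * (c * norm p) \<le> norm p * norm v" by (simp add: power2_eq_square algebra_simps)
  then have "c * norm p \<le> norm v" using False by (simp add: p_def)
  then show ?thesis using c by (simp add: p_def field_simps)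
qed (use c in simp)

lemma coercive_quad_inv:
  assumes c: "0 < c" and A: "coercive c A"
  shows "v \<bullet> (matrix_inv A *v v) \<le> (norm v)\<^sup>2 / c"
proof -
  have "v \<bullet> (matrix_inv A *v v) \<le> norm v * norm (matrix_inv A *v v)" by (rule norm_cauchy_schwarz)
  also have "\<dots> \<le> norm v * (norm v / c)" by (intro mult_left_mono coercive_norm_inv[OF c A]) simp
  finally show ?thesis by (simp add: power2_eq_square)
qed

lemma norm_matrix_vector_le:
  fixes A :: "real^'n^'m"
  shows "norm (A *v x) \<le> norm A * norm x"
proof -
  have "norm (A *v x) = L2_set (\<lambda>i. \<bar>A $ i \<bullet> x\<bar>) UNIV"
    by (simp add: norm_vec_def matrix_vector_mul_component)
  also have "\<dots> \<le> L2_set (\<lambda>i. norm (A $ i) * norm x) UNIV"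
    by (intro L2_set_mono) (auto simp: Cauchy_Schwarz_ineq2)
  also have "\<dots> = norm A * norm x"
    by (simp add: norm_vec_def L2_set_left_distrib)
  finally show ?thesis .
qed

lemma quad_le_norm:
  fixes A :: "real^'n^'n"
  shows "\<bar>x \<bullet> (A *v y)\<bar> \<le> norm A * (norm x * norm y)"
proof -
  have "\<bar>x \<bullet> (A *v y)\<bar> \<le> norm x * norm (A *v y)" by (rule Cauchy_Schwarz_ineq2)
  also have "\<dots> \<le> norm x * (norm A * norm y)" by (intro mult_left_mono norm_matrix_vector_le) simp
  finally show ?thesis by (simp add: algebra_simps)
qed

lemma norm_matrix_le_columns:
  fixes A :: "real^'n^'m" and B :: real
  assumes "\<And>v. norm (A *v v) \<le> B * norm v"
  shows "norm A \<le> CARD('m) * (CARD('n) * B)"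
proof -
  have "\<bar>A $ i $ j\<bar> \<le> B" for i j
  proof -
    have "\<bar>A $ i $ j\<bar> = \<bar>(A *v axis j 1) $ i\<bar>"
      by (simp add: matrix_vector_mult_basis column_def)
    also have "\<dots> \<le> norm (A *v axis j 1)" by (rule component_le_norm_cart)
    also have "\<dots> \<le> B" using assms[of "axis j 1"] by (simp add: norm_axis_1)
    finally show ?thesis .
  qed
  then have "norm (A $ i) \<le> CARD('n) * B" for i
    by (intro order_trans[OF norm_le_l1_cart] order_trans[OF sum_bounded_above[where K=B]]) auto
  then have "(\<Sum>i\<in>UNIV. norm (A $ i)) \<le> CARD('m) * (CARD('n) * B)"
    by (intro order_trans[OF sum_bounded_above[where K="CARD('n) * B"]]) auto
  moreover have "norm A \<le> (\<Sum>i\<in>UNIV. norm (A $ i))"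
    unfolding norm_vec_def by (rule L2_set_le_sum) simp
  ultimately show ?thesis by simp
qed

lemma coercive_norm_matrix_inv:
  fixes A :: "real^'n^'n"
  assumes c: "0 < c" and A: "coercive c A"
  shows "norm (matrix_inv A) \<le> (CARD('n))\<^sup>2 / c"
  using norm_matrix_le_columns[where A="matrix_inv A" and B="1/c"] coercive_norm_inv[OF c A]
  by (simp add: power2_eq_square)

section \<open>The Brownian filtration\<close>

locale brownian = prob_space M for M :: "'a measure" +
  fixes W :: "real \<Rightarrow> 'a \<Rightarrow> real" and T :: real
  assumes T_pos: "0 < T" and bm: "brownian_motion M T W"
begin

abbreviation "F \<equiv> bm_filtration M W"

lemma W_measurable: "0 \<le> t \<Longrightarrow> t \<le> T \<Longrightarrow> W t \<in> borel_measurable M"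
  and W_0: "AE \<omega> in M. W 0 \<omega> = 0"
  and W_normal: "0 \<le> a \<Longrightarrow> a < b \<Longrightarrow> b \<le> T \<Longrightarrow>
    distributed M lborel (\<lambda>\<omega>. W b \<omega> - W a \<omega>) (normal_density 0 (sqrt (b - a)))"
  and W_indep: "0 \<le> \<tau> 0 \<Longrightarrow> (\<forall>i<n. \<tau> i < \<tau> (Suc i)) \<Longrightarrow> \<tau> n \<le> T \<Longrightarrow>
    indep_vars (\<lambda>_. borel) (\<lambda>i \<omega>. W (\<tau> (Suc i)) \<omega> - W (\<tau> i) \<omega>) {..<n}"
  using bm unfolding brownian_motion_def by auto

abbreviation "F_gen t \<equiv> {W s -` B \<inter> space M | s B. 0 \<le> s \<and> s \<le> t \<and> B \<in> sets borel} \<union> null_sets M"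

lemma F_gen_Pow: "F_gen t \<subseteq> Pow (space M)"
  using sets.sets_into_space by fastforce

lemma space_F [simp]: "space (F t) = space M"
  unfolding bm_filtration_def by (rule space_measure_of[OF F_gen_Pow])

lemma sets_F: "sets (F t) = sigma_sets (space M) (F_gen t)"
  unfolding bm_filtration_def by (rule sets_measure_of[OF F_gen_Pow])

lemma sets_F_mono: "s \<le> t \<Longrightarrow> sets (F s) \<subseteq> sets (F t)"
  unfolding sets_F by (intro sigma_sets_mono') fastforce

lemma subalgebra_F_mono: "s \<le> t \<Longrightarrow> subalgebra (F t) (F s)"
  by (simp add: subalgebra_def sets_F_mono)

lemma sets_F_M: assumes "t \<le> T" shows "sets (F t) \<subseteq> sets M"
  unfolding sets_F
proof (intro sets.sigma_sets_subset subsetI)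
  fix A assume "A \<in> F_gen t"
  then consider s B where "A = W s -` B \<inter> space M" "0 \<le> s" "s \<le> t" "B \<in> sets borel" | "A \<in> null_sets M"
    by blast
  then show "A \<in> sets M"
  proof cases
    case 1
    then show ?thesis using measurable_sets[OF W_measurable[of s] 1(4)] assms by simp
  qed auto
qed

lemma subalgebra_F: "t \<le> T \<Longrightarrow> subalgebra M (F t)"
  by (simp add: subalgebra_def sets_F_M)

lemma sigma_finite_F: "t \<le> T \<Longrightarrow> sigma_finite_subalgebra M (F t)"
  by (intro finite_measure_subalgebra_is_sigma_finite finite_measure_subalgebra.intro
      finite_measure_subalgebra_axioms.intro finite_measure_axioms subalgebra_F)

lemma measurable_F_mono: "f \<in> measurable (F s) N \<Longrightarrow> s \<le> t \<Longrightarrow> f \<in> measurable (F t) N"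
  using measurable_from_subalg[OF subalgebra_F_mono] by blast

lemma measurable_F_M: "f \<in> measurable (F t) N \<Longrightarrow> t \<le> T \<Longrightarrow> f \<in> measurable M N"
  using measurable_from_subalg[OF subalgebra_F] by blast

lemma W_adapted: "0 \<le> s \<Longrightarrow> s \<le> t \<Longrightarrow> W s \<in> borel_measurable (F t)"
  by (rule measurableI) (auto simp: sets_F intro!: sigma_sets.Basic)

text \<open>A cylinder event in finitely many values of \<open>W\<close> before \<open>a\<close> is, up to a null set, an event in
  finitely many increments before \<open>a\<close>, since \<open>W\<close> starts at \<open>0\<close>.\<close>

lemma increment_indep_cylinder:
  assumes ab: "0 \<le> a" "a < b" "b \<le> T" and J: "finite J" "J \<subseteq> {0..a}"
    and B: "\<And>s. s \<in> J \<Longrightarrow> B s \<in> sets borel" and C: "C \<in> sets borel"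
  shows "prob ({\<omega>\<in>space M. \<forall>s\<in>J. W s \<omega> \<in> B s} \<inter> {\<omega>\<in>space M. W b \<omega> - W a \<omega> \<in> C})
       = prob {\<omega>\<in>space M. \<forall>s\<in>J. W s \<omega> \<in> B s} * prob {\<omega>\<in>space M. W b \<omega> - W a \<omega> \<in> C}"
proof -
  define K where "K = insert 0 (insert a J)"
  have K: "finite K" "K \<subseteq> {0..a}" "K \<noteq> {}" using J ab by (auto simp: K_def)
  define xs where "xs = sorted_list_of_set K"
  have xs: "set xs = K" "sorted_wrt (<) xs" "xs \<noteq> []"
    using K by (auto simp: xs_def)
  define n where "n = length xs - 1"
  have len: "length xs = Suc n" using xs by (simp add: n_def)
  \<comment> \<open>The times of the cylinder event in increasing order, from \<open>0\<close> to \<open>a\<close>, followed by \<open>b\<close>.\<close>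
  define \<tau> where "\<tau> i = (if i \<le> n then xs ! i else b)" for i
  have xs_less: "xs ! i < xs ! j" if "i < j" "j \<le> n" for i j
    using xs(2) that len by (auto simp: sorted_wrt_iff_nth_less)
  obtain i0 where i0: "i0 \<le> n" "xs ! i0 = 0" using xs(1) len by (metis K_def in_set_conv_nth insertI1 less_Suc_eq_le)
  obtain ia where ia: "ia \<le> n" "xs ! ia = a" using xs(1) len by (metis K_def in_set_conv_nth insertI1 insertI2 less_Suc_eq_le)
  have in_K: "xs ! i \<in> K" if "i \<le> n" for i using xs(1) len that by (metis less_Suc_eq_le nth_mem)
  have \<tau>0: "\<tau> 0 = 0"
  proof (cases "i0 = 0")
    case False
    then have "xs ! 0 < xs ! i0" using xs_less[of 0 i0] i0 by simp
    then show ?thesis using in_K[of 0] K(2) i0 by auto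
  qed (use i0 in \<open>simp add: \<tau>_def\<close>)
  have \<tau>n: "\<tau> n = a"
  proof (cases "ia = n")
    case False
    then have "xs ! ia < xs ! n" using xs_less[of ia n] ia by simp
    then show ?thesis using in_K[of n] K(2) ia by auto
  qed (use ia in \<open>simp add: \<tau>_def\<close>)
  have \<tau>S: "\<tau> (Suc n) = b" by (simp add: \<tau>_def)
  have \<tau>_mono: "\<tau> i < \<tau> (Suc i)" if "i < Suc n" for i
  proof (cases "i = n")
    case False
    then show ?thesis using that xs_less[of i "Suc i"] by (simp add: \<tau>_def)
  qed (use \<tau>n \<tau>S ab in simp)
  have \<tau>_range: "0 \<le> \<tau> i \<and> \<tau> i \<le> a" if "i \<le> n" for i
    using in_K[OF that] K(2) that by (auto simp: \<tau>_def)
  let ?X = "\<lambda>i \<omega>. W (\<tau> (Suc i)) \<omega> - W (\<tau> i) \<omega>"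
  have ind: "indep_vars (\<lambda>_. borel) ?X {..<Suc n}"
    by (rule W_indep) (use \<tau>0 \<tau>_mono \<tau>S ab in auto)
  have ind2: "indep_var (PiM {..<n} (\<lambda>_. borel)) (\<lambda>\<omega>. restrict (\<lambda>i. ?X i \<omega>) {..<n})
      (PiM {n} (\<lambda>_. borel)) (\<lambda>\<omega>. restrict (\<lambda>i. ?X i \<omega>) {n})"
    by (rule indep_var_restrict[OF ind]) auto
  \<comment> \<open>The position of the time \<open>s\<close>: \<open>W s\<close> is the sum of the first \<open>k s\<close> increments.\<close>
  define k where "k s = (LEAST i. i \<le> n \<and> xs ! i = s)" for s
  have k: "k s \<le> n \<and> xs ! k s = s" if "s \<in> J" for s
  proof -
    have "\<exists>i. i \<le> n \<and> xs ! i = s"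
      using that xs(1) len by (metis K_def in_set_conv_nth insertI2 less_Suc_eq_le)
    then show ?thesis unfolding k_def by (rule LeastI_ex)
  qed
  define D where "D = {f \<in> space (PiM {..<n} (\<lambda>_. borel)). \<forall>s\<in>J. (\<Sum>i<k s. f i :: real) \<in> B s}"
  have D: "D \<in> sets (PiM {..<n} (\<lambda>_. borel))"
    unfolding D_def
  proof (intro sets.sets_Collect_finite_All J)
    fix s assume s: "s \<in> J"
    have "(\<lambda>f. (\<Sum>i<k s. f i :: real)) \<in> borel_measurable (PiM {..<n} (\<lambda>_. borel))"
      using k[OF s] by (intro borel_measurable_sum measurable_component_singleton) auto
    from measurable_sets[OF this B[OF s]]
    show "{x \<in> space (PiM {..<n} (\<lambda>_. borel)). (\<Sum>i<k s. x i :: real) \<in> B s} \<in> sets (PiM {..<n} (\<lambda>_. borel))"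
      by (simp add: vimage_def Int_def conj_commute)
  qed
  define C' where "C' = {f \<in> space (PiM {n} (\<lambda>_. borel)). f n \<in> C}"
  have C': "C' \<in> sets (PiM {n} (\<lambda>_. borel))"
  proof -
    have "(\<lambda>f. f n :: real) \<in> borel_measurable (PiM {n} (\<lambda>_. borel))"
      by (intro measurable_component_singleton) simp
    from measurable_sets[OF this C] show ?thesis
      unfolding C'_def by (simp add: vimage_def Int_def conj_commute)
  qed
  let ?A = "{\<omega>\<in>space M. \<forall>s\<in>J. W s \<omega> \<in> B s}" and ?E = "{\<omega>\<in>space M. W b \<omega> - W a \<omega> \<in> C}"
  let ?A' = "(\<lambda>\<omega>. restrict (\<lambda>i. ?X i \<omega>) {..<n}) -` D \<inter> space M"
  have W_sum: "W (\<tau> j) \<omega> = (\<Sum>i<j. ?X i \<omega>)" if "W 0 \<omega> = 0" for j \<omega>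
    using that sum_lessThan_telescope[of "\<lambda>i. W (\<tau> i) \<omega>" j] \<tau>0 by simp
  have AE_A: "AE \<omega> in M. \<omega> \<in> ?A \<longleftrightarrow> \<omega> \<in> ?A'"
    using W_0 AE_space
  proof eventually_elim
    case (elim \<omega>)
    have "W s \<omega> = (\<Sum>i<k s. restrict (\<lambda>i. ?X i \<omega>) {..<n} i)" if "s \<in> J" for s
    proof -
      have "W s \<omega> = W (\<tau> (k s)) \<omega>" using k[OF that] by (simp add: \<tau>_def)
      also have "\<dots> = (\<Sum>i<k s. restrict (\<lambda>i. ?X i \<omega>) {..<n} i)"
        by (rule trans[OF W_sum[OF elim(1)]]) (use k[OF that] in \<open>auto intro!: sum.cong\<close>)
      finally show ?thesis .
    qed
    then show ?case using elim(2) by (auto simp: D_def space_PiM)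
  qed
  have measA: "?A \<in> sets M"
  proof (intro sets.sets_Collect_finite_All J)
    fix s assume s: "s \<in> J"
    then have "W s \<in> borel_measurable M" using J ab by (intro W_measurable) auto
    from measurable_sets[OF this B[OF s]] show "{x \<in> space M. W s x \<in> B s} \<in> events"
      by (simp add: vimage_def Int_def conj_commute)
  qed
  have measX: "(\<lambda>\<omega>. restrict (\<lambda>i. ?X i \<omega>) {..<n}) \<in> measurable M (PiM {..<n} (\<lambda>_. borel))"
    using ind2 by (auto dest: indep_var_rv1)
  have measA': "?A' \<in> sets M" by (rule measurable_sets[OF measX D])
  have dW: "(\<lambda>\<omega>. W b \<omega> - W a \<omega>) \<in> borel_measurable M"
    using ab by (intro borel_measurable_diff W_measurable) auto
  have measE: "?E \<in> sets M"
    using measurable_sets[OF dW C] by (simp add: vimage_def Int_def conj_commute)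
  have "prob (?A \<inter> ?E) = prob (?A' \<inter> ?E)"
    by (intro measure_eq_AE sets.Int measA measA' measE) (use AE_A in auto)
  also have "\<dots> = prob ((\<lambda>x. (restrict (\<lambda>i. ?X i x) {..<n}, restrict (\<lambda>i. ?X i x) {n})) -` (D \<times> C') \<inter> space M)"
    by (intro arg_cong[where f=prob]) (auto simp: \<tau>S \<tau>n C'_def space_PiM)
  also have "\<dots> = prob ?A' * prob ((\<lambda>\<omega>. restrict (\<lambda>i. ?X i \<omega>) {n}) -` C' \<inter> space M)"
    by (rule indep_varD[OF ind2 D C'])
  also have "(\<lambda>\<omega>. restrict (\<lambda>i. ?X i \<omega>) {n}) -` C' \<inter> space M = ?E"
    by (auto simp: \<tau>S \<tau>n C'_def space_PiM)
  also have "prob ?A' = prob ?A"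
    by (intro measure_eq_AE measA measA') (use AE_A in auto)
  finally show ?thesis .
qed

text \<open>The events that agree almost surely with a cylinder event in times up to \<open>a\<close> form a
  \<open>\<pi>\<close>-system that contains the generator of \<open>F\<^sub>a\<close>, null sets included.\<close>

lemma increment_indep:
  assumes ab: "0 \<le> a" "a < b" "b \<le> T" and A: "A \<in> sets (F a)" and C: "C \<in> sets borel"
  shows "prob (A \<inter> {\<omega>\<in>space M. W b \<omega> - W a \<omega> \<in> C}) = prob A * prob {\<omega>\<in>space M. W b \<omega> - W a \<omega> \<in> C}"
proof -
  let ?E = "{\<omega>\<in>space M. W b \<omega> - W a \<omega> \<in> C}"
  have dW: "(\<lambda>\<omega>. W b \<omega> - W a \<omega>) \<in> borel_measurable M"
    using ab by (intro borel_measurable_diff W_measurable) auto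
  have E: "?E \<in> sets M"
    using measurable_sets[OF dW C] by (simp add: vimage_def Int_def conj_commute)
  define P where "P = {A. A \<in> sets M \<and> (\<exists>J B. finite J \<and> J \<subseteq> {0..a} \<and> (\<forall>s\<in>J. B s \<in> sets borel) \<and>
      (AE \<omega> in M. \<omega> \<in> A \<longleftrightarrow> (\<forall>s\<in>J. W s \<omega> \<in> B s)))}"
  have P_I: "A \<in> P" if "A \<in> sets M" "finite J" "J \<subseteq> {0..a}" "\<And>s. s \<in> J \<Longrightarrow> B s \<in> sets borel"
    "AE \<omega> in M. \<omega> \<in> A \<longleftrightarrow> (\<forall>s\<in>J. W s \<omega> \<in> B s)" for A J B
    using that unfolding P_def by blast
  have P_M: "P \<subseteq> sets M" by (auto simp: P_def)
  have stable: "Int_stable P"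
  proof (rule Int_stableI)
    fix A A' assume "A \<in> P" "A' \<in> P"
    then obtain J B J' B' where 1: "A \<in> sets M" "finite J" "J \<subseteq> {0..a}" "\<And>s. s \<in> J \<Longrightarrow> B s \<in> sets borel"
      "AE \<omega> in M. \<omega> \<in> A \<longleftrightarrow> (\<forall>s\<in>J. W s \<omega> \<in> B s)"
      and 2: "A' \<in> sets M" "finite J'" "J' \<subseteq> {0..a}" "\<And>s. s \<in> J' \<Longrightarrow> B' s \<in> sets borel"
      "AE \<omega> in M. \<omega> \<in> A' \<longleftrightarrow> (\<forall>s\<in>J'. W s \<omega> \<in> B' s)"
      unfolding P_def by blast
    show "A \<inter> A' \<in> P"
    proof (rule P_I[of _ "J \<union> J'" "\<lambda>s. (if s \<in> J then B s else UNIV) \<inter> (if s \<in> J' then B' s else UNIV)"])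
      show "AE \<omega> in M. \<omega> \<in> A \<inter> A' \<longleftrightarrow> (\<forall>s\<in>J \<union> J'. W s \<omega> \<in>
          (if s \<in> J then B s else UNIV) \<inter> (if s \<in> J' then B' s else UNIV))"
        using 1(5) 2(5) by eventually_elim auto
    qed (use 1 2 in auto)
  qed
  have "F_gen a \<subseteq> P"
  proof
    fix A assume "A \<in> F_gen a"
    then consider s B where "A = W s -` B \<inter> space M" "0 \<le> s" "s \<le> a" "B \<in> sets borel" | "A \<in> null_sets M"
      by blast
    then show "A \<in> P"
    proof cases
      case 1
      then have A: "A \<in> sets M" using measurable_sets[OF W_measurable[of s] 1(4)] ab by simp
      show ?thesis by (rule P_I[of _ "{s}" "\<lambda>_. B"]) (use 1 A in auto)
    next
      case 2
      have "AE \<omega> in M. \<omega> \<notin> A" using 2 by (rule AE_not_in)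
      then show ?thesis by (intro P_I[of _ "{0}" "\<lambda>_. {}"]) (use 2 ab in auto)
    qed
  qed
  then have AP: "A \<in> sigma_sets (space M) P"
    using A sigma_sets_mono'[of "F_gen a" P "space M"] unfolding sets_F by blast
  have Pow: "P \<subseteq> Pow (space M)" using P_M sets.sets_into_space by blast
  have Psub: "sigma_sets (space M) P \<subseteq> sets M" using P_M by (rule sets.sigma_sets_subset)
  show ?thesis using stable Pow AP
  proof (induction rule: sigma_sets_induct_disjoint)
    case (basic A)
    then obtain J B where 1: "A \<in> sets M" "finite J" "J \<subseteq> {0..a}" "\<And>s. s \<in> J \<Longrightarrow> B s \<in> sets borel"
      "AE \<omega> in M. \<omega> \<in> A \<longleftrightarrow> (\<forall>s\<in>J. W s \<omega> \<in> B s)"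
      unfolding P_def by blast
    let ?A = "{\<omega>\<in>space M. \<forall>s\<in>J. W s \<omega> \<in> B s}"
    have A': "?A \<in> sets M"
    proof (intro sets.sets_Collect_finite_All 1)
      fix s assume s: "s \<in> J"
      then have "W s \<in> borel_measurable M" using 1 ab by (intro W_measurable) auto
      from measurable_sets[OF this 1(4)[OF s]] show "{x \<in> space M. W s x \<in> B s} \<in> events"
        by (simp add: vimage_def Int_def conj_commute)
    qed
    have "prob (A \<inter> ?E) = prob (?A \<inter> ?E)"
      by (intro measure_eq_AE sets.Int 1(1) A' E) (use 1(5) in auto)
    moreover have "prob A = prob ?A"
      by (intro measure_eq_AE 1(1) A') (use 1(5) in auto)
    ultimately show ?case using increment_indep_cylinder[OF ab 1(2,3,4) C] by simp
  next
    case empty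
    then show ?case by simp
  next
    case (compl A)
    have A: "A \<in> sets M" using compl(1) Psub by blast
    have "prob ((space M - A) \<inter> ?E) = prob (?E - A \<inter> ?E)"
      by (intro arg_cong[where f=prob]) auto
    also have "\<dots> = prob ?E - prob (A \<inter> ?E)"
      by (rule finite_measure_Diff) (use A E in auto)
    finally show ?case using compl(2) A by (simp add: prob_compl algebra_simps)
  next
    case (union A)
    have A: "range A \<subseteq> sets M" using union(2) Psub by blast
    have "(\<lambda>i. prob (A i \<inter> ?E)) sums prob (\<Union>i. A i \<inter> ?E)"
      by (intro finite_measure_UNION) (use A E union(1) in \<open>auto simp: disjoint_family_on_def\<close>)
    moreover have "(\<lambda>i. prob (A i) * prob ?E) sums (prob (\<Union>i. A i) * prob ?E)"
      by (intro sums_mult2 finite_measure_UNION) (use A union(1) in auto)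
    ultimately show ?case using union(3) by (simp add: sums_unique2)
  qed
qed

lemma increment_indep_var:
  fixes f :: "'a \<Rightarrow> real"
  assumes ab: "0 \<le> a" "a < b" "b \<le> T" and f: "f \<in> borel_measurable (F a)"
  shows "indep_var borel f borel (\<lambda>\<omega>. W b \<omega> - W a \<omega>)"
proof -
  let ?X = "\<lambda>\<omega>. W b \<omega> - W a \<omega>"
  let ?S = "{?X -` C \<inter> space M | C. C \<in> sets borel}"
  have dW: "?X \<in> borel_measurable M"
    using ab by (intro borel_measurable_diff W_measurable) auto
  have fM: "f \<in> borel_measurable M" using measurable_F_M[OF f] ab by simp
  have X_eq: "?X -` C \<inter> space M = {\<omega>\<in>space M. ?X \<omega> \<in> C}" for C by auto
  have "indep_set (sets (F a)) ?S"
    unfolding indep_sets2_eq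
    using sets_F_M[of a] ab measurable_sets[OF dW] increment_indep[OF ab] unfolding X_eq by auto
  then have "indep_set (sigma_sets (space M) (sets (F a))) (sigma_sets (space M) ?S)"
  proof (rule indep_set_sigma_sets)
    show "Int_stable (sets (F a))" by (auto simp: Int_stable_def)
    show "Int_stable ?S"
    proof (rule Int_stableI)
      fix x y assume "x \<in> ?S" "y \<in> ?S"
      then obtain C D where "C \<in> sets borel" "D \<in> sets borel" "x = ?X -` C \<inter> space M" "y = ?X -` D \<inter> space M" by blast
      then show "x \<inter> y \<in> ?S" by (intro CollectI exI[of _ "C \<inter> D"]) auto
    qed
  qed
  moreover have "sigma_sets (space M) {f -` A \<inter> space M |A. A \<in> sets borel} \<subseteq> sigma_sets (space M) (sets (F a))"
    by (intro sigma_sets_mono') (use measurable_sets[OF f] in auto)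
  ultimately have "indep_set (sigma_sets (space M) {f -` A \<inter> space M |A. A \<in> sets borel}) (sigma_sets (space M) ?S)"
    unfolding indep_sets2_eq by blast
  then show ?thesis unfolding indep_var_eq using fM dW by simp
qed

lemma increment_moments:
  assumes ab: "0 \<le> a" "a \<le> b" "b \<le> T"
  shows "integrable M (\<lambda>\<omega>. W b \<omega> - W a \<omega>)" "expectation (\<lambda>\<omega>. W b \<omega> - W a \<omega>) = 0"
    "integrable M (\<lambda>\<omega>. (W b \<omega> - W a \<omega>)\<^sup>2)" "expectation (\<lambda>\<omega>. (W b \<omega> - W a \<omega>)\<^sup>2) = b - a"
proof -
  let ?X = "\<lambda>\<omega>. W b \<omega> - W a \<omega>"
  have "integrable M ?X \<and> expectation ?X = 0 \<and> integrable M (\<lambda>\<omega>. (?X \<omega>)\<^sup>2) \<and> expectation (\<lambda>\<omega>. (?X \<omega>)\<^sup>2) = b - a"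
  proof (cases "a = b")
    case False
    then have a: "a < b" using ab by simp
    define \<sigma> where "\<sigma> = sqrt (b - a)"
    have \<sigma>: "0 < \<sigma>" "\<sigma>\<^sup>2 = b - a" using a by (simp_all add: \<sigma>_def)
    have D: "distributed M lborel ?X (normal_density 0 \<sigma>)"
      using W_normal[OF ab(1) a ab(3)] by (simp add: \<sigma>_def)
    have "has_bochner_integral lborel (\<lambda>x. normal_density 0 \<sigma> x * x) 0"
      using normal_moment_odd[OF \<sigma>(1), of 0 0] by simp
    moreover have "has_bochner_integral lborel (\<lambda>x. normal_density 0 \<sigma> x * x\<^sup>2) (b - a)"
    proof -
      have "fact (2 * 1) / ((2 / \<sigma>\<^sup>2) ^ 1 * fact 1) = b - a"
        unfolding \<sigma>(2) using a by (simp add: fact_numeral)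
      with normal_moment_even[OF \<sigma>(1), of 0 1] show ?thesis by simp
    qed
    ultimately show ?thesis
      using distributed_integrable[OF D, of "\<lambda>x. x"] distributed_integral[OF D, of "\<lambda>x. x"]
        distributed_integrable[OF D, of "\<lambda>x. x\<^sup>2"] distributed_integral[OF D, of "\<lambda>x. x\<^sup>2"]
      by (auto simp: has_bochner_integral_iff)
  qed simp
  then show "integrable M ?X" "expectation ?X = 0"
    "integrable M (\<lambda>\<omega>. (?X \<omega>)\<^sup>2)" "expectation (\<lambda>\<omega>. (?X \<omega>)\<^sup>2) = b - a" by auto
qed

lemma expectation_mult_increment:
  fixes f :: "'a \<Rightarrow> real"
  assumes ab: "0 \<le> a" "a \<le> b" "b \<le> T" and f: "f \<in> borel_measurable (F a)" "integrable M f"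
  shows "integrable M (\<lambda>\<omega>. f \<omega> * (W b \<omega> - W a \<omega>))" "expectation (\<lambda>\<omega>. f \<omega> * (W b \<omega> - W a \<omega>)) = 0"
    "integrable M (\<lambda>\<omega>. f \<omega> * (W b \<omega> - W a \<omega>)\<^sup>2)"
    "expectation (\<lambda>\<omega>. f \<omega> * (W b \<omega> - W a \<omega>)\<^sup>2) = expectation f * (b - a)"
proof -
  let ?X = "\<lambda>\<omega>. W b \<omega> - W a \<omega>"
  note mom = increment_moments[OF ab]
  have "integrable M (\<lambda>\<omega>. f \<omega> * ?X \<omega>) \<and> expectation (\<lambda>\<omega>. f \<omega> * ?X \<omega>) = 0 \<and>
    integrable M (\<lambda>\<omega>. f \<omega> * (?X \<omega>)\<^sup>2) \<and> expectation (\<lambda>\<omega>. f \<omega> * (?X \<omega>)\<^sup>2) = expectation f * (b - a)"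
  proof (cases "a = b")
    case False
    then have ind: "indep_var borel f borel ?X" using increment_indep_var[OF ab(1) _ ab(3) f(1)] ab by simp
    have ind2: "indep_var borel f borel (\<lambda>\<omega>. (?X \<omega>)\<^sup>2)"
      using indep_var_compose[OF ind, of id borel "\<lambda>x. x\<^sup>2" borel] by (simp add: comp_def)
    show ?thesis
      using indep_var_integrable[OF ind f(2) mom(1)] indep_var_lebesgue_integral[OF ind f(2) mom(1)]
        indep_var_integrable[OF ind2 f(2) mom(3)] indep_var_lebesgue_integral[OF ind2 f(2) mom(3)] mom
      by simp
  qed simp
  then show "integrable M (\<lambda>\<omega>. f \<omega> * ?X \<omega>)" "expectation (\<lambda>\<omega>. f \<omega> * ?X \<omega>) = 0"
    "integrable M (\<lambda>\<omega>. f \<omega> * (?X \<omega>)\<^sup>2)"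
    "expectation (\<lambda>\<omega>. f \<omega> * (?X \<omega>)\<^sup>2) = expectation f * (b - a)" by auto
qed

end

section \<open>The Ito isometry and the martingale property\<close>

lemma integrable_bounded_mult:
  fixes f g :: "'a \<Rightarrow> real"
  assumes "integrable M g" "f \<in> borel_measurable M" "AE x in M. \<bar>f x\<bar> \<le> K"
  shows "integrable M (\<lambda>x. f x * g x)"
proof (rule Bochner_Integration.integrable_bound)
  show "integrable M (\<lambda>x. K * g x)" using assms by simp
  show "(\<lambda>x. f x * g x) \<in> borel_measurable M"
    using assms by (intro borel_measurable_times) auto
  show "AE x in M. norm (f x * g x) \<le> norm (K * g x)"
    using assms(3) by eventually_elim (auto simp: abs_mult intro!: mult_right_mono)
qed

text \<open>Extended by zero outside \<open>S\<close>, the process becomes measurable on the product with the whole real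
  line, where the theorems of Fubini and Tonelli apply.\<close>

lemma prog_measurable_joint_gen:
  fixes X :: "real \<Rightarrow> 'a \<Rightarrow> 'b::{second_countable_topology, real_normed_vector}"
  assumes X: "(\<lambda>(r, \<omega>). X r \<omega>) \<in> borel_measurable (restrict_space borel S \<Otimes>\<^sub>M N)" and S: "S \<in> sets borel"
  shows "(\<lambda>(r, \<omega>). indicator S r *\<^sub>R X r \<omega>) \<in> borel_measurable (lborel \<Otimes>\<^sub>M N)"
proof -
  let ?P = "lborel \<Otimes>\<^sub>M N"
  have A: "S \<times> space N \<in> sets ?P" using S by (intro pair_measureI) auto
  have 1: "fst \<in> measurable (restrict_space ?P (S \<times> space N)) (restrict_space borel S)"
  proof (rule measurable_restrict_space2)
    have "fst \<in> measurable ?P borel" using measurable_fst[of lborel N] by simp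
    then show "fst \<in> measurable (restrict_space ?P (S \<times> space N)) borel"
      by (rule measurable_restrict_space1)
  qed (auto simp: space_restrict_space space_pair_measure)
  have "(\<lambda>x. (fst x, snd x)) \<in> measurable (restrict_space ?P (S \<times> space N)) (restrict_space borel S \<Otimes>\<^sub>M N)"
    by (intro measurable_Pair 1 measurable_restrict_space1 measurable_snd)
  from measurable_compose[OF this X]
  have "(\<lambda>x. X (fst x) (snd x)) \<in> borel_measurable (restrict_space ?P (S \<times> space N))"
    by (simp only: prod.case)
  then have "(\<lambda>x. indicator (S \<times> space N) x *\<^sub>R X (fst x) (snd x)) \<in> borel_measurable ?P"
    using A by (subst (asm) borel_measurable_restrict_space_iff) (auto simp: space_pair_measure)
  also have "?this \<longleftrightarrow> ?thesis"
    by (intro measurable_cong) (auto simp: space_pair_measure indicator_def)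
  finally show ?thesis .
qed

lemma indicator_Ioc_integral:
  fixes x y :: real
  shows "integrable lborel (\<lambda>r. indicator {x<..y} r :: real)"
    "(\<integral>r. indicator {x<..y} r \<partial>lborel) = max 0 (y - x)"
  by (cases "x \<le> y"; simp)+

context brownian
begin

lemma prog_measurable_joint_F:
  fixes X :: "real \<Rightarrow> 'a \<Rightarrow> 'b::{second_countable_topology, real_normed_vector}"
  assumes X: "prog_measurable F I X" and t: "t \<in> I" and S: "S = I \<inter> {..t}" "S \<in> sets borel"
  shows "(\<lambda>(r, \<omega>). indicator S r *\<^sub>R X r \<omega>) \<in> borel_measurable (lborel \<Otimes>\<^sub>M F t)"
  by (rule prog_measurable_joint_gen) (use X t S in \<open>auto simp: prog_measurable_def\<close>)

lemma prog_measurable_joint: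
  fixes X :: "real \<Rightarrow> 'a \<Rightarrow> 'b::{second_countable_topology, real_normed_vector}"
  assumes X: "prog_measurable F I X" and t: "t \<in> I" "t \<le> T" and S: "S = I \<inter> {..t}" "S \<in> sets borel"
  shows "(\<lambda>(r, \<omega>). indicator S r *\<^sub>R X r \<omega>) \<in> borel_measurable (lborel \<Otimes>\<^sub>M M)"
proof -
  have "id \<in> measurable M (F t)"
    using sets_F_M[OF t(2)] sets.sets_into_space by (intro measurableI) (auto simp: Int_absorb2)
  then have "(\<lambda>x. (fst x, id (snd x))) \<in> measurable (lborel \<Otimes>\<^sub>M M) (lborel \<Otimes>\<^sub>M F t)"
    by (intro measurable_Pair measurable_fst measurable_compose[OF measurable_snd])
  from measurable_compose[OF this prog_measurable_joint_F[OF X t(1) S]] show ?thesis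
    by (simp add: case_prod_beta)
qed

lemma prog_measurable_adapted:
  fixes X :: "real \<Rightarrow> 'a \<Rightarrow> 'b::{second_countable_topology, real_normed_vector}"
  assumes X: "prog_measurable F I X" and t: "t \<in> I"
  shows "X t \<in> borel_measurable (F t)"
proof -
  have "(\<lambda>\<omega>. (t, \<omega>)) \<in> measurable (F t) (restrict_space borel (I \<inter> {..t}) \<Otimes>\<^sub>M F t)"
    using t by (intro measurable_Pair1') (simp add: space_restrict_space)
  moreover have "(\<lambda>(s, \<omega>). X s \<omega>) \<in> borel_measurable (restrict_space borel (I \<inter> {..t}) \<Otimes>\<^sub>M F t)"
    using X t unfolding prog_measurable_def by blast
  ultimately have "(\<lambda>\<omega>. case (t, \<omega>) of (s, \<omega>) \<Rightarrow> X s \<omega>) \<in> borel_measurable (F t)"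
    by (rule measurable_compose)
  then show ?thesis by simp
qed

lemma increment_measurable:
  "0 \<le> x \<Longrightarrow> x \<le> z \<Longrightarrow> 0 \<le> y \<Longrightarrow> y \<le> z \<Longrightarrow> (\<lambda>\<omega>. W y \<omega> - W x \<omega>) \<in> borel_measurable (F z)"
  by (intro borel_measurable_diff W_adapted)

text \<open>If the intervals overlap, then the product of the increments is the square of the increment over
  the overlap plus two terms with a factor that is independent of the rest and has mean zero.\<close>

lemma expectation_increments_product_ordered:
  fixes f :: "'a \<Rightarrow> real"
  assumes ab: "0 \<le> a" "a \<le> b" "b \<le> T" and cd: "a \<le> c" "c \<le> d" "d \<le> T"
    and f: "f \<in> borel_measurable (F c)" and K: "\<And>\<omega>. \<omega> \<in> space M \<Longrightarrow> \<bar>f \<omega>\<bar> \<le> K"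
  shows "integrable M (\<lambda>\<omega>. f \<omega> * ((W b \<omega> - W a \<omega>) * (W d \<omega> - W c \<omega>))) \<and>
    expectation (\<lambda>\<omega>. f \<omega> * ((W b \<omega> - W a \<omega>) * (W d \<omega> - W c \<omega>))) = expectation f * max 0 (min b d - c)"
proof -
  have fM: "f \<in> borel_measurable M" using measurable_F_M[OF f] cd by simp
  have f_int: "integrable M f"
    by (rule integrable_const_bound[where B=K]) (use K fM in auto)
  have K': "AE \<omega> in M. \<bar>f \<omega>\<bar> \<le> K" using K by auto
  have fD: "integrable M (\<lambda>\<omega>. f \<omega> * (W y \<omega> - W x \<omega>))" if "0 \<le> x" "x \<le> y" "y \<le> T" for x y
    by (rule integrable_bounded_mult[OF increment_moments(1)[OF that] fM K'])
  show ?thesis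
  proof (cases "b \<le> c")
    case True
    let ?g = "\<lambda>\<omega>. f \<omega> * (W b \<omega> - W a \<omega>)"
    have "?g \<in> borel_measurable (F c)"
      using ab cd True by (intro borel_measurable_times f increment_measurable) auto
    moreover have "integrable M ?g" by (rule fD[OF ab])
    ultimately show ?thesis
      using expectation_mult_increment[of c d ?g] ab cd True by (simp add: mult.assoc)
  next
    case False
    define e g where "e = min b d" and "g = max b d"
    have e: "c \<le> e" "e \<le> g" "g \<le> T" "0 \<le> e" "e \<le> T" "0 \<le> c" using False ab cd by (auto simp: e_def g_def)
    let ?T1 = "\<lambda>\<omega>. f \<omega> * (W c \<omega> - W a \<omega>) * (W d \<omega> - W c \<omega>)"
    let ?T2 = "\<lambda>\<omega>. f \<omega> * (W e \<omega> - W c \<omega>)\<^sup>2"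
    let ?T3 = "\<lambda>\<omega>. f \<omega> * (W e \<omega> - W c \<omega>) * (W g \<omega> - W e \<omega>)"
    have eq: "f \<omega> * ((W b \<omega> - W a \<omega>) * (W d \<omega> - W c \<omega>)) = ?T1 \<omega> + ?T2 \<omega> + ?T3 \<omega>" for \<omega>
    proof (cases "b \<le> d")
      case True
      then have "e = b" "g = d" by (simp_all add: e_def g_def)
      then show ?thesis by (simp add: power2_eq_square algebra_simps)
    next
      case False
      then have "e = d" "g = b" by (simp_all add: e_def g_def)
      then show ?thesis by (simp add: power2_eq_square algebra_simps)
    qed
    have 1: "integrable M ?T1" "expectation ?T1 = 0"
      by (rule expectation_mult_increment[of c d "\<lambda>\<omega>. f \<omega> * (W c \<omega> - W a \<omega>)"];
          (intro borel_measurable_times f increment_measurable fD)?; use ab cd e in simp)+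
    have 2: "integrable M ?T2" "expectation ?T2 = expectation f * (e - c)"
      by (rule expectation_mult_increment(3,4)[of c e f]; use f f_int ab cd e in simp)+
    have 3: "integrable M ?T3" "expectation ?T3 = 0"
      by (rule expectation_mult_increment[of e g "\<lambda>\<omega>. f \<omega> * (W e \<omega> - W c \<omega>)"];
          (intro borel_measurable_times measurable_F_mono[OF f] increment_measurable fD)?; use ab cd e in simp)+
    show ?thesis unfolding eq
      using 1 2 3 e by (simp add: e_def[symmetric])
  qed
qed

text \<open>Degenerate intervals occur when the partition of a simple process is stopped at a time before its
  end; the coefficient of such an interval may fail to be measurable at the time of stopping.\<close>

lemma expectation_increments_product:
  fixes f :: "'a \<Rightarrow> real"
  assumes ab: "0 \<le> a" "a \<le> b" "b \<le> T" and cd: "0 \<le> c" "c \<le> d" "d \<le> T"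
    and f: "a < b \<Longrightarrow> c < d \<Longrightarrow> f \<in> borel_measurable (F (max a c))"
    and K: "\<And>\<omega>. \<omega> \<in> space M \<Longrightarrow> \<bar>f \<omega>\<bar> \<le> K"
  shows "integrable M (\<lambda>\<omega>. f \<omega> * ((W b \<omega> - W a \<omega>) * (W d \<omega> - W c \<omega>)))"
    "expectation (\<lambda>\<omega>. f \<omega> * ((W b \<omega> - W a \<omega>) * (W d \<omega> - W c \<omega>))) = expectation f * max 0 (min b d - max a c)"
proof -
  have "integrable M (\<lambda>\<omega>. f \<omega> * ((W b \<omega> - W a \<omega>) * (W d \<omega> - W c \<omega>))) \<and>
    expectation (\<lambda>\<omega>. f \<omega> * ((W b \<omega> - W a \<omega>) * (W d \<omega> - W c \<omega>))) = expectation f * max 0 (min b d - max a c)"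
  proof (cases "a < b \<and> c < d")
    case True
    show ?thesis
    proof (cases "a \<le> c")
      case ac: True
      then show ?thesis
        using expectation_increments_product_ordered[OF ab ac cd(2,3) _ K] f True by (simp add: max_absorb2)
    next
      case False
      then have ca: "c \<le> a" by simp
      then show ?thesis
        using expectation_increments_product_ordered[OF cd ca ab(2,3) _ K] f True
        by (simp add: max_absorb1 min.commute mult.commute[of "W d _ - W c _"])
    qed
  next
    case False
    then have "a = b \<or> c = d" using ab cd by auto
    then show ?thesis by (auto simp: max_def min_def)
  qed
  then show "integrable M (\<lambda>\<omega>. f \<omega> * ((W b \<omega> - W a \<omega>) * (W d \<omega> - W c \<omega>)))"
    "expectation (\<lambda>\<omega>. f \<omega> * ((W b \<omega> - W a \<omega>) * (W d \<omega> - W c \<omega>))) = expectation f * max 0 (min b d - max a c)"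
    by auto
qed

text \<open>Both sides are quadratic in the integrand, so the isometry reduces to pairs of intervals. The
  intervals may overlap, and thus the difference of two simple processes on different partitions is
  covered.\<close>

lemma simple_isometry:
  fixes \<xi> :: "'i \<Rightarrow> 'a \<Rightarrow> 'b::euclidean_space"
  assumes J: "finite J"
    and ab: "\<And>i. i \<in> J \<Longrightarrow> 0 \<le> a i \<and> a i \<le> b i \<and> b i \<le> T"
    and meas: "\<And>i. i \<in> J \<Longrightarrow> a i < b i \<Longrightarrow> \<xi> i \<in> borel_measurable (F (a i))"
    and K: "\<And>i \<omega>. i \<in> J \<Longrightarrow> \<omega> \<in> space M \<Longrightarrow> norm (\<xi> i \<omega>) \<le> K"
  shows "(\<integral>\<^sup>+\<omega>. ennreal ((norm (\<Sum>i\<in>J. (W (b i) \<omega> - W (a i) \<omega>) *\<^sub>R \<xi> i \<omega>))\<^sup>2) \<partial>M)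
       = (\<integral>\<^sup>+\<omega>. (\<integral>\<^sup>+r. ennreal ((norm (\<Sum>i\<in>J. indicator {a i<..b i} r *\<^sub>R \<xi> i \<omega>))\<^sup>2) \<partial>lborel) \<partial>M)"
proof -
  define len where "len i j = max 0 (min (b i) (b j) - max (a i) (a j))" for i j
  let ?c = "\<lambda>i j \<omega>. \<xi> i \<omega> \<bullet> \<xi> j \<omega>"
  let ?D = "\<lambda>i \<omega>. W (b i) \<omega> - W (a i) \<omega>"
  have c_meas: "?c i j \<in> borel_measurable (F (max (a i) (a j)))"
    if "i \<in> J" "j \<in> J" "a i < b i" "a j < b j" for i j
    using measurable_F_mono[OF meas, of i "max (a i) (a j)"] measurable_F_mono[OF meas, of j "max (a i) (a j)"] that
    by (intro borel_measurable_inner) auto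
  have c_bound: "\<bar>?c i j \<omega>\<bar> \<le> K * K" if "i \<in> J" "j \<in> J" "\<omega> \<in> space M" for i j \<omega>
  proof -
    have "\<bar>?c i j \<omega>\<bar> \<le> norm (\<xi> i \<omega>) * norm (\<xi> j \<omega>)" by (rule Cauchy_Schwarz_ineq2)
    also have "\<dots> \<le> K * K" 
    proof (rule mult_mono)
      show "0 \<le> K" using K[OF that(1,3)] norm_ge_zero[of "\<xi> i \<omega>"] by linarith
    qed (use K[OF that(1,3)] K[OF that(2,3)] in auto)
    finally show ?thesis .
  qed
  have cross: "integrable M (\<lambda>\<omega>. ?c i j \<omega> * (?D i \<omega> * ?D j \<omega>))"
    "expectation (\<lambda>\<omega>. ?c i j \<omega> * (?D i \<omega> * ?D j \<omega>)) = expectation (?c i j) * len i j" if "i \<in> J" "j \<in> J" for i j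
    unfolding len_def
    using expectation_increments_product[of "a i" "b i" "a j" "b j" "?c i j" "K*K"]
      c_meas[OF that] c_bound[OF that] ab that by auto
  have sq_W: "(norm (\<Sum>i\<in>J. ?D i \<omega> *\<^sub>R \<xi> i \<omega>))\<^sup>2 = (\<Sum>i\<in>J. \<Sum>j\<in>J. ?c i j \<omega> * (?D i \<omega> * ?D j \<omega>))" for \<omega>
    unfolding power2_norm_eq_inner inner_sum_left inner_sum_right
    by (intro sum.cong refl) (simp add: inner_commute)
  have sq_r: "(norm (\<Sum>i\<in>J. indicator {a i<..b i} r *\<^sub>R \<xi> i \<omega>))\<^sup>2
      = (\<Sum>i\<in>J. \<Sum>j\<in>J. ?c i j \<omega> * indicator {max (a i) (a j)<..min (b i) (b j)} r)" for r \<omega>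
    unfolding power2_norm_eq_inner inner_sum_left inner_sum_right
    by (intro sum.cong refl) (auto simp: indicator_def inner_commute)
  have len_int: "integrable lborel (\<lambda>r. indicator {max (a i) (a j)<..min (b i) (b j)} r :: real)"
    "(\<integral>r. indicator {max (a i) (a j)<..min (b i) (b j)} r \<partial>lborel) = len i j" for i j
    unfolding len_def by (rule indicator_Ioc_integral)+
  have integral_r: "(\<integral>r. (\<Sum>i\<in>J. \<Sum>j\<in>J. ?c i j \<omega> * indicator {max (a i) (a j)<..min (b i) (b j)} r) \<partial>lborel)
      = (\<Sum>i\<in>J. \<Sum>j\<in>J. ?c i j \<omega> * len i j)" for \<omega>
    by (subst Bochner_Integration.integral_sum,
        intro Bochner_Integration.integrable_sum integrable_mult_right len_int,
        intro sum.cong refl, subst Bochner_Integration.integral_sum,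
        intro integrable_mult_right len_int, intro sum.cong refl,
        simp only: integral_mult_right_zero len_int(2))
  have inner: "(\<integral>\<^sup>+r. ennreal ((norm (\<Sum>i\<in>J. indicator {a i<..b i} r *\<^sub>R \<xi> i \<omega>))\<^sup>2) \<partial>lborel)
      = ennreal (\<Sum>i\<in>J. \<Sum>j\<in>J. ?c i j \<omega> * len i j)" for \<omega>
  proof -
    have "integrable lborel (\<lambda>r. (norm (\<Sum>i\<in>J. indicator {a i<..b i} r *\<^sub>R \<xi> i \<omega>))\<^sup>2)"
      unfolding sq_r by (intro Bochner_Integration.integrable_sum integrable_mult_right len_int)
    then have "(\<integral>\<^sup>+r. ennreal ((norm (\<Sum>i\<in>J. indicator {a i<..b i} r *\<^sub>R \<xi> i \<omega>))\<^sup>2) \<partial>lborel)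
      = ennreal (\<integral>r. (norm (\<Sum>i\<in>J. indicator {a i<..b i} r *\<^sub>R \<xi> i \<omega>))\<^sup>2 \<partial>lborel)"
      by (intro nn_integral_eq_integral) auto
    also have "(\<integral>r. (norm (\<Sum>i\<in>J. indicator {a i<..b i} r *\<^sub>R \<xi> i \<omega>))\<^sup>2 \<partial>lborel)
      = (\<Sum>i\<in>J. \<Sum>j\<in>J. ?c i j \<omega> * len i j)"
      unfolding sq_r by (rule integral_r)
    finally show ?thesis .
  qed
  have pos: "0 \<le> (\<Sum>i\<in>J. \<Sum>j\<in>J. ?c i j \<omega> * len i j)" for \<omega>
  proof -
    have "0 \<le> (\<integral>r. (norm (\<Sum>i\<in>J. indicator {a i<..b i} r *\<^sub>R \<xi> i \<omega>))\<^sup>2 \<partial>lborel)" by simp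
    also have "\<dots> = (\<Sum>i\<in>J. \<Sum>j\<in>J. ?c i j \<omega> * len i j)"
      unfolding sq_r by (rule integral_r)
    finally show ?thesis .
  qed
  have c_int: "integrable M (\<lambda>\<omega>. ?c i j \<omega> * len i j)" if "i \<in> J" "j \<in> J" for i j
  proof (cases "a i < b i \<and> a j < b j")
    case True
    have "?c i j \<in> borel_measurable M"
      using measurable_F_M[OF c_meas[OF that]] True ab that by fastforce
    then have "integrable M (?c i j)"
      by (rule integrable_const_bound[where B="K*K", rotated]) (use c_bound that in auto)
    then show ?thesis by simp
  next
    case False
    then have "len i j = 0" using ab[OF that(1)] ab[OF that(2)] by (auto simp: len_def)
    then show ?thesis by simp
  qed
  have "(\<integral>\<^sup>+\<omega>. ennreal ((norm (\<Sum>i\<in>J. ?D i \<omega> *\<^sub>R \<xi> i \<omega>))\<^sup>2) \<partial>M)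
    = ennreal (expectation (\<lambda>\<omega>. (norm (\<Sum>i\<in>J. ?D i \<omega> *\<^sub>R \<xi> i \<omega>))\<^sup>2))"
    unfolding sq_W
    by (intro nn_integral_eq_integral Bochner_Integration.integrable_sum cross)
       (auto simp: sq_W[symmetric])
  also have "expectation (\<lambda>\<omega>. (norm (\<Sum>i\<in>J. ?D i \<omega> *\<^sub>R \<xi> i \<omega>))\<^sup>2) = (\<Sum>i\<in>J. \<Sum>j\<in>J. expectation (?c i j) * len i j)"
    unfolding sq_W
    by (subst Bochner_Integration.integral_sum;
        intro sum.cong refl Bochner_Integration.integrable_sum cross)
       (auto simp: Bochner_Integration.integral_sum[OF cross(1)] cross(2) intro!: sum.cong)
  also have "\<dots> = expectation (\<lambda>\<omega>. \<Sum>i\<in>J. \<Sum>j\<in>J. ?c i j \<omega> * len i j)"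
    by (subst Bochner_Integration.integral_sum;
        intro sum.cong refl Bochner_Integration.integrable_sum c_int)
       (auto simp: Bochner_Integration.integral_sum[OF c_int])
  also have "ennreal \<dots> = (\<integral>\<^sup>+\<omega>. ennreal (\<Sum>i\<in>J. \<Sum>j\<in>J. ?c i j \<omega> * len i j) \<partial>M)"
    by (intro nn_integral_eq_integral[symmetric] Bochner_Integration.integrable_sum c_int)
       (auto simp: pos)
  finally show ?thesis unfolding inner .
qed

lemma simple_processD:
  fixes \<xi> :: "nat \<Rightarrow> 'a \<Rightarrow> 'b::euclidean_space"
  assumes sp: "simple_process F u n \<tau> \<xi>"
  shows simple_process_ge: "i \<le> n \<Longrightarrow> 0 \<le> \<tau> i"
    and simple_process_le: "i \<le> n \<Longrightarrow> \<tau> i \<le> u"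
    and simple_process_step: "i < n \<Longrightarrow> \<tau> i \<le> \<tau> (Suc i)"
    and simple_process_measurable: "i < n \<Longrightarrow> \<xi> i \<in> borel_measurable (F (\<tau> i))"
    and simple_process_bounded: "\<exists>B. \<forall>i<n. \<forall>\<omega>\<in>space M. norm (\<xi> i \<omega>) \<le> B"
proof -
  show step: "\<And>i. i < n \<Longrightarrow> \<tau> i \<le> \<tau> (Suc i)" and "\<And>i. i < n \<Longrightarrow> \<xi> i \<in> borel_measurable (F (\<tau> i))"
    using sp unfolding simple_process_def by auto
  have ends: "0 \<le> \<tau> 0" "\<tau> n \<le> u" using sp unfolding simple_process_def by auto
  have mono: "j \<le> l \<Longrightarrow> l \<le> n \<Longrightarrow> \<tau> j \<le> \<tau> l" for j l
  proof (induction l)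
    case (Suc l)
    then show ?case using step[of l] by (cases "j = Suc l") auto
  qed simp
  show "i \<le> n \<Longrightarrow> 0 \<le> \<tau> i" using mono[of 0 i] ends by simp
  show "i \<le> n \<Longrightarrow> \<tau> i \<le> u" using mono[of i n] ends by simp
  have "bounded (\<Union>i\<in>{..<n}. \<xi> i ` space M)"
    using sp unfolding simple_process_def by (intro bounded_UN) auto
  then obtain B where "\<forall>x\<in>(\<Union>i\<in>{..<n}. \<xi> i ` space M). norm x \<le> B" unfolding bounded_iff by blast
  then show "\<exists>B. \<forall>i<n. \<forall>\<omega>\<in>space M. norm (\<xi> i \<omega>) \<le> B" by blast
qed

definition stopped_integral ::
    "real \<Rightarrow> nat \<Rightarrow> (nat \<Rightarrow> real) \<Rightarrow> (nat \<Rightarrow> 'a \<Rightarrow> 'b::euclidean_space) \<Rightarrow> 'a \<Rightarrow> 'b" where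
  "stopped_integral s n \<tau> \<xi> \<omega> = (\<Sum>i<n. (W (min (\<tau> (Suc i)) s) \<omega> - W (min (\<tau> i) s) \<omega>) *\<^sub>R \<xi> i \<omega>)"

text \<open>The part of the integral after \<open>s\<close> is a sum of increments of \<open>W\<close> that start at \<open>s\<close> or later.\<close>

lemma simple_integral_martingale:
  fixes \<xi> :: "nat \<Rightarrow> 'a \<Rightarrow> 'b::euclidean_space" and \<zeta> :: "'a \<Rightarrow> real"
  assumes sp: "simple_process F t n \<tau> \<xi>" and st: "0 \<le> s" "s \<le> t" "t \<le> T"
    and \<zeta>: "\<zeta> \<in> borel_measurable (F s)" and K: "\<And>\<omega>. \<omega> \<in> space M \<Longrightarrow> \<bar>\<zeta> \<omega>\<bar> \<le> K"
  shows "integrable M (\<lambda>\<omega>. \<zeta> \<omega> * ((simple_integral_dW W n \<tau> \<xi> \<omega> - stopped_integral s n \<tau> \<xi> \<omega>) \<bullet> e))"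
    "expectation (\<lambda>\<omega>. \<zeta> \<omega> * ((simple_integral_dW W n \<tau> \<xi> \<omega> - stopped_integral s n \<tau> \<xi> \<omega>) \<bullet> e)) = 0"
proof -
  let ?D = "\<lambda>i \<omega>. W (max (\<tau> (Suc i)) s) \<omega> - W (max (\<tau> i) s) \<omega>"
  let ?f = "\<lambda>i \<omega>. \<zeta> \<omega> * (\<xi> i \<omega> \<bullet> e)"
  have D: "(W (\<tau> (Suc i)) \<omega> - W (\<tau> i) \<omega>) - (W (min (\<tau> (Suc i)) s) \<omega> - W (min (\<tau> i) s) \<omega>) = ?D i \<omega>" for i \<omega>
    by (cases "\<tau> i \<le> s"; cases "\<tau> (Suc i) \<le> s") (simp_all add: min_absorb1 min_absorb2 max_absorb1 max_absorb2)
  have diff: "simple_integral_dW W n \<tau> \<xi> \<omega> - stopped_integral s n \<tau> \<xi> \<omega> = (\<Sum>i<n. ?D i \<omega> *\<^sub>R \<xi> i \<omega>)" for \<omega>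
    unfolding simple_integral_dW_def stopped_integral_def sum_subtractf[symmetric]
    by (simp only: scaleR_left_diff_distrib[symmetric] D)
  have eq: "\<zeta> \<omega> * ((simple_integral_dW W n \<tau> \<xi> \<omega> - stopped_integral s n \<tau> \<xi> \<omega>) \<bullet> e) = (\<Sum>i<n. ?f i \<omega> * ?D i \<omega>)" for \<omega>
    unfolding diff inner_sum_left sum_distrib_left by (intro sum.cong refl) simp
  obtain B where B: "\<forall>i<n. \<forall>\<omega>\<in>space M. norm (\<xi> i \<omega>) \<le> B" using simple_process_bounded[OF sp] by blast
  have summand: "integrable M (\<lambda>\<omega>. ?f i \<omega> * ?D i \<omega>) \<and> expectation (\<lambda>\<omega>. ?f i \<omega> * ?D i \<omega>) = 0" if i: "i < n" for i
  proof -
    let ?m = "max (\<tau> i) s"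
    have m: "0 \<le> ?m" "?m \<le> max (\<tau> (Suc i)) s" "max (\<tau> (Suc i)) s \<le> T" "?m \<le> T"
      using simple_process_le[OF sp, of "Suc i"] simple_process_step[OF sp i] i st by auto
    have f_meas: "?f i \<in> borel_measurable (F ?m)"
      by (intro borel_measurable_times borel_measurable_inner borel_measurable_const
          measurable_F_mono[OF \<zeta>] measurable_F_mono[OF simple_process_measurable[OF sp i]]) auto
    have f_bound: "\<bar>?f i \<omega>\<bar> \<le> K * (B * norm e)" if "\<omega> \<in> space M" for \<omega>
    proof -
      have "\<bar>\<xi> i \<omega> \<bullet> e\<bar> \<le> B * norm e"
        using Cauchy_Schwarz_ineq2[of "\<xi> i \<omega>" e] mult_right_mono[OF B[rule_format, OF i that] norm_ge_zero[of e]] by linarith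
      then show ?thesis
        unfolding abs_mult using K[OF that] by (intro mult_mono) auto
    qed
    have f_int: "integrable M (?f i)"
      by (rule integrable_const_bound[where B="K * (B * norm e)"])
         (use f_bound measurable_F_M[OF f_meas m(4)] in auto)
    show ?thesis using expectation_mult_increment(1,2)[OF m(1,2,3) f_meas f_int] by blast
  qed
  show "integrable M (\<lambda>\<omega>. \<zeta> \<omega> * ((simple_integral_dW W n \<tau> \<xi> \<omega> - stopped_integral s n \<tau> \<xi> \<omega>) \<bullet> e))"
    unfolding eq by (rule Bochner_Integration.integrable_sum) (use summand in auto)
  have "expectation (\<lambda>\<omega>. \<Sum>i<n. ?f i \<omega> * ?D i \<omega>) = (\<Sum>i<n. expectation (\<lambda>\<omega>. ?f i \<omega> * ?D i \<omega>))"
    by (rule Bochner_Integration.integral_sum) (use summand in auto)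
  also have "\<dots> = 0" by (rule sum.neutral) (use summand in auto)
  finally show "expectation (\<lambda>\<omega>. \<zeta> \<omega> * ((simple_integral_dW W n \<tau> \<xi> \<omega> - stopped_integral s n \<tau> \<xi> \<omega>) \<bullet> e)) = 0"
    unfolding eq .
qed

lemma simple_val_measurable:
  fixes \<xi> :: "nat \<Rightarrow> 'a \<Rightarrow> 'b::euclidean_space"
  assumes sp: "simple_process F u n \<tau> \<xi>" and u: "u \<le> T"
  shows "(\<lambda>(r, \<omega>). simple_val n \<tau> \<xi> r \<omega>) \<in> borel_measurable (lborel \<Otimes>\<^sub>M M)"
  unfolding simple_val_def case_prod_beta
proof (intro borel_measurable_sum borel_measurable_scaleR)
  fix i assume "i \<in> {..<n}"
  then have i: "i < n" by simp
  have "\<xi> i \<in> borel_measurable M"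
    using measurable_F_M[OF simple_process_measurable[OF sp i]] simple_process_le[OF sp, of i] i u by simp
  then show "(\<lambda>x. \<xi> i (snd x)) \<in> borel_measurable (lborel \<Otimes>\<^sub>M M)"
    by (rule measurable_compose[OF measurable_snd])
  show "(\<lambda>x. indicator {\<tau> i<..\<tau> (Suc i)} (fst x) :: real) \<in> borel_measurable (lborel \<Otimes>\<^sub>M M)"
    by (rule measurable_compose[OF measurable_fst]) simp
qed

lemma simple_distance_measurable:
  fixes Z :: "real \<Rightarrow> 'a \<Rightarrow> 'b::euclidean_space"
  assumes sp: "simple_process F u n \<tau> \<xi>" and Z: "prog_measurable F {0..<T} Z" and u: "0 \<le> u" "u < T"
  shows "(\<lambda>(r, \<omega>). ennreal ((norm (simple_val n \<tau> \<xi> r \<omega> - Z r \<omega>))\<^sup>2) * indicator {0..u} r) \<in> borel_measurable (lborel \<Otimes>\<^sub>M M)"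
proof -
  have "{0..u} = {0..<T} \<inter> {..u}" using u by auto
  from prog_measurable_joint[OF Z _ _ this] u
  have Zm: "(\<lambda>(r, \<omega>). indicator {0..u} r *\<^sub>R Z r \<omega>) \<in> borel_measurable (lborel \<Otimes>\<^sub>M M)" by simp
  have ind: "(\<lambda>x. indicator {0..u} (fst x) :: ennreal) \<in> borel_measurable (lborel \<Otimes>\<^sub>M M)"
    by (rule measurable_compose[OF measurable_fst]) simp
  have "(\<lambda>x. (case x of (r, \<omega>) \<Rightarrow> simple_val n \<tau> \<xi> r \<omega>) - (case x of (r, \<omega>) \<Rightarrow> indicator {0..u} r *\<^sub>R Z r \<omega>)) \<in> borel_measurable (lborel \<Otimes>\<^sub>M M)"
    by (rule borel_measurable_diff[OF simple_val_measurable[OF sp] Zm]) (use u in simp)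
  then have "(\<lambda>x. ennreal ((norm ((case x of (r, \<omega>) \<Rightarrow> simple_val n \<tau> \<xi> r \<omega>) - (case x of (r, \<omega>) \<Rightarrow> indicator {0..u} r *\<^sub>R Z r \<omega>)))\<^sup>2)) \<in> borel_measurable (lborel \<Otimes>\<^sub>M M)"
    by (rule measurable_compose[where g="\<lambda>v. ennreal ((norm v)\<^sup>2)"]) simp
  from borel_measurable_times_ennreal[OF this ind]
  have "(\<lambda>x. ennreal ((norm ((case x of (r, \<omega>) \<Rightarrow> simple_val n \<tau> \<xi> r \<omega>) - (case x of (r, \<omega>) \<Rightarrow> indicator {0..u} r *\<^sub>R Z r \<omega>)))\<^sup>2) * indicator {0..u} (fst x)) \<in> borel_measurable (lborel \<Otimes>\<^sub>M M)" .
  also have "?this \<longleftrightarrow> ?thesis"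
    by (intro measurable_cong) (auto simp: indicator_def)
  finally show ?thesis .
qed

lemma simple_distance_measurable_sections:
  fixes Z :: "real \<Rightarrow> 'a \<Rightarrow> 'b::euclidean_space"
  assumes sp: "simple_process F u n \<tau> \<xi>" and Z: "prog_measurable F {0..<T} Z" and u: "0 \<le> u" "u < T"
  shows "\<omega> \<in> space M \<Longrightarrow> (\<lambda>r. ennreal ((norm (simple_val n \<tau> \<xi> r \<omega> - Z r \<omega>))\<^sup>2) * indicator {0..u} r) \<in> borel_measurable lborel"
    and "(\<lambda>\<omega>. \<integral>\<^sup>+r. ennreal ((norm (simple_val n \<tau> \<xi> r \<omega> - Z r \<omega>))\<^sup>2) * indicator {0..u} r \<partial>lborel) \<in> borel_measurable M"
proof -
  note m = simple_distance_measurable[OF assms]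
  show "(\<lambda>r. ennreal ((norm (simple_val n \<tau> \<xi> r \<omega> - Z r \<omega>))\<^sup>2) * indicator {0..u} r) \<in> borel_measurable lborel" if "\<omega> \<in> space M"
    using measurable_compose[OF measurable_Pair2'[OF that] m] by simp
  have "(\<lambda>(\<omega>, r). ennreal ((norm (simple_val n \<tau> \<xi> r \<omega> - Z r \<omega>))\<^sup>2) * indicator {0..u} r) \<in> borel_measurable (M \<Otimes>\<^sub>M lborel)"
    using measurable_compose[OF measurable_pair_swap' m] by (simp add: case_prod_beta)
  then show "(\<lambda>\<omega>. \<integral>\<^sup>+r. ennreal ((norm (simple_val n \<tau> \<xi> r \<omega> - Z r \<omega>))\<^sup>2) * indicator {0..u} r \<partial>lborel) \<in> borel_measurable M"
    by (rule lborel.borel_measurable_nn_integral)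
qed

lemma power2_norm_diff_le:
  fixes x y z :: "'v::real_normed_vector"
  shows "(norm (x - y))\<^sup>2 \<le> 2 * (norm (x - z))\<^sup>2 + 2 * (norm (y - z))\<^sup>2"
proof -
  have "norm (x - y) \<le> norm (x - z) + norm (y - z)"
    using norm_triangle_ineq4[of "x - z" "y - z"] by simp
  then have "(norm (x - y))\<^sup>2 \<le> (norm (x - z) + norm (y - z))\<^sup>2" by (intro power_mono) auto
  also have "\<dots> \<le> 2 * (norm (x - z))\<^sup>2 + 2 * (norm (y - z))\<^sup>2"
    using sum_squares_bound[of "norm (x - z)" "norm (y - z)"] by (simp add: power2_sum)
  finally show ?thesis .
qed

text \<open>Two simple processes that are close to \<open>Z\<close> on \<open>[0, s]\<close> have integrals up to \<open>s\<close> that are close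
  to each other, by the isometry.\<close>

lemma stopped_integral_distance:
  fixes Z :: "real \<Rightarrow> 'a \<Rightarrow> 'b::euclidean_space"
  assumes sp: "simple_process F t n \<tau> \<xi>" and sp': "simple_process F s n' \<tau>' \<xi>'"
    and Z: "prog_measurable F {0..<T} Z" and st: "0 \<le> s" "s \<le> t" "t < T"
  shows "(\<integral>\<^sup>+\<omega>. ennreal ((norm (stopped_integral s n \<tau> \<xi> \<omega> - simple_integral_dW W n' \<tau>' \<xi>' \<omega>))\<^sup>2) \<partial>M)
    \<le> 2 * (\<integral>\<^sup>+\<omega>. (\<integral>\<^sup>+r\<in>{0..t}. ennreal ((norm (simple_val n \<tau> \<xi> r \<omega> - Z r \<omega>))\<^sup>2) \<partial>lborel) \<partial>M)
    + 2 * (\<integral>\<^sup>+\<omega>. (\<integral>\<^sup>+r\<in>{0..s}. ennreal ((norm (simple_val n' \<tau>' \<xi>' r \<omega> - Z r \<omega>))\<^sup>2) \<partial>lborel) \<partial>M)" (is "_ \<le> ?R")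
proof -
  \<comment> \<open>The difference as one sum: stopped intervals on the left, negated second process on the right.\<close>
  define J where "J = Inl ` {..<n} \<union> Inr ` {..<n'}"
  define a where "a = case_sum (\<lambda>i. min (\<tau> i) s) \<tau>'"
  define b where "b = case_sum (\<lambda>i. min (\<tau> (Suc i)) s) (\<lambda>i. \<tau>' (Suc i))"
  define x where "x = case_sum \<xi> (\<lambda>i \<omega>. - \<xi>' i \<omega>)"
  have fin: "finite J" by (simp add: J_def)
  have sum_J: "(\<Sum>i\<in>J. g i) = (\<Sum>i<n. g (Inl i)) + (\<Sum>i<n'. g (Inr i))" for g :: "_ \<Rightarrow> 'b"
    unfolding J_def by (subst sum.union_disjoint) (auto simp: sum.reindex)
  obtain B where B: "\<forall>i<n. \<forall>\<omega>\<in>space M. norm (\<xi> i \<omega>) \<le> B"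
    using simple_process_bounded[OF sp] ..
  obtain B' where B': "\<forall>i<n'. \<forall>\<omega>\<in>space M. norm (\<xi>' i \<omega>) \<le> B'"
    using simple_process_bounded[OF sp'] ..
  have xB: "norm (x i \<omega>) \<le> max B B'" if "i \<in> J" "\<omega> \<in> space M" for i \<omega>
  proof (cases i)
    case (Inl j)
    then have "j < n" using that by (auto simp: J_def)
    then have "norm (\<xi> j \<omega>) \<le> B" using B that(2) by blast
    then show ?thesis by (simp add: x_def Inl)
  next
    case (Inr j)
    then have "j < n'" using that by (auto simp: J_def)
    then have "norm (\<xi>' j \<omega>) \<le> B'" using B' that(2) by blast
    then show ?thesis by (simp add: x_def Inr)
  qed
  have ab: "0 \<le> a i \<and> a i \<le> b i \<and> b i \<le> s" if "i \<in> J" for i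
  proof (cases i)
    case (Inl j)
    then have "j < n" using that by (auto simp: J_def)
    then show ?thesis using simple_process_ge[OF sp, of j] simple_process_step[OF sp, of j] st Inl
      by (auto simp: a_def b_def)
  next
    case (Inr j)
    then have "j < n'" using that by (auto simp: J_def)
    then show ?thesis
      using simple_process_ge[OF sp', of j] simple_process_le[OF sp', of "Suc j"] simple_process_step[OF sp', of j] Inr
      by (auto simp: a_def b_def)
  qed
  have xm: "x i \<in> borel_measurable (F (a i))" if "i \<in> J" "a i < b i" for i
  proof (cases i)
    case (Inl j)
    then have j: "j < n" "min (\<tau> j) s < min (\<tau> (Suc j)) s" using that by (auto simp: J_def a_def b_def)
    then have "\<tau> j \<le> s" by linarith
    then show ?thesis using simple_process_measurable[OF sp j(1)] Inl by (simp add: x_def a_def)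
  next
    case (Inr j)
    then have "j < n'" using that by (auto simp: J_def)
    then show ?thesis using simple_process_measurable[OF sp', of j] Inr by (simp add: x_def a_def)
  qed
  let ?v = "\<lambda>r \<omega>. simple_val n \<tau> \<xi> r \<omega>" and ?v' = "\<lambda>r \<omega>. simple_val n' \<tau>' \<xi>' r \<omega>"
  let ?g = "\<lambda>r \<omega>. ennreal ((norm (?v r \<omega> - Z r \<omega>))\<^sup>2) * indicator {0..t} r"
  let ?g' = "\<lambda>r \<omega>. ennreal ((norm (?v' r \<omega> - Z r \<omega>))\<^sup>2) * indicator {0..s} r"
  have "(\<integral>\<^sup>+\<omega>. ennreal ((norm (stopped_integral s n \<tau> \<xi> \<omega> - simple_integral_dW W n' \<tau>' \<xi>' \<omega>))\<^sup>2) \<partial>M)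
    = (\<integral>\<^sup>+\<omega>. ennreal ((norm (\<Sum>i\<in>J. (W (b i) \<omega> - W (a i) \<omega>) *\<^sub>R x i \<omega>))\<^sup>2) \<partial>M)"
    unfolding sum_J by (simp add: stopped_integral_def simple_integral_dW_def a_def b_def x_def sum_negf)
  also have "\<dots> = (\<integral>\<^sup>+\<omega>. (\<integral>\<^sup>+r. ennreal ((norm (\<Sum>i\<in>J. indicator {a i<..b i} r *\<^sub>R x i \<omega>))\<^sup>2) \<partial>lborel) \<partial>M)"
    by (rule simple_isometry[OF fin _ xm xB]) (use ab st in force)+
  also have "\<dots> \<le> (\<integral>\<^sup>+\<omega>. (\<integral>\<^sup>+r. 2 * ?g r \<omega> + 2 * ?g' r \<omega> \<partial>lborel) \<partial>M)"
  proof (intro nn_integral_mono)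
    fix \<omega> r
    show "ennreal ((norm (\<Sum>i\<in>J. indicator {a i<..b i} r *\<^sub>R x i \<omega>))\<^sup>2) \<le> 2 * ?g r \<omega> + 2 * ?g' r \<omega>"
    proof (cases "0 \<le> r \<and> r \<le> s")
      case True
      have 1: "(\<Sum>i<n. indicator {min (\<tau> i) s<..min (\<tau> (Suc i)) s} r *\<^sub>R \<xi> i \<omega>) = ?v r \<omega>"
        unfolding simple_val_def using True by (intro sum.cong refl) (auto simp: indicator_def)
      have 2: "(\<Sum>i\<in>J. indicator {a i<..b i} r *\<^sub>R x i \<omega>) = ?v r \<omega> - ?v' r \<omega>"
        unfolding sum_J by (simp add: a_def b_def x_def 1) (simp add: simple_val_def sum_negf)
      have "ennreal ((norm (?v r \<omega> - ?v' r \<omega>))\<^sup>2) \<le> ennreal (2 * (norm (?v r \<omega> - Z r \<omega>))\<^sup>2 + 2 * (norm (?v' r \<omega> - Z r \<omega>))\<^sup>2)"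
        by (intro ennreal_leI power2_norm_diff_le)
      then show ?thesis using True st by (simp add: 2 ennreal_mult)
    next
      case False
      have "indicator {a i<..b i} r *\<^sub>R x i \<omega> = 0" if "i \<in> J" for i
        using ab[OF that] False by auto
      then have "(\<Sum>i\<in>J. indicator {a i<..b i} r *\<^sub>R x i \<omega>) = 0" by (rule sum.neutral[rule_format])
      then show ?thesis by simp
    qed
  qed
  also have "\<dots> = (\<integral>\<^sup>+\<omega>. 2 * (\<integral>\<^sup>+r. ?g r \<omega> \<partial>lborel) + 2 * (\<integral>\<^sup>+r. ?g' r \<omega> \<partial>lborel) \<partial>M)"
  proof (intro nn_integral_cong)
    fix \<omega> assume \<omega>: "\<omega> \<in> space M"
    note r = simple_distance_measurable_sections(1)[OF sp Z _ _ \<omega>] simple_distance_measurable_sections(1)[OF sp' Z _ _ \<omega>]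
    show "(\<integral>\<^sup>+r. 2 * ?g r \<omega> + 2 * ?g' r \<omega> \<partial>lborel) = 2 * (\<integral>\<^sup>+r. ?g r \<omega> \<partial>lborel) + 2 * (\<integral>\<^sup>+r. ?g' r \<omega> \<partial>lborel)"
      by (subst nn_integral_add; (intro borel_measurable_times_ennreal borel_measurable_const r)?;
          (subst nn_integral_cmult)?; (subst nn_integral_cmult)?; (intro r)?; use st in simp)
  qed
  also have "\<dots> = ?R"
    by (subst nn_integral_add;
        (intro borel_measurable_times_ennreal borel_measurable_const simple_distance_measurable_sections(2)[OF sp Z] simple_distance_measurable_sections(2)[OF sp' Z])?;
        (subst nn_integral_cmult)?; (subst nn_integral_cmult)?;
        (intro simple_distance_measurable_sections(2)[OF sp Z] simple_distance_measurable_sections(2)[OF sp' Z])?; use st in simp)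
  finally show ?thesis .
qed

lemma power2_norm_add3_le:
  fixes x y z :: "'v::real_normed_vector"
  shows "(norm (x + y + z))\<^sup>2 \<le> 3 * ((norm x)\<^sup>2 + (norm y)\<^sup>2 + (norm z)\<^sup>2)"
proof -
  have "norm (x + y + z) \<le> norm x + norm y + norm z"
    using norm_triangle_ineq[of "x + y" z] norm_triangle_ineq[of x y] by simp
  then have "(norm (x + y + z))\<^sup>2 \<le> (norm x + norm y + norm z)\<^sup>2" by (intro power_mono) auto
  also have "\<dots> \<le> 3 * ((norm x)\<^sup>2 + (norm y)\<^sup>2 + (norm z)\<^sup>2)"
    using sum_squares_bound[of "norm x" "norm y"] sum_squares_bound[of "norm x" "norm z"] sum_squares_bound[of "norm y" "norm z"]
    by (simp add: power2_eq_square algebra_simps)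
  finally show ?thesis .
qed

text \<open>Simple processes that approximate \<open>Z\<close> on \<open>[0, t]\<close>, stopped at \<open>s\<close>, have integrals close to \<open>I\<^sub>s\<close>,
  since they approximate \<open>Z\<close> on \<open>[0, s]\<close> as well. Hence \<open>I\<^sub>t - I\<^sub>s\<close> is a limit in \<open>L\<^sup>2\<close> of sums of increments
  after \<open>s\<close>.\<close>

lemma ito_martingale:
  fixes Z I :: "real \<Rightarrow> 'a \<Rightarrow> 'b::euclidean_space" and \<zeta> :: "'a \<Rightarrow> real"
  assumes ito: "ito_integral M W T Z I" and Z: "prog_measurable F {0..<T} Z"
    and st: "0 \<le> s" "s \<le> t" "t < T"
    and \<zeta>: "\<zeta> \<in> borel_measurable (F s)" and K: "\<And>\<omega>. \<omega> \<in> space M \<Longrightarrow> \<bar>\<zeta> \<omega>\<bar> \<le> K"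
  shows "integrable M (\<lambda>\<omega>. \<zeta> \<omega> * ((I t \<omega> - I s \<omega>) \<bullet> e))"
    "expectation (\<lambda>\<omega>. \<zeta> \<omega> * ((I t \<omega> - I s \<omega>) \<bullet> e)) = 0"
proof -
  have I_meas: "I u \<in> borel_measurable M" if "0 \<le> u" "u < T" for u
    using ito that measurable_F_M[of "I u" u] unfolding ito_integral_def by auto
  obtain n \<tau> \<xi> where sp: "\<And>k::nat. simple_process F t (n k) (\<tau> k) (\<xi> k)"
    and Z_lim: "(\<lambda>k. \<integral>\<^sup>+\<omega>. (\<integral>\<^sup>+r\<in>{0..t}. ennreal ((norm (simple_val (n k) (\<tau> k) (\<xi> k) r \<omega> - Z r \<omega>))\<^sup>2) \<partial>lborel) \<partial>M) \<longlonglongrightarrow> 0"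
    and I_lim: "(\<lambda>k. \<integral>\<^sup>+\<omega>. ennreal ((norm (simple_integral_dW W (n k) (\<tau> k) (\<xi> k) \<omega> - I t \<omega>))\<^sup>2) \<partial>M) \<longlonglongrightarrow> 0"
    using ito[unfolded ito_integral_def, THEN conjunct2, THEN conjunct2, rule_format, of t] st
    by auto
  obtain n' \<tau>' \<xi>' where sp': "\<And>k::nat. simple_process F s (n' k) (\<tau>' k) (\<xi>' k)"
    and Z_lim': "(\<lambda>k. \<integral>\<^sup>+\<omega>. (\<integral>\<^sup>+r\<in>{0..s}. ennreal ((norm (simple_val (n' k) (\<tau>' k) (\<xi>' k) r \<omega> - Z r \<omega>))\<^sup>2) \<partial>lborel) \<partial>M) \<longlonglongrightarrow> 0"
    and I_lim': "(\<lambda>k. \<integral>\<^sup>+\<omega>. ennreal ((norm (simple_integral_dW W (n' k) (\<tau>' k) (\<xi>' k) \<omega> - I s \<omega>))\<^sup>2) \<partial>M) \<longlonglongrightarrow> 0"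
    using ito[unfolded ito_integral_def, THEN conjunct2, THEN conjunct2, rule_format, of s] st
    by auto
  have S_meas: "simple_integral_dW W n \<tau> \<xi> \<in> borel_measurable M"
    and P_meas: "stopped_integral s n \<tau> \<xi> \<in> borel_measurable M"
    if sp: "simple_process F u n \<tau> \<xi>" and u: "u \<le> T" for u n \<tau> and \<xi> :: "nat \<Rightarrow> 'a \<Rightarrow> 'b"
  proof -
    have 1: "\<xi> i \<in> borel_measurable M" if "i < n" for i
      using measurable_F_M[OF simple_process_measurable[OF sp that]] simple_process_le[OF sp, of i] that u by simp
    have 2: "W (\<tau> i) \<in> borel_measurable M" "W (min (\<tau> i) s) \<in> borel_measurable M" if "i \<le> n" for i
      using simple_process_ge[OF sp that] simple_process_le[OF sp that] u st by (auto intro!: W_measurable)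
    show "simple_integral_dW W n \<tau> \<xi> \<in> borel_measurable M"
      unfolding simple_integral_dW_def
      by (intro borel_measurable_sum borel_measurable_scaleR borel_measurable_diff 1 2) auto
    show "stopped_integral s n \<tau> \<xi> \<in> borel_measurable M"
      unfolding stopped_integral_def
      by (intro borel_measurable_sum borel_measurable_scaleR borel_measurable_diff 1 2) auto
  qed
  have \<zeta>M: "\<zeta> \<in> borel_measurable M" using measurable_F_M[OF \<zeta>] st by simp
  define S where "S k = simple_integral_dW W (n k) (\<tau> k) (\<xi> k)" for k
  define S' where "S' k = simple_integral_dW W (n' k) (\<tau>' k) (\<xi>' k)" for k
  define P where "P k = stopped_integral s (n k) (\<tau> k) (\<xi> k)" for k
  note meas = S_meas[OF sp, folded S_def] S_meas[OF sp', folded S'_def] P_meas[OF sp, folded P_def]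
  have S_meas: "S k \<in> borel_measurable M" and S'_meas: "S' k \<in> borel_measurable M" and P_meas: "P k \<in> borel_measurable M" for k
    using meas st by auto
  have SP: "integrable M (\<lambda>\<omega>. \<zeta> \<omega> * ((S k \<omega> - P k \<omega>) \<bullet> e)) \<and> expectation (\<lambda>\<omega>. \<zeta> \<omega> * ((S k \<omega> - P k \<omega>) \<bullet> e)) = 0" for k
    unfolding S_def P_def using simple_integral_martingale[OF sp _ _ _ \<zeta> K] st by simp
  let ?E = "\<lambda>k. \<integral>\<^sup>+\<omega>. (\<integral>\<^sup>+r\<in>{0..t}. ennreal ((norm (simple_val (n k) (\<tau> k) (\<xi> k) r \<omega> - Z r \<omega>))\<^sup>2) \<partial>lborel) \<partial>M"
  let ?E' = "\<lambda>k. \<integral>\<^sup>+\<omega>. (\<integral>\<^sup>+r\<in>{0..s}. ennreal ((norm (simple_val (n' k) (\<tau>' k) (\<xi>' k) r \<omega> - Z r \<omega>))\<^sup>2) \<partial>lborel) \<partial>M"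
  have PS: "(\<integral>\<^sup>+\<omega>. ennreal ((norm (P k \<omega> - S' k \<omega>))\<^sup>2) \<partial>M) \<le> 2 * ?E k + 2 * ?E' k" for k
    unfolding P_def S'_def by (rule stopped_integral_distance[OF sp sp' Z st])
  define D where "D k \<omega> = (I t \<omega> - I s \<omega>) - (S k \<omega> - P k \<omega>)" for k \<omega>
  have D_meas: "D k \<in> borel_measurable M" for k
    unfolding D_def using I_meas st by (intro borel_measurable_diff S_meas P_meas) auto
  define d where "d k = 3 * ((\<integral>\<^sup>+\<omega>. ennreal ((norm (S k \<omega> - I t \<omega>))\<^sup>2) \<partial>M)
      + (\<integral>\<^sup>+\<omega>. ennreal ((norm (S' k \<omega> - I s \<omega>))\<^sup>2) \<partial>M) + (2 * ?E k + 2 * ?E' k))" for k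
  have D_le: "(\<integral>\<^sup>+\<omega>. ennreal ((norm (D k \<omega>))\<^sup>2) \<partial>M) \<le> d k" for k
  proof -
    have "(\<integral>\<^sup>+\<omega>. ennreal ((norm (D k \<omega>))\<^sup>2) \<partial>M)
      \<le> (\<integral>\<^sup>+\<omega>. 3 * (ennreal ((norm (S k \<omega> - I t \<omega>))\<^sup>2) + ennreal ((norm (S' k \<omega> - I s \<omega>))\<^sup>2) + ennreal ((norm (P k \<omega> - S' k \<omega>))\<^sup>2)) \<partial>M)"
    proof (rule nn_integral_mono)
      fix \<omega>
      have eq: "D k \<omega> = (S' k \<omega> - I s \<omega>) + (P k \<omega> - S' k \<omega>) + (I t \<omega> - S k \<omega>)"
        unfolding D_def by simp
      have "ennreal ((norm (D k \<omega>))\<^sup>2) \<le> ennreal (3 * ((norm (S' k \<omega> - I s \<omega>))\<^sup>2 + (norm (P k \<omega> - S' k \<omega>))\<^sup>2 + (norm (S k \<omega> - I t \<omega>))\<^sup>2))"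
        unfolding eq norm_minus_commute[of "S k \<omega>"] by (intro ennreal_leI power2_norm_add3_le)
      also have "\<dots> = 3 * (ennreal ((norm (S k \<omega> - I t \<omega>))\<^sup>2) + ennreal ((norm (S' k \<omega> - I s \<omega>))\<^sup>2) + ennreal ((norm (P k \<omega> - S' k \<omega>))\<^sup>2))"
        by (simp add: ennreal_mult ennreal_plus add_ac )
      finally show "ennreal ((norm (D k \<omega>))\<^sup>2) \<le> 3 * (ennreal ((norm (S k \<omega> - I t \<omega>))\<^sup>2) + ennreal ((norm (S' k \<omega> - I s \<omega>))\<^sup>2) + ennreal ((norm (P k \<omega> - S' k \<omega>))\<^sup>2))" .
    qed
    also have "\<dots> = 3 * ((\<integral>\<^sup>+\<omega>. ennreal ((norm (S k \<omega> - I t \<omega>))\<^sup>2) \<partial>M)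
      + (\<integral>\<^sup>+\<omega>. ennreal ((norm (S' k \<omega> - I s \<omega>))\<^sup>2) \<partial>M) + (\<integral>\<^sup>+\<omega>. ennreal ((norm (P k \<omega> - S' k \<omega>))\<^sup>2) \<partial>M))"
      using S_meas[of k] S'_meas[of k] P_meas[of k] I_meas[of t] I_meas[of s] st
      by (simp add: nn_integral_add nn_integral_cmult)
    also have "\<dots> \<le> d k" unfolding d_def by (intro mult_left_mono add_mono order_refl PS) simp
    finally show ?thesis .
  qed
  have d_lim: "d \<longlonglongrightarrow> 0"
  proof -
    have c: "(\<lambda>k. c * f k) \<longlonglongrightarrow> 0" if "f \<longlonglongrightarrow> 0" "c < top" for c and f :: "nat \<Rightarrow> ennreal"
      using ennreal_tendsto_cmult[OF that(2,1)] by simp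
    have p: "(\<lambda>k. f k + g k) \<longlonglongrightarrow> 0" if "f \<longlonglongrightarrow> 0" "g \<longlonglongrightarrow> 0" for f g :: "nat \<Rightarrow> ennreal"
      using tendsto_add[OF that] by simp
    show ?thesis
      unfolding d_def
      by (rule c[OF p[OF p[OF I_lim[folded S_def] I_lim'[folded S'_def]] p[OF c[OF Z_lim] c[OF Z_lim']]]]) simp_all
  qed
  have D_int: "integrable M (\<lambda>\<omega>. (norm (D k \<omega>))\<^sup>2)" if "d k < \<infinity>" for k
    using D_le[of k] that D_meas[of k] by (intro integrableI_nonneg) (auto simp: less_top[symmetric] top_unique)
  \<comment> \<open>The elementary bound \<open>\<bar>d\<bar> \<le> \<gamma> + d\<^sup>2 / \<gamma>\<close> turns smallness in \<open>L\<^sup>2\<close> into smallness in \<open>L\<^sup>1\<close>.\<close>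
  have bnd: "integrable M (\<lambda>\<omega>. \<zeta> \<omega> * (D k \<omega> \<bullet> e)) \<and>
      \<bar>expectation (\<lambda>\<omega>. \<zeta> \<omega> * (D k \<omega> \<bullet> e))\<bar> \<le> \<bar>K\<bar> * norm e * (\<gamma> + enn2real (d k) / \<gamma>)"
    if dk: "d k < \<infinity>" and \<gamma>: "0 < \<gamma>" for k \<gamma>
  proof -
    have le: "\<bar>\<zeta> \<omega> * (D k \<omega> \<bullet> e)\<bar> \<le> \<bar>K\<bar> * norm e * (\<gamma> + (norm (D k \<omega>))\<^sup>2 / \<gamma>)" if "\<omega> \<in> space M" for \<omega>
    proof -
      have 1: "norm (D k \<omega>) \<le> \<gamma> + (norm (D k \<omega>))\<^sup>2 / \<gamma>"
      proof (cases "norm (D k \<omega>) \<le> \<gamma>")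
        case False
        then have "norm (D k \<omega>) * \<gamma> \<le> norm (D k \<omega>) * norm (D k \<omega>)" by (intro mult_left_mono) auto
        then have "norm (D k \<omega>) \<le> (norm (D k \<omega>))\<^sup>2 / \<gamma>" using \<gamma> by (simp add: field_simps power2_eq_square)
        then show ?thesis using \<gamma> by simp
      qed (use \<gamma> in \<open>simp add: add_increasing2\<close>)
      have "\<bar>\<zeta> \<omega> * (D k \<omega> \<bullet> e)\<bar> \<le> \<bar>K\<bar> * (norm (D k \<omega>) * norm e)"
        unfolding abs_mult using K[OF that] Cauchy_Schwarz_ineq2[of "D k \<omega>" e] by (intro mult_mono) auto
      also have "\<dots> \<le> \<bar>K\<bar> * ((\<gamma> + (norm (D k \<omega>))\<^sup>2 / \<gamma>) * norm e)" by (intro mult_left_mono mult_right_mono 1) auto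
      finally show ?thesis by (simp add: mult_ac)
    qed
    have int: "integrable M (\<lambda>\<omega>. \<bar>K\<bar> * norm e * (\<gamma> + (norm (D k \<omega>))\<^sup>2 / \<gamma>))"
      using D_int[OF dk] by (intro integrable_mult_right Bochner_Integration.integrable_add) auto
    have i1: "integrable M (\<lambda>\<omega>. \<zeta> \<omega> * (D k \<omega> \<bullet> e))"
    proof (rule Bochner_Integration.integrable_bound[OF int])
      show "(\<lambda>\<omega>. \<zeta> \<omega> * (D k \<omega> \<bullet> e)) \<in> borel_measurable M"
        by (intro borel_measurable_times borel_measurable_inner \<zeta>M D_meas) simp
      show "AE \<omega> in M. norm (\<zeta> \<omega> * (D k \<omega> \<bullet> e)) \<le> norm (\<bar>K\<bar> * norm e * (\<gamma> + (norm (D k \<omega>))\<^sup>2 / \<gamma>))"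
        using le by (intro AE_I2) (auto intro: order_trans[OF _ abs_ge_self])
    qed
    have "\<bar>expectation (\<lambda>\<omega>. \<zeta> \<omega> * (D k \<omega> \<bullet> e))\<bar> \<le> expectation (\<lambda>\<omega>. \<bar>\<zeta> \<omega> * (D k \<omega> \<bullet> e)\<bar>)"
      by (rule integral_abs_bound)
    also have "\<dots> \<le> expectation (\<lambda>\<omega>. \<bar>K\<bar> * norm e * (\<gamma> + (norm (D k \<omega>))\<^sup>2 / \<gamma>))"
      by (rule integral_mono[OF integrable_abs[OF i1] int le])
    also have "\<dots> = \<bar>K\<bar> * norm e * (\<gamma> + expectation (\<lambda>\<omega>. (norm (D k \<omega>))\<^sup>2) / \<gamma>)"
      using D_int[OF dk] by (simp add: prob_space)
    also have "\<dots> \<le> \<bar>K\<bar> * norm e * (\<gamma> + enn2real (d k) / \<gamma>)"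
    proof -
      have "ennreal (expectation (\<lambda>\<omega>. (norm (D k \<omega>))\<^sup>2)) \<le> d k"
        using D_le[of k] nn_integral_eq_integral[OF D_int[OF dk]] by simp
      then have "enn2real (ennreal (expectation (\<lambda>\<omega>. (norm (D k \<omega>))\<^sup>2))) \<le> enn2real (d k)"
        using dk by (intro enn2real_mono) auto
      then have "expectation (\<lambda>\<omega>. (norm (D k \<omega>))\<^sup>2) \<le> enn2real (d k)" by simp
      then show ?thesis using \<gamma> by (intro mult_left_mono add_left_mono divide_right_mono) auto
    qed
    finally show ?thesis using i1 by blast
  qed
  have split: "\<zeta> \<omega> * ((I t \<omega> - I s \<omega>) \<bullet> e) = \<zeta> \<omega> * ((S k \<omega> - P k \<omega>) \<bullet> e) + \<zeta> \<omega> * (D k \<omega> \<bullet> e)" for k \<omega>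
    by (simp add: D_def inner_diff_left algebra_simps)
  have ev: "\<forall>\<^sub>F k in sequentially. d k < \<infinity>"
    using order_tendstoD(2)[OF d_lim, of \<infinity>] by simp
  then obtain k0 where k0: "d k0 < \<infinity>" by (auto simp: eventually_sequentially)
  show int: "integrable M (\<lambda>\<omega>. \<zeta> \<omega> * ((I t \<omega> - I s \<omega>) \<bullet> e))"
    unfolding split[of _ k0] using SP[of k0] bnd[OF k0, of 1] by auto
  let ?x = "expectation (\<lambda>\<omega>. \<zeta> \<omega> * ((I t \<omega> - I s \<omega>) \<bullet> e))"
  have "\<bar>?x\<bar> \<le> \<bar>K\<bar> * norm e * \<gamma>" if \<gamma>: "0 < \<gamma>" for \<gamma>
  proof -
    have lim: "(\<lambda>k. \<bar>K\<bar> * norm e * (\<gamma> + enn2real (d k) / \<gamma>)) \<longlonglongrightarrow> \<bar>K\<bar> * norm e * (\<gamma> + 0 / \<gamma>)"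
      using tendsto_enn2real[of d 0 sequentially] d_lim \<gamma> by (intro tendsto_intros) auto
    have "\<forall>\<^sub>F k in sequentially. \<bar>?x\<bar> \<le> \<bar>K\<bar> * norm e * (\<gamma> + enn2real (d k) / \<gamma>)"
      using ev
    proof eventually_elim
      case (elim k)
      have "?x = expectation (\<lambda>\<omega>. \<zeta> \<omega> * (D k \<omega> \<bullet> e))"
        unfolding split[of _ k] using SP[of k] bnd[OF elim \<gamma>] by simp
      then show ?case using bnd[OF elim \<gamma>] by simp
    qed
    then show ?thesis using tendsto_lowerbound[OF lim] by simp
  qed
  then have "\<bar>?x\<bar> \<le> \<gamma>" if "0 < \<gamma>" for \<gamma>
  proof -
    have "\<bar>?x\<bar> \<le> \<bar>K\<bar> * norm e * (\<gamma> / (\<bar>K\<bar> * norm e + 1))"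
      by (intro \<open>\<And>\<gamma>. 0 < \<gamma> \<Longrightarrow> \<bar>?x\<bar> \<le> \<bar>K\<bar> * norm e * \<gamma>\<close>) (use that in \<open>simp add: add_nonneg_pos\<close>)
    also have "\<dots> = (\<bar>K\<bar> * norm e / (\<bar>K\<bar> * norm e + 1)) * \<gamma>" by simp
    also have "\<dots> \<le> 1 * \<gamma>" using that by (intro mult_right_mono) (auto simp: divide_le_eq add_nonneg_pos)
    finally show ?thesis by simp
  qed
  then have "\<bar>?x\<bar> \<le> 0" by (rule field_le_epsilon) simp
  then show "?x = 0" by simp
qed

end

section \<open>Random subsequences and the terminal condition\<close>

lemma limsup_frequently_close:
  fixes g :: "nat \<Rightarrow> real"
  assumes B: "\<And>k. \<bar>g k\<bar> \<le> B" and \<epsilon>: "0 < \<epsilon>"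
  shows "\<exists>i>n. \<bar>g i - real_of_ereal (limsup (\<lambda>k. ereal (g k)))\<bar> < \<epsilon>"
proof -
  define L where "L = limsup (\<lambda>k. ereal (g k))"
  have gB: "g k \<le> B" "- B \<le> g k" for k using B[of k] by auto
  have "L \<le> ereal B" unfolding L_def by (rule Limsup_bounded) (simp add: gB)
  moreover have "ereal (- B) \<le> L" unfolding L_def
    by (rule le_Limsup) (simp_all add: gB)
  ultimately obtain l where l: "L = ereal l" by (cases L) auto
  have "\<forall>\<^sub>F k in sequentially. ereal (g k) < ereal (l + \<epsilon>)"
    by (rule Limsup_lessD) (use l \<epsilon> in \<open>simp add: L_def\<close>)
  then obtain N where N: "\<And>k. N \<le> k \<Longrightarrow> g k < l + \<epsilon>" by (auto simp: eventually_sequentially)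
  have "\<not> (\<forall>\<^sub>F k in sequentially. ereal (g k) \<le> ereal (l - \<epsilon>))"
  proof
    assume "\<forall>\<^sub>F k in sequentially. ereal (g k) \<le> ereal (l - \<epsilon>)"
    then have "L \<le> ereal (l - \<epsilon>)" unfolding L_def by (rule Limsup_bounded)
    then show False using l \<epsilon> by simp
  qed
  then obtain i where "max N (Suc n) \<le> i" "\<not> g i \<le> l - \<epsilon>"
    unfolding eventually_sequentially ereal_less_eq by blast
  then show ?thesis using N[of i] l by (intro exI[of _ i]) (auto simp: L_def[symmetric])
qed

definition random_subseq :: "'a measure \<Rightarrow> (nat \<Rightarrow> 'a \<Rightarrow> nat) \<Rightarrow> bool" where
  "random_subseq M r \<longleftrightarrow> (\<forall>j. r j \<in> measurable M (count_space UNIV)) \<and>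
     (\<forall>\<omega>\<in>space M. strict_mono (\<lambda>j. r j \<omega>))"

lemma measurable_at_random_index:
  assumes "\<And>k. g k \<in> measurable M N" "r \<in> measurable M (count_space (UNIV::nat set))"
  shows "(\<lambda>\<omega>. g (r \<omega>) \<omega>) \<in> measurable M N"
  by (rule measurable_compose_countable[OF assms])

text \<open>A measurable Bolzano-Weierstrass theorem: the subsequence consists of the first index after
  the previous one at which the sequence comes close enough to its upper limit.\<close>

lemma random_subseq_limsup:
  fixes g :: "nat \<Rightarrow> 'a \<Rightarrow> real"
  assumes g: "\<And>k. g k \<in> borel_measurable M" and B: "\<And>k \<omega>. \<omega> \<in> space M \<Longrightarrow> \<bar>g k \<omega>\<bar> \<le> B"
    and r: "random_subseq M r"
  obtains s where "random_subseq M (\<lambda>j \<omega>. r (s j \<omega>) \<omega>)" "\<And>\<omega>. \<omega> \<in> space M \<Longrightarrow> strict_mono (\<lambda>j. s j \<omega>)"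
    "\<And>\<omega>. \<omega> \<in> space M \<Longrightarrow>
      (\<lambda>j. g (r (s j \<omega>) \<omega>) \<omega>) \<longlonglongrightarrow> real_of_ereal (limsup (\<lambda>k. ereal (g (r k \<omega>) \<omega>)))"
proof -
  have r_meas: "r j \<in> measurable M (count_space UNIV)" for j using r by (simp add: random_subseq_def)
  have gr: "(\<lambda>\<omega>. g (r k \<omega>) \<omega>) \<in> borel_measurable M" for k
    by (rule measurable_at_random_index[OF g r_meas])
  define L where "L \<omega> = real_of_ereal (limsup (\<lambda>k. ereal (g (r k \<omega>) \<omega>)))" for \<omega>
  have L_meas: "L \<in> borel_measurable M"
    unfolding L_def[abs_def] using gr by measurable
  define P where "P j i \<omega> \<longleftrightarrow> \<bar>g (r i \<omega>) \<omega> - L \<omega>\<bar> < 1 / real (Suc j)" for j i \<omega>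
  have P_meas: "Measurable.pred M (P j i)" for j i
    unfolding P_def[abs_def] using gr[of i] L_meas by measurable
  have P_ex: "\<exists>i>n. P j i \<omega>" if "\<omega> \<in> space M" for n j \<omega>
    unfolding P_def L_def by (rule limsup_frequently_close[where B=B]) (use B that in auto)
  define s where "s = rec_nat (\<lambda>\<omega>. LEAST i. P 0 i \<omega>) (\<lambda>j s \<omega>. LEAST i. s \<omega> < i \<and> P (Suc j) i \<omega>)"
  have s0: "s 0 \<omega> = (LEAST i. P 0 i \<omega>)" and sS: "s (Suc j) \<omega> = (LEAST i. s j \<omega> < i \<and> P (Suc j) i \<omega>)" for j \<omega>
    by (simp_all add: s_def)
  have s_prop: "s j \<omega> < s (Suc j) \<omega> \<and> P (Suc j) (s (Suc j) \<omega>) \<omega>" if "\<omega> \<in> space M" for j \<omega>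
    unfolding sS by (rule LeastI_ex) (use P_ex[OF that, of "s j \<omega>" "Suc j"] in blast)
  have s_meas: "s j \<in> measurable M (count_space UNIV)" for j
  proof (induction j)
    case 0
    show ?case unfolding s0[abs_def] by (rule measurable_Least) (rule P_meas)
  next
    case (Suc j)
    have "Measurable.pred M (\<lambda>\<omega>. s j \<omega> < i \<and> P (Suc j) i \<omega>)" for i
      using Suc P_meas[of "Suc j" i] by measurable
    then show ?case unfolding sS[abs_def] by (rule measurable_Least)
  qed
  have s_mono: "strict_mono (\<lambda>j. s j \<omega>)" if "\<omega> \<in> space M" for \<omega>
    using s_prop[OF that] by (simp add: strict_mono_Suc_iff)
  show thesis
  proof (rule that[of s])
    show "random_subseq M (\<lambda>j \<omega>. r (s j \<omega>) \<omega>)"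
      unfolding random_subseq_def
    proof (intro conjI allI ballI)
      show "(\<lambda>\<omega>. r (s j \<omega>) \<omega>) \<in> measurable M (count_space UNIV)" for j
        by (rule measurable_at_random_index[OF r_meas s_meas])
      show "strict_mono (\<lambda>j. r (s j \<omega>) \<omega>)" if "\<omega> \<in> space M" for \<omega>
        using strict_mono_compose[of "\<lambda>j. r j \<omega>" "\<lambda>j. s j \<omega>"] s_mono[OF that] r that
        by (simp add: random_subseq_def)
    qed
    show "strict_mono (\<lambda>j. s j \<omega>)" if "\<omega> \<in> space M" for \<omega> by (rule s_mono[OF that])
    show "(\<lambda>j. g (r (s j \<omega>) \<omega>) \<omega>) \<longlonglongrightarrow> real_of_ereal (limsup (\<lambda>k. ereal (g (r k \<omega>) \<omega>)))"
      if \<omega>: "\<omega> \<in> space M" for \<omega>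
      unfolding L_def[symmetric]
    proof (rule LIMSEQ_imp_Suc, rule LIM_zero_cancel, rule Lim_null_comparison)
      show "\<forall>\<^sub>F j in sequentially. norm (g (r (s (Suc j) \<omega>) \<omega>) \<omega> - L \<omega>) \<le> 1 / real (Suc (Suc j))"
        using s_prop[OF \<omega>] by (intro always_eventually) (auto simp: P_def less_imp_le)
      show "(\<lambda>j. 1 / real (Suc (Suc j))) \<longlonglongrightarrow> 0"
        by (rule LIMSEQ_Suc[OF LIMSEQ_Suc[OF lim_1_over_n]])
    qed
  qed
qed

text \<open>The first subsequence is taken for the norm, so that the norm of the limit is the upper limit of
  the norms of the whole sequence; further subsequences make the components converge one by one.\<close>

lemma random_subseq_vector:
  fixes p :: "nat \<Rightarrow> 'a \<Rightarrow> real^'n"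
  assumes p: "\<And>k. p k \<in> borel_measurable M" and B: "\<And>k \<omega>. \<omega> \<in> space M \<Longrightarrow> norm (p k \<omega>) \<le> B"
  obtains r v where "random_subseq M r" "v \<in> borel_measurable M"
    "\<And>\<omega>. \<omega> \<in> space M \<Longrightarrow> (\<lambda>j. p (r j \<omega>) \<omega>) \<longlonglongrightarrow> v \<omega>"
    "\<And>\<omega>. \<omega> \<in> space M \<Longrightarrow> norm (v \<omega>) = real_of_ereal (limsup (\<lambda>k. ereal (norm (p k \<omega>))))"
proof -
  let ?L = "\<lambda>\<omega>. real_of_ereal (limsup (\<lambda>k. ereal (norm (p k \<omega>))))"
  have norm_p: "(\<lambda>\<omega>. norm (p k \<omega>)) \<in> borel_measurable M" for k
    by (rule measurable_compose[OF p borel_measurable_norm])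
  have id: "random_subseq M (\<lambda>j \<omega>. j)" by (auto simp: random_subseq_def strict_mono_def)
  have "\<exists>r. random_subseq M r \<and> (\<forall>\<omega>\<in>space M. (\<lambda>j. norm (p (r j \<omega>) \<omega>)) \<longlonglongrightarrow> ?L \<omega> \<and>
      (\<forall>i\<in>S. convergent (\<lambda>j. p (r j \<omega>) \<omega> $ i)))" if "finite S" for S :: "'n set"
    using that
  proof (induction S)
    case empty
    have bd: "\<bar>norm (p k \<omega>)\<bar> \<le> B" if "\<omega> \<in> space M" for k \<omega> using B[OF that] by simp
    obtain s where "random_subseq M (\<lambda>j \<omega>. s j \<omega>)"
      "\<And>\<omega>. \<omega> \<in> space M \<Longrightarrow> (\<lambda>j. norm (p (s j \<omega>) \<omega>)) \<longlonglongrightarrow> ?L \<omega>"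
      by (rule random_subseq_limsup[of "\<lambda>k \<omega>. norm (p k \<omega>)" M B "\<lambda>j \<omega>. j", OF norm_p bd id]) (assumption+, blast)
    then show ?case by (intro exI[of _ s]) simp
  next
    case (insert i S)
    then obtain r where r: "random_subseq M r"
      and r_lim: "\<And>\<omega>. \<omega> \<in> space M \<Longrightarrow> (\<lambda>j. norm (p (r j \<omega>) \<omega>)) \<longlonglongrightarrow> ?L \<omega>"
      and r_conv: "\<And>\<omega> i. \<omega> \<in> space M \<Longrightarrow> i \<in> S \<Longrightarrow> convergent (\<lambda>j. p (r j \<omega>) \<omega> $ i)"
      by auto
    have pi: "(\<lambda>\<omega>. p k \<omega> $ i) \<in> borel_measurable M" for k
      by (rule borel_measurable_vec_nth[OF p])
    have bd: "\<bar>p k \<omega> $ i\<bar> \<le> B" if "\<omega> \<in> space M" for k \<omega>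
      using B[OF that, of k] component_le_norm_cart[of "p k \<omega>" i] by linarith
    obtain s where s: "random_subseq M (\<lambda>j \<omega>. r (s j \<omega>) \<omega>)" "\<And>\<omega>. \<omega> \<in> space M \<Longrightarrow> strict_mono (\<lambda>j. s j \<omega>)"
      "\<And>\<omega>. \<omega> \<in> space M \<Longrightarrow> (\<lambda>j. p (r (s j \<omega>) \<omega>) \<omega> $ i) \<longlonglongrightarrow> real_of_ereal (limsup (\<lambda>k. ereal (p (r k \<omega>) \<omega> $ i)))"
      by (rule random_subseq_limsup[of "\<lambda>k \<omega>. p k \<omega> $ i" M B r, OF pi bd r]) (assumption+, blast)
    have "(\<lambda>j. norm (p (r (s j \<omega>) \<omega>) \<omega>)) \<longlonglongrightarrow> ?L \<omega>" if "\<omega> \<in> space M" for \<omega>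
      using LIMSEQ_subseq_LIMSEQ[OF r_lim[OF that] s(2)[OF that]] by (simp add: comp_def)
    moreover have "convergent (\<lambda>j. p (r (s j \<omega>) \<omega>) \<omega> $ l)" if "\<omega> \<in> space M" "l \<in> insert i S" for \<omega> l
    proof (cases "l = i")
      case True
      then show ?thesis using s(3)[OF that(1)] convergent_def by blast
    next
      case False
      then have "l \<in> S" using that by simp
      from convergent_subseq_convergent[OF r_conv[OF that(1) this] s(2)[OF that(1)]]
      show ?thesis by (simp add: comp_def)
    qed
    ultimately show ?case using s(1) by (intro exI[of _ "\<lambda>j \<omega>. r (s j \<omega>) \<omega>"]) blast
  qed
  from this[of UNIV] obtain r where r: "random_subseq M r"
    and r_lim: "\<And>\<omega>. \<omega> \<in> space M \<Longrightarrow> (\<lambda>j. norm (p (r j \<omega>) \<omega>)) \<longlonglongrightarrow> ?L \<omega>"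
    and r_conv: "\<And>\<omega> i. \<omega> \<in> space M \<Longrightarrow> convergent (\<lambda>j. p (r j \<omega>) \<omega> $ i)" by auto
  define v where "v \<omega> = (\<chi> i. lim (\<lambda>j. p (r j \<omega>) \<omega> $ i))" for \<omega>
  have v_lim: "(\<lambda>j. p (r j \<omega>) \<omega>) \<longlonglongrightarrow> v \<omega>" if "\<omega> \<in> space M" for \<omega>
    unfolding v_def using r_conv[OF that] by (intro vec_tendstoI) (simp add: convergent_LIMSEQ_iff)
  have pr: "(\<lambda>\<omega>. p (r j \<omega>) \<omega>) \<in> borel_measurable M" for j
  proof (rule measurable_at_random_index[OF p])
    show "r j \<in> measurable M (count_space UNIV)" using r unfolding random_subseq_def by blast
  qed
  have "v \<in> borel_measurable M" by (rule borel_measurable_LIMSEQ_metric[OF pr v_lim])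
  moreover have "norm (v \<omega>) = ?L \<omega>" if "\<omega> \<in> space M" for \<omega>
    using LIMSEQ_unique[OF tendsto_norm[OF v_lim[OF that]] r_lim[OF that]] .
  ultimately show thesis using that[OF r _ v_lim] by blast
qed

text \<open>The clause \<open>\<psi>\<^sub>T \<noteq> 0\<close> of the terminal condition of a supersolution.\<close>

definition singular_at :: "'a measure \<Rightarrow> real \<Rightarrow> (real \<Rightarrow> 'a \<Rightarrow> real^'n^'n) \<Rightarrow> bool" where
  "singular_at M T Y \<longleftrightarrow> (\<forall>\<psi>. (\<forall>t\<in>{0..T}. \<psi> t \<in> borel_measurable M) \<and>
      (AE \<omega> in M. ((\<lambda>t. \<psi> t \<omega>) \<longlongrightarrow> \<psi> T \<omega>) (at_left T)) \<longrightarrow>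
      (AE \<omega> in M. \<psi> T \<omega> \<noteq> 0 \<longrightarrow> Liminf (at_left T) (\<lambda>t. ereal (\<psi> t \<omega> \<bullet> (Y t \<omega> *v \<psi> t \<omega>))) = \<infinity>))"

text \<open>Vectors on which the forms \<open>Y\<^sub>t\<close> stay bounded as \<open>t \<rightarrow> T\<close> must tend to zero: a limit point is the
  value at \<open>T\<close> of a process \<open>\<psi>\<close>, left-continuous at \<open>T\<close>, that passes through a subsequence of them.\<close>

lemma singular_bounded_form_tendsto_0:
  fixes p :: "nat \<Rightarrow> 'a \<Rightarrow> real^'n"
  assumes Y: "singular_at M T Y"
    and S: "strict_mono S" "S \<longlonglongrightarrow> T" "\<And>k. S k < T"
    and p: "\<And>k. p k \<in> borel_measurable M" and B: "\<And>k \<omega>. \<omega> \<in> space M \<Longrightarrow> norm (p k \<omega>) \<le> B"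
    and C: "AE \<omega> in M. \<forall>k. p k \<omega> \<bullet> (Y (S k) \<omega> *v p k \<omega>) \<le> C"
  shows "AE \<omega> in M. (\<lambda>k. p k \<omega>) \<longlonglongrightarrow> 0"
proof -
  obtain r v where r: "random_subseq M r" and v: "v \<in> borel_measurable M"
    and lim: "\<And>\<omega>. \<omega> \<in> space M \<Longrightarrow> (\<lambda>j. p (r j \<omega>) \<omega>) \<longlonglongrightarrow> v \<omega>"
    and norm_v: "\<And>\<omega>. \<omega> \<in> space M \<Longrightarrow> norm (v \<omega>) = real_of_ereal (limsup (\<lambda>k. ereal (norm (p k \<omega>))))"
  proof (rule random_subseq_vector[where p = p and M = M and B = B, OF p B])
    fix r v assume "random_subseq M r" "v \<in> borel_measurable M"
      "\<And>\<omega>. \<omega> \<in> space M \<Longrightarrow> (\<lambda>j. p (r j \<omega>) \<omega>) \<longlonglongrightarrow> v \<omega>"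
      "\<And>\<omega>. \<omega> \<in> space M \<Longrightarrow> norm (v \<omega>) = real_of_ereal (limsup (\<lambda>k. ereal (norm (p k \<omega>))))"
    then show thesis by (rule that)
  qed
  have r_mono: "strict_mono (\<lambda>j. r j \<omega>)" if "\<omega> \<in> space M" for \<omega> using r that by (simp add: random_subseq_def)
  have r_meas [measurable]: "r j \<in> measurable M (count_space UNIV)" for j
    using r unfolding random_subseq_def by blast
  have r_ge: "j \<le> r j \<omega>" if "\<omega> \<in> space M" for j \<omega> by (rule seq_suble[OF r_mono[OF that]])
  have S_inj: "S k = S l \<longleftrightarrow> k = l" for k l using S(1) strict_mono_eq by blast
  have S_less: "S k < S l \<longleftrightarrow> k < l" for k l using S(1) strict_mono_less by blast
  \<comment> \<open>Equal to the limit \<open>v\<close>, except at the times \<open>S (r j)\<close>, where it visits \<open>p (r j)\<close>.\<close>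
  define \<psi> where "\<psi> t \<omega> = (if \<exists>k. t = S k \<and> k \<in> range (\<lambda>j. r j \<omega>) then p (THE k. t = S k) \<omega> else v \<omega>)" for t \<omega>
  have \<psi>_S: "\<psi> (S k) \<omega> = (if k \<in> range (\<lambda>j. r j \<omega>) then p k \<omega> else v \<omega>)" for k \<omega>
    unfolding \<psi>_def by (simp add: S_inj)
  have \<psi>_else: "\<psi> t = v" if "t \<notin> range S" for t
    using that by (auto simp: \<psi>_def fun_eq_iff)
  have T_S: "T \<notin> range S" using S(3) by (metis less_irrefl rangeE)
  have meas: "\<psi> t \<in> borel_measurable M" for t
  proof (cases "t \<in> range S")
    case True
    then obtain k where t: "t = S k" by blast
    have "Measurable.pred M (\<lambda>\<omega>. \<exists>j. r j \<omega> = k)"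
      using r_meas by measurable
    then have "(\<lambda>\<omega>. if \<exists>j. r j \<omega> = k then p k \<omega> else v \<omega>) \<in> borel_measurable M"
      by (intro measurable_If p v) (simp_all add: pred_def)
    moreover have "(\<lambda>\<omega>. if \<exists>j. r j \<omega> = k then p k \<omega> else v \<omega>) = \<psi> t"
      unfolding t \<psi>_S[abs_def] by (intro ext) (auto simp: image_iff)
    ultimately show ?thesis by simp
  qed (simp add: \<psi>_else v)
  have "((\<lambda>t. \<psi> t \<omega>) \<longlongrightarrow> \<psi> T \<omega>) (at_left T)" if \<omega>: "\<omega> \<in> space M" for \<omega>
    unfolding \<psi>_else[OF T_S]
  proof (rule tendstoI)
    fix e :: real assume e: "0 < e"
    then obtain j0 where j0: "\<And>j. j0 \<le> j \<Longrightarrow> dist (p (r j \<omega>) \<omega>) (v \<omega>) < e"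
      using tendstoD[OF lim[OF \<omega>] e] by (auto simp: eventually_sequentially)
    show "\<forall>\<^sub>F t in at_left T. dist (\<psi> t \<omega>) (v \<omega>) < e"
    proof (rule eventually_at_leftI[of "S (r j0 \<omega>)"])
      fix t assume t: "t \<in> {S (r j0 \<omega>)<..<T}"
      show "dist (\<psi> t \<omega>) (v \<omega>) < e"
      proof (cases "\<exists>j. t = S (r j \<omega>)")
        case True
        then obtain j where j: "t = S (r j \<omega>)" by blast
        then have "r j0 \<omega> < r j \<omega>" using t S_less by simp
        then have "j0 < j" using strict_mono_less[OF r_mono[OF \<omega>]] by blast
        then show ?thesis using j0[of j] j \<psi>_S[of "r j \<omega>" \<omega>] by simp
      next
        case False
        then have "\<psi> t \<omega> = v \<omega>" by (auto simp: \<psi>_def)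
        then show ?thesis using e by simp
      qed
    qed (rule S(3))
  qed
  then have "AE \<omega> in M. ((\<lambda>t. \<psi> t \<omega>) \<longlongrightarrow> \<psi> T \<omega>) (at_left T)" by (rule AE_I2)
  then have inf: "AE \<omega> in M. \<psi> T \<omega> \<noteq> 0 \<longrightarrow> Liminf (at_left T) (\<lambda>t. ereal (\<psi> t \<omega> \<bullet> (Y t \<omega> *v \<psi> t \<omega>))) = \<infinity>"
    using Y meas unfolding singular_at_def by blast
  show ?thesis using inf C AE_space
  proof eventually_elim
    case (elim \<omega>)
    note \<omega> = elim(3)
    have "v \<omega> = 0"
    proof (rule ccontr)
      assume "v \<omega> \<noteq> 0"
      then have "Liminf (at_left T) (\<lambda>t. ereal (\<psi> t \<omega> \<bullet> (Y t \<omega> *v \<psi> t \<omega>))) = \<infinity>"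
        using elim(1) \<psi>_else[OF T_S] by simp
      then have "ereal C < Liminf (at_left T) (\<lambda>t. ereal (\<psi> t \<omega> \<bullet> (Y t \<omega> *v \<psi> t \<omega>)))" by simp
      then have "\<forall>\<^sub>F t in at_left T. ereal C < ereal (\<psi> t \<omega> \<bullet> (Y t \<omega> *v \<psi> t \<omega>))" by (rule less_LiminfD)
      then obtain b where b: "b < T" "\<And>t. b < t \<Longrightarrow> t < T \<Longrightarrow> C < \<psi> t \<omega> \<bullet> (Y t \<omega> *v \<psi> t \<omega>)"
        unfolding eventually_at_left_field by auto
      obtain k0 where k0: "\<And>k. k0 \<le> k \<Longrightarrow> b < S k"
        using order_tendstoD(1)[OF S(2) b(1)] by (auto simp: eventually_sequentially)
      let ?k = "r k0 \<omega>"
      have "C < \<psi> (S ?k) \<omega> \<bullet> (Y (S ?k) \<omega> *v \<psi> (S ?k) \<omega>)"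
        by (rule b(2)[OF k0[OF r_ge[OF \<omega>]] S(3)])
      then show False using elim(2) \<psi>_S[of ?k \<omega>] by (simp add: not_less[symmetric])
    qed
    then have L0: "real_of_ereal (limsup (\<lambda>k. ereal (norm (p k \<omega>)))) = 0" using norm_v[OF \<omega>] by simp
    define L where "L = limsup (\<lambda>k. ereal (norm (p k \<omega>)))"
    have "L \<le> ereal B" unfolding L_def by (rule Limsup_bounded) (simp add: B[OF \<omega>])
    moreover have "0 \<le> L" unfolding L_def by (rule le_Limsup) simp_all
    ultimately have "L = 0" using L0 unfolding L_def[symmetric] by (cases L) auto
    show "(\<lambda>k. p k \<omega>) \<longlonglongrightarrow> 0"
    proof (rule tendstoI)
      fix e :: real assume "0 < e"
      then have "L < ereal e" using \<open>L = 0\<close> by simp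
      then show "\<forall>\<^sub>F k in sequentially. dist (p k \<omega>) 0 < e"
        unfolding L_def by (auto dest!: Limsup_lessD)
    qed
  qed
qed

section \<open>Conditional expectations of random vectors\<close>

lemma integrable_vecI:
  fixes f :: "'a \<Rightarrow> ('b::euclidean_space)^'n"
  assumes "\<And>i. integrable M (\<lambda>x. f x $ i)"
  shows "integrable M f"
proof (rule Bochner_Integration.integrable_bound)
  show "integrable M (\<lambda>x. \<Sum>i\<in>UNIV. norm (f x $ i))"
    by (intro Bochner_Integration.integrable_sum integrable_norm assms)
  show "f \<in> borel_measurable M"
    by (intro borel_measurable_vecI borel_measurable_integrable assms)
  have "norm (f x) \<le> (\<Sum>i\<in>UNIV. norm (f x $ i))" for x
    unfolding norm_vec_def by (rule L2_set_le_sum) simp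
  then show "AE x in M. norm (f x) \<le> norm (\<Sum>i\<in>UNIV. norm (f x $ i))"
    by (simp add: sum_nonneg)
qed

context brownian
begin

definition cexp :: "('a \<Rightarrow> real^'n) \<Rightarrow> real \<Rightarrow> 'a \<Rightarrow> real^'n" where
  "cexp V s \<omega> = (\<chi> i. real_cond_exp M (F s) (\<lambda>\<omega>. V \<omega> $ i) \<omega>)"

lemma cexp_measurable_F: "cexp V s \<in> borel_measurable (F s)"
  unfolding cexp_def by (intro borel_measurable_vecI) simp

lemma cexp_measurable: "s \<le> T \<Longrightarrow> cexp V s \<in> borel_measurable M"
  by (rule measurable_F_M[OF cexp_measurable_F])

lemma integrable_bounded_inner:
  fixes f g :: "'a \<Rightarrow> 'b::euclidean_space"
  assumes f: "f \<in> borel_measurable M" "AE \<omega> in M. norm (f \<omega>) \<le> K"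
    and g: "integrable M g"
  shows "integrable M (\<lambda>\<omega>. f \<omega> \<bullet> g \<omega>)"
proof (rule Bochner_Integration.integrable_bound)
  show "integrable M (\<lambda>\<omega>. K * norm (g \<omega>))" using g by simp
  show "(\<lambda>\<omega>. f \<omega> \<bullet> g \<omega>) \<in> borel_measurable M"
    by (intro borel_measurable_inner f borel_measurable_integrable g)
  show "AE \<omega> in M. norm (f \<omega> \<bullet> g \<omega>) \<le> norm (K * norm (g \<omega>))"
    using f(2)
  proof eventually_elim
    case (elim \<omega>)
    have "norm (f \<omega> \<bullet> g \<omega>) \<le> norm (f \<omega>) * norm (g \<omega>)" by (simp add: Cauchy_Schwarz_ineq2)
    also have "\<dots> \<le> K * norm (g \<omega>)" using elim by (intro mult_right_mono) auto
    finally show ?case by (metis abs_ge_self order_trans real_norm_def)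
  qed
qed

lemma integrable_vec_nth: "integrable M (V :: 'a \<Rightarrow> real^'n) \<Longrightarrow> integrable M (\<lambda>\<omega>. V \<omega> $ i)"
  by (simp add: cart_eq_inner_axis)

lemma cexp_integrable:
  fixes V :: "'a \<Rightarrow> real^'n"
  assumes V: "integrable M V" and s: "s \<le> T"
  shows "integrable M (cexp V s)"
proof -
  interpret s: sigma_finite_subalgebra M "F s" by (rule sigma_finite_F[OF s])
  show ?thesis
    by (rule integrable_vecI) (simp add: cexp_def s.real_cond_exp_int(1)[OF integrable_vec_nth[OF V]])
qed

lemma cexp_inner_integrable:
  fixes V f :: "'a \<Rightarrow> real^'n"
  assumes V: "integrable M V" and s: "s \<le> T" and f: "f \<in> borel_measurable (F s)"
    and fi: "\<And>i. integrable M (\<lambda>\<omega>. f \<omega> $ i * V \<omega> $ i)"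
  shows "expectation (\<lambda>\<omega>. f \<omega> \<bullet> cexp V s \<omega>) = expectation (\<lambda>\<omega>. f \<omega> \<bullet> V \<omega>)"
proof -
  interpret s: sigma_finite_subalgebra M "F s" by (rule sigma_finite_F[OF s])
  have fiF: "(\<lambda>\<omega>. f \<omega> $ i) \<in> borel_measurable (F s)" for i by (rule borel_measurable_vec_nth[OF f])
  have ViM: "(\<lambda>\<omega>. V \<omega> $ i) \<in> borel_measurable M" for i
    by (rule borel_measurable_vec_nth[OF borel_measurable_integrable[OF V]])
  note * = s.real_cond_exp_intg[OF fi fiF ViM]
  have "expectation (\<lambda>\<omega>. f \<omega> \<bullet> cexp V s \<omega>) = (\<Sum>i\<in>UNIV. expectation (\<lambda>\<omega>. f \<omega> $ i * real_cond_exp M (F s) (\<lambda>\<omega>. V \<omega> $ i) \<omega>))"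
    unfolding inner_vec_def cexp_def by (simp add: Bochner_Integration.integral_sum[OF *(1)])
  also have "\<dots> = (\<Sum>i\<in>UNIV. expectation (\<lambda>\<omega>. f \<omega> $ i * V \<omega> $ i))"
    by (intro sum.cong refl *(2))
  also have "\<dots> = expectation (\<lambda>\<omega>. f \<omega> \<bullet> V \<omega>)"
    unfolding inner_vec_def by (simp add: Bochner_Integration.integral_sum[OF fi])
  finally show ?thesis .
qed

lemma cexp_inner:
  fixes V f :: "'a \<Rightarrow> real^'n"
  assumes V: "integrable M V" and s: "s \<le> T"
    and f: "f \<in> borel_measurable (F s)" "AE \<omega> in M. norm (f \<omega>) \<le> K"
  shows "integrable M (\<lambda>\<omega>. f \<omega> \<bullet> cexp V s \<omega>)" "integrable M (\<lambda>\<omega>. f \<omega> \<bullet> V \<omega>)"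
    "expectation (\<lambda>\<omega>. f \<omega> \<bullet> cexp V s \<omega>) = expectation (\<lambda>\<omega>. f \<omega> \<bullet> V \<omega>)"
proof -
  have fM: "f \<in> borel_measurable M" by (rule measurable_F_M[OF f(1) s])
  show "integrable M (\<lambda>\<omega>. f \<omega> \<bullet> cexp V s \<omega>)" "integrable M (\<lambda>\<omega>. f \<omega> \<bullet> V \<omega>)"
    by (rule integrable_bounded_inner[OF fM f(2)]; rule V cexp_integrable[OF V s])+
  have fi: "integrable M (\<lambda>\<omega>. f \<omega> $ i * V \<omega> $ i)" for i
  proof (rule integrable_bounded_mult[where K=K])
    show "integrable M (\<lambda>\<omega>. V \<omega> $ i)" by (rule integrable_vec_nth[OF V])
    show "(\<lambda>\<omega>. f \<omega> $ i) \<in> borel_measurable M" by (rule borel_measurable_vec_nth[OF fM])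
    show "AE \<omega> in M. \<bar>f \<omega> $ i\<bar> \<le> K"
      using f(2) by eventually_elim (metis component_le_norm_cart order_trans)
  qed
  show "expectation (\<lambda>\<omega>. f \<omega> \<bullet> cexp V s \<omega>) = expectation (\<lambda>\<omega>. f \<omega> \<bullet> V \<omega>)"
    by (rule cexp_inner_integrable[OF V s f(1) fi])
qed

lemma bounded_integrable:
  fixes V :: "'a \<Rightarrow> 'b::euclidean_space"
  assumes "V \<in> borel_measurable M" "\<And>\<omega>. \<omega> \<in> space M \<Longrightarrow> norm (V \<omega>) \<le> K"
  shows "integrable M V"
  by (rule integrable_const_bound[where B=K]) (use assms in auto)

lemma cexp_bounded:
  fixes V :: "'a \<Rightarrow> real^'n" and K :: real
  assumes V: "V \<in> borel_measurable M" "\<And>\<omega>. \<omega> \<in> space M \<Longrightarrow> norm (V \<omega>) \<le> K" and s: "s \<le> T"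
  shows "AE \<omega> in M. norm (cexp V s \<omega>) \<le> CARD('n) * K"
proof -
  interpret s: sigma_finite_subalgebra M "F s" by (rule sigma_finite_F[OF s])
  have int: "integrable M (\<lambda>\<omega>. V \<omega> $ i)" for i by (rule integrable_vec_nth[OF bounded_integrable[OF V]])
  have Vi: "\<bar>V \<omega> $ i\<bar> \<le> K" if "\<omega> \<in> space M" for \<omega> i
    using V(2)[OF that] component_le_norm_cart order_trans by blast
  have "AE \<omega> in M. \<bar>real_cond_exp M (F s) (\<lambda>\<omega>. V \<omega> $ i) \<omega>\<bar> \<le> K" for i
  proof -
    have "AE \<omega> in M. V \<omega> $ i \<le> K" "AE \<omega> in M. - K \<le> V \<omega> $ i"
      using Vi by (auto simp: abs_le_iff minus_le_iff intro!: AE_I2)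
    from s.real_cond_exp_le_c[OF int this(1)] s.real_cond_exp_ge_c[OF int this(2)]
    show ?thesis by eventually_elim auto
  qed
  then have "AE \<omega> in M. \<forall>i\<in>UNIV. \<bar>real_cond_exp M (F s) (\<lambda>\<omega>. V \<omega> $ i) \<omega>\<bar> \<le> K"
    by (intro AE_finite_allI) auto
  then show ?thesis
  proof eventually_elim
    case (elim \<omega>)
    have "norm (cexp V s \<omega>) \<le> (\<Sum>i\<in>UNIV. \<bar>cexp V s \<omega> $ i\<bar>)" by (rule norm_le_l1_cart)
    also have "\<dots> \<le> CARD('n) * K"
      by (rule sum_bounded_above) (use elim in \<open>simp add: cexp_def\<close>)
    finally show ?case .
  qed
qed

text \<open>Increments of the martingale are orthogonal to the past.\<close>

lemma cexp_increment:
  fixes V :: "'a \<Rightarrow> real^'n" and K :: real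
  assumes V: "V \<in> borel_measurable M" "\<And>\<omega>. \<omega> \<in> space M \<Longrightarrow> norm (V \<omega>) \<le> K"
    and st: "s \<le> r" "r \<le> T"
  shows "integrable M (\<lambda>\<omega>. (norm (cexp V r \<omega>))\<^sup>2)"
    "integrable M (\<lambda>\<omega>. (norm (cexp V r \<omega> - cexp V s \<omega>))\<^sup>2)"
    "expectation (\<lambda>\<omega>. (norm (cexp V r \<omega> - cexp V s \<omega>))\<^sup>2)
      = expectation (\<lambda>\<omega>. (norm (cexp V r \<omega>))\<^sup>2) - expectation (\<lambda>\<omega>. (norm (cexp V s \<omega>))\<^sup>2)"
proof -
  have s: "s \<le> T" using st by simp
  have V_int: "integrable M V" by (rule bounded_integrable[OF V])
  note bs = cexp_bounded[OF V s] and br = cexp_bounded[OF V st(2)]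
  have rr: "integrable M (\<lambda>\<omega>. cexp V r \<omega> \<bullet> cexp V r \<omega>)"
    by (rule cexp_inner(1)[OF V_int st(2) cexp_measurable_F br])
  have ss: "integrable M (\<lambda>\<omega>. cexp V s \<omega> \<bullet> cexp V s \<omega>)"
    "expectation (\<lambda>\<omega>. cexp V s \<omega> \<bullet> cexp V s \<omega>) = expectation (\<lambda>\<omega>. cexp V s \<omega> \<bullet> V \<omega>)"
    using cexp_inner[OF V_int s cexp_measurable_F bs] by simp_all
  have sr: "integrable M (\<lambda>\<omega>. cexp V s \<omega> \<bullet> cexp V r \<omega>)"
    "expectation (\<lambda>\<omega>. cexp V s \<omega> \<bullet> cexp V r \<omega>) = expectation (\<lambda>\<omega>. cexp V s \<omega> \<bullet> V \<omega>)"
    using cexp_inner[OF V_int st(2) measurable_F_mono[OF cexp_measurable_F st(1)] bs] by simp_all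
  show "integrable M (\<lambda>\<omega>. (norm (cexp V r \<omega>))\<^sup>2)" unfolding power2_norm_eq_inner by (rule rr)
  have eq: "(norm (cexp V r \<omega> - cexp V s \<omega>))\<^sup>2 = cexp V r \<omega> \<bullet> cexp V r \<omega> - 2 * (cexp V s \<omega> \<bullet> cexp V r \<omega>) + cexp V s \<omega> \<bullet> cexp V s \<omega>" for \<omega>
    by (simp add: power2_norm_eq_inner inner_diff_left inner_diff_right inner_commute)
  show "integrable M (\<lambda>\<omega>. (norm (cexp V r \<omega> - cexp V s \<omega>))\<^sup>2)"
    unfolding eq using rr ss sr by simp
  show "expectation (\<lambda>\<omega>. (norm (cexp V r \<omega> - cexp V s \<omega>))\<^sup>2)
      = expectation (\<lambda>\<omega>. (norm (cexp V r \<omega>))\<^sup>2) - expectation (\<lambda>\<omega>. (norm (cexp V s \<omega>))\<^sup>2)"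
    unfolding eq unfolding power2_norm_eq_inner using rr ss sr by simp
qed

end

lemma locally_mono_imp_le:
  fixes w :: "real \<Rightarrow> real"
  assumes h: "0 < h" and loc: "\<And>s s'. a \<le> s \<Longrightarrow> s \<le> s' \<Longrightarrow> s' \<le> b \<Longrightarrow> s' \<le> s + h \<Longrightarrow> w s \<le> w s'"
    and ab: "a \<le> b"
  shows "w a \<le> w b"
proof -
  have *: "w a \<le> w (min b (a + real n * h))" for n
  proof (induction n)
    case 0
    then show ?case using ab by simp
  next
    case (Suc n)
    have "w (min b (a + real n * h)) \<le> w (min b (a + real (Suc n) * h))"
    proof (rule loc)
      show "a \<le> min b (a + real n * h)" using ab h by simp
      show "min b (a + real n * h) \<le> min b (a + real (Suc n) * h)" using h by (simp add: algebra_simps min_def)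
      show "min b (a + real (Suc n) * h) \<le> min b (a + real n * h) + h" using h by (auto simp: algebra_simps min_def)
    qed simp
    then show ?case using Suc by simp
  qed
  obtain n where "(b - a) / h \<le> real n" using real_arch_simple by blast
  then have "b \<le> a + real n * h" using h by (simp add: field_simps)
  then show ?thesis using *[of n] by (simp add: min_absorb1)
qed

section \<open>Supersolutions along bounded directions\<close>

text \<open>One of the integrals \<open>I\<close> of \<open>Z\<close> whose existence is part of the definition of a supersolution is made
  a parameter, and so is the lower bound \<open>\<delta>\<close> of \<open>\<eta>\<close>.\<close>

locale supersolution_process = brownian M W T for M :: "'a measure" and W T +
  fixes \<eta> Y Z I :: "real \<Rightarrow> 'a \<Rightarrow> real^'n^'n" and \<delta> :: real
  assumes delta: "0 < \<delta>"
    and eta_prog: "prog_measurable F {0..T} \<eta>"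
    and eta_spd: "\<And>t \<omega>. 0 \<le> t \<Longrightarrow> t \<le> T \<Longrightarrow> \<omega> \<in> space M \<Longrightarrow> spd (\<eta> t \<omega>)"
    and eta_coercive: "AE \<omega> in M. \<forall>t\<in>{0..T}. coercive \<delta> (\<eta> t \<omega>)"
    and Y_prog: "prog_measurable F {0..<T} Y"
    and Z_prog: "prog_measurable F {0..<T} Z"
    and Y_psd: "\<And>t \<omega>. 0 \<le> t \<Longrightarrow> t < T \<Longrightarrow> \<omega> \<in> space M \<Longrightarrow> psd (Y t \<omega>)"
    and Y_sup: "\<And>t. 0 \<le> t \<Longrightarrow> t < T \<Longrightarrow> (\<integral>\<^sup>+\<omega>. (SUP s\<in>{0..t}. ennreal ((norm (Y s \<omega>))\<^sup>2)) \<partial>M) < \<infinity>"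
    and ito: "ito_integral M W T Z I"
    and dynamics: "AE \<omega> in M. \<forall>s t. 0 \<le> s \<and> s \<le> t \<and> t < T \<longrightarrow>
           set_integrable lborel {s..t} (\<lambda>r. Y r \<omega> ** matrix_inv (\<eta> r \<omega>) ** Y r \<omega>) \<and>
           Y t \<omega> - Y s \<omega> = (LINT r:{s..t}|lborel. Y r \<omega> ** matrix_inv (\<eta> r \<omega>) ** Y r \<omega>)
                            + (I t \<omega> - I s \<omega>)"
    and singular: "singular_at M T Y"
begin

lemma Y_F: "0 \<le> t \<Longrightarrow> t < T \<Longrightarrow> Y t \<in> borel_measurable (F t)"
  by (rule prog_measurable_adapted[OF Y_prog]) simp

lemma Y_M: "0 \<le> t \<Longrightarrow> t < T \<Longrightarrow> Y t \<in> borel_measurable M"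
  using measurable_F_M[OF Y_F] by simp

lemma eta_F: "0 \<le> t \<Longrightarrow> t \<le> T \<Longrightarrow> \<eta> t \<in> borel_measurable (F t)"
  by (rule prog_measurable_adapted[OF eta_prog]) simp

lemma eta_M: "0 \<le> t \<Longrightarrow> t \<le> T \<Longrightarrow> \<eta> t \<in> borel_measurable M"
  using measurable_F_M[OF eta_F] by simp

lemma Y_joint:
  assumes "0 \<le> t" "t < T"
  shows "(\<lambda>(r, \<omega>). indicator {0..t} r *\<^sub>R Y r \<omega>) \<in> borel_measurable (lborel \<Otimes>\<^sub>M M)"
  by (rule prog_measurable_joint[OF Y_prog, of t]) (use assms in auto)

lemma eta_joint: "(\<lambda>(r, \<omega>). indicator {0..T} r *\<^sub>R \<eta> r \<omega>) \<in> borel_measurable (lborel \<Otimes>\<^sub>M M)"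
  by (rule prog_measurable_joint[OF eta_prog, of T]) (use T_pos in auto)

lemma Y_continuous: "AE \<omega> in M. \<forall>S. 0 \<le> S \<and> S < T \<longrightarrow> continuous_on {0..S} (\<lambda>t. Y t \<omega>)"
proof -
  have I_cont: "AE \<omega> in M. continuous_on {0..<T} (\<lambda>t. I t \<omega>)"
    using ito unfolding ito_integral_def by blast
  show ?thesis
    using I_cont dynamics
  proof eventually_elim
    case (elim \<omega>)
    let ?f = "\<lambda>r. Y r \<omega> ** matrix_inv (\<eta> r \<omega>) ** Y r \<omega>"
    show ?case
    proof (intro allI impI)
      fix S assume S: "0 \<le> S \<and> S < T"
      have int: "set_integrable lborel {s..t} ?f" if "0 \<le> s" "s \<le> t" "t < T" for s t
        using elim(2) that by blast
      have "?f integrable_on {0..S}"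
        using set_borel_integral_eq_integral(1)[OF int[of 0 S]] S by simp
      then have "continuous_on {0..S} (\<lambda>t. integral {0..t} ?f)"
        by (rule indefinite_integral_continuous_1)
      moreover have "continuous_on {0..S} (\<lambda>t. I t \<omega>)"
        by (rule continuous_on_subset[OF elim(1)]) (use S in auto)
      ultimately have "continuous_on {0..S} (\<lambda>t. Y 0 \<omega> + integral {0..t} ?f + (I t \<omega> - I 0 \<omega>))"
        by (intro continuous_intros)
      also have "?this \<longleftrightarrow> continuous_on {0..S} (\<lambda>t. Y t \<omega>)"
      proof (rule continuous_on_cong[OF refl])
        fix t assume t: "t \<in> {0..S}"
        have "Y t \<omega> - Y 0 \<omega> = (LINT r:{0..t}|lborel. ?f r) + (I t \<omega> - I 0 \<omega>)"
          using elim(2) t S by auto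
        moreover have "(LINT r:{0..t}|lborel. ?f r) = integral {0..t} ?f"
          by (rule set_borel_integral_eq_integral(2)[OF int]) (use t S in auto)
        ultimately show "Y 0 \<omega> + integral {0..t} ?f + (I t \<omega> - I 0 \<omega>) = Y t \<omega>"
          by (simp add: algebra_simps)
      qed
      finally show "continuous_on {0..S} (\<lambda>t. Y t \<omega>)" .
    qed
  qed
qed

text \<open>The pathwise supremum over rational times is measurable, and by continuity it bounds the path.\<close>

lemma Y_dominated:
  assumes S: "0 \<le> S" "S < T"
  obtains G where "integrable M G" "AE \<omega> in M. \<forall>s\<in>{0..S}. (norm (Y s \<omega>))\<^sup>2 \<le> G \<omega>"
proof -
  define Q where "Q = {0..S} \<inter> \<rat>"
  have Q: "countable Q" "Q \<subseteq> {0..S}" "0 \<in> Q"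
    using S countable_rat by (auto simp: Q_def)
  define f where "f \<omega> = (SUP s\<in>Q. ennreal ((norm (Y s \<omega>))\<^sup>2))" for \<omega>
  have f_meas: "f \<in> borel_measurable M"
    unfolding f_def
  proof (rule borel_measurable_SUP[OF Q(1)])
    fix s assume "s \<in> Q"
    then have "Y s \<in> borel_measurable M" using Q(2) S by (intro Y_M) auto
    then show "(\<lambda>\<omega>. ennreal ((norm (Y s \<omega>))\<^sup>2)) \<in> borel_measurable M"
      by (rule measurable_compose) simp
  qed
  have "(\<integral>\<^sup>+\<omega>. f \<omega> \<partial>M) \<le> (\<integral>\<^sup>+\<omega>. (SUP s\<in>{0..S}. ennreal ((norm (Y s \<omega>))\<^sup>2)) \<partial>M)"
    unfolding f_def by (intro nn_integral_mono SUP_subset_mono Q(2) order_refl)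
  also have "\<dots> < \<infinity>" by (rule Y_sup[OF S])
  finally have f_fin: "(\<integral>\<^sup>+\<omega>. f \<omega> \<partial>M) < \<infinity>" .
  have f_AE: "AE \<omega> in M. f \<omega> \<noteq> \<infinity>"
    by (rule nn_integral_PInf_AE[OF f_meas]) (use f_fin in simp)
  show thesis
  proof (rule that[of "\<lambda>\<omega>. enn2real (f \<omega>)"])
    show "integrable M (\<lambda>\<omega>. enn2real (f \<omega>))"
    proof (rule integrableI_nonneg)
      show "(\<lambda>\<omega>. enn2real (f \<omega>)) \<in> borel_measurable M" by (rule measurable_compose[OF f_meas]) simp
      have "(\<integral>\<^sup>+\<omega>. ennreal (enn2real (f \<omega>)) \<partial>M) = (\<integral>\<^sup>+\<omega>. f \<omega> \<partial>M)"
        by (rule nn_integral_cong_AE) (use f_AE in \<open>auto simp: less_top\<close>)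
      then show "(\<integral>\<^sup>+\<omega>. ennreal (enn2real (f \<omega>)) \<partial>M) < \<infinity>" using f_fin by simp
    qed simp
    show "AE \<omega> in M. \<forall>s\<in>{0..S}. (norm (Y s \<omega>))\<^sup>2 \<le> enn2real (f \<omega>)"
      using f_AE Y_continuous
    proof eventually_elim
      case (elim \<omega>)
      have cont: "continuous_on {0..S} (\<lambda>s. (norm (Y s \<omega>))\<^sup>2)"
        using elim(2) S by (intro continuous_intros) auto
      have Q_le: "(norm (Y s \<omega>))\<^sup>2 \<le> enn2real (f \<omega>)" if "s \<in> Q" for s
      proof -
        have "ennreal ((norm (Y s \<omega>))\<^sup>2) \<le> f \<omega>" unfolding f_def by (rule SUP_upper[OF that])
        then have "enn2real (ennreal ((norm (Y s \<omega>))\<^sup>2)) \<le> enn2real (f \<omega>)"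
          by (rule enn2real_mono) (use elim(1) in \<open>simp add: less_top\<close>)
        then show ?thesis by simp
      qed
      show ?case
      proof (rule ballI, rule ccontr)
        fix s assume s: "s \<in> {0..S}" and "\<not> (norm (Y s \<omega>))\<^sup>2 \<le> enn2real (f \<omega>)"
        then have gap: "0 < (norm (Y s \<omega>))\<^sup>2 - enn2real (f \<omega>)" by simp
        then have s0: "0 < s" using Q_le[OF Q(3)] s by (cases "s = 0") auto
        obtain d where d: "0 < d" "\<And>u. u \<in> {0..S} \<Longrightarrow> dist u s < d \<Longrightarrow>
            dist ((norm (Y u \<omega>))\<^sup>2) ((norm (Y s \<omega>))\<^sup>2) < (norm (Y s \<omega>))\<^sup>2 - enn2real (f \<omega>)"
          using cont s gap unfolding continuous_on_iff by blast
        obtain q where q: "q \<in> \<rat>" "max 0 (s - d) < q" "q < s"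
          using Rats_dense_in_real[of "max 0 (s - d)" s] s0 d(1) by auto
        then have "q \<in> Q" "q \<in> {0..S}" "dist q s < d" using s by (auto simp: Q_def dist_real_def)
        then show False using d(2)[of q] Q_le[of q] by (auto simp: dist_real_def)
      qed
    qed
  qed
qed

lemma quad_Y_integrable:
  assumes s: "0 \<le> s" "s < T" and p: "p \<in> borel_measurable M" "AE \<omega> in M. norm (p \<omega>) \<le> B"
    and A: "A \<in> sets M"
  shows "integrable M (\<lambda>\<omega>. indicator A \<omega> * (p \<omega> \<bullet> (Y s \<omega> *v p \<omega>)))"
proof -
  obtain G where G: "integrable M G" "AE \<omega> in M. \<forall>u\<in>{0..s}. (norm (Y u \<omega>))\<^sup>2 \<le> G \<omega>"
    by (rule Y_dominated[OF s]) (rule that)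
  show ?thesis
  proof (rule Bochner_Integration.integrable_bound)
    show "integrable M (\<lambda>\<omega>. (1 + G \<omega>) * B\<^sup>2)" using G(1) by simp
    show "(\<lambda>\<omega>. indicator A \<omega> * (p \<omega> \<bullet> (Y s \<omega> *v p \<omega>))) \<in> borel_measurable M"
      by (intro borel_measurable_times borel_measurable_indicator A borel_measurable_inner
          borel_measurable_mult_vec p Y_M s)
    show "AE \<omega> in M. norm (indicator A \<omega> * (p \<omega> \<bullet> (Y s \<omega> *v p \<omega>)) :: real) \<le> norm ((1 + G \<omega>) * B\<^sup>2)"
      using G(2) p(2)
    proof eventually_elim
      case (elim \<omega>)
      have Y2: "(norm (Y s \<omega>))\<^sup>2 \<le> G \<omega>" using elim(1) s by simp
      have "2 * norm (Y s \<omega>) \<le> 1 + (norm (Y s \<omega>))\<^sup>2"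
        using sum_squares_bound[of 1 "norm (Y s \<omega>)"] by simp
      then have "norm (Y s \<omega>) \<le> 1 + (norm (Y s \<omega>))\<^sup>2"
        using norm_ge_zero[of "Y s \<omega>"] by linarith
      then have Y1: "norm (Y s \<omega>) \<le> 1 + G \<omega>" using Y2 by simp
      have "norm (indicator A \<omega> * (p \<omega> \<bullet> (Y s \<omega> *v p \<omega>)) :: real) \<le> \<bar>p \<omega> \<bullet> (Y s \<omega> *v p \<omega>)\<bar>"
        by (simp add: indicator_def)
      also have "\<dots> \<le> norm (Y s \<omega>) * (norm (p \<omega>) * norm (p \<omega>))" by (rule quad_le_norm)
      also have "\<dots> \<le> (1 + G \<omega>) * (B * B)"
        using Y1 elim(2) order_trans[OF norm_ge_zero elim(2)] order_trans[OF norm_ge_zero Y1]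
        by (intro mult_mono) auto
      finally show ?case by (simp add: power2_eq_square)
    qed
  qed
qed

lemma quad_expand:
  fixes B :: "real^'n^'n"
  shows "p \<bullet> (B *v p) = (\<Sum>i\<in>UNIV. \<Sum>j\<in>UNIV. (p $ i * p $ j) * (B \<bullet> axis i (axis j 1)))"
  unfolding inner_axis inner_vec_def[of p] matrix_vector_mult_def
  by (simp add: sum_distrib_left mult_ac inner_axis)

lemma bounded_linear_quad: "bounded_linear (\<lambda>B :: real^'n^'n. p \<bullet> (B *v p))"
  unfolding quad_expand
  by (intro bounded_linear_sum bounded_linear_const_mult bounded_linear_inner_left)

lemma quad_drift:
  fixes A E :: "real^'n^'n"
  assumes "psd A"
  shows "p \<bullet> ((A ** E ** A) *v p) = (A *v p) \<bullet> (E *v (A *v p))"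
  using assms by (simp add: psd_def sym_mat_inner matrix_vector_mul_assoc[symmetric])

text \<open>In a direction \<open>p\<close> known at time \<open>s\<close> the stochastic integral has mean zero, so that the form of
  \<open>Y\<close> grows in mean exactly by the drift.\<close>

lemma expected_growth:
  assumes ss: "0 \<le> s" "s \<le> s'" "s' < T" and A: "A \<in> sets (F s)"
    and p: "p \<in> borel_measurable (F s)" "\<And>\<omega>. \<omega> \<in> space M \<Longrightarrow> norm (p \<omega>) \<le> B"
  obtains D where "0 \<le> D"
    "expectation (\<lambda>\<omega>. indicator A \<omega> * (p \<omega> \<bullet> (Y s' \<omega> *v p \<omega>)))
      = expectation (\<lambda>\<omega>. indicator A \<omega> * (p \<omega> \<bullet> (Y s \<omega> *v p \<omega>))) + D"
    "ennreal D = (\<integral>\<^sup>+r\<in>{s..s'}. (\<integral>\<^sup>+\<omega>. ennreal (indicator A \<omega> *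
        ((Y r \<omega> *v p \<omega>) \<bullet> (matrix_inv (\<eta> r \<omega>) *v (Y r \<omega> *v p \<omega>)))) \<partial>M) \<partial>lborel)"
proof -
  have AM: "A \<in> sets M" using sets_F_M[of s] A ss by auto
  have pM: "p \<in> borel_measurable M" using measurable_F_M[OF p(1)] ss by simp
  have pB: "AE \<omega> in M. norm (p \<omega>) \<le> B" using p(2) by auto
  define \<zeta> where "\<zeta> i j \<omega> = indicator A \<omega> * (p \<omega> $ i * p \<omega> $ j)" for i j \<omega>
  have \<zeta>_F: "\<zeta> i j \<in> borel_measurable (F s)" for i j
    unfolding \<zeta>_def by (intro borel_measurable_times borel_measurable_indicator A borel_measurable_vec_nth p)
  have \<zeta>_B: "\<bar>\<zeta> i j \<omega>\<bar> \<le> B * B" if "\<omega> \<in> space M" for i j \<omega>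
  proof -
    have "\<bar>p \<omega> $ i\<bar> \<le> B" "\<bar>p \<omega> $ j\<bar> \<le> B"
      using p(2)[OF that] component_le_norm_cart order_trans by blast+
    then have "\<bar>p \<omega> $ i\<bar> * \<bar>p \<omega> $ j\<bar> \<le> B * B" by (intro mult_mono) auto
    moreover have "\<bar>\<zeta> i j \<omega>\<bar> \<le> \<bar>p \<omega> $ i\<bar> * \<bar>p \<omega> $ j\<bar>"
      by (simp add: \<zeta>_def abs_mult indicator_def)
    ultimately show ?thesis by simp
  qed
  let ?e = "\<lambda>i j. axis i (axis j 1) :: real^'n^'n"
  let ?m = "\<lambda>i j \<omega>. \<zeta> i j \<omega> * ((I s' \<omega> - I s \<omega>) \<bullet> ?e i j)"
  have m: "integrable M (?m i j)" "expectation (?m i j) = 0" for i j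
    by (rule ito_martingale[OF ito Z_prog ss \<zeta>_F \<zeta>_B]; assumption)+
  define q where "q u \<omega> = indicator A \<omega> * (p \<omega> \<bullet> (Y u \<omega> *v p \<omega>))" for u \<omega>
  have q_int: "integrable M (q u)" if "0 \<le> u" "u < T" for u
    unfolding q_def by (rule quad_Y_integrable[OF that pM pB AM])
  define f where "f \<omega> = q s' \<omega> - q s \<omega> - (\<Sum>i\<in>UNIV. \<Sum>j\<in>UNIV. ?m i j \<omega>)" for \<omega>
  have m_sum: "integrable M (\<lambda>\<omega>. \<Sum>i\<in>UNIV. \<Sum>j\<in>UNIV. ?m i j \<omega>)"
    "expectation (\<lambda>\<omega>. \<Sum>i\<in>UNIV. \<Sum>j\<in>UNIV. ?m i j \<omega>) = 0"
  proof -
    have 1: "integrable M (\<lambda>\<omega>. \<Sum>j\<in>UNIV. ?m i j \<omega>)" for i by (intro Bochner_Integration.integrable_sum m)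
    show "integrable M (\<lambda>\<omega>. \<Sum>i\<in>UNIV. \<Sum>j\<in>UNIV. ?m i j \<omega>)" by (intro Bochner_Integration.integrable_sum m)
    show "expectation (\<lambda>\<omega>. \<Sum>i\<in>UNIV. \<Sum>j\<in>UNIV. ?m i j \<omega>) = 0"
      by (simp only: Bochner_Integration.integral_sum[OF 1] Bochner_Integration.integral_sum[OF m(1)] m(2) sum.neutral_const)
  qed
  have f_int: "integrable M f" and f_exp: "expectation f = expectation (q s') - expectation (q s)"
    unfolding f_def using q_int[of s'] q_int[of s] m_sum ss by auto
  let ?g = "\<lambda>r \<omega>. indicator A \<omega> * ((Y r \<omega> *v p \<omega>) \<bullet> (matrix_inv (\<eta> r \<omega>) *v (Y r \<omega> *v p \<omega>)))"
  have g_nonneg: "0 \<le> ?g r \<omega>" if "0 \<le> r" "r \<le> T" "\<omega> \<in> space M" for r \<omega>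
    using psd_quad_nonneg[OF spd_imp_psd[OF spd_matrix_inv[OF eta_spd[OF that]]]] by simp
  have path: "AE \<omega> in M. 0 \<le> f \<omega> \<and> ennreal (f \<omega>) = (\<integral>\<^sup>+r\<in>{s..s'}. ennreal (?g r \<omega>) \<partial>lborel)"
    using dynamics AE_space
  proof eventually_elim
    case (elim \<omega>)
    let ?d = "\<lambda>r. Y r \<omega> ** matrix_inv (\<eta> r \<omega>) ** Y r \<omega>"
    let ?L = "\<lambda>B :: real^'n^'n. indicator A \<omega> * (p \<omega> \<bullet> (B *v p \<omega>))"
    have lin: "bounded_linear ?L" by (intro bounded_linear_const_mult bounded_linear_quad)
    have d_int: "integrable lborel (\<lambda>r. indicator {s..s'} r *\<^sub>R ?d r)"
      using elim(1) ss unfolding set_integrable_def by blast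
    have eq: "Y s' \<omega> - Y s \<omega> = (LINT r:{s..s'}|lborel. ?d r) + (I s' \<omega> - I s \<omega>)"
      using elim(1) ss by blast
    have L_I: "?L (I s' \<omega> - I s \<omega>) = (\<Sum>i\<in>UNIV. \<Sum>j\<in>UNIV. ?m i j \<omega>)"
      unfolding quad_expand \<zeta>_def by (simp add: sum_distrib_left mult_ac)
    have L_Y: "?L (Y s' \<omega> - Y s \<omega>) = q s' \<omega> - q s \<omega>"
      unfolding q_def by (simp add: matrix_vector_mult_diff_rdistrib inner_diff_right algebra_simps)
    have "?L (Y s' \<omega> - Y s \<omega>) = ?L (LINT r:{s..s'}|lborel. ?d r) + ?L (I s' \<omega> - I s \<omega>)"
      unfolding eq by (rule linear_add[OF bounded_linear.linear[OF lin]])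
    then have "f \<omega> = ?L (LINT r:{s..s'}|lborel. ?d r)"
      unfolding f_def L_I L_Y by simp
    also have "\<dots> = (\<integral>r. ?L (indicator {s..s'} r *\<^sub>R ?d r) \<partial>lborel)"
      unfolding set_lebesgue_integral_def by (rule integral_bounded_linear[OF lin d_int, symmetric])
    finally have f_eq: "f \<omega> = (\<integral>r. ?L (indicator {s..s'} r *\<^sub>R ?d r) \<partial>lborel)" .
    have L_g: "?L (indicator {s..s'} r *\<^sub>R ?d r) = ?g r \<omega> * indicator {s..s'} r" for r
    proof (cases "r \<in> {s..s'}")
      case True
      then have "psd (Y r \<omega>)" using ss elim(2) by (intro Y_psd) auto
      then show ?thesis using True quad_drift[of "Y r \<omega>" "p \<omega>" "matrix_inv (\<eta> r \<omega>)"] by simp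
    qed simp
    have L_nonneg: "0 \<le> ?L (indicator {s..s'} r *\<^sub>R ?d r)" for r
      unfolding L_g using g_nonneg[of r \<omega>] elim(2) ss by (auto simp: indicator_def)
    have "ennreal (f \<omega>) = (\<integral>\<^sup>+r. ennreal (?L (indicator {s..s'} r *\<^sub>R ?d r)) \<partial>lborel)"
      unfolding f_eq
      by (rule nn_integral_eq_integral[symmetric])
         (use L_nonneg integrable_bounded_linear[OF lin d_int] in auto)
    also have "\<dots> = (\<integral>\<^sup>+r\<in>{s..s'}. ennreal (?g r \<omega>) \<partial>lborel)"
      unfolding L_g by (intro nn_integral_cong) (simp add: indicator_def)
    finally have "ennreal (f \<omega>) = (\<integral>\<^sup>+r\<in>{s..s'}. ennreal (?g r \<omega>) \<partial>lborel)" .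
    moreover have "0 \<le> f \<omega>" unfolding f_eq by (rule integral_nonneg_AE) (use L_nonneg in blast)
    ultimately show ?case by blast
  qed
  have joint: "(\<lambda>(r, \<omega>). ennreal (?g r \<omega>) * indicator {s..s'} r) \<in> borel_measurable (lborel \<Otimes>\<^sub>M M)"
  proof -
    let ?Y = "\<lambda>x. case x of (r, \<omega>) \<Rightarrow> indicator {0..s'} r *\<^sub>R Y r \<omega>"
    let ?\<eta> = "\<lambda>x. case x of (r, \<omega>) \<Rightarrow> indicator {0..T} r *\<^sub>R \<eta> r \<omega>"
    have Ym: "?Y \<in> borel_measurable (lborel \<Otimes>\<^sub>M M)" using Y_joint[of s'] ss by simp
    have ps: "(\<lambda>x. p (snd x)) \<in> borel_measurable (lborel \<Otimes>\<^sub>M M)" by (rule measurable_compose[OF measurable_snd pM])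
    have As: "(\<lambda>x. indicator A (snd x) :: real) \<in> borel_measurable (lborel \<Otimes>\<^sub>M M)"
      by (rule measurable_compose[OF measurable_snd]) (rule borel_measurable_indicator[OF AM])
    have ind: "(\<lambda>x. indicator {s..s'} (fst x) :: ennreal) \<in> borel_measurable (lborel \<Otimes>\<^sub>M M)"
      by (rule measurable_compose[OF measurable_fst]) simp
    have "(\<lambda>x. indicator A (snd x) * ((?Y x *v p (snd x)) \<bullet> (matrix_inv (?\<eta> x) *v (?Y x *v p (snd x))))) \<in> borel_measurable (lborel \<Otimes>\<^sub>M M)"
      by (intro borel_measurable_times As borel_measurable_inner borel_measurable_mult_vec
          borel_measurable_matrix_inv Ym ps eta_joint)
    then have "(\<lambda>x. ennreal (indicator A (snd x) * ((?Y x *v p (snd x)) \<bullet> (matrix_inv (?\<eta> x) *v (?Y x *v p (snd x))))) * indicator {s..s'} (fst x))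
        \<in> borel_measurable (lborel \<Otimes>\<^sub>M M)"
      by (intro borel_measurable_times_ennreal ind measurable_compose[OF _ measurable_ennreal])
    also have "?this \<longleftrightarrow> ?thesis"
      using ss by (intro measurable_cong) (auto simp: indicator_def)
    finally show ?thesis .
  qed
  have "ennreal (expectation f) = (\<integral>\<^sup>+\<omega>. ennreal (f \<omega>) \<partial>M)"
    by (rule nn_integral_eq_integral[symmetric, OF f_int]) (use path in eventually_elim, simp)
  also have "\<dots> = (\<integral>\<^sup>+\<omega>. (\<integral>\<^sup>+r. ennreal (?g r \<omega>) * indicator {s..s'} r \<partial>lborel) \<partial>M)"
    by (rule nn_integral_cong_AE) (use path in eventually_elim, simp)
  also have "\<dots> = (\<integral>\<^sup>+r. (\<integral>\<^sup>+\<omega>. ennreal (?g r \<omega>) * indicator {s..s'} r \<partial>M) \<partial>lborel)"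
  proof -
    interpret pair_sigma_finite lborel M by unfold_locales
    show ?thesis using Fubini[OF joint] by simp
  qed
  also have "\<dots> = (\<integral>\<^sup>+r\<in>{s..s'}. (\<integral>\<^sup>+\<omega>. ennreal (?g r \<omega>) \<partial>M) \<partial>lborel)"
    by (intro nn_integral_cong) (simp add: indicator_def)
  finally have fubini: "ennreal (expectation f) = (\<integral>\<^sup>+r\<in>{s..s'}. (\<integral>\<^sup>+\<omega>. ennreal (?g r \<omega>) \<partial>M) \<partial>lborel)" .
  show thesis
  proof (rule that[OF _ _ fubini])
    show "0 \<le> expectation f" by (rule integral_nonneg_AE) (use path in eventually_elim, simp)
    show "expectation (\<lambda>\<omega>. indicator A \<omega> * (p \<omega> \<bullet> (Y s' \<omega> *v p \<omega>)))
      = expectation (\<lambda>\<omega>. indicator A \<omega> * (p \<omega> \<bullet> (Y s \<omega> *v p \<omega>))) + expectation f"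
      using f_exp unfolding q_def by simp
  qed
qed

end

section \<open>The dual bound\<close>

text \<open>The random vector \<open>V\<close> is the terminal value of the martingale \<open>N\<close>, and expectations are taken over
  an event \<open>A\<close> known at the initial time \<open>t0\<close>. The shift \<open>\<epsilon>\<close> makes the forms coercive as long as nothing
  is known about \<open>Y\<close> itself.\<close>

locale dual_bound = supersolution_process M W T \<eta> Y Z I \<delta>
  for M :: "'a measure" and W T and \<eta> Y Z I :: "real \<Rightarrow> 'a \<Rightarrow> real^'n^'n" and \<delta> +
  fixes \<epsilon> c K t0 :: real and V :: "'a \<Rightarrow> real^'n" and A :: "'a set"
  assumes eps: "0 \<le> \<epsilon>" and c: "0 < c"
    and R_coercive: "AE \<omega> in M. \<forall>s. 0 \<le> s \<and> s < T \<longrightarrow> coercive c (Y s \<omega> + \<epsilon> *\<^sub>R mat 1)"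
    and V_meas: "V \<in> borel_measurable M" and V_bound: "\<And>\<omega>. \<omega> \<in> space M \<Longrightarrow> norm (V \<omega>) \<le> K"
    and t0: "0 \<le> t0" "t0 < T" and A: "A \<in> sets (F t0)"
begin

abbreviation N :: "real \<Rightarrow> 'a \<Rightarrow> real^'n" where "N \<equiv> cexp V"

definition R :: "real \<Rightarrow> 'a \<Rightarrow> real^'n^'n" where "R s \<omega> = Y s \<omega> + \<epsilon> *\<^sub>R mat 1"

definition KN :: real where "KN = CARD('n) * K"

text \<open>\<open>p s\<close> is \<open>R\<^sub>s\<^sup>-\<^sup>1 N\<^sub>s\<close>, cut off on a null set to make it bounded everywhere.\<close>

definition p :: "real \<Rightarrow> 'a \<Rightarrow> real^'n" where
  "p s \<omega> = (let v = matrix_inv (R s \<omega>) *v N s \<omega> in if norm v \<le> KN / c then v else 0)"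

definition q :: "real \<Rightarrow> 'a \<Rightarrow> real" where
  "q s \<omega> = N s \<omega> \<bullet> (matrix_inv (R s \<omega>) *v N s \<omega>)"

definition \<phi> :: "real \<Rightarrow> real" where "\<phi> s = expectation (\<lambda>\<omega>. indicator A \<omega> * q s \<omega>)"

definition g :: "real \<Rightarrow> real" where "g s = expectation (\<lambda>\<omega>. (norm (N s \<omega>))\<^sup>2)"

lemma AM: "A \<in> sets M"
  using sets_F_M[of t0] A t0 by auto

lemma A_F: "t0 \<le> s \<Longrightarrow> A \<in> sets (F s)"
  using sets_F_mono A by blast

lemma K_nonneg: "0 \<le> K"
proof -
  obtain \<omega> where "\<omega> \<in> space M" using not_empty by blast
  from V_bound[OF this] show ?thesis using norm_ge_zero order_trans by blast
qed

lemma KN_nonneg: "0 \<le> KN" unfolding KN_def using K_nonneg by simp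

lemma V_int: "integrable M V" by (rule bounded_integrable[OF V_meas V_bound])

lemma N_bound: "s \<le> T \<Longrightarrow> AE \<omega> in M. norm (N s \<omega>) \<le> KN"
  unfolding KN_def by (rule cexp_bounded[OF V_meas V_bound])

lemma R_F: "0 \<le> s \<Longrightarrow> s < T \<Longrightarrow> R s \<in> borel_measurable (F s)"
  unfolding R_def by (intro borel_measurable_add Y_F borel_measurable_const)

lemma R_coercive': "AE \<omega> in M. \<forall>s. 0 \<le> s \<and> s < T \<longrightarrow> coercive c (R s \<omega>)"
  using R_coercive unfolding R_def .

lemma Rinv_F: "0 \<le> s \<Longrightarrow> s < T \<Longrightarrow> (\<lambda>\<omega>. matrix_inv (R s \<omega>) *v N s \<omega>) \<in> borel_measurable (F s)"
  by (intro borel_measurable_mult_vec borel_measurable_matrix_inv R_F cexp_measurable_F)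

lemma p_F: assumes "0 \<le> s" "s < T" shows "p s \<in> borel_measurable (F s)"
proof -
  note m = Rinv_F[OF assms]
  have "(\<lambda>\<omega>. norm (matrix_inv (R s \<omega>) *v N s \<omega>)) \<in> borel_measurable (F s)"
    by (rule measurable_compose[OF m borel_measurable_norm])
  then have "{\<omega> \<in> space (F s). norm (matrix_inv (R s \<omega>) *v N s \<omega>) \<le> KN / c} \<in> sets (F s)"
    by (rule borel_measurable_le) simp
  then show ?thesis unfolding p_def Let_def by (intro measurable_If m) simp_all
qed

lemma p_M: "0 \<le> s \<Longrightarrow> s < T \<Longrightarrow> p s \<in> borel_measurable M"
  using measurable_F_M[OF p_F] by simp

lemma p_bound: "norm (p s \<omega>) \<le> KN / c"
  unfolding p_def Let_def using KN_nonneg c by simp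

lemma p_eq: assumes s: "0 \<le> s" "s < T"
  shows "AE \<omega> in M. p s \<omega> = matrix_inv (R s \<omega>) *v N s \<omega>"
proof -
  have "AE \<omega> in M. norm (N s \<omega>) \<le> KN" by (rule N_bound) (use s in simp)
  then show ?thesis using R_coercive'
  proof eventually_elim
    case (elim \<omega>)
    have "norm (matrix_inv (R s \<omega>) *v N s \<omega>) \<le> norm (N s \<omega>) / c"
      by (rule coercive_norm_inv[OF c]) (use elim(2) s in blast)
    also have "\<dots> \<le> KN / c" using elim(1) c by (intro divide_right_mono) auto
    finally show ?case by (simp add: p_def Let_def)
  qed
qed

lemma q_M: "0 \<le> s \<Longrightarrow> s < T \<Longrightarrow> q s \<in> borel_measurable M"
  unfolding q_def
  by (intro borel_measurable_inner measurable_F_M[OF Rinv_F] cexp_measurable) simp_all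

lemma q_bounds: assumes s: "0 \<le> s" "s < T"
  shows "AE \<omega> in M. 0 \<le> q s \<omega> \<and> q s \<omega> \<le> KN\<^sup>2 / c"
proof -
  have "AE \<omega> in M. norm (N s \<omega>) \<le> KN" by (rule N_bound) (use s in simp)
  then show ?thesis using R_coercive'
  proof eventually_elim
    case (elim \<omega>)
    have R: "coercive c (R s \<omega>)" using elim(2) s by blast
    have "q s \<omega> \<le> (norm (N s \<omega>))\<^sup>2 / c" unfolding q_def by (rule coercive_quad_inv[OF c R])
    also have "\<dots> \<le> KN\<^sup>2 / c" using elim(1) c by (intro divide_right_mono power_mono) auto
    finally show ?case
      unfolding q_def using psd_quad_nonneg[OF spd_imp_psd[OF spd_matrix_inv[OF coercive_spd[OF c R]]]] by simp
  qed
qed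

lemma Aq_integrable: assumes s: "0 \<le> s" "s < T"
  shows "integrable M (\<lambda>\<omega>. indicator A \<omega> * q s \<omega>)"
proof (rule integrable_const_bound[where B="KN\<^sup>2 / c"])
  show "(\<lambda>\<omega>. indicator A \<omega> * q s \<omega>) \<in> borel_measurable M"
    by (intro borel_measurable_times borel_measurable_indicator AM q_M s)
  show "AE \<omega> in M. norm (indicator A \<omega> * q s \<omega>) \<le> KN\<^sup>2 / c"
    using q_bounds[OF s] by eventually_elim (use c in \<open>auto simp: indicator_def\<close>)
qed

text \<open>One step: the direction that is optimal at \<open>s\<close> is admissible at \<open>s'\<close>, by the Legendre
  representation, and the linear term is a martingale.\<close>

lemma phi_step:
  assumes ss: "t0 \<le> s" "s \<le> s'" "s' < T"
  obtains D where "0 \<le> D" "\<phi> s \<le> \<phi> s' + D"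
    "ennreal D = (\<integral>\<^sup>+r\<in>{s..s'}. (\<integral>\<^sup>+\<omega>. ennreal (indicator A \<omega> *
        ((Y r \<omega> *v p s \<omega>) \<bullet> (matrix_inv (\<eta> r \<omega>) *v (Y r \<omega> *v p s \<omega>)))) \<partial>M) \<partial>lborel)"
proof -
  have s: "0 \<le> s" "s < T" "s \<le> T" and s': "0 \<le> s'" "s' < T" "s' \<le> T" using ss t0 by auto
  obtain D where D: "0 \<le> D"
    "expectation (\<lambda>\<omega>. indicator A \<omega> * (p s \<omega> \<bullet> (Y s' \<omega> *v p s \<omega>)))
      = expectation (\<lambda>\<omega>. indicator A \<omega> * (p s \<omega> \<bullet> (Y s \<omega> *v p s \<omega>))) + D"
    "ennreal D = (\<integral>\<^sup>+r\<in>{s..s'}. (\<integral>\<^sup>+\<omega>. ennreal (indicator A \<omega> *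
        ((Y r \<omega> *v p s \<omega>) \<bullet> (matrix_inv (\<eta> r \<omega>) *v (Y r \<omega> *v p s \<omega>)))) \<partial>M) \<partial>lborel)"
    by (rule expected_growth[OF s(1) ss(2,3) A_F[OF ss(1)] p_F[OF s(1,2)] p_bound]) (rule that)
  let ?f = "\<lambda>\<omega>. indicator A \<omega> *\<^sub>R p s \<omega>"
  have f_F: "?f \<in> borel_measurable (F s)"
    by (intro borel_measurable_scaleR borel_measurable_indicator A_F[OF ss(1)] p_F s)
  have f_B: "AE \<omega> in M. norm (?f \<omega>) \<le> KN / c"
    using p_bound[of s] KN_nonneg c by (auto simp: indicator_def)
  have pB: "AE \<omega> in M. norm (p s \<omega>) \<le> KN / c" using p_bound by simp
  note lin = cexp_inner[OF V_int s(3) f_F f_B]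
  note lin' = cexp_inner[OF V_int s'(3) measurable_F_mono[OF f_F ss(2)] f_B]
  define l where "l u = expectation (\<lambda>\<omega>. ?f \<omega> \<bullet> N u \<omega>)" for u
  define y where "y u = expectation (\<lambda>\<omega>. indicator A \<omega> * (p s \<omega> \<bullet> (Y u \<omega> *v p s \<omega>)))" for u
  define e where "e = expectation (\<lambda>\<omega>. indicator A \<omega> * (norm (p s \<omega>))\<^sup>2)"
  have y_int: "integrable M (\<lambda>\<omega>. indicator A \<omega> * (p s \<omega> \<bullet> (Y u \<omega> *v p s \<omega>)))" if "0 \<le> u" "u < T" for u
    by (rule quad_Y_integrable[OF that p_M[OF s(1,2)] pB AM])
  have e_int: "integrable M (\<lambda>\<omega>. indicator A \<omega> * (norm (p s \<omega>))\<^sup>2)"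
  proof (rule integrable_const_bound[where B="(KN / c)\<^sup>2"])
    show "(\<lambda>\<omega>. indicator A \<omega> * (norm (p s \<omega>))\<^sup>2) \<in> borel_measurable M"
      by (intro borel_measurable_times borel_measurable_indicator AM borel_measurable_power
          measurable_compose[OF p_M[OF s(1,2)] borel_measurable_norm])
    show "AE \<omega> in M. norm (indicator A \<omega> * (norm (p s \<omega>))\<^sup>2) \<le> (KN / c)\<^sup>2"
      using p_bound[of s] by (auto simp: indicator_def intro!: power_mono AE_I2)
  qed
  have quadR: "p s \<omega> \<bullet> (R u \<omega> *v p s \<omega>) = p s \<omega> \<bullet> (Y u \<omega> *v p s \<omega>) + \<epsilon> * (norm (p s \<omega>))\<^sup>2" for u \<omega>
    by (simp add: R_def matrix_vector_mult_add_rdistrib inner_add_right power2_norm_eq_inner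
        scaleR_matrix_vector_assoc[symmetric])
  let ?h = "\<lambda>u \<omega>. 2 * (?f \<omega> \<bullet> N u \<omega>) - indicator A \<omega> * (p s \<omega> \<bullet> (Y u \<omega> *v p s \<omega>)) - \<epsilon> * (indicator A \<omega> * (norm (p s \<omega>))\<^sup>2)"
  have h_eq: "?h u \<omega> = indicator A \<omega> * (2 * (p s \<omega> \<bullet> N u \<omega>) - p s \<omega> \<bullet> (R u \<omega> *v p s \<omega>))" for u \<omega>
    unfolding quadR by (simp add: algebra_simps)
  have h_int: "integrable M (?h s)" "integrable M (?h s')"
    by (intro Bochner_Integration.integrable_diff integrable_mult_right lin(1) lin'(1) y_int e_int s s')+
  have h_exp: "expectation (?h s) = 2 * l s - y s - \<epsilon> * e" "expectation (?h s') = 2 * l s' - y s' - \<epsilon> * e"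
    unfolding l_def y_def e_def using lin(1) lin'(1) y_int[OF s(1,2)] y_int[OF s'(1,2)] e_int by simp_all
  have "\<phi> s = expectation (?h s)"
    unfolding \<phi>_def
  proof (rule integral_cong_AE)
    show "AE \<omega> in M. indicator A \<omega> * q s \<omega> = ?h s \<omega>"
      using p_eq[OF s(1,2)] R_coercive'
    proof eventually_elim
      case (elim \<omega>)
      have "spd (R s \<omega>)" using elim(2) s coercive_spd[OF c] by blast
      from spd_legendre_attained[OF this elim(1)] show ?case unfolding h_eq q_def by simp
    qed
  qed (use Aq_integrable[OF s(1,2)] h_int in \<open>auto intro: borel_measurable_integrable\<close>)
  moreover have "expectation (?h s') \<le> \<phi> s'"
    unfolding \<phi>_def
  proof (rule integral_mono_AE[OF h_int(2) Aq_integrable[OF s'(1,2)]])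
    show "AE \<omega> in M. ?h s' \<omega> \<le> indicator A \<omega> * q s' \<omega>"
      using R_coercive'
    proof eventually_elim
      case (elim \<omega>)
      have "spd (R s' \<omega>)" using elim s' coercive_spd[OF c] by blast
      from spd_legendre[OF this, of "p s \<omega>" "N s' \<omega>"] show ?case
        unfolding h_eq q_def by (intro mult_left_mono) auto
    qed
  qed
  moreover have "l s = l s'" unfolding l_def using lin(3) lin'(3) by simp
  moreover have "y s' = y s + D" using D(2) unfolding y_def .
  ultimately have "\<phi> s \<le> \<phi> s' + D" using h_exp by simp
  then show thesis by (rule that[OF D(1) _ D(3)])
qed

text \<open>\<open>m s r\<close> is the bound on \<open>norm (Y\<^sub>r (R\<^sub>s\<^sup>-\<^sup>1 - R\<^sub>r\<^sup>-\<^sup>1))\<close> from the resolvent identity; the cut at \<open>2 / c\<close>, which bounds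
  the norm of \<open>R\<^sub>s\<^sup>-\<^sup>1 - R\<^sub>r\<^sup>-\<^sup>1\<close>, makes its square integrable.\<close>

definition m :: "real \<Rightarrow> real \<Rightarrow> 'a \<Rightarrow> real" where
  "m s r \<omega> = norm (Y r \<omega>) * min (2 / c) (norm (Y r \<omega> - Y s \<omega>) / c\<^sup>2)"

lemma m_le:
  assumes G: "(norm (Y r \<omega>))\<^sup>2 \<le> B"
  shows "(m s r \<omega>)\<^sup>2 \<le> B * (2 / c)\<^sup>2" "(m s r \<omega>)\<^sup>2 \<le> B * (norm (Y r \<omega> - Y s \<omega>) / c\<^sup>2)\<^sup>2"
proof -
  have B: "0 \<le> B" using G zero_le_power2 order_trans by blast
  have 0: "0 \<le> min (2 / c) (norm (Y r \<omega> - Y s \<omega>) / c\<^sup>2)" using c by simp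
  have "(min (2 / c) (norm (Y r \<omega> - Y s \<omega>) / c\<^sup>2))\<^sup>2 \<le> (2 / c)\<^sup>2"
    "(min (2 / c) (norm (Y r \<omega> - Y s \<omega>) / c\<^sup>2))\<^sup>2 \<le> (norm (Y r \<omega> - Y s \<omega>) / c\<^sup>2)\<^sup>2"
    by (intro power_mono 0; simp)+
  then show "(m s r \<omega>)\<^sup>2 \<le> B * (2 / c)\<^sup>2" "(m s r \<omega>)\<^sup>2 \<le> B * (norm (Y r \<omega> - Y s \<omega>) / c\<^sup>2)\<^sup>2"
    unfolding m_def power_mult_distrib by (intro mult_mono G B; simp)+
qed

text \<open>A change of \<open>R\<close> enters through \<open>R\<^sub>s\<^sup>-\<^sup>1 - R\<^sub>r\<^sup>-\<^sup>1 = R\<^sub>s\<^sup>-\<^sup>1 (Y\<^sub>r - Y\<^sub>s) R\<^sub>r\<^sup>-\<^sup>1\<close>. A change of the vector enters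
  through \<open>Y\<^sub>r R\<^sub>r\<^sup>-\<^sup>1 = Id - \<epsilon> R\<^sub>r\<^sup>-\<^sup>1\<close>, which is bounded however large \<open>Y\<^sub>r\<close> is.\<close>

lemma direction_change:
  assumes R: "coercive c (R s \<omega>)" "coercive c (R r \<omega>)"
  shows "(norm (Y r \<omega> *v (matrix_inv (R s \<omega>) *v v) - Y r \<omega> *v (matrix_inv (R r \<omega>) *v w)))\<^sup>2
    \<le> 2 * ((m s r \<omega>)\<^sup>2 * (norm v)\<^sup>2) + 2 * ((1 + \<epsilon> / c)\<^sup>2 * (norm (w - v))\<^sup>2)"
proof -
  let ?x = "matrix_inv (R s \<omega>) *v v" and ?y = "matrix_inv (R r \<omega>) *v v"
  have spd: "spd (R s \<omega>)" "spd (R r \<omega>)" using R coercive_spd[OF c] by blast+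
  have "norm (?x - ?y) \<le> 2 / c * norm v"
    using norm_triangle_ineq4[of ?x ?y] coercive_norm_inv[OF c R(1), of v] coercive_norm_inv[OF c R(2), of v] by simp
  moreover have "norm (?x - ?y) \<le> norm (Y r \<omega> - Y s \<omega>) / c\<^sup>2 * norm v"
  proof -
    have "R s \<omega> *v (?x - ?y) = (Y r \<omega> - Y s \<omega>) *v ?y"
    proof -
      have "R s \<omega> *v (?x - ?y) = R r \<omega> *v ?y - R s \<omega> *v ?y"
        using spd by (simp add: matrix_vector_mult_diff_distrib)
      also have "\<dots> = (Y r \<omega> - Y s \<omega>) *v ?y"
        unfolding R_def by (simp add: matrix_vector_mult_diff_rdistrib matrix_vector_mult_add_rdistrib)
      finally show ?thesis .
    qed
    then have "?x - ?y = matrix_inv (R s \<omega>) *v ((Y r \<omega> - Y s \<omega>) *v ?y)"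
      using spd_mult_inv(2)[OF spd(1), of "?x - ?y"] by simp
    then have "norm (?x - ?y) \<le> norm ((Y r \<omega> - Y s \<omega>) *v ?y) / c"
      using coercive_norm_inv[OF c R(1)] by simp
    also have "\<dots> \<le> (norm (Y r \<omega> - Y s \<omega>) * norm ?y) / c"
      using c by (intro divide_right_mono norm_matrix_vector_le) simp
    also have "\<dots> \<le> (norm (Y r \<omega> - Y s \<omega>) * (norm v / c)) / c"
      using c by (intro divide_right_mono mult_left_mono coercive_norm_inv[OF c R(2)]) simp_all
    finally show ?thesis by (simp add: power2_eq_square mult_ac)
  qed
  ultimately have "norm (?x - ?y) \<le> min (2 / c) (norm (Y r \<omega> - Y s \<omega>) / c\<^sup>2) * norm v"
    by (simp add: min_def)
  then have 1: "norm (Y r \<omega> *v (?x - ?y)) \<le> m s r \<omega> * norm v"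
    using order_trans[OF norm_matrix_vector_le mult_left_mono[OF _ norm_ge_zero]]
    unfolding m_def mult.assoc by blast
  define z where "z = matrix_inv (R r \<omega>) *v (w - v)"
  have 2: "norm (Y r \<omega> *v z) \<le> (1 + \<epsilon> / c) * norm (w - v)"
  proof -
    have "Y r \<omega> *v z + \<epsilon> *\<^sub>R z = R r \<omega> *v z"
      unfolding R_def by (simp add: matrix_vector_mult_add_rdistrib scaleR_matrix_vector_assoc[symmetric])
    moreover have "R r \<omega> *v z = w - v" unfolding z_def by (rule spd_mult_inv(1)[OF spd(2)])
    ultimately have "Y r \<omega> *v z = (w - v) - \<epsilon> *\<^sub>R z" by (simp add: eq_diff_eq)
    then have "norm (Y r \<omega> *v z) \<le> norm (w - v) + \<epsilon> * norm z"
      using norm_triangle_ineq4[of "w - v" "\<epsilon> *\<^sub>R z"] eps by simp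
    also have "\<dots> \<le> norm (w - v) + \<epsilon> * (norm (w - v) / c)"
      unfolding z_def using eps by (intro add_left_mono mult_left_mono coercive_norm_inv[OF c R(2)])
    finally show ?thesis by (simp add: algebra_simps)
  qed
  have "matrix_inv (R r \<omega>) *v w = ?y + z" unfolding z_def by (simp add: matrix_vector_mult_diff_distrib)
  then have eq: "Y r \<omega> *v ?x - Y r \<omega> *v (matrix_inv (R r \<omega>) *v w) = Y r \<omega> *v (?x - ?y) - Y r \<omega> *v z"
    by (simp add: matrix_vector_right_distrib matrix_vector_mult_diff_distrib)
  have "(norm (Y r \<omega> *v (?x - ?y) - Y r \<omega> *v z))\<^sup>2 \<le> 2 * (norm (Y r \<omega> *v (?x - ?y)))\<^sup>2 + 2 * (norm (Y r \<omega> *v z))\<^sup>2"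
    using power2_norm_diff_le[of "Y r \<omega> *v (?x - ?y)" "Y r \<omega> *v z" 0] by simp
  also have "\<dots> \<le> 2 * (m s r \<omega> * norm v)\<^sup>2 + 2 * ((1 + \<epsilon> / c) * norm (w - v))\<^sup>2"
    using 1 2 by (intro add_mono mult_left_mono power_mono) auto
  finally show ?thesis unfolding eq by (simp add: power_mult_distrib)
qed

lemma m_integrable:
  assumes s: "0 \<le> s" "s < T" and r: "0 \<le> r" "r < T"
  shows "integrable M (\<lambda>\<omega>. (m s r \<omega>)\<^sup>2)" "(\<lambda>\<omega>. (m s r \<omega>)\<^sup>2) \<in> borel_measurable M"
proof -
  show meas: "(\<lambda>\<omega>. (m s r \<omega>)\<^sup>2) \<in> borel_measurable M"
    unfolding m_def using Y_M[OF s] Y_M[OF r] by measurable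
  obtain G where G: "integrable M G" "AE \<omega> in M. \<forall>u\<in>{0..r}. (norm (Y u \<omega>))\<^sup>2 \<le> G \<omega>"
    by (rule Y_dominated[OF r]) (rule that)
  show "integrable M (\<lambda>\<omega>. (m s r \<omega>)\<^sup>2)"
  proof (rule Bochner_Integration.integrable_bound[OF _ meas])
    show "integrable M (\<lambda>\<omega>. G \<omega> * (2 / c)\<^sup>2)" using G(1) by simp
    show "AE \<omega> in M. norm ((m s r \<omega>)\<^sup>2) \<le> norm (G \<omega> * (2 / c)\<^sup>2)"
      using G(2)
    proof eventually_elim
      case (elim \<omega>)
      have "(norm (Y r \<omega>))\<^sup>2 \<le> G \<omega>" using elim r by simp
      then have "(m s r \<omega>)\<^sup>2 \<le> G \<omega> * (2 / c)\<^sup>2" by (rule m_le)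
      then show ?case by (simp add: order_trans[OF _ abs_ge_self])
    qed
  qed
qed

text \<open>Uniform continuity in mean follows by dominated convergence from uniform continuity of paths.\<close>

lemma m_small:
  assumes S: "0 \<le> S" "S < T" and \<gamma>: "0 < \<gamma>"
  obtains h where "0 < h" "\<And>s r. s \<in> {0..S} \<Longrightarrow> r \<in> {0..S} \<Longrightarrow> \<bar>s - r\<bar> \<le> h \<Longrightarrow> expectation (\<lambda>\<omega>. (m s r \<omega>)\<^sup>2) \<le> \<gamma>"
proof (rule ccontr)
  assume no: "\<not> thesis"
  note found = that
  have neg: "\<exists>s r. s \<in> {0..S} \<and> r \<in> {0..S} \<and> \<bar>s - r\<bar> \<le> h \<and> \<gamma> < expectation (\<lambda>\<omega>. (m s r \<omega>)\<^sup>2)" if h: "0 < h" for h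
  proof (rule ccontr)
    assume "\<nexists>s r. s \<in> {0..S} \<and> r \<in> {0..S} \<and> \<bar>s - r\<bar> \<le> h \<and> \<gamma> < expectation (\<lambda>\<omega>. (m s r \<omega>)\<^sup>2)"
    then have thesis by (intro found[OF h]) (auto simp: not_less)
    then show False using no by blast
  qed
  have "\<forall>n. \<exists>s r. s \<in> {0..S} \<and> r \<in> {0..S} \<and> \<bar>s - r\<bar> \<le> 1 / real (Suc n) \<and> \<gamma> < expectation (\<lambda>\<omega>. (m s r \<omega>)\<^sup>2)"
    by (intro allI neg) simp
  then obtain s r where sr: "\<And>n. s n \<in> {0..S}" "\<And>n. r n \<in> {0..S}" "\<And>n. \<bar>s n - r n\<bar> \<le> 1 / real (Suc n)"
    "\<And>n. \<gamma> < expectation (\<lambda>\<omega>. (m (s n) (r n) \<omega>)\<^sup>2)"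
    by metis
  obtain G where G: "integrable M G" "AE \<omega> in M. \<forall>u\<in>{0..S}. (norm (Y u \<omega>))\<^sup>2 \<le> G \<omega>"
    by (rule Y_dominated[OF S]) (rule that)
  have "(\<lambda>n. expectation (\<lambda>\<omega>. (m (s n) (r n) \<omega>)\<^sup>2)) \<longlonglongrightarrow> expectation (\<lambda>\<omega>. 0)"
  proof (rule integral_dominated_convergence[where w="\<lambda>\<omega>. G \<omega> * (2 / c)\<^sup>2"])
    show "(\<lambda>\<omega>. (m (s n) (r n) \<omega>)\<^sup>2) \<in> borel_measurable M" for n
      by (rule m_integrable(2)) (use sr(1)[of n] sr(2)[of n] S in auto)
    show "integrable M (\<lambda>\<omega>. G \<omega> * (2 / c)\<^sup>2)" using G(1) by simp
    show "AE \<omega> in M. norm ((m (s n) (r n) \<omega>)\<^sup>2) \<le> G \<omega> * (2 / c)\<^sup>2" for n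
      using G(2)
    proof eventually_elim
      case (elim \<omega>)
      have "(norm (Y (r n) \<omega>))\<^sup>2 \<le> G \<omega>" using elim sr(2) by blast
      then have "(m (s n) (r n) \<omega>)\<^sup>2 \<le> G \<omega> * (2 / c)\<^sup>2" by (rule m_le)
      then show ?case by simp
    qed
    show "AE \<omega> in M. (\<lambda>n. (m (s n) (r n) \<omega>)\<^sup>2) \<longlonglongrightarrow> 0"
      using Y_continuous G(2)
    proof eventually_elim
      case (elim \<omega>)
      have "uniformly_continuous_on {0..S} (\<lambda>t. Y t \<omega>)"
        by (rule compact_uniformly_continuous) (use elim(1) S in auto)
      moreover have "(\<lambda>n. dist (r n) (s n)) \<longlonglongrightarrow> 0"
        by (rule Lim_null_comparison[OF _ LIMSEQ_Suc[OF lim_1_over_n]])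
           (use sr(3) in \<open>auto simp: dist_real_def abs_minus_commute\<close>)
      ultimately have "(\<lambda>n. dist (Y (r n) \<omega>) (Y (s n) \<omega>)) \<longlonglongrightarrow> 0"
        unfolding uniformly_continuous_on_sequentially using sr(1,2) by blast
      then have lim: "(\<lambda>n. norm (Y (r n) \<omega> - Y (s n) \<omega>)) \<longlonglongrightarrow> 0" by (simp add: dist_norm)
      have "(\<lambda>n. G \<omega> * (norm (Y (r n) \<omega> - Y (s n) \<omega>) / c\<^sup>2)\<^sup>2) \<longlonglongrightarrow> G \<omega> * (0 / c\<^sup>2)\<^sup>2"
        using c by (intro tendsto_intros lim) simp
      then have lim2: "(\<lambda>n. G \<omega> * (norm (Y (r n) \<omega> - Y (s n) \<omega>) / c\<^sup>2)\<^sup>2) \<longlonglongrightarrow> 0" by simp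
      show ?case
      proof (rule Lim_null_comparison[OF always_eventually lim2], rule allI)
        fix n
        have "(norm (Y (r n) \<omega>))\<^sup>2 \<le> G \<omega>" using elim(2) sr(2) by blast
        then have "(m (s n) (r n) \<omega>)\<^sup>2 \<le> G \<omega> * (norm (Y (r n) \<omega> - Y (s n) \<omega>) / c\<^sup>2)\<^sup>2" by (rule m_le)
        then show "norm ((m (s n) (r n) \<omega>)\<^sup>2) \<le> G \<omega> * (norm (Y (r n) \<omega> - Y (s n) \<omega>) / c\<^sup>2)\<^sup>2" by simp
      qed
    qed
  qed simp
  then have lim0: "(\<lambda>n. expectation (\<lambda>\<omega>. (m (s n) (r n) \<omega>)\<^sup>2)) \<longlonglongrightarrow> 0" by simp
  have "\<gamma> \<le> 0"
    by (rule tendsto_lowerbound[OF lim0]) (use sr(4) in \<open>auto intro!: always_eventually simp: less_imp_le\<close>)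
  then show False using \<gamma> by simp
qed

lemma g_mono:
  assumes "s \<le> r" "r \<le> T"
  shows "g s \<le> g r"
proof -
  have "0 \<le> expectation (\<lambda>\<omega>. (norm (N r \<omega> - N s \<omega>))\<^sup>2)" by simp
  also have "\<dots> = g r - g s" unfolding g_def by (rule cexp_increment(3)[OF V_meas V_bound assms])
  finally show ?thesis by simp
qed

lemma g_le: assumes "r \<le> T" shows "g r \<le> KN\<^sup>2"
proof -
  have "g r \<le> expectation (\<lambda>\<omega>. KN\<^sup>2)"
    unfolding g_def
  proof (rule integral_mono_AE[OF cexp_increment(1)[OF V_meas V_bound order_refl assms]])
    show "AE \<omega> in M. (norm (N r \<omega>))\<^sup>2 \<le> KN\<^sup>2"
      using N_bound[OF assms] by eventually_elim (rule power_mono, simp_all)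
    show "integrable M (\<lambda>\<omega>. KN\<^sup>2)" by (rule integrable_const)
  qed
  then show ?thesis by (simp add: prob_space)
qed

lemma g_nonneg: "0 \<le> g r" unfolding g_def by simp

text \<open>The drift of \<open>r \<mapsto> \<langle>v, Y\<^sub>r v\<rangle>\<close>.\<close>

definition X :: "real \<Rightarrow> 'a \<Rightarrow> real^'n \<Rightarrow> real" where
  "X r \<omega> v = (Y r \<omega> *v v) \<bullet> (matrix_inv (\<eta> r \<omega>) *v (Y r \<omega> *v v))"

lemma X_M:
  assumes r: "0 \<le> r" "r < T" and v: "v \<in> borel_measurable M"
  shows "(\<lambda>\<omega>. ennreal (indicator A \<omega> * X r \<omega> (v \<omega>))) \<in> borel_measurable M"
  unfolding X_def using r
  by (intro measurable_compose[OF _ measurable_ennreal] borel_measurable_times borel_measurable_indicator AM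
      borel_measurable_inner borel_measurable_mult_vec borel_measurable_matrix_inv Y_M eta_M v) simp_all

text \<open>The price, in terms of the drift at time \<open>r\<close>, for keeping the direction that was optimal at \<open>s\<close>.
  Young's inequality moves it almost entirely to the errors, up to the factor \<open>1 + \<kappa>\<close>.\<close>

lemma frozen_direction_cost:
  assumes sr: "t0 \<le> s" "s \<le> r" "r < T" and k: "0 < \<kappa>"
    and b: "0 \<le> b" "(\<integral>\<^sup>+\<omega>. ennreal (indicator A \<omega> * X r \<omega> (p r \<omega>)) \<partial>M) \<le> ennreal b"
  shows "(\<integral>\<^sup>+\<omega>. ennreal (indicator A \<omega> * X r \<omega> (p s \<omega>)) \<partial>M) \<le> ennreal ((1 + \<kappa>) * b
      + (1 + 1 / \<kappa>) / \<delta> * (2 * KN\<^sup>2 * expectation (\<lambda>\<omega>. (m s r \<omega>)\<^sup>2) + 2 * (1 + \<epsilon> / c)\<^sup>2 * (g r - g s)))"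
proof -
  have s: "0 \<le> s" "s < T" "s \<le> T" and r: "0 \<le> r" "r < T" "r \<le> T" using sr t0 by auto
  let ?C = "(1 + 1 / \<kappa>) / \<delta>"
  have C: "0 \<le> ?C" using k delta by simp
  let ?u = "\<lambda>\<omega>. ?C * (2 * KN\<^sup>2 * (m s r \<omega>)\<^sup>2 + 2 * (1 + \<epsilon> / c)\<^sup>2 * (norm (N r \<omega> - N s \<omega>))\<^sup>2)"
  have u_nonneg: "0 \<le> ?u \<omega>" for \<omega> by (intro mult_nonneg_nonneg[OF C] add_nonneg_nonneg) simp_all
  note inc = cexp_increment[OF V_meas V_bound sr(2) r(3)]
  have u_int: "integrable M ?u"
    by (intro integrable_mult_right Bochner_Integration.integrable_add m_integrable inc s r)
  have u_exp: "expectation ?u = ?C * (2 * KN\<^sup>2 * expectation (\<lambda>\<omega>. (m s r \<omega>)\<^sup>2) + 2 * (1 + \<epsilon> / c)\<^sup>2 * (g r - g s))"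
    using m_integrable(1)[OF s(1,2) r(1,2)] inc unfolding g_def by simp
  have "AE \<omega> in M. ennreal (indicator A \<omega> * X r \<omega> (p s \<omega>))
      \<le> ennreal (1 + \<kappa>) * ennreal (indicator A \<omega> * X r \<omega> (p r \<omega>)) + ennreal (?u \<omega>)"
    using p_eq[OF s(1,2)] p_eq[OF r(1,2)] R_coercive' N_bound[OF s(3)] eta_coercive
  proof eventually_elim
    case (elim \<omega>)
    have Rs: "coercive c (R s \<omega>)" and Rr: "coercive c (R r \<omega>)" using elim(3) s r by blast+
    have eta: "coercive \<delta> (\<eta> r \<omega>)" using elim(5) r by simp
    let ?E = "matrix_inv (\<eta> r \<omega>)"
    have E: "psd ?E" by (intro spd_imp_psd spd_matrix_inv coercive_spd[OF delta eta])
    define d where "d = Y r \<omega> *v p s \<omega> - Y r \<omega> *v p r \<omega>"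
    have "(norm d)\<^sup>2 \<le> 2 * ((m s r \<omega>)\<^sup>2 * (norm (N s \<omega>))\<^sup>2) + 2 * ((1 + \<epsilon> / c)\<^sup>2 * (norm (N r \<omega> - N s \<omega>))\<^sup>2)"
      unfolding d_def elim(1) elim(2) by (rule direction_change[OF Rs Rr])
    also have "\<dots> \<le> 2 * ((m s r \<omega>)\<^sup>2 * KN\<^sup>2) + 2 * ((1 + \<epsilon> / c)\<^sup>2 * (norm (N r \<omega> - N s \<omega>))\<^sup>2)"
      by (intro add_right_mono mult_left_mono power_mono elim(4)) simp_all
    finally have d_le: "(norm d)\<^sup>2 \<le> 2 * KN\<^sup>2 * (m s r \<omega>)\<^sup>2 + 2 * (1 + \<epsilon> / c)\<^sup>2 * (norm (N r \<omega> - N s \<omega>))\<^sup>2"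
      by (simp add: mult_ac)
    have "X r \<omega> (p s \<omega>) = (Y r \<omega> *v p r \<omega> + d) \<bullet> (?E *v (Y r \<omega> *v p r \<omega> + d))"
      unfolding X_def d_def by simp
    also have "\<dots> \<le> (1 + \<kappa>) * X r \<omega> (p r \<omega>) + (1 + 1 / \<kappa>) * (d \<bullet> (?E *v d))"
      unfolding X_def by (rule psd_young[OF E k])
    also have "(1 + 1 / \<kappa>) * (d \<bullet> (?E *v d)) \<le> (1 + 1 / \<kappa>) * ((norm d)\<^sup>2 / \<delta>)"
      using k by (intro mult_left_mono coercive_quad_inv[OF delta eta]) simp
    also have "(1 + 1 / \<kappa>) * ((norm d)\<^sup>2 / \<delta>) = ?C * (norm d)\<^sup>2" by simp
    also have "?C * (norm d)\<^sup>2 \<le> ?u \<omega>" by (intro mult_left_mono d_le C)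
    finally have le: "X r \<omega> (p s \<omega>) \<le> (1 + \<kappa>) * X r \<omega> (p r \<omega>) + ?u \<omega>" by simp
    have X_nonneg: "0 \<le> X r \<omega> (p r \<omega>)" unfolding X_def by (rule psd_quad_nonneg[OF E])
    have "indicator A \<omega> * X r \<omega> (p s \<omega>) \<le> (1 + \<kappa>) * (indicator A \<omega> * X r \<omega> (p r \<omega>)) + ?u \<omega>"
      using le u_nonneg[of \<omega>] by (cases "\<omega> \<in> A") auto
    then have "ennreal (indicator A \<omega> * X r \<omega> (p s \<omega>)) \<le> ennreal ((1 + \<kappa>) * (indicator A \<omega> * X r \<omega> (p r \<omega>)) + ?u \<omega>)"
      by (rule ennreal_leI)
    also have "\<dots> = ennreal ((1 + \<kappa>) * (indicator A \<omega> * X r \<omega> (p r \<omega>))) + ennreal (?u \<omega>)"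
      using k X_nonneg by (intro ennreal_plus u_nonneg mult_nonneg_nonneg) simp_all
    also have "ennreal ((1 + \<kappa>) * (indicator A \<omega> * X r \<omega> (p r \<omega>))) = ennreal (1 + \<kappa>) * ennreal (indicator A \<omega> * X r \<omega> (p r \<omega>))"
      using k by (intro ennreal_mult') simp
    finally show ?case .
  qed
  then have "(\<integral>\<^sup>+\<omega>. ennreal (indicator A \<omega> * X r \<omega> (p s \<omega>)) \<partial>M)
    \<le> (\<integral>\<^sup>+\<omega>. ennreal (1 + \<kappa>) * ennreal (indicator A \<omega> * X r \<omega> (p r \<omega>)) + ennreal (?u \<omega>) \<partial>M)"
    by (rule nn_integral_mono_AE)
  also have "\<dots> = ennreal (1 + \<kappa>) * (\<integral>\<^sup>+\<omega>. ennreal (indicator A \<omega> * X r \<omega> (p r \<omega>)) \<partial>M) + (\<integral>\<^sup>+\<omega>. ennreal (?u \<omega>) \<partial>M)"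
  proof -
    note mX = X_M[OF r(1,2) p_M[OF r(1,2)]]
    have mu: "(\<lambda>\<omega>. ennreal (?u \<omega>)) \<in> borel_measurable M"
      by (rule measurable_compose[OF borel_measurable_integrable[OF u_int] measurable_ennreal])
    show ?thesis
      by (simp only: nn_integral_add[OF borel_measurable_times_ennreal[OF borel_measurable_const mX] mu] nn_integral_cmult[OF mX])
  qed
  also have "\<dots> \<le> ennreal (1 + \<kappa>) * ennreal b + ennreal (expectation ?u)"
  proof (intro add_mono mult_left_mono b)
    have "(\<integral>\<^sup>+\<omega>. ennreal (?u \<omega>) \<partial>M) = ennreal (expectation ?u)"
      by (rule nn_integral_eq_integral[OF u_int]) (use u_nonneg in blast)
    then show "(\<integral>\<^sup>+\<omega>. ennreal (?u \<omega>) \<partial>M) \<le> ennreal (expectation ?u)" by simp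
  qed simp
  also have "ennreal (1 + \<kappa>) * ennreal b = ennreal ((1 + \<kappa>) * b)"
    using k by (intro ennreal_mult'[symmetric]) simp
  also have "ennreal ((1 + \<kappa>) * b) + ennreal (expectation ?u) = ennreal ((1 + \<kappa>) * b + expectation ?u)"
    using k b(1) u_nonneg by (intro ennreal_plus[symmetric] mult_nonneg_nonneg integral_nonneg_AE) simp_all
  finally show ?thesis unfolding u_exp .
qed

lemma phi_increment:
  fixes b :: "real \<Rightarrow> real"
  assumes ss: "t0 \<le> s" "s \<le> s'" "s' < T" and k: "0 < \<kappa>" and \<gamma>: "0 \<le> \<gamma>"
    and b_int: "set_integrable lborel {s..s'} b" and b_nonneg: "\<And>r. r \<in> {s..s'} \<Longrightarrow> 0 \<le> b r"
    and b: "\<And>r. r \<in> {s..s'} \<Longrightarrow> (\<integral>\<^sup>+\<omega>. ennreal (indicator A \<omega> * X r \<omega> (p r \<omega>)) \<partial>M) \<le> ennreal (b r)"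
    and small: "\<And>r. r \<in> {s..s'} \<Longrightarrow> expectation (\<lambda>\<omega>. (m s r \<omega>)\<^sup>2) \<le> \<gamma>"
  shows "\<phi> s \<le> \<phi> s' + (1 + \<kappa>) * (LINT r:{s..s'}|lborel. b r)
      + (1 + 1 / \<kappa>) / \<delta> * (2 * KN\<^sup>2 * \<gamma> + 2 * (1 + \<epsilon> / c)\<^sup>2 * (g s' - g s)) * (s' - s)"
proof -
  define C where "C = (1 + 1 / \<kappa>) / \<delta> * (2 * KN\<^sup>2 * \<gamma> + 2 * (1 + \<epsilon> / c)\<^sup>2 * (g s' - g s))"
  have C0: "0 \<le> (1 + 1 / \<kappa>) / \<delta>" using k delta by simp
  have gs: "g s \<le> g r" "g r \<le> g s'" if "r \<in> {s..s'}" for r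
    using that ss by (intro g_mono; simp)+
  have C: "0 \<le> C" unfolding C_def
    by (intro mult_nonneg_nonneg[OF C0] add_nonneg_nonneg mult_nonneg_nonneg) (use \<gamma> gs[of s'] ss in simp_all)
  obtain D where D: "0 \<le> D" "\<phi> s \<le> \<phi> s' + D"
    "ennreal D = (\<integral>\<^sup>+r\<in>{s..s'}. (\<integral>\<^sup>+\<omega>. ennreal (indicator A \<omega> * X r \<omega> (p s \<omega>)) \<partial>M) \<partial>lborel)"
    by (rule phi_step[OF ss, folded X_def]) (rule that)
  let ?w = "\<lambda>r. indicator {s..s'} r * ((1 + \<kappa>) * b r + C)"
  have w_eq: "?w r = (1 + \<kappa>) * (indicator {s..s'} r *\<^sub>R b r) + C * indicator {s..s'} r" for r
    by (simp add: algebra_simps)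
  have i1: "integrable lborel (\<lambda>r. indicator {s..s'} r *\<^sub>R b r)" using b_int unfolding set_integrable_def .
  have i2: "integrable lborel (\<lambda>r. indicator {s..s'} r :: real)"
    by (rule integrable_real_indicator) (use ss in simp_all)
  have w_int: "integrable lborel ?w" unfolding w_eq using i1 i2 by simp
  have w_nonneg: "0 \<le> ?w r" for r using k b_nonneg[of r] C by (auto simp: indicator_def)
  have "ennreal D \<le> (\<integral>\<^sup>+r. ennreal (?w r) \<partial>lborel)"
    unfolding D(3)
  proof (rule nn_integral_mono)
    fix r
    show "(\<integral>\<^sup>+\<omega>. ennreal (indicator A \<omega> * X r \<omega> (p s \<omega>)) \<partial>M) * indicator {s..s'} r \<le> ennreal (?w r)"
    proof (cases "r \<in> {s..s'}")
      case True
      have "(\<integral>\<^sup>+\<omega>. ennreal (indicator A \<omega> * X r \<omega> (p s \<omega>)) \<partial>M) \<le> ennreal ((1 + \<kappa>) * b r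
        + (1 + 1 / \<kappa>) / \<delta> * (2 * KN\<^sup>2 * expectation (\<lambda>\<omega>. (m s r \<omega>)\<^sup>2) + 2 * (1 + \<epsilon> / c)\<^sup>2 * (g r - g s)))"
        by (rule frozen_direction_cost[OF ss(1) _ _ k b_nonneg[OF True] b[OF True]]) (use True ss in auto)
      also have "\<dots> \<le> ennreal ((1 + \<kappa>) * b r + C)"
        unfolding C_def
        by (intro ennreal_leI add_left_mono mult_left_mono[OF _ C0] add_mono mult_left_mono small[OF True] diff_right_mono gs[OF True]) simp_all
      finally show ?thesis using True by simp
    qed simp
  qed
  also have "\<dots> = ennreal (\<integral>r. ?w r \<partial>lborel)"
    by (rule nn_integral_eq_integral[OF w_int]) (use w_nonneg in simp)
  finally have "D \<le> (\<integral>r. ?w r \<partial>lborel)"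
    using w_nonneg by (subst (asm) ennreal_le_iff) (auto intro: integral_nonneg_AE)
  also have "\<dots> = (1 + \<kappa>) * (LINT r:{s..s'}|lborel. b r) + C * (s' - s)"
    unfolding w_eq set_lebesgue_integral_def using i1 i2 ss by simp
  finally show ?thesis using D(2) unfolding C_def by simp
qed

text \<open>Over an interval \<open>[s, s']\<close> no longer than \<open>l\<close> the errors are of the order \<open>\<gamma> (s' - s) + l (g s' - g s)\<close>.
  Added to \<open>\<phi>\<close>, the functions \<open>\<gamma> s\<close> and \<open>l g s\<close> absorb them and leave a locally monotone function. As \<open>g\<close>
  is bounded, both vanish with \<open>\<gamma>\<close> and \<open>l\<close>, whatever the number of intervals.\<close>

lemma phi_bound_before_T:
  fixes b :: "real \<Rightarrow> real"
  assumes S: "t0 \<le> S" "S < T"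
    and b_int: "set_integrable lborel {t0..T} b" and b_nonneg: "\<And>r. r \<in> {t0..T} \<Longrightarrow> 0 \<le> b r"
    and b: "\<And>r. t0 \<le> r \<Longrightarrow> r < T \<Longrightarrow> (\<integral>\<^sup>+\<omega>. ennreal (indicator A \<omega> * X r \<omega> (p r \<omega>)) \<partial>M) \<le> ennreal (b r)"
  shows "\<phi> t0 \<le> \<phi> S + (LINT r:{t0..T}|lborel. b r)"
proof -
  define J where "J = (LINT r:{t0..T}|lborel. b r)"
  have sub_int: "set_integrable lborel {s..s'} b" if "t0 \<le> s" "s' \<le> T" for s s'
    by (rule set_integrable_subset[OF b_int]) (use that in auto)
  have LINT_eq: "(LINT r:{s..s'}|lborel. b r) = integral {s..s'} b" "b integrable_on {s..s'}" if "t0 \<le> s" "s' \<le> T" for s s'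
    using set_borel_integral_eq_integral[OF sub_int[OF that]] by simp_all
  define H where "H s = integral {t0..s} b" for s
  have H_diff: "(LINT r:{s..s'}|lborel. b r) = H s' - H s" if "t0 \<le> s" "s \<le> s'" "s' \<le> T" for s s'
    using Henstock_Kurzweil_Integration.integral_combine[OF that(1,2) LINT_eq(2)[of t0 s']] that
    by (simp add: H_def LINT_eq(1)[OF that(1,3)])
  have H_nonneg: "0 \<le> H s' - H s" if "t0 \<le> s" "s \<le> s'" "s' \<le> T" for s s'
    unfolding H_diff[OF that, symmetric] set_lebesgue_integral_def
    by (rule integral_nonneg_AE) (use that b_nonneg in \<open>auto simp: indicator_def\<close>)
  have H_J: "H S - H t0 \<le> J"
    using H_nonneg[of S T] H_diff[of t0 T] S t0 unfolding J_def by simp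
  have J: "0 \<le> J" using H_J H_nonneg[of t0 S] S by simp
  have approx: "\<phi> t0 \<le> \<phi> S + (1 + \<kappa>) * J + (1 + 1 / \<kappa>) / \<delta> * (2 * KN\<^sup>2 * T + 2 * (1 + \<epsilon> / c)\<^sup>2 * KN\<^sup>2) * \<gamma>"
    if k: "0 < \<kappa>" and \<gamma>: "0 < \<gamma>" for \<kappa> \<gamma>
  proof -
    let ?C = "(1 + 1 / \<kappa>) / \<delta>" and ?E = "2 * (1 + \<epsilon> / c)\<^sup>2"
    have C: "0 \<le> ?C" using k delta by simp
    obtain h where h: "0 < h" "\<And>s r. s \<in> {0..S} \<Longrightarrow> r \<in> {0..S} \<Longrightarrow> \<bar>s - r\<bar> \<le> h \<Longrightarrow> expectation (\<lambda>\<omega>. (m s r \<omega>)\<^sup>2) \<le> \<gamma>"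
      by (rule m_small[OF _ S(2) \<gamma>]) (use S t0 in auto)
    define l where "l = min h \<gamma>"
    have l: "0 < l" "l \<le> h" "l \<le> \<gamma>" using h(1) \<gamma> by (auto simp: l_def)
    define w where "w s = \<phi> s + (1 + \<kappa>) * H s + ?C * (2 * KN\<^sup>2 * \<gamma> * s + ?E * l * g s)" for s
    have "w t0 \<le> w S"
    proof (rule locally_mono_imp_le[OF l(1) _ S(1)])
      fix s s' assume s: "t0 \<le> s" "s \<le> s'" "s' \<le> S" "s' \<le> s + l"
      have "\<phi> s \<le> \<phi> s' + (1 + \<kappa>) * (LINT r:{s..s'}|lborel. b r) + ?C * (2 * KN\<^sup>2 * \<gamma> + ?E * (g s' - g s)) * (s' - s)"
        by (rule phi_increment[OF s(1,2) _ k _ sub_int b_nonneg b h(2)]) (use s S t0 \<gamma> l in auto)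
      also have "(LINT r:{s..s'}|lborel. b r) = H s' - H s" using s S by (intro H_diff) auto
      also have "?C * (2 * KN\<^sup>2 * \<gamma> + ?E * (g s' - g s)) * (s' - s) \<le> ?C * (2 * KN\<^sup>2 * \<gamma> * (s' - s) + ?E * (g s' - g s) * l)"
      proof -
        have "(g s' - g s) * (s' - s) \<le> (g s' - g s) * l"
          using g_mono[of s s'] s S by (intro mult_left_mono) auto
        then have "?E * ((g s' - g s) * (s' - s)) \<le> ?E * ((g s' - g s) * l)" by (rule mult_left_mono) simp
        then have "(2 * KN\<^sup>2 * \<gamma> + ?E * (g s' - g s)) * (s' - s) \<le> 2 * KN\<^sup>2 * \<gamma> * (s' - s) + ?E * (g s' - g s) * l"
          by (simp add: distrib_right mult.assoc)
        from mult_left_mono[OF this C] show ?thesis by (simp add: mult.assoc)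
      qed
      finally show "w s \<le> w s'" unfolding w_def by (simp add: right_diff_distrib left_diff_distrib distrib_left mult_ac)
    qed
    moreover have "(1 + \<kappa>) * H S - (1 + \<kappa>) * H t0 \<le> (1 + \<kappa>) * J"
      using mult_left_mono[OF H_J, of "1 + \<kappa>"] k by (simp add: right_diff_distrib)
    moreover have "?C * (2 * KN\<^sup>2 * \<gamma> * S + ?E * l * g S) - ?C * (2 * KN\<^sup>2 * \<gamma> * t0 + ?E * l * g t0)
      \<le> ?C * (2 * KN\<^sup>2 * T + ?E * KN\<^sup>2) * \<gamma>"
    proof -
      have "2 * KN\<^sup>2 * \<gamma> * S \<le> 2 * KN\<^sup>2 * \<gamma> * T" using S \<gamma> by (intro mult_left_mono) auto
      moreover have "?E * l * g S \<le> ?E * \<gamma> * KN\<^sup>2"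
        using g_le[of S] g_nonneg[of S] S l by (intro mult_mono) auto
      moreover have "0 \<le> 2 * KN\<^sup>2 * \<gamma> * t0 + ?E * l * g t0" using t0 \<gamma> l g_nonneg[of t0] by simp
      ultimately have "(2 * KN\<^sup>2 * \<gamma> * S + ?E * l * g S) - (2 * KN\<^sup>2 * \<gamma> * t0 + ?E * l * g t0) \<le> (2 * KN\<^sup>2 * \<gamma> * T + ?E * \<gamma> * KN\<^sup>2)"
        by linarith
      also have "\<dots> = (2 * KN\<^sup>2 * T + ?E * KN\<^sup>2) * \<gamma>" by (simp add: algebra_simps)
      finally have "(2 * KN\<^sup>2 * \<gamma> * S + ?E * l * g S) - (2 * KN\<^sup>2 * \<gamma> * t0 + ?E * l * g t0) \<le> (2 * KN\<^sup>2 * T + ?E * KN\<^sup>2) * \<gamma>" .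
      from mult_left_mono[OF this C] show ?thesis by (simp only: right_diff_distrib mult.assoc)
    qed
    ultimately show ?thesis unfolding w_def by linarith
  qed
  have lim1: "\<phi> t0 \<le> \<phi> S + (1 + \<kappa>) * J" if k: "0 < \<kappa>" for \<kappa>
  proof -
    let ?B = "(1 + 1 / \<kappa>) / \<delta> * (2 * KN\<^sup>2 * T + 2 * (1 + \<epsilon> / c)\<^sup>2 * KN\<^sup>2)"
    have lim: "((\<lambda>\<gamma>. \<phi> S + (1 + \<kappa>) * J + ?B * \<gamma>) \<longlongrightarrow> \<phi> S + (1 + \<kappa>) * J + ?B * 0) (at_right 0)"
      by (intro tendsto_intros)
    have ev: "\<forall>\<^sub>F \<gamma> in at_right 0. \<phi> t0 \<le> \<phi> S + (1 + \<kappa>) * J + ?B * \<gamma>"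
      using eventually_at_right_less[of "0::real"] by eventually_elim (rule approx[OF k])
    show ?thesis using tendsto_lowerbound[OF lim ev] by simp
  qed
  have ev: "\<forall>\<^sub>F \<kappa> in at_right 0. \<phi> t0 \<le> \<phi> S + (1 + \<kappa>) * J"
    using eventually_at_right_less[of "0::real"] by eventually_elim (rule lim1)
  have "((\<lambda>\<kappa>. \<phi> S + (1 + \<kappa>) * J) \<longlongrightarrow> \<phi> S + (1 + 0) * J) (at_right 0)"
    by (intro tendsto_intros)
  from tendsto_lowerbound[OF this ev] show ?thesis unfolding J_def by simp
qed

text \<open>At the terminal time the forms \<open>\<langle>N, R\<^sup>-\<^sup>1 N\<rangle>\<close> vanish, because \<open>Y\<close> blows up in every direction.\<close>

lemma phi_tendsto_0:
  assumes S: "strict_mono S" "S \<longlonglongrightarrow> T" "\<And>k. t0 \<le> S k" "\<And>k. S k < T"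
  shows "(\<lambda>k. \<phi> (S k)) \<longlonglongrightarrow> 0"
proof -
  have S0: "0 \<le> S k" for k using S(3)[of k] t0 by simp
  have AE_p: "AE \<omega> in M. \<forall>k. p (S k) \<omega> = matrix_inv (R (S k) \<omega>) *v N (S k) \<omega>"
    unfolding AE_all_countable using p_eq[OF S0 S(4)] by blast
  have AE_q: "AE \<omega> in M. \<forall>k. 0 \<le> q (S k) \<omega> \<and> q (S k) \<omega> \<le> KN\<^sup>2 / c"
    unfolding AE_all_countable using q_bounds[OF S0 S(4)] by blast
  have AE_N: "AE \<omega> in M. \<forall>k. norm (N (S k) \<omega>) \<le> KN"
    unfolding AE_all_countable using N_bound[OF less_imp_le[OF S(4)]] by blast
  have "AE \<omega> in M. \<forall>k. p (S k) \<omega> \<bullet> (Y (S k) \<omega> *v p (S k) \<omega>) \<le> KN\<^sup>2 / c"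
    using AE_p AE_q R_coercive'
  proof eventually_elim
    case (elim \<omega>)
    show ?case
    proof
      fix k
      have spd: "spd (R (S k) \<omega>)" using elim(3) S0 S(4) coercive_spd[OF c] by blast
      have "p (S k) \<omega> \<bullet> (Y (S k) \<omega> *v p (S k) \<omega>) \<le> p (S k) \<omega> \<bullet> (R (S k) \<omega> *v p (S k) \<omega>)"
        using eps unfolding R_def
        by (simp add: matrix_vector_mult_add_rdistrib inner_add_right scaleR_matrix_vector_assoc[symmetric])
      also have "\<dots> = q (S k) \<omega>"
        unfolding q_def using elim(1) spd by (simp add: inner_commute)
      finally show "p (S k) \<omega> \<bullet> (Y (S k) \<omega> *v p (S k) \<omega>) \<le> KN\<^sup>2 / c"
        using elim(2) order_trans by blast
    qed
  qed
  then have p_lim: "AE \<omega> in M. (\<lambda>k. p (S k) \<omega>) \<longlonglongrightarrow> 0"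
    by (rule singular_bounded_form_tendsto_0[OF singular S(1,2,4) p_M[OF S0 S(4)] p_bound])
  have "(\<lambda>k. \<phi> (S k)) \<longlonglongrightarrow> expectation (\<lambda>\<omega>. 0)"
    unfolding \<phi>_def
  proof (rule integral_dominated_convergence[where w="\<lambda>\<omega>. KN\<^sup>2 / c"])
    show "(\<lambda>\<omega>. indicator A \<omega> * q (S k) \<omega>) \<in> borel_measurable M" for k
      by (rule borel_measurable_integrable[OF Aq_integrable[OF S0 S(4)]])
    show "integrable M (\<lambda>\<omega>. KN\<^sup>2 / c)" by (rule integrable_const)
    show "AE \<omega> in M. norm (indicator A \<omega> * q (S k) \<omega>) \<le> KN\<^sup>2 / c" for k
      using AE_q by eventually_elim (use c in \<open>auto simp: indicator_def\<close>)
    show "AE \<omega> in M. (\<lambda>k. indicator A \<omega> * q (S k) \<omega>) \<longlonglongrightarrow> 0"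
      using p_lim AE_p AE_N
    proof eventually_elim
      case (elim \<omega>)
      show ?case
      proof (rule Lim_null_comparison[OF always_eventually], rule allI)
        fix k
        have "norm (indicator A \<omega> * q (S k) \<omega>) \<le> \<bar>q (S k) \<omega>\<bar>" by (simp add: indicator_def)
        also have "\<dots> \<le> norm (N (S k) \<omega>) * norm (p (S k) \<omega>)"
          unfolding q_def elim(2)[rule_format] by (rule Cauchy_Schwarz_ineq2)
        also have "\<dots> \<le> KN * norm (p (S k) \<omega>)" using elim(3) by (intro mult_right_mono) auto
        finally show "norm (indicator A \<omega> * q (S k) \<omega>) \<le> KN * norm (p (S k) \<omega>)" .
        show "(\<lambda>k. KN * norm (p (S k) \<omega>)) \<longlonglongrightarrow> 0"
          using tendsto_mult_right_zero[OF tendsto_norm_zero[OF elim(1)]] .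
      qed
    qed
  qed simp
  then show ?thesis by simp
qed

text \<open>At time \<open>t0\<close> the Legendre representation is used with the constant direction \<open>x\<close>.\<close>

theorem dual_inequality:
  fixes b :: "real \<Rightarrow> real" and x :: "real^'n"
  assumes b_int: "set_integrable lborel {t0..T} b" and b_nonneg: "\<And>r. r \<in> {t0..T} \<Longrightarrow> 0 \<le> b r"
    and b: "\<And>r. t0 \<le> r \<Longrightarrow> r < T \<Longrightarrow> (\<integral>\<^sup>+\<omega>. ennreal (indicator A \<omega> * X r \<omega> (p r \<omega>)) \<partial>M) \<le> ennreal (b r)"
  shows "expectation (\<lambda>\<omega>. indicator A \<omega> * (2 * (x \<bullet> V \<omega>) - x \<bullet> (R t0 \<omega> *v x))) \<le> (LINT r:{t0..T}|lborel. b r)"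
proof -
  define S where "S k = T - (T - t0) / real (Suc k)" for k
  have S: "strict_mono S" "S \<longlonglongrightarrow> T" "t0 \<le> S k" "S k < T" for k
  proof -
    show "strict_mono S" unfolding strict_mono_Suc_iff S_def using t0 by (auto intro: divide_strict_left_mono)
    have "(\<lambda>k. T - (T - t0) * (1 / real (Suc k))) \<longlonglongrightarrow> T - (T - t0) * 0"
      by (intro tendsto_intros LIMSEQ_Suc[OF lim_1_over_n])
    then show "S \<longlonglongrightarrow> T" unfolding S_def[abs_def] by simp
    have "(T - t0) / real (Suc k) \<le> (T - t0) / 1" using t0 by (intro divide_left_mono) auto
    then show "t0 \<le> S k" unfolding S_def by simp
    show "S k < T" unfolding S_def using t0 by simp
  qed
  have "\<phi> t0 \<le> 0 + (LINT r:{t0..T}|lborel. b r)"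
  proof (rule tendsto_lowerbound)
    show "(\<lambda>k. \<phi> (S k) + (LINT r:{t0..T}|lborel. b r)) \<longlonglongrightarrow> 0 + (LINT r:{t0..T}|lborel. b r)"
      by (intro tendsto_add phi_tendsto_0 S tendsto_const)
    show "\<forall>\<^sub>F k in sequentially. \<phi> t0 \<le> \<phi> (S k) + (LINT r:{t0..T}|lborel. b r)"
      using phi_bound_before_T[OF S(3,4) b_int b_nonneg b] by (intro always_eventually allI)
  qed simp
  moreover have "expectation (\<lambda>\<omega>. indicator A \<omega> * (2 * (x \<bullet> V \<omega>) - x \<bullet> (R t0 \<omega> *v x))) \<le> \<phi> t0"
  proof -
    let ?f = "\<lambda>\<omega>. indicator A \<omega> *\<^sub>R x"
    have T0: "t0 \<le> T" using t0 by simp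
    have f_F: "?f \<in> borel_measurable (F t0)" by (intro borel_measurable_scaleR borel_measurable_indicator A) simp
    have f_B: "AE \<omega> in M. norm (?f \<omega>) \<le> norm x" by (simp add: indicator_def)
    note lin = cexp_inner[OF V_int T0 f_F f_B]
    have Y_int: "integrable M (\<lambda>\<omega>. indicator A \<omega> * (x \<bullet> (Y t0 \<omega> *v x)))"
      by (rule quad_Y_integrable[OF t0 _ _ AM, where B="norm x"]) simp_all
    have A_int: "integrable M (\<lambda>\<omega>. indicator A \<omega> * (\<epsilon> * (x \<bullet> x)) :: real)"
      by (rule integrable_mult_left) (rule integrable_real_indicator[OF AM], simp add: emeasure_eq_measure)
    have R_eq: "indicator A \<omega> * (x \<bullet> (R t0 \<omega> *v x)) = indicator A \<omega> * (x \<bullet> (Y t0 \<omega> *v x)) + indicator A \<omega> * (\<epsilon> * (x \<bullet> x))" for \<omega>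
      unfolding R_def by (simp add: matrix_vector_mult_add_rdistrib inner_add_right scaleR_matrix_vector_assoc[symmetric] algebra_simps)
    have R_int: "integrable M (\<lambda>\<omega>. indicator A \<omega> * (x \<bullet> (R t0 \<omega> *v x)))"
      unfolding R_eq by (intro Bochner_Integration.integrable_add Y_int A_int)
    have split: "indicator A \<omega> * (2 * (x \<bullet> v) - x \<bullet> (R t0 \<omega> *v x)) = 2 * (?f \<omega> \<bullet> v) - indicator A \<omega> * (x \<bullet> (R t0 \<omega> *v x))" for \<omega> v
      by (simp add: algebra_simps)
    have "expectation (\<lambda>\<omega>. indicator A \<omega> * (2 * (x \<bullet> V \<omega>) - x \<bullet> (R t0 \<omega> *v x)))
      = expectation (\<lambda>\<omega>. indicator A \<omega> * (2 * (x \<bullet> N t0 \<omega>) - x \<bullet> (R t0 \<omega> *v x)))"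
      unfolding split using lin R_int by simp
    also have "\<dots> \<le> \<phi> t0"
      unfolding \<phi>_def
    proof (rule integral_mono_AE[OF _ Aq_integrable[OF t0]])
      show "integrable M (\<lambda>\<omega>. indicator A \<omega> * (2 * (x \<bullet> N t0 \<omega>) - x \<bullet> (R t0 \<omega> *v x)))"
        unfolding split using lin R_int by simp
      show "AE \<omega> in M. indicator A \<omega> * (2 * (x \<bullet> N t0 \<omega>) - x \<bullet> (R t0 \<omega> *v x)) \<le> indicator A \<omega> * q t0 \<omega>"
        using R_coercive'
      proof eventually_elim
        case (elim \<omega>)
        have "spd (R t0 \<omega>)" using elim t0 coercive_spd[OF c] by blast
        from spd_legendre[OF this] show ?case unfolding q_def by (intro mult_left_mono) auto
      qed
    qed
    finally show ?thesis .
  qed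
  ultimately show ?thesis by simp
qed

end

section \<open>Uncorrelated multiplicative increments\<close>

locale multiplicative_increments = brownian M W T for M :: "'a measure" and W T +
  fixes \<eta> :: "real \<Rightarrow> 'a \<Rightarrow> real^'n^'n" and \<delta> :: real
  assumes delta: "0 < \<delta>"
    and eta_prog: "prog_measurable F {0..T} \<eta>"
    and eta_spd: "\<And>t \<omega>. 0 \<le> t \<Longrightarrow> t \<le> T \<Longrightarrow> \<omega> \<in> space M \<Longrightarrow> spd (\<eta> t \<omega>)"
    and eta_coercive: "AE \<omega> in M. \<forall>t\<in>{0..T}. coercive \<delta> (\<eta> t \<omega>)"
    and eta_int: "\<And>t. 0 \<le> t \<Longrightarrow> t \<le> T \<Longrightarrow> integrable M (\<eta> t)"
    and inc_int: "\<And>s t. 0 \<le> s \<Longrightarrow> s \<le> t \<Longrightarrow> t \<le> T \<Longrightarrow> integrable M (\<lambda>\<omega>. matrix_inv (\<eta> s \<omega>) ** \<eta> t \<omega>)"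
    and eta_T_sq: "integrable M (\<lambda>\<omega>. (norm (\<eta> T \<omega>))\<^sup>2)"
    and umi: "uncorrelated_mult_increments M W T \<eta>"
begin

lemma T_nonneg: "0 \<le> T" using T_pos by simp

lemma eta_F: "0 \<le> t \<Longrightarrow> t \<le> T \<Longrightarrow> \<eta> t \<in> borel_measurable (F t)"
  by (rule prog_measurable_adapted[OF eta_prog]) simp

lemma eta_M: "0 \<le> t \<Longrightarrow> t \<le> T \<Longrightarrow> \<eta> t \<in> borel_measurable M"
  using measurable_F_M[OF eta_F] by simp

lemma eta_joint: "(\<lambda>(r, \<omega>). indicator {0..T} r *\<^sub>R \<eta> r \<omega>) \<in> borel_measurable (lborel \<Otimes>\<^sub>M M)"
  by (rule prog_measurable_joint[OF eta_prog, of T]) (use T_nonneg in auto)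

definition mbar :: "real \<Rightarrow> real^'n^'n" where "mbar t = (LINT \<omega>|M. \<eta> t \<omega>)"

lemma bounded_linear_mult_vec: "bounded_linear (\<lambda>B :: real^'n^'n. B *v z)"
  by (rule bounded_linear_intro[of _ "norm z"])
     (simp_all add: matrix_vector_mult_add_rdistrib scaleR_matrix_vector_assoc norm_matrix_vector_le)

lemma eta_vec_int: "0 \<le> t \<Longrightarrow> t \<le> T \<Longrightarrow> integrable M (\<lambda>\<omega>. \<eta> t \<omega> *v z)"
  by (rule integrable_bounded_linear[OF bounded_linear_mult_vec eta_int])

lemma mbar_vec: "0 \<le> t \<Longrightarrow> t \<le> T \<Longrightarrow> mbar t *v z = (LINT \<omega>|M. \<eta> t \<omega> *v z)"
  unfolding mbar_def by (rule integral_bounded_linear[OF bounded_linear_mult_vec eta_int, symmetric])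

lemma mbar_coercive:
  assumes t: "0 \<le> t" "t \<le> T"
  shows "coercive \<delta> (mbar t)"
  unfolding coercive_def sym_mat_iff_inner
proof (intro conjI allI)
  fix x y :: "real^'n"
  note int = eta_vec_int[OF t]
  have 1: "x \<bullet> (mbar t *v y) = expectation (\<lambda>\<omega>. x \<bullet> (\<eta> t \<omega> *v y))" for x y
    unfolding mbar_vec[OF t] by (rule integral_inner_right[OF int, symmetric])
  have "x \<bullet> (mbar t *v y) = expectation (\<lambda>\<omega>. y \<bullet> (\<eta> t \<omega> *v x))"
    unfolding 1
  proof (rule Bochner_Integration.integral_cong[OF refl])
    fix \<omega> assume "\<omega> \<in> space M"
    from eta_spd[OF t this] show "x \<bullet> (\<eta> t \<omega> *v y) = y \<bullet> (\<eta> t \<omega> *v x)"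
      by (metis spd_sym sym_mat_inner inner_commute)
  qed
  then show "x \<bullet> (mbar t *v y) = (mbar t *v x) \<bullet> y" unfolding 1[of y x, symmetric] by (simp add: inner_commute)
  have "\<delta> * (norm x)\<^sup>2 = expectation (\<lambda>\<omega>. \<delta> * (norm x)\<^sup>2)" by (simp add: prob_space)
  also have "\<dots> \<le> expectation (\<lambda>\<omega>. x \<bullet> (\<eta> t \<omega> *v x))"
  proof (rule integral_mono_AE)
    show "integrable M (\<lambda>\<omega>. \<delta> * (norm x)\<^sup>2)" by (rule integrable_const)
    show "integrable M (\<lambda>\<omega>. x \<bullet> (\<eta> t \<omega> *v x))" by (rule integrable_inner_right[OF int])
    show "AE \<omega> in M. \<delta> * (norm x)\<^sup>2 \<le> x \<bullet> (\<eta> t \<omega> *v x)"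
      using eta_coercive by eventually_elim (use t in \<open>auto simp: coercive_def\<close>)
  qed
  finally show "\<delta> * (norm x)\<^sup>2 \<le> x \<bullet> (mbar t *v x)" unfolding 1 .
qed

lemma mbar_spd: "0 \<le> t \<Longrightarrow> t \<le> T \<Longrightarrow> spd (mbar t)"
  by (rule coercive_spd[OF delta mbar_coercive])

text \<open>The defining property localised to a set on which \<open>\<eta>\<^sub>s\<close> is bounded, so that \<open>\<eta>\<^sub>s\<close> can be pulled
  out of the conditional expectation of \<open>\<eta>\<^sub>s (\<eta>\<^sub>s\<^sup>-\<^sup>1 \<eta>\<^sub>t)\<close> entry by entry.\<close>

lemma eta_factor_localized:
  assumes st: "0 \<le> s" "s \<le> t" "t \<le> T" and H: "H \<in> sets (F s)" "\<And>\<omega>. \<omega> \<in> H \<Longrightarrow> norm (\<eta> s \<omega>) \<le> C"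
  defines "K \<equiv> (LINT \<omega>|M. matrix_inv (\<eta> s \<omega>) ** \<eta> t \<omega>)"
  shows "expectation (\<lambda>\<omega>. indicator H \<omega> * (\<eta> t \<omega> *v z) $ i) = expectation (\<lambda>\<omega>. indicator H \<omega> * (\<eta> s \<omega> *v (K *v z)) $ i)"
proof -
  have s: "s \<le> T" using st by simp
  interpret s: sigma_finite_subalgebra M "F s" by (rule sigma_finite_F[OF s])
  let ?W = "\<lambda>k j \<omega>. (matrix_inv (\<eta> s \<omega>) ** \<eta> t \<omega>) $ k $ j"
  let ?f = "\<lambda>k \<omega>. indicator H \<omega> * \<eta> s \<omega> $ i $ k"
  have W_int: "integrable M (?W k j)" for k j
    using integrable_inner_left[OF inc_int[OF st], of "axis k (axis j 1)"] by (simp add: inner_axis)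
  have f_F: "?f k \<in> borel_measurable (F s)" for k
    by (intro borel_measurable_times borel_measurable_indicator H borel_measurable_vec_nth eta_F st s)
  have f_B: "\<bar>?f k \<omega>\<bar> \<le> \<bar>C\<bar>" for k \<omega>
  proof (cases "\<omega> \<in> H")
    case True
    have "\<bar>\<eta> s \<omega> $ i $ k\<bar> \<le> norm (\<eta> s \<omega> $ i)" by (rule component_le_norm_cart)
    also have "\<dots> \<le> norm (\<eta> s \<omega>)" by (rule Finite_Cartesian_Product.norm_nth_le)
    finally show ?thesis using H(2)[OF True] True by simp
  qed simp
  have f_M: "?f k \<in> borel_measurable M" for k by (rule measurable_F_M[OF f_F s])
  have fW_int: "integrable M (\<lambda>\<omega>. ?f k \<omega> * ?W k j \<omega>)" for k j
    by (rule integrable_bounded_mult[OF W_int f_M, where K="\<bar>C\<bar>"]) (use f_B in blast)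
  have f_int: "integrable M (?f k)" for k
    by (rule integrable_const_bound[where B="\<bar>C\<bar>"]) (use f_B f_M in auto)
  have fW: "expectation (\<lambda>\<omega>. ?f k \<omega> * ?W k j \<omega>) = expectation (\<lambda>\<omega>. ?f k \<omega> * K $ k $ j)" for k j
  proof -
    have "AE \<omega> in M. mat_cond_exp M (F s) (\<lambda>\<omega>. matrix_inv (\<eta> s \<omega>) ** \<eta> t \<omega>) \<omega> = K"
      using umi st unfolding uncorrelated_mult_increments_def K_def by blast
    then have AE_K: "AE \<omega> in M. real_cond_exp M (F s) (?W k j) \<omega> = K $ k $ j"
      by eventually_elim (auto simp: mat_cond_exp_def vec_eq_iff)
    have "expectation (\<lambda>\<omega>. ?f k \<omega> * ?W k j \<omega>) = expectation (\<lambda>\<omega>. ?f k \<omega> * real_cond_exp M (F s) (?W k j) \<omega>)"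
      by (rule s.real_cond_exp_intg(2)[symmetric, OF fW_int f_F borel_measurable_integrable[OF W_int]])
    also have "\<dots> = expectation (\<lambda>\<omega>. ?f k \<omega> * K $ k $ j)"
      by (rule integral_cong_AE)
         (use AE_K f_M in \<open>auto intro!: borel_measurable_times\<close>)
    finally show ?thesis .
  qed
  have expand: "indicator H \<omega> * (\<eta> t \<omega> *v z) $ i = (\<Sum>k\<in>UNIV. \<Sum>j\<in>UNIV. (?f k \<omega> * ?W k j \<omega>) * z $ j)"
    if "\<omega> \<in> space M" for \<omega>
  proof -
    have "spd (\<eta> s \<omega>)" by (rule eta_spd[OF st(1) s that])
    then have "\<eta> t \<omega> *v z = \<eta> s \<omega> *v ((matrix_inv (\<eta> s \<omega>) ** \<eta> t \<omega>) *v z)"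
      by (simp add: matrix_vector_mul_assoc[symmetric])
    then show ?thesis
      by (simp add: matrix_vector_mult_def[of "\<eta> s \<omega>"] matrix_vector_mult_def[of "matrix_inv (\<eta> s \<omega>) ** \<eta> t \<omega>"]
          sum_distrib_left mult_ac)
  qed
  have expandK: "indicator H \<omega> * (\<eta> s \<omega> *v (K *v z)) $ i = (\<Sum>k\<in>UNIV. \<Sum>j\<in>UNIV. (?f k \<omega> * K $ k $ j) * z $ j)" for \<omega>
    by (simp add: matrix_vector_mult_def[of "\<eta> s \<omega>"] matrix_vector_mult_def[of K] sum_distrib_left mult_ac)
  have "expectation (\<lambda>\<omega>. indicator H \<omega> * (\<eta> t \<omega> *v z) $ i)
    = expectation (\<lambda>\<omega>. \<Sum>k\<in>UNIV. \<Sum>j\<in>UNIV. (?f k \<omega> * ?W k j \<omega>) * z $ j)"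
    by (rule Bochner_Integration.integral_cong[OF refl expand])
  also have "\<dots> = (\<Sum>k\<in>UNIV. \<Sum>j\<in>UNIV. expectation (\<lambda>\<omega>. ?f k \<omega> * ?W k j \<omega>) * z $ j)"
    by (simp add: Bochner_Integration.integral_sum fW_int)
  also have "\<dots> = (\<Sum>k\<in>UNIV. \<Sum>j\<in>UNIV. expectation (\<lambda>\<omega>. ?f k \<omega> * K $ k $ j) * z $ j)"
    unfolding fW ..
  also have "\<dots> = expectation (\<lambda>\<omega>. \<Sum>k\<in>UNIV. \<Sum>j\<in>UNIV. (?f k \<omega> * K $ k $ j) * z $ j)"
    using f_int by (simp add: Bochner_Integration.integral_sum)
  also have "\<dots> = expectation (\<lambda>\<omega>. indicator H \<omega> * (\<eta> s \<omega> *v (K *v z)) $ i)"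
    unfolding expandK ..
  finally show ?thesis .
qed

text \<open>The sets where \<open>norm (\<eta> s) \<le> n\<close> exhaust \<open>B\<close>, and both sides pass to the limit.\<close>

lemma eta_factor:
  assumes st: "0 \<le> s" "s \<le> t" "t \<le> T" and B: "B \<in> sets (F s)"
  defines "K \<equiv> (LINT \<omega>|M. matrix_inv (\<eta> s \<omega>) ** \<eta> t \<omega>)"
  shows "expectation (\<lambda>\<omega>. indicator B \<omega> * (\<eta> t \<omega> *v z) $ i) = expectation (\<lambda>\<omega>. indicator B \<omega> * (\<eta> s \<omega> *v (K *v z)) $ i)"
proof -
  have s: "s \<le> T" and t: "0 \<le> t" using st by simp_all
  define H where "H n = {\<omega> \<in> B. norm (\<eta> s \<omega>) \<le> real n}" for n :: nat
  have BM: "B \<subseteq> space M" using sets.sets_into_space[OF B] by simp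
  have H_F: "H n \<in> sets (F s)" for n
  proof -
    have "(\<lambda>\<omega>. norm (\<eta> s \<omega>)) \<in> borel_measurable (F s)"
      by (rule measurable_compose[OF eta_F[OF st(1) s] borel_measurable_norm])
    then have "{\<omega> \<in> space (F s). norm (\<eta> s \<omega>) \<le> real n} \<in> sets (F s)" by (rule borel_measurable_le) simp
    then have "B \<inter> {\<omega> \<in> space (F s). norm (\<eta> s \<omega>) \<le> real n} \<in> sets (F s)" using B by blast
    moreover have "H n = B \<inter> {\<omega> \<in> space (F s). norm (\<eta> s \<omega>) \<le> real n}" using BM by (auto simp: H_def)
    ultimately show ?thesis by simp
  qed
  have H_M: "H n \<in> sets M" for n using H_F sets_F_M[OF s] by blast
  have B_M: "B \<in> sets M" using B sets_F_M[OF s] by blast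
  have lim: "(\<lambda>n. expectation (\<lambda>\<omega>. indicator (H n) \<omega> * f \<omega>)) \<longlonglongrightarrow> expectation (\<lambda>\<omega>. indicator B \<omega> * f \<omega>)"
    if f: "integrable M f" for f :: "'a \<Rightarrow> real"
  proof (rule integral_dominated_convergence[where w="\<lambda>\<omega>. \<bar>f \<omega>\<bar>"])
    show "(\<lambda>\<omega>. indicator B \<omega> * f \<omega>) \<in> borel_measurable M" "(\<lambda>\<omega>. indicator (H n) \<omega> * f \<omega>) \<in> borel_measurable M" for n
      by (intro borel_measurable_times borel_measurable_indicator B_M H_M borel_measurable_integrable[OF f])+
    show "integrable M (\<lambda>\<omega>. \<bar>f \<omega>\<bar>)" using f by simp
    show "AE \<omega> in M. norm (indicator (H n) \<omega> * f \<omega>) \<le> \<bar>f \<omega>\<bar>" for n by (simp add: indicator_def)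
    show "AE \<omega> in M. (\<lambda>n. indicator (H n) \<omega> * f \<omega>) \<longlonglongrightarrow> indicator B \<omega> * f \<omega>"
    proof (rule AE_I2)
      fix \<omega>
      obtain n0 where n0: "norm (\<eta> s \<omega>) \<le> real n0" using real_arch_simple by blast
      have "\<forall>\<^sub>F n in sequentially. indicator (H n) \<omega> * f \<omega> = indicator B \<omega> * f \<omega>"
        unfolding eventually_sequentially
      proof (intro exI[of _ n0] allI impI)
        fix n assume "n0 \<le> n"
        then have "norm (\<eta> s \<omega>) \<le> real n" using n0 by simp
        then show "indicator (H n) \<omega> * f \<omega> = indicator B \<omega> * f \<omega>" by (simp add: H_def indicator_def)
      qed
      then show "(\<lambda>n. indicator (H n) \<omega> * f \<omega>) \<longlonglongrightarrow> indicator B \<omega> * f \<omega>" by (rule tendsto_eventually)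
    qed
  qed
  have i1: "integrable M (\<lambda>\<omega>. (\<eta> t \<omega> *v z) $ i)" by (rule integrable_vec_nth[OF eta_vec_int[OF t st(3)]])
  have i2: "integrable M (\<lambda>\<omega>. (\<eta> s \<omega> *v (K *v z)) $ i)" by (rule integrable_vec_nth[OF eta_vec_int[OF st(1) s]])
  have eq: "expectation (\<lambda>\<omega>. indicator (H n) \<omega> * (\<eta> t \<omega> *v z) $ i) = expectation (\<lambda>\<omega>. indicator (H n) \<omega> * (\<eta> s \<omega> *v (K *v z)) $ i)" for n
    unfolding K_def by (rule eta_factor_localized[OF st H_F, where C="real n"]) (simp add: H_def)
  show ?thesis
    using LIMSEQ_unique[OF lim[OF i1]] lim[OF i2] unfolding eq by blast
qed

definition D :: "real \<Rightarrow> 'a \<Rightarrow> real^'n^'n" where "D t \<omega> = \<eta> t \<omega> ** matrix_inv (mbar t)"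

lemma D_vec: "D t \<omega> *v y = \<eta> t \<omega> *v (matrix_inv (mbar t) *v y)"
  by (simp add: D_def matrix_vector_mul_assoc)

lemma D_F: "0 \<le> t \<Longrightarrow> t \<le> T \<Longrightarrow> D t \<in> borel_measurable (F t)"
  unfolding D_def by (intro borel_measurable_mult_matrix eta_F) simp_all

lemma D_vec_int: "0 \<le> t \<Longrightarrow> t \<le> T \<Longrightarrow> integrable M (\<lambda>\<omega>. D t \<omega> *v y)"
  unfolding D_vec by (rule eta_vec_int)

text \<open>Taking \<open>B = \<Omega>\<close> in \<open>eta_factor\<close> identifies \<open>E[\<eta>\<^sub>s\<^sup>-\<^sup>1 \<eta>\<^sub>t]\<close> as \<open>E[\<eta>\<^sub>s]\<^sup>-\<^sup>1 E[\<eta>\<^sub>t]\<close>, whence the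
  normalised process \<open>\<eta>\<^sub>t E[\<eta>\<^sub>t]\<^sup>-\<^sup>1\<close> is a martingale.\<close>

lemma D_martingale:
  assumes st: "0 \<le> s" "s \<le> t" "t \<le> T" and B: "B \<in> sets (F s)"
  shows "expectation (\<lambda>\<omega>. indicator B \<omega> * (D t \<omega> *v y) $ i) = expectation (\<lambda>\<omega>. indicator B \<omega> * (D s \<omega> *v y) $ i)"
proof -
  have s: "s \<le> T" and t: "0 \<le> t" using st by simp_all
  define K where "K = (LINT \<omega>|M. matrix_inv (\<eta> s \<omega>) ** \<eta> t \<omega>)"
  have "(mbar t *v z) $ i = (mbar s *v (K *v z)) $ i" for z i
  proof -
    have nth: "(mbar u *v w) $ i = expectation (\<lambda>\<omega>. (\<eta> u \<omega> *v w) $ i)" if "0 \<le> u" "u \<le> T" for u w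
      unfolding mbar_vec[OF that]
      by (rule integral_bounded_linear[OF bounded_linear_vec_nth eta_vec_int[OF that], symmetric])
    have sp: "space M \<in> sets (F s)" using sets.top[of "F s"] by simp
    have ind: "expectation (\<lambda>\<omega>. indicator (space M) \<omega> * f \<omega>) = expectation f" for f :: "'a \<Rightarrow> real"
      by (rule Bochner_Integration.integral_cong) auto
    show ?thesis
      using eta_factor[OF st sp, of z i] unfolding ind K_def[symmetric] nth[OF t st(3)] nth[OF st(1) s] .
  qed
  then have "mbar t *v z = mbar s *v (K *v z)" for z by (simp add: vec_eq_iff)
  from this[of "matrix_inv (mbar t) *v y"]
  have "y = mbar s *v (K *v (matrix_inv (mbar t) *v y))" using mbar_spd[OF t st(3)] by simp
  then have K: "K *v (matrix_inv (mbar t) *v y) = matrix_inv (mbar s) *v y"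
    using spd_mult_inv(2)[OF mbar_spd[OF st(1) s]] by metis
  show ?thesis unfolding D_vec using eta_factor[OF st B, of "matrix_inv (mbar t) *v y" i] K
    unfolding K_def by simp
qed

lemma D_cexp:
  assumes s: "0 \<le> s" "s \<le> T"
  shows "AE \<omega> in M. cexp (\<lambda>\<omega>. D T \<omega> *v y) s \<omega> = D s \<omega> *v y"
proof -
  interpret s: sigma_finite_subalgebra M "F s" by (rule sigma_finite_F[OF s(2)])
  have "AE \<omega> in M. real_cond_exp M (F s) (\<lambda>\<omega>. (D T \<omega> *v y) $ i) \<omega> = (D s \<omega> *v y) $ i" for i
  proof (rule s.real_cond_exp_charact)
    show "integrable M (\<lambda>\<omega>. (D T \<omega> *v y) $ i)" "integrable M (\<lambda>\<omega>. (D s \<omega> *v y) $ i)"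
      by (rule integrable_vec_nth[OF D_vec_int]; use T_nonneg s in simp)+
    show "(\<lambda>\<omega>. (D s \<omega> *v y) $ i) \<in> borel_measurable (F s)"
      by (intro borel_measurable_vec_nth borel_measurable_mult_vec D_F s) simp
    show "(LINT \<omega>:B|M. (D T \<omega> *v y) $ i) = (LINT \<omega>:B|M. (D s \<omega> *v y) $ i)" if "B \<in> sets (F s)" for B
      using D_martingale[OF s order_refl that, of y i] unfolding set_lebesgue_integral_def by simp
  qed
  then have "AE \<omega> in M. \<forall>i\<in>UNIV. real_cond_exp M (F s) (\<lambda>\<omega>. (D T \<omega> *v y) $ i) \<omega> = (D s \<omega> *v y) $ i"
    by (intro AE_finite_allI) auto
  then show ?thesis by eventually_elim (simp add: cexp_def vec_eq_iff)
qed

lemma D_martingale_inner: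
  assumes st: "0 \<le> s" "s \<le> t" "t \<le> T" and B: "B \<in> sets (F s)"
  shows "expectation (\<lambda>\<omega>. indicator B \<omega> * (x \<bullet> (D t \<omega> *v y))) = expectation (\<lambda>\<omega>. indicator B \<omega> * (x \<bullet> (D s \<omega> *v y)))"
proof -
  have BM: "B \<in> sets M" using B sets_F_M[of s] st by auto
  have int: "integrable M (\<lambda>\<omega>. indicator B \<omega> * (D u \<omega> *v y) $ i)" if "0 \<le> u" "u \<le> T" for u i
    using integrable_mult_indicator[OF BM integrable_vec_nth[OF D_vec_int[OF that, of y], of i]] by simp
  have "expectation (\<lambda>\<omega>. indicator B \<omega> * (x \<bullet> (D u \<omega> *v y))) = (\<Sum>i\<in>UNIV. x $ i * expectation (\<lambda>\<omega>. indicator B \<omega> * (D u \<omega> *v y) $ i))"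
    if "0 \<le> u" "u \<le> T" for u
  proof -
    have "expectation (\<lambda>\<omega>. indicator B \<omega> * (x \<bullet> (D u \<omega> *v y)))
      = expectation (\<lambda>\<omega>. \<Sum>i\<in>UNIV. x $ i * (indicator B \<omega> * (D u \<omega> *v y) $ i))"
      unfolding inner_vec_def by (simp add: sum_distrib_left mult_ac)
    also have "\<dots> = (\<Sum>i\<in>UNIV. expectation (\<lambda>\<omega>. x $ i * (indicator B \<omega> * (D u \<omega> *v y) $ i)))"
      by (rule Bochner_Integration.integral_sum) (intro integrable_mult_right int that)
    finally show ?thesis by simp
  qed
  then show ?thesis using D_martingale[OF st B] st by simp
qed

lemma D_T_sq: "integrable M (\<lambda>\<omega>. (norm (D T \<omega> *v y))\<^sup>2)"
proof (rule Bochner_Integration.integrable_bound)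
  let ?z = "matrix_inv (mbar T) *v y"
  show "integrable M (\<lambda>\<omega>. (norm (\<eta> T \<omega>))\<^sup>2 * (norm ?z)\<^sup>2)" using eta_T_sq by simp
  show "(\<lambda>\<omega>. (norm (D T \<omega> *v y))\<^sup>2) \<in> borel_measurable M"
    by (intro borel_measurable_power measurable_compose[OF _ borel_measurable_norm] borel_measurable_integrable[OF D_vec_int])
       (use T_nonneg in simp_all)
  show "AE \<omega> in M. norm ((norm (D T \<omega> *v y))\<^sup>2) \<le> norm ((norm (\<eta> T \<omega>))\<^sup>2 * (norm ?z)\<^sup>2)"
    unfolding D_vec
    by (auto simp: power_mult_distrib[symmetric] intro!: AE_I2 power_mono norm_matrix_vector_le)
qed

subsection \<open>The deterministic weight\<close>

lemma mbar_measurable: "(\<lambda>t. indicator {0..T} t *\<^sub>R mbar t) \<in> borel_measurable borel"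
proof -
  have "(\<lambda>t. LINT \<omega>|M. indicator {0..T} t *\<^sub>R \<eta> t \<omega>) \<in> borel_measurable lborel"
    by (rule borel_measurable_lebesgue_integral[OF eta_joint])
  then show ?thesis unfolding mbar_def by simp
qed

text \<open>The extension by zero outside \<open>[0, T]\<close> is Borel measurable on the whole line.\<close>

definition minv :: "real \<Rightarrow> real^'n^'n" where "minv t = indicator {0..T} t *\<^sub>R matrix_inv (mbar t)"

lemma minv_eq: "0 \<le> t \<Longrightarrow> t \<le> T \<Longrightarrow> minv t = matrix_inv (mbar t)"
  by (simp add: minv_def)

lemma minv_measurable: "minv \<in> borel_measurable borel"
proof -
  have "(\<lambda>t. indicator {0..T} t *\<^sub>R matrix_inv (indicator {0..T} t *\<^sub>R mbar t)) \<in> borel_measurable borel"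
    by (intro borel_measurable_scaleR borel_measurable_indicator borel_measurable_matrix_inv mbar_measurable) simp
  moreover have "(\<lambda>t. indicator {0..T} t *\<^sub>R matrix_inv (indicator {0..T} t *\<^sub>R mbar t)) = minv"
    by (auto simp: minv_def fun_eq_iff indicator_def)
  ultimately show ?thesis by simp
qed

lemma minv_vec_measurable: "(\<lambda>t. minv t *v y) \<in> borel_measurable borel"
  by (rule borel_measurable_mult_vec[OF minv_measurable]) simp

lemma minv_spd: "0 \<le> t \<Longrightarrow> t \<le> T \<Longrightarrow> spd (minv t)"
  by (simp add: minv_eq spd_matrix_inv mbar_spd)

lemma minv_bound: "norm (minv t) \<le> (CARD('n))\<^sup>2 / \<delta>"
proof (cases "t \<in> {0..T}")
  case True
  then show ?thesis using coercive_norm_matrix_inv[OF delta mbar_coercive] by (simp add: minv_eq)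
qed (use delta in \<open>simp add: minv_def\<close>)

lemma minv_integrable: "set_integrable lborel {s..t} minv"
  unfolding set_integrable_def
proof (rule integrableI_bounded_set_indicator[where B="(CARD('n))\<^sup>2 / \<delta>"])
  show "minv \<in> borel_measurable lborel" using minv_measurable by simp
  show "emeasure lborel {s..t} < \<infinity>" by (simp add: emeasure_lborel_Icc_eq)
qed (use minv_bound in auto)

definition G :: "real \<Rightarrow> real^'n^'n" where "G t = (LINT r:{t..T}|lborel. minv r)"

lemma minv_vec_integrable: "set_integrable lborel {s..t} (\<lambda>r. minv r *v y)"
  using integrable_bounded_linear[OF bounded_linear_mult_vec minv_integrable[of s t, unfolded set_integrable_def], of y]
  unfolding set_integrable_def by (simp add: scaleR_matrix_vector_assoc[symmetric])

lemma G_vec: "G t *v y = (LINT r:{t..T}|lborel. minv r *v y)"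
  unfolding G_def set_lebesgue_integral_def
  using integral_bounded_linear[OF bounded_linear_mult_vec minv_integrable[of t T, unfolded set_integrable_def], of y]
  by (simp add: scaleR_matrix_vector_assoc[symmetric])

lemma G_inner: "x \<bullet> (G t *v y) = (LINT r:{t..T}|lborel. x \<bullet> (minv r *v y))"
  unfolding G_vec set_lebesgue_integral_def
  by (subst integral_inner_right[symmetric])
     (use minv_vec_integrable[of t T y] in \<open>simp_all add: set_integrable_def\<close>)

lemma minv_inner_integrable: "set_integrable lborel {s..t} (\<lambda>r. x \<bullet> (minv r *v y))"
  using integrable_inner_right[OF minv_vec_integrable[of s t y, unfolded set_integrable_def], of x]
  unfolding set_integrable_def by simp

lemma G_spd:
  assumes t: "0 \<le> t" "t < T"
  shows "spd (G t)"
  unfolding spd_def sym_mat_iff_inner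
proof (intro conjI allI impI)
  fix x y :: "real^'n"
  have "x \<bullet> (G t *v y) = (LINT r:{t..T}|lborel. y \<bullet> (minv r *v x))"
    unfolding G_inner
    by (rule set_lebesgue_integral_cong) (use t in \<open>auto intro!: trans[OF sym_mat_inner[OF spd_sym[OF minv_spd]] inner_commute]\<close>)
  then show "x \<bullet> (G t *v y) = (G t *v x) \<bullet> y" unfolding G_inner[symmetric] by (simp add: inner_commute)
next
  fix x :: "real^'n" assume x: "x \<noteq> 0"
  let ?f = "\<lambda>r. indicator {t..T} r *\<^sub>R (x \<bullet> (minv r *v x))"
  have pos: "0 < x \<bullet> (minv r *v x)" if "r \<in> {t..T}" for r
    using minv_spd[of r] that t x by (auto simp: spd_def)
  have int: "integrable lborel ?f" using minv_inner_integrable[of t T x x] unfolding set_integrable_def .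
  have nonneg: "AE r in lborel. 0 \<le> ?f r" using pos by (auto simp: indicator_def less_imp_le)
  have "0 \<le> integral\<^sup>L lborel ?f" by (rule integral_nonneg_AE[OF nonneg])
  moreover have "integral\<^sup>L lborel ?f \<noteq> 0"
  proof
    assume "integral\<^sup>L lborel ?f = 0"
    then have "AE r in lborel. ?f r = 0" using integral_nonneg_eq_0_iff_AE[OF int nonneg] by simp
    then have "AE r in lborel. r \<notin> {t..T}"
    proof eventually_elim
      case (elim r)
      show ?case
      proof
        assume r: "r \<in> {t..T}"
        then have "x \<bullet> (minv r *v x) = 0" using elim by simp
        then show False using pos[OF r] by simp
      qed
    qed
    moreover have "{r \<in> space lborel. \<not> r \<notin> {t..T}} = {t..T}" by auto
    ultimately have "emeasure lborel {t..T} = 0"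
      using AE_iff_measurable[of "{t..T}" lborel "\<lambda>r. r \<notin> {t..T}"] by simp
    then show False using t by simp
  qed
  ultimately show "0 < x \<bullet> (G t *v x)" unfolding G_inner set_lebesgue_integral_def by simp
qed

text \<open>The formula for \<open>Y\<close> reduces to \<open>Y\<^sub>t = D\<^sub>t G(t)\<^sup>-\<^sup>1\<close>: the martingale property gives
  \<open>E[\<eta>\<^sub>s | F\<^sub>t] = D\<^sub>t E[\<eta>\<^sub>s]\<close>, so that \<open>D\<^sub>t\<close> can be taken out of the integral over \<open>s\<close>.\<close>

lemma inv_int_inv_cond_exp_eq:
  assumes Y: "inv_int_inv_cond_exp M W T \<eta> Y" and t: "0 \<le> t" "t < T"
  shows "AE \<omega> in M. Y t \<omega> = D t \<omega> ** matrix_inv (G t)"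
proof -
  have tT: "t \<le> T" using t by simp
  obtain m where m_meas: "(\<lambda>(s, \<omega>). m s \<omega>) \<in> borel_measurable (restrict_space borel {t..T} \<Otimes>\<^sub>M F t)"
    and m: "\<And>s. s \<in> {t..T} \<Longrightarrow> AE \<omega> in M. m s \<omega> = mat_cond_exp M (F t) (\<eta> s) \<omega>"
    and Ym: "AE \<omega> in M. Y t \<omega> = matrix_inv (LINT s:{t..T}|lborel. matrix_inv (m s \<omega>))"
  proof -
    have "t \<in> {0..<T}" using t by simp
    from Y[unfolded inv_int_inv_cond_exp_def, rule_format, OF this] show thesis
      by (elim exE conjE) (rule that, assumption, erule (1) bspec, assumption)
  qed
  have cond: "AE \<omega> in M. mat_cond_exp M (F t) (\<eta> s) \<omega> = D t \<omega> ** mbar s" if s: "s \<in> {t..T}" for s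
  proof -
    have s': "0 \<le> s" "t \<le> s" "s \<le> T" using s t by auto
    interpret t: sigma_finite_subalgebra M "F t" by (rule sigma_finite_F[OF tT])
    have col: "D u \<omega> *v (mbar s *v axis j 1) = (D u \<omega> ** mbar s) *v axis j 1" for u \<omega> j
      by (simp add: matrix_vector_mul_assoc)
    have entry: "(B *v axis j 1) $ i = B $ i $ j" for B :: "real^'n^'n" and i j
      by (simp add: matrix_vector_mult_basis column_def)
    have Ds: "D s \<omega> ** mbar s = \<eta> s \<omega>" for \<omega>
      unfolding D_def using matrix_inv_left[OF spd_invertible[OF mbar_spd[OF s'(1,3)]]]
      by (simp add: matrix_mul_assoc[symmetric])
    have "AE \<omega> in M. real_cond_exp M (F t) (\<lambda>\<omega>. \<eta> s \<omega> $ i $ j) \<omega> = (D t \<omega> ** mbar s) $ i $ j" for i j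
    proof (rule t.real_cond_exp_charact)
      show "integrable M (\<lambda>\<omega>. \<eta> s \<omega> $ i $ j)"
        using integrable_vec_nth[OF eta_vec_int[OF s'(1,3), of "axis j 1"], of i] unfolding entry .
      show "integrable M (\<lambda>\<omega>. (D t \<omega> ** mbar s) $ i $ j)"
        using integrable_vec_nth[OF D_vec_int[OF t(1) tT, of "mbar s *v axis j 1"], of i] unfolding col entry .
      show "(\<lambda>\<omega>. (D t \<omega> ** mbar s) $ i $ j) \<in> borel_measurable (F t)"
        by (intro borel_measurable_vec_nth borel_measurable_mult_matrix D_F t tT) simp
      show "(LINT \<omega>:B|M. \<eta> s \<omega> $ i $ j) = (LINT \<omega>:B|M. (D t \<omega> ** mbar s) $ i $ j)" if "B \<in> sets (F t)" for B
        using D_martingale[OF t(1) s'(2,3) that, of "mbar s *v axis j 1" i]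
        unfolding col entry Ds set_lebesgue_integral_def by simp
    qed
    then have "AE \<omega> in M. \<forall>i\<in>UNIV. \<forall>j\<in>UNIV. real_cond_exp M (F t) (\<lambda>\<omega>. \<eta> s \<omega> $ i $ j) \<omega> = (D t \<omega> ** mbar s) $ i $ j"
      by (intro AE_finite_allI) auto
    then show ?thesis by eventually_elim (simp add: mat_cond_exp_def vec_eq_iff)
  qed
  text \<open>By Fubini, the version \<open>m\<close> agrees with \<open>D\<^sub>t E[\<eta>\<^sub>s]\<close> at almost every \<open>s\<close>, for almost every \<open>\<omega>\<close>.\<close>
  have path: "AE \<omega> in M. AE s in lborel. s \<in> {t..T} \<longrightarrow> m s \<omega> = D t \<omega> ** mbar s"
  proof -
    have idF: "id \<in> measurable M (F t)"
      using sets_F_M[OF tT] sets.sets_into_space by (intro measurableI) (auto simp: Int_absorb2)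
    let ?m = "\<lambda>x. case x of (s, \<omega>) \<Rightarrow> indicator {t..T} s *\<^sub>R m s \<omega>"
    have 1: "?m \<in> borel_measurable (lborel \<Otimes>\<^sub>M F t)" by (rule prog_measurable_joint_gen[OF m_meas]) simp
    have "(\<lambda>x. (fst x, id (snd x))) \<in> measurable (lborel \<Otimes>\<^sub>M M) (lborel \<Otimes>\<^sub>M F t)"
      by (intro measurable_Pair measurable_fst measurable_compose[OF measurable_snd idF])
    from measurable_compose[OF this 1] have mm: "?m \<in> borel_measurable (lborel \<Otimes>\<^sub>M M)" by (simp add: case_prod_beta)
    let ?d = "\<lambda>x. case x of (s, \<omega>) \<Rightarrow> indicator {t..T} s *\<^sub>R (D t \<omega> ** (indicator {0..T} s *\<^sub>R mbar s))"
    have "D t \<in> borel_measurable M" by (rule measurable_F_M[OF D_F tT]) (use t tT in simp_all)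
    then have Dm: "(\<lambda>x. D t (snd x)) \<in> borel_measurable (lborel \<Otimes>\<^sub>M M)" by (rule measurable_compose[OF measurable_snd])
    have bm: "(\<lambda>x. indicator {0..T} (fst x) *\<^sub>R mbar (fst x)) \<in> borel_measurable (lborel \<Otimes>\<^sub>M M)"
      by (rule measurable_compose[OF measurable_fst]) (use mbar_measurable in simp)
    have im: "(\<lambda>x. indicator {t..T} (fst x) :: real) \<in> borel_measurable (lborel \<Otimes>\<^sub>M M)"
      by (rule measurable_compose[OF measurable_fst]) simp
    have dm: "?d \<in> borel_measurable (lborel \<Otimes>\<^sub>M M)"
      unfolding case_prod_beta by (intro borel_measurable_scaleR im borel_measurable_mult_matrix Dm bm)
    have meas: "{x \<in> space (lborel \<Otimes>\<^sub>M M). ?m x = ?d x} \<in> sets (lborel \<Otimes>\<^sub>M M)"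
    proof -
      have "(\<lambda>x. norm (?m x - ?d x)) \<in> borel_measurable (lborel \<Otimes>\<^sub>M M)"
        by (rule measurable_compose[OF borel_measurable_diff[OF mm dm] borel_measurable_norm])
      then have "{x \<in> space (lborel \<Otimes>\<^sub>M M). norm (?m x - ?d x) = 0} \<in> sets (lborel \<Otimes>\<^sub>M M)"
        by (rule borel_measurable_eq) simp
      then show ?thesis by (simp only: norm_eq_zero right_minus_eq)
    qed
    interpret pair_sigma_finite lborel M by unfold_locales
    have "AE s in lborel. AE \<omega> in M. ?m (s, \<omega>) = ?d (s, \<omega>)"
    proof (rule AE_I2)
      fix s
      show "AE \<omega> in M. ?m (s, \<omega>) = ?d (s, \<omega>)"
      proof (cases "s \<in> {t..T}")
        case True
        show ?thesis using m[OF True] cond[OF True] by eventually_elim (use True t in simp)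
      qed simp
    qed
    then have "AE x in lborel \<Otimes>\<^sub>M M. ?m x = ?d x"
      by (intro AE_pair_measure) (use meas in \<open>simp_all add: case_prod_beta\<close>)
    then have "AE \<omega> in M. AE s in lborel. ?m (s, \<omega>) = ?d (s, \<omega>)"
      using AE_commute[of "\<lambda>s \<omega>. ?m (s, \<omega>) = ?d (s, \<omega>)"] meas AE_pair[of "\<lambda>x. ?m x = ?d x"]
      by (simp add: case_prod_beta space_pair_measure)
    then show ?thesis
    proof eventually_elim
      case (elim \<omega>)
      then show ?case by eventually_elim (use t in \<open>auto simp: indicator_def\<close>)
    qed
  qed
  show ?thesis
    using path Ym AE_space
  proof eventually_elim
    case (elim \<omega>)
    have inv_\<eta>: "invertible (\<eta> t \<omega>)" using eta_spd[OF t(1) tT elim(3)] by (rule spd_invertible)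
    have inv_mb: "invertible (mbar t)" using mbar_spd[OF t(1) tT] by (rule spd_invertible)
    have inv_G: "invertible (G t)" using G_spd[OF t] by (rule spd_invertible)
    define E where "E = mbar t ** matrix_inv (\<eta> t \<omega>)"
    have DE: "D t \<omega> ** E = mat 1"
    proof -
      have "D t \<omega> ** E = \<eta> t \<omega> ** (matrix_inv (mbar t) ** mbar t) ** matrix_inv (\<eta> t \<omega>)"
        unfolding D_def E_def by (simp only: matrix_mul_assoc)
      then show ?thesis using matrix_inv_left[OF inv_mb] matrix_inv_right[OF inv_\<eta>] by simp
    qed
    then have ED: "E ** D t \<omega> = mat 1" using matrix_left_right_inverse by blast
    have inv_m: "matrix_inv (D t \<omega> ** mbar s) = minv s ** E" if s: "s \<in> {t..T}" for s
    proof (rule matrix_inv_unique)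
      have s': "0 \<le> s" "s \<le> T" using s t by auto
      have "D t \<omega> ** mbar s ** (minv s ** E) = D t \<omega> ** (mbar s ** matrix_inv (mbar s)) ** E"
        unfolding minv_eq[OF s'] by (simp only: matrix_mul_assoc)
      then show "D t \<omega> ** mbar s ** (minv s ** E) = mat 1"
        using matrix_inv_right[OF spd_invertible[OF mbar_spd[OF s']]] DE by simp
    qed
    have bl: "bounded_linear (\<lambda>B :: real^'n^'n. B ** E)"
    proof (rule linear_conv_bounded_linear[THEN iffD1], rule linearI)
      show "(A + B) ** E = A ** E + B ** E" for A B :: "real^'n^'n"
        by (simp add: matrix_matrix_mult_def vec_eq_iff distrib_right sum.distrib)
      show "(r *\<^sub>R A) ** E = r *\<^sub>R (A ** E)" for r and A :: "real^'n^'n"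
        by (simp add: scalar_matrix_assoc)
    qed
    have "(LINT s:{t..T}|lborel. matrix_inv (m s \<omega>)) = (LINT s:{t..T}|lborel. minv s ** E)"
      unfolding set_lebesgue_integral_def
    proof (rule integral_cong_AE)
      have mS: "(\<lambda>s. case (s, \<omega>) of (s, \<omega>) \<Rightarrow> indicator {t..T} s *\<^sub>R m s \<omega>) \<in> borel_measurable lborel"
        using measurable_compose[OF measurable_Pair2'[of \<omega> "F t" lborel] prog_measurable_joint_gen[OF m_meas]] elim(3) by simp
      have "(\<lambda>s. indicator {t..T} s *\<^sub>R matrix_inv (indicator {t..T} s *\<^sub>R m s \<omega>)) \<in> borel_measurable lborel"
        by (intro borel_measurable_scaleR borel_measurable_matrix_inv mS[unfolded prod.case]) simp
      moreover have "(\<lambda>s. indicator {t..T} s *\<^sub>R matrix_inv (indicator {t..T} s *\<^sub>R m s \<omega>)) = (\<lambda>s. indicator {t..T} s *\<^sub>R matrix_inv (m s \<omega>))"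
        by (auto simp: fun_eq_iff indicator_def)
      ultimately show "(\<lambda>s. indicator {t..T} s *\<^sub>R matrix_inv (m s \<omega>)) \<in> borel_measurable lborel" by simp
      show "(\<lambda>s. indicator {t..T} s *\<^sub>R (minv s ** E)) \<in> borel_measurable lborel"
        using minv_measurable by (intro borel_measurable_scaleR borel_measurable_mult_matrix) simp_all
      show "AE s in lborel. indicator {t..T} s *\<^sub>R matrix_inv (m s \<omega>) = indicator {t..T} s *\<^sub>R (minv s ** E)"
        using elim(1) by eventually_elim (use inv_m in \<open>auto simp: indicator_def\<close>)
    qed
    also have "\<dots> = G t ** E"
      unfolding G_def set_lebesgue_integral_def
      using integral_bounded_linear[OF bl minv_integrable[of t T, unfolded set_integrable_def]]
      by (simp add: linear_cmul[OF bounded_linear.linear[OF bl]])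
    finally have "Y t \<omega> = matrix_inv (G t ** E)" using elim(2) by simp
    also have "\<dots> = D t \<omega> ** matrix_inv (G t)"
    proof (rule matrix_inv_unique)
      have "G t ** E ** (D t \<omega> ** matrix_inv (G t)) = G t ** (E ** D t \<omega>) ** matrix_inv (G t)"
        by (simp only: matrix_mul_assoc)
      then show "G t ** E ** (D t \<omega> ** matrix_inv (G t)) = mat 1"
        using ED matrix_inv_right[OF inv_G] by simp
    qed
    finally show ?case .
  qed
qed

end

section \<open>Coercivity of supersolutions\<close>

context brownian
begin

text \<open>The event \<open>C < f\<close> is tested.\<close>

lemma AE_le_of_expectations:
  fixes f :: "'a \<Rightarrow> real"
  assumes t: "t \<le> T" and f: "f \<in> borel_measurable (F t)" "integrable M f"
    and le: "\<And>A. A \<in> sets (F t) \<Longrightarrow> expectation (\<lambda>\<omega>. indicator A \<omega> * f \<omega>) \<le> C * prob A"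
  shows "AE \<omega> in M. f \<omega> \<le> C"
proof -
  define A where "A = {\<omega> \<in> space (F t). C < f \<omega>}"
  have A: "A \<in> sets (F t)" unfolding A_def by (rule borel_measurable_less) (use f in simp_all)
  have AM: "A \<in> sets M" using A sets_F_M[OF t] by blast
  let ?g = "\<lambda>\<omega>. indicator A \<omega> * (f \<omega> - C)"
  have int: "integrable M (\<lambda>\<omega>. indicator A \<omega> * f \<omega>)" "integrable M (\<lambda>\<omega>. indicator A \<omega> * C)"
    using integrable_mult_indicator[OF AM f(2)] integrable_mult_indicator[OF AM integrable_const[of C]] by simp_all
  have g_eq: "?g \<omega> = indicator A \<omega> * f \<omega> - indicator A \<omega> * C" for \<omega> by (simp add: algebra_simps)
  have g_int: "integrable M ?g" unfolding g_eq by (rule Bochner_Integration.integrable_diff[OF int])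
  have g_nonneg: "AE \<omega> in M. 0 \<le> ?g \<omega>" by (auto simp: A_def indicator_def)
  have "expectation ?g = expectation (\<lambda>\<omega>. indicator A \<omega> * f \<omega>) - C * prob A"
    unfolding g_eq using int AM by simp
  then have "expectation ?g \<le> 0" using le[OF A] by simp
  moreover have "0 \<le> expectation ?g" by (rule integral_nonneg_AE[OF g_nonneg])
  ultimately have "AE \<omega> in M. ?g \<omega> = 0"
    using integral_nonneg_eq_0_iff_AE[OF g_int g_nonneg] by simp
  then show ?thesis using AE_space
    by eventually_elim (auto simp: A_def indicator_def not_less split: if_splits)
qed

text \<open>Inequalities between forms pass from single times and directions to all of them, by density of
  the rational times and of a countable set of directions.\<close>

lemma AE_quad_nonneg_all:
  fixes B :: "real \<Rightarrow> 'a \<Rightarrow> real^'n^'n"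
  assumes B: "\<And>t x. 0 \<le> t \<Longrightarrow> t < T \<Longrightarrow> AE \<omega> in M. 0 \<le> x \<bullet> (B t \<omega> *v x)"
    and cont: "AE \<omega> in M. \<forall>S. 0 \<le> S \<and> S < T \<longrightarrow> continuous_on {0..S} (\<lambda>t. B t \<omega>)"
  shows "AE \<omega> in M. \<forall>t x. 0 \<le> t \<and> t < T \<longrightarrow> 0 \<le> x \<bullet> (B t \<omega> *v x)"
proof -
  obtain Q :: "(real^'n) set" where Q: "countable Q" "closure Q = UNIV"
    using separable[of "UNIV :: (real^'n) set"] by (metis UNIV_I subset_UNIV subset_antisym)
  define R where "R = {0..<T} \<inter> \<rat>"
  have R: "countable R" using countable_rat by (auto simp: R_def)
  have "AE \<omega> in M. \<forall>t\<in>R. \<forall>x\<in>Q. 0 \<le> x \<bullet> (B t \<omega> *v x)"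
    using R Q(1) B by (intro AE_ball_countable[THEN iffD2] ballI) (auto simp: R_def)
  then show ?thesis using cont
  proof eventually_elim
    case (elim \<omega>)
    have rat: "0 \<le> x \<bullet> (B t \<omega> *v x)" if "t \<in> R" for t x
    proof -
      have "continuous_on UNIV (\<lambda>x. x \<bullet> (B t \<omega> *v x))"
        by (intro continuous_intros linear_continuous_on matrix_vector_mul_bounded_linear)
      then have "closed {x. 0 \<le> x \<bullet> (B t \<omega> *v x)}"
        by (intro closed_Collect_le continuous_on_const)
      moreover have "Q \<subseteq> {x. 0 \<le> x \<bullet> (B t \<omega> *v x)}" using elim(1) that by blast
      ultimately have "closure Q \<subseteq> {x. 0 \<le> x \<bullet> (B t \<omega> *v x)}" by (rule closure_minimal[rotated])
      then show ?thesis using Q(2) by blast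
    qed
    show ?case
    proof (intro allI impI, rule ccontr)
      fix t x assume t: "0 \<le> t \<and> t < T" and neg: "\<not> 0 \<le> x \<bullet> (B t \<omega> *v x)"
      have t0: "0 < t"
      proof (cases "t = 0")
        case True
        then have "t \<in> R" using T_pos by (auto simp: R_def)
        then show ?thesis using rat neg by blast
      qed (use t in simp)
      have "bounded_linear (\<lambda>C :: real^'n^'n. x \<bullet> (C *v x))"
        by (rule bounded_linear_intro[of _ "norm x * norm x"])
           (use quad_le_norm[of x] in \<open>simp_all add: matrix_vector_mult_add_rdistrib inner_add_right scaleR_matrix_vector_assoc[symmetric]\<close>)
      then have "continuous_on {0..t} (\<lambda>s. x \<bullet> (B s \<omega> *v x))"
        by (rule bounded_linear.continuous_on) (use elim(2) t in blast)
      then obtain d where d: "0 < d" "\<And>s. s \<in> {0..t} \<Longrightarrow> dist s t < d \<Longrightarrow>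
          dist (x \<bullet> (B s \<omega> *v x)) (x \<bullet> (B t \<omega> *v x)) < - (x \<bullet> (B t \<omega> *v x))"
        using neg t unfolding continuous_on_iff by (metis atLeastAtMost_iff not_le neg_0_less_iff_less order_refl)
      obtain q where q: "q \<in> \<rat>" "max 0 (t - d) < q" "q < t"
        using Rats_dense_in_real[of "max 0 (t - d)" t] t0 d(1) by auto
      have "0 \<le> x \<bullet> (B q \<omega> *v x)" by (rule rat) (use q t in \<open>auto simp: R_def\<close>)
      then show False using d(2)[of q] q neg by (auto simp: dist_real_def)
    qed
  qed
qed

text \<open>Jensen's inequality for the square, component by component.\<close>

lemma cexp_contraction:
  fixes U :: "'a \<Rightarrow> real^'n"
  assumes U: "integrable M U" "integrable M (\<lambda>\<omega>. (norm (U \<omega>))\<^sup>2)" and s: "s \<le> T"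
  shows "integrable M (\<lambda>\<omega>. (norm (cexp U s \<omega>))\<^sup>2)"
    "expectation (\<lambda>\<omega>. (norm (cexp U s \<omega>))\<^sup>2) \<le> expectation (\<lambda>\<omega>. (norm (U \<omega>))\<^sup>2)"
proof -
  interpret s: sigma_finite_subalgebra M "F s" by (rule sigma_finite_F[OF s])
  have norm2: "(norm v)\<^sup>2 = (\<Sum>i\<in>UNIV. (v $ i)\<^sup>2)" for v :: "real^'n"
    unfolding power2_norm_eq_inner inner_vec_def by (simp add: power2_eq_square)
  have Ui: "integrable M (\<lambda>\<omega>. U \<omega> $ i)" for i by (rule integrable_vec_nth[OF U(1)])
  have Ui2: "integrable M (\<lambda>\<omega>. (U \<omega> $ i)\<^sup>2)" for i
  proof (rule Bochner_Integration.integrable_bound[OF U(2)])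
    show "(\<lambda>\<omega>. (U \<omega> $ i)\<^sup>2) \<in> borel_measurable M"
      by (intro borel_measurable_power borel_measurable_integrable[OF Ui])
    show "AE \<omega> in M. norm ((U \<omega> $ i)\<^sup>2) \<le> norm ((norm (U \<omega>))\<^sup>2)"
    proof (rule AE_I2)
      fix \<omega>
      have "\<bar>U \<omega> $ i\<bar>\<^sup>2 \<le> (norm (U \<omega>))\<^sup>2" by (intro power_mono component_le_norm_cart abs_ge_zero)
      then show "norm ((U \<omega> $ i)\<^sup>2) \<le> norm ((norm (U \<omega>))\<^sup>2)" by simp
    qed
  qed
  have cvx: "convex_on UNIV (\<lambda>x::real. x\<^sup>2)" by (rule convex_power2)
  have ci: "integrable M (\<lambda>\<omega>. (real_cond_exp M (F s) (\<lambda>\<omega>. U \<omega> $ i) \<omega>)\<^sup>2)" for i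
    by (rule s.integrable_convex_cond_exp[where I=UNIV and q="\<lambda>x. x\<^sup>2"]) (use Ui Ui2 cvx emeasure_space_1 in auto)
  have le: "expectation (\<lambda>\<omega>. (real_cond_exp M (F s) (\<lambda>\<omega>. U \<omega> $ i) \<omega>)\<^sup>2) \<le> expectation (\<lambda>\<omega>. (U \<omega> $ i)\<^sup>2)" for i
  proof -
    have "AE \<omega> in M. (real_cond_exp M (F s) (\<lambda>\<omega>. U \<omega> $ i) \<omega>)\<^sup>2 \<le> real_cond_exp M (F s) (\<lambda>\<omega>. (U \<omega> $ i)\<^sup>2) \<omega>"
      by (rule s.real_cond_exp_jensens_inequality(2)[where I=UNIV and q="\<lambda>x. x\<^sup>2"]) (use Ui Ui2 cvx in auto)
    then have "expectation (\<lambda>\<omega>. (real_cond_exp M (F s) (\<lambda>\<omega>. U \<omega> $ i) \<omega>)\<^sup>2) \<le> expectation (real_cond_exp M (F s) (\<lambda>\<omega>. (U \<omega> $ i)\<^sup>2))"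
      by (rule integral_mono_AE[OF ci s.real_cond_exp_int(1)[OF Ui2]])
    then show ?thesis using s.real_cond_exp_int(2)[OF Ui2] by simp
  qed
  have c2: "(norm (cexp U s \<omega>))\<^sup>2 = (\<Sum>i\<in>UNIV. (real_cond_exp M (F s) (\<lambda>\<omega>. U \<omega> $ i) \<omega>)\<^sup>2)" for \<omega>
    unfolding norm2 cexp_def by simp
  show "integrable M (\<lambda>\<omega>. (norm (cexp U s \<omega>))\<^sup>2)"
    unfolding c2 by (intro Bochner_Integration.integrable_sum ci)
  show "expectation (\<lambda>\<omega>. (norm (cexp U s \<omega>))\<^sup>2) \<le> expectation (\<lambda>\<omega>. (norm (U \<omega>))\<^sup>2)"
    unfolding c2 unfolding norm2 by (simp add: Bochner_Integration.integral_sum ci Ui2 sum_mono le)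
qed

lemma cexp_diff:
  fixes U V :: "'a \<Rightarrow> real^'n"
  assumes U: "integrable M U" and V: "integrable M V" and s: "s \<le> T"
  shows "AE \<omega> in M. cexp (\<lambda>\<omega>. U \<omega> - V \<omega>) s \<omega> = cexp U s \<omega> - cexp V s \<omega>"
proof -
  interpret s: sigma_finite_subalgebra M "F s" by (rule sigma_finite_F[OF s])
  have "AE \<omega> in M. \<forall>i\<in>UNIV. real_cond_exp M (F s) (\<lambda>\<omega>. U \<omega> $ i - V \<omega> $ i) \<omega>
      = real_cond_exp M (F s) (\<lambda>\<omega>. U \<omega> $ i) \<omega> - real_cond_exp M (F s) (\<lambda>\<omega>. V \<omega> $ i) \<omega>"
    by (intro AE_finite_allI s.real_cond_exp_diff integrable_vec_nth U V) simp
  then show ?thesis by eventually_elim (simp add: cexp_def vec_eq_iff)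
qed

lemma cexp_const:
  assumes s: "s \<le> T"
  shows "AE \<omega> in M. cexp (\<lambda>_. v :: real^'n) s \<omega> = v"
proof -
  interpret s: sigma_finite_subalgebra M "F s" by (rule sigma_finite_F[OF s])
  have "AE \<omega> in M. \<forall>i\<in>UNIV. real_cond_exp M (F s) (\<lambda>\<omega>. v $ i) \<omega> = v $ i"
    by (intro AE_finite_allI s.real_cond_exp_F_meas) simp_all
  then show ?thesis by eventually_elim (simp add: cexp_def vec_eq_iff)
qed

end

lemma coercive_add_scaled_id:
  assumes "psd (A :: real^'n^'n)"
  shows "coercive \<epsilon> (A + \<epsilon> *\<^sub>R mat 1)"
  unfolding coercive_def sym_mat_iff_inner
proof (intro conjI allI)
  have A: "x \<bullet> (A *v y) = (A *v x) \<bullet> y" for x y using assms by (simp add: psd_def sym_mat_inner)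
  show "x \<bullet> ((A + \<epsilon> *\<^sub>R mat 1) *v y) = ((A + \<epsilon> *\<^sub>R mat 1) *v x) \<bullet> y" for x y
    by (simp add: matrix_vector_mult_add_rdistrib inner_add_right inner_add_left scaleR_matrix_vector_assoc[symmetric] A)
  show "\<epsilon> * (norm x)\<^sup>2 \<le> x \<bullet> ((A + \<epsilon> *\<^sub>R mat 1) *v x)" for x
    using psd_quad_nonneg[OF assms, of x]
    by (simp add: matrix_vector_mult_add_rdistrib inner_add_right scaleR_matrix_vector_assoc[symmetric] power2_norm_eq_inner)
qed

context supersolution_process
begin

text \<open>For a constant \<open>V\<close> the drift in the optimal direction is at most \<open>4 norm(V)\<^sup>2 / \<delta>\<close>, however small \<open>\<epsilon>\<close> is,
  because \<open>Y R\<^sup>-\<^sup>1 V = V - \<epsilon> R\<^sup>-\<^sup>1 V\<close> has norm at most \<open>2 norm V\<close>. The multiple \<open>V = \<kappa> x\<close> maximises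
  \<open>2 \<langle>x, V\<rangle> - 4 T norm(V)\<^sup>2 / \<delta>\<close>.\<close>

lemma quad_regularised_lower:
  assumes t: "0 \<le> t" "t < T" and e: "0 < \<epsilon>"
  defines "\<kappa> \<equiv> \<delta> / (4 * T)"
  shows "AE \<omega> in M. \<kappa> * (norm x)\<^sup>2 \<le> x \<bullet> (Y t \<omega> *v x) + \<epsilon> * (norm x)\<^sup>2"
proof -
  have kT: "4 * T * \<kappa> = \<delta>" using T_pos by (simp add: \<kappa>_def)
  define v where "v = \<kappa> *\<^sub>R x"
  have Rc: "AE \<omega> in M. \<forall>s. 0 \<le> s \<and> s < T \<longrightarrow> coercive \<epsilon> (Y s \<omega> + \<epsilon> *\<^sub>R mat 1)"
    using AE_space by eventually_elim (auto intro: coercive_add_scaled_id Y_psd)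
  let ?f = "\<lambda>\<omega>. 2 * (x \<bullet> v) - x \<bullet> ((Y t \<omega> + \<epsilon> *\<^sub>R mat 1) *v x)"
  have f_F: "?f \<in> borel_measurable (F t)"
    by (intro borel_measurable_diff borel_measurable_const borel_measurable_inner borel_measurable_mult_vec
        borel_measurable_add Y_F t)
  have quad_int: "integrable M (\<lambda>\<omega>. x \<bullet> (Y t \<omega> *v x))"
  proof -
    have "integrable M (\<lambda>\<omega>. indicator (space M) \<omega> * (x \<bullet> (Y t \<omega> *v x)))"
      by (rule quad_Y_integrable[OF t, where B="norm x" and p="\<lambda>_. x"]) simp_all
    also have "?this \<longleftrightarrow> ?thesis" by (rule Bochner_Integration.integrable_cong) auto
    finally show ?thesis .
  qed
  have f_eq: "?f \<omega> = 2 * (x \<bullet> v) - (x \<bullet> (Y t \<omega> *v x) + \<epsilon> * (norm x)\<^sup>2)" for \<omega>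
    by (simp add: matrix_vector_mult_add_rdistrib inner_add_right scaleR_matrix_vector_assoc[symmetric] power2_norm_eq_inner)
  have f_int: "integrable M ?f"
    unfolding f_eq by (intro Bochner_Integration.integrable_diff Bochner_Integration.integrable_add quad_int integrable_const)
  have "AE \<omega> in M. ?f \<omega> \<le> T * (4 * (norm v)\<^sup>2 / \<delta>)"
  proof (rule AE_le_of_expectations[OF less_imp_le[OF t(2)] f_F f_int])
    fix A assume A: "A \<in> sets (F t)"
    interpret D: dual_bound M W T \<eta> Y Z I \<delta> \<epsilon> \<epsilon> "norm v" t "\<lambda>_. v" A
      by unfold_locales (use e Rc t A in simp_all)
    let ?b = "4 * (norm v)\<^sup>2 / \<delta> * prob A"
    have b: "(\<integral>\<^sup>+\<omega>. ennreal (indicator A \<omega> * D.X r \<omega> (D.p r \<omega>)) \<partial>M) \<le> ennreal ?b" if r: "t \<le> r" "r < T" for r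
    proof -
      have r': "0 \<le> r" "r \<le> T" using r t by auto
      have "AE \<omega> in M. ennreal (indicator A \<omega> * D.X r \<omega> (D.p r \<omega>)) \<le> ennreal (4 * (norm v)\<^sup>2 / \<delta>) * indicator A \<omega>"
        using D.p_eq[OF r'(1) r(2)] cexp_const[OF r'(2), of v] D.R_coercive' eta_coercive
      proof eventually_elim
        case (elim \<omega>)
        have R: "coercive \<epsilon> (D.R r \<omega>)" using elim(3) r r' by blast
        have p: "D.p r \<omega> = matrix_inv (D.R r \<omega>) *v v" using elim(1,2) by simp
        have "D.R r \<omega> *v D.p r \<omega> = v" unfolding p by (rule spd_mult_inv(1)[OF coercive_spd[OF e R]])
        then have "Y r \<omega> *v D.p r \<omega> = v - \<epsilon> *\<^sub>R D.p r \<omega>"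
          unfolding D.R_def by (simp add: matrix_vector_mult_add_rdistrib scaleR_matrix_vector_assoc[symmetric] eq_diff_eq)
        then have "norm (Y r \<omega> *v D.p r \<omega>) \<le> norm v + \<epsilon> * norm (D.p r \<omega>)"
          using norm_triangle_ineq4[of v "\<epsilon> *\<^sub>R D.p r \<omega>"] e by simp
        also have "\<dots> \<le> norm v + \<epsilon> * (norm v / \<epsilon>)"
          unfolding p using e by (intro add_left_mono mult_left_mono coercive_norm_inv[OF e R]) simp
        finally have Yp: "norm (Y r \<omega> *v D.p r \<omega>) \<le> 2 * norm v" using e by simp
        have "D.X r \<omega> (D.p r \<omega>) \<le> (norm (Y r \<omega> *v D.p r \<omega>))\<^sup>2 / \<delta>"
          unfolding D.X_def by (rule coercive_quad_inv[OF delta]) (use elim(4) r r' in simp)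
        also have "\<dots> \<le> (2 * norm v)\<^sup>2 / \<delta>" using delta Yp by (intro divide_right_mono power_mono) simp_all
        finally have "D.X r \<omega> (D.p r \<omega>) \<le> 4 * (norm v)\<^sup>2 / \<delta>" by (simp add: power_mult_distrib)
        then show ?case by (simp add: indicator_def ennreal_leI)
      qed
      then have "(\<integral>\<^sup>+\<omega>. ennreal (indicator A \<omega> * D.X r \<omega> (D.p r \<omega>)) \<partial>M) \<le> (\<integral>\<^sup>+\<omega>. ennreal (4 * (norm v)\<^sup>2 / \<delta>) * indicator A \<omega> \<partial>M)"
        by (rule nn_integral_mono_AE)
      also have "\<dots> = ennreal ?b"
        using D.AM delta by (simp add: nn_integral_cmult_indicator emeasure_eq_measure ennreal_mult'[symmetric])
      finally show ?thesis .
    qed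
    have b_int: "set_integrable lborel {t..T} (\<lambda>r. ?b)"
      unfolding set_integrable_def by (intro integrable_scaleR_left integrable_real_indicator) (simp_all add: emeasure_lborel_Icc_eq)
    have "expectation (\<lambda>\<omega>. indicator A \<omega> * ?f \<omega>) \<le> (LINT r:{t..T}|lborel. ?b)"
      using D.dual_inequality[OF b_int _ b, of x] delta unfolding D.R_def by simp
    also have "\<dots> = (T - t) * ?b" using t unfolding set_lebesgue_integral_def by simp
    also have "\<dots> \<le> T * ?b" using t delta by (intro mult_right_mono) simp_all
    finally show "expectation (\<lambda>\<omega>. indicator A \<omega> * ?f \<omega>) \<le> T * (4 * (norm v)\<^sup>2 / \<delta>) * prob A" by simp
  qed
  then show ?thesis
  proof eventually_elim
    case (elim \<omega>)
    have xv: "x \<bullet> v = \<kappa> * (norm x)\<^sup>2" by (simp add: v_def power2_norm_eq_inner)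
    have "T * (4 * (norm v)\<^sup>2 / \<delta>) = (4 * T * \<kappa>) * \<kappa> * (norm x)\<^sup>2 / \<delta>"
      by (simp add: v_def power_mult_distrib power2_eq_square)
    also have "\<dots> = \<kappa> * (norm x)\<^sup>2" unfolding kT using delta by simp
    finally show ?case using elim[unfolded f_eq] xv by linarith
  qed
qed

lemma Y_coercive: "AE \<omega> in M. \<forall>t. 0 \<le> t \<and> t < T \<longrightarrow> coercive (\<delta> / (4 * T)) (Y t \<omega>)"
proof -
  let ?k = "\<delta> / (4 * T)"
  have "AE \<omega> in M. \<forall>t x. 0 \<le> t \<and> t < T \<longrightarrow> 0 \<le> x \<bullet> ((Y t \<omega> - ?k *\<^sub>R mat 1) *v x)"
  proof (rule AE_quad_nonneg_all)
    fix t x assume t: "0 \<le> t" "t < T"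
    have "AE \<omega> in M. \<forall>n::nat. ?k * (norm x)\<^sup>2 \<le> x \<bullet> (Y t \<omega> *v x) + 1 / real (Suc n) * (norm x)\<^sup>2"
      unfolding AE_all_countable using quad_regularised_lower[OF t, of "1 / real (Suc _)" x] by simp
    then show "AE \<omega> in M. 0 \<le> x \<bullet> ((Y t \<omega> - ?k *\<^sub>R mat 1) *v x)"
    proof eventually_elim
      case (elim \<omega>)
      have lim: "(\<lambda>n. x \<bullet> (Y t \<omega> *v x) + 1 / real (Suc n) * (norm x)\<^sup>2) \<longlonglongrightarrow> x \<bullet> (Y t \<omega> *v x) + 0 * (norm x)\<^sup>2"
        by (intro tendsto_intros LIMSEQ_Suc[OF lim_1_over_n])
      have "?k * (norm x)\<^sup>2 \<le> x \<bullet> (Y t \<omega> *v x) + 0 * (norm x)\<^sup>2"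
        by (rule tendsto_lowerbound[OF lim]) (use elim in auto)
      then show ?case
        by (simp add: matrix_vector_mult_diff_rdistrib inner_diff_right scaleR_matrix_vector_assoc[symmetric] power2_norm_eq_inner)
    qed
  next
    show "AE \<omega> in M. \<forall>S. 0 \<le> S \<and> S < T \<longrightarrow> continuous_on {0..S} (\<lambda>t. Y t \<omega> - ?k *\<^sub>R mat 1)"
      using Y_continuous by eventually_elim (auto intro: continuous_intros)
  qed
  then show ?thesis using AE_space
  proof eventually_elim
    case (elim \<omega>)
    show ?case
    proof (intro allI impI)
      fix t assume t: "0 \<le> t \<and> t < T"
      then have "sym_mat (Y t \<omega>)" using Y_psd[of t \<omega>] elim(2) by (simp add: psd_def)
      then show "coercive ?k (Y t \<omega>)"
        using elim(1) t unfolding coercive_def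
        by (simp add: matrix_vector_mult_diff_rdistrib inner_diff_right scaleR_matrix_vector_assoc[symmetric] power2_norm_eq_inner)
    qed
  qed
qed

end

section \<open>Minimality\<close>

context multiplicative_increments
begin

lemma D_inverse_form:
  assumes r: "0 \<le> r" "r \<le> T" and \<omega>: "\<omega> \<in> space M"
  shows "matrix_inv (\<eta> r \<omega>) *v (D r \<omega> *v y) = minv r *v y" "0 \<le> (D r \<omega> *v y) \<bullet> (minv r *v y)"
proof -
  have D: "D r \<omega> *v y = \<eta> r \<omega> *v (minv r *v y)" unfolding D_vec minv_eq[OF r] ..
  show "matrix_inv (\<eta> r \<omega>) *v (D r \<omega> *v y) = minv r *v y"
    unfolding D by (rule spd_mult_inv(2)[OF eta_spd[OF r \<omega>]])
  show "0 \<le> (D r \<omega> *v y) \<bullet> (minv r *v y)"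
    unfolding D inner_commute[of "\<eta> r \<omega> *v _"] by (rule psd_quad_nonneg[OF spd_imp_psd[OF eta_spd[OF r \<omega>]]])
qed

text \<open>By the martingale property the mean over an event of \<open>F\<^sub>t\<close> does not depend on \<open>r \<ge> t\<close>.\<close>

lemma D_mean:
  assumes t: "0 \<le> t" "t \<le> r" "r \<le> T" and A: "A \<in> sets (F t)"
  shows "integrable M (\<lambda>\<omega>. indicator A \<omega> * (z \<bullet> (D r \<omega> *v y)))"
    "expectation (\<lambda>\<omega>. indicator A \<omega> * (z \<bullet> (D r \<omega> *v y))) = z \<bullet> (LINT \<omega>|M. indicator A \<omega> *\<^sub>R (D t \<omega> *v y))"
proof -
  have tT: "t \<le> T" and r0: "0 \<le> r" using t by simp_all
  have AM: "A \<in> sets M" using A sets_F_M[OF tT] by auto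
  have int: "integrable M (\<lambda>\<omega>. indicator A \<omega> *\<^sub>R (D u \<omega> *v y))" if "0 \<le> u" "u \<le> T" for u
    by (rule integrable_mult_indicator[OF AM D_vec_int[OF that]])
  show "integrable M (\<lambda>\<omega>. indicator A \<omega> * (z \<bullet> (D r \<omega> *v y)))"
    using integrable_inner_right[OF int[OF r0 t(3)], of z] by simp
  have "expectation (\<lambda>\<omega>. indicator A \<omega> * (z \<bullet> (D r \<omega> *v y))) = expectation (\<lambda>\<omega>. z \<bullet> (indicator A \<omega> *\<^sub>R (D t \<omega> *v y)))"
    using D_martingale_inner[OF t A, of z y] by simp
  also have "\<dots> = z \<bullet> (LINT \<omega>|M. indicator A \<omega> *\<^sub>R (D t \<omega> *v y))"
    by (rule integral_inner_right) (rule int[OF t(1) tT])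
  finally show "expectation (\<lambda>\<omega>. indicator A \<omega> * (z \<bullet> (D r \<omega> *v y))) = z \<bullet> (LINT \<omega>|M. indicator A \<omega> *\<^sub>R (D t \<omega> *v y))" .
qed

text \<open>The dual inequality takes bounded terminal values, whereas \<open>D\<^sub>T y\<close> is only square integrable.\<close>

definition trunc :: "real^'n \<Rightarrow> real \<Rightarrow> 'a \<Rightarrow> real^'n" where
  "trunc y K \<omega> = (if norm (D T \<omega> *v y) \<le> K then D T \<omega> *v y else 0)"

definition trunc_error :: "real^'n \<Rightarrow> real \<Rightarrow> real" where
  "trunc_error y K = expectation (\<lambda>\<omega>. (norm (trunc y K \<omega> - D T \<omega> *v y))\<^sup>2)"

lemma DT_int: "integrable M (\<lambda>\<omega>. D T \<omega> *v y)"
  by (rule D_vec_int) (use T_nonneg in simp_all)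

lemma trunc_M: "trunc y K \<in> borel_measurable M"
proof -
  have [measurable]: "(\<lambda>\<omega>. D T \<omega> *v y) \<in> borel_measurable M" by (rule borel_measurable_integrable[OF DT_int])
  show ?thesis unfolding trunc_def[abs_def] by measurable
qed

lemma trunc_bound: "0 \<le> K \<Longrightarrow> norm (trunc y K \<omega>) \<le> K"
  by (simp add: trunc_def)

lemma trunc_diff_le: "norm (trunc y K \<omega> - D T \<omega> *v y) \<le> norm (D T \<omega> *v y)"
  by (simp add: trunc_def)

lemma trunc_int: "integrable M (trunc y K)"
  by (rule Bochner_Integration.integrable_bound[OF DT_int[of y] trunc_M]) (simp add: trunc_def)

lemma trunc_diff_sq_int: "integrable M (\<lambda>\<omega>. (norm (trunc y K \<omega> - D T \<omega> *v y))\<^sup>2)"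
proof (rule Bochner_Integration.integrable_bound[OF D_T_sq[of y]])
  show "(\<lambda>\<omega>. (norm (trunc y K \<omega> - D T \<omega> *v y))\<^sup>2) \<in> borel_measurable M"
    by (intro borel_measurable_power measurable_compose[OF _ borel_measurable_norm] borel_measurable_diff trunc_M
        borel_measurable_integrable[OF DT_int])
  have "(norm (trunc y K \<omega> - D T \<omega> *v y))\<^sup>2 \<le> (norm (D T \<omega> *v y))\<^sup>2" for \<omega>
    by (rule power_mono[OF trunc_diff_le]) simp
  then show "AE \<omega> in M. norm ((norm (trunc y K \<omega> - D T \<omega> *v y))\<^sup>2) \<le> norm ((norm (D T \<omega> *v y))\<^sup>2)" by simp
qed

lemma trunc_eventually: "\<forall>\<^sub>F k in sequentially. trunc y (real k) \<omega> = D T \<omega> *v y"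
proof -
  obtain n :: nat where n: "norm (D T \<omega> *v y) \<le> real n" using real_arch_simple by blast
  show ?thesis unfolding eventually_sequentially
  proof (intro exI allI impI)
    fix k assume "n \<le> k"
    then have "norm (D T \<omega> *v y) \<le> real k" using n by linarith
    then show "trunc y (real k) \<omega> = D T \<omega> *v y" by (simp add: trunc_def)
  qed
qed

lemma trunc_error_tendsto_0: "(\<lambda>k. trunc_error y (real k)) \<longlonglongrightarrow> 0"
proof -
  have "(\<lambda>k. trunc_error y (real k)) \<longlonglongrightarrow> expectation (\<lambda>_. 0)"
    unfolding trunc_error_def
  proof (rule integral_dominated_convergence[where w="\<lambda>\<omega>. (norm (D T \<omega> *v y))\<^sup>2"])
    show "(\<lambda>\<omega>. (norm (trunc y (real k) \<omega> - D T \<omega> *v y))\<^sup>2) \<in> borel_measurable M" for k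
      by (rule borel_measurable_integrable[OF trunc_diff_sq_int])
    show "AE \<omega> in M. (\<lambda>k. (norm (trunc y (real k) \<omega> - D T \<omega> *v y))\<^sup>2) \<longlonglongrightarrow> 0"
    proof (rule AE_I2)
      fix \<omega>
      have "\<forall>\<^sub>F k in sequentially. (norm (trunc y (real k) \<omega> - D T \<omega> *v y))\<^sup>2 = 0"
        using trunc_eventually[of y \<omega>] by eventually_elim simp
      then show "(\<lambda>k. (norm (trunc y (real k) \<omega> - D T \<omega> *v y))\<^sup>2) \<longlonglongrightarrow> 0" by (rule tendsto_eventually)
    qed
    have "(norm (trunc y (real k) \<omega> - D T \<omega> *v y))\<^sup>2 \<le> (norm (D T \<omega> *v y))\<^sup>2" for \<omega> k
      by (rule power_mono[OF trunc_diff_le]) simp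
    then show "AE \<omega> in M. norm ((norm (trunc y (real k) \<omega> - D T \<omega> *v y))\<^sup>2) \<le> (norm (D T \<omega> *v y))\<^sup>2" for k by simp
  qed (use D_T_sq in simp_all)
  then show ?thesis by simp
qed

lemma trunc_mean_tendsto:
  assumes A: "A \<in> sets M"
  shows "(\<lambda>k. expectation (\<lambda>\<omega>. indicator A \<omega> * (x \<bullet> trunc y (real k) \<omega>)))
    \<longlonglongrightarrow> expectation (\<lambda>\<omega>. indicator A \<omega> * (x \<bullet> (D T \<omega> *v y)))"
proof (rule integral_dominated_convergence[where w="\<lambda>\<omega>. norm x * norm (D T \<omega> *v y)"])
  show "(\<lambda>\<omega>. indicator A \<omega> * (x \<bullet> trunc y (real k) \<omega>)) \<in> borel_measurable M" for k
    by (intro borel_measurable_times borel_measurable_indicator A borel_measurable_inner borel_measurable_const trunc_M)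
  show "(\<lambda>\<omega>. indicator A \<omega> * (x \<bullet> (D T \<omega> *v y))) \<in> borel_measurable M"
    by (intro borel_measurable_times borel_measurable_indicator A borel_measurable_inner borel_measurable_const
        borel_measurable_integrable[OF DT_int])
  show "integrable M (\<lambda>\<omega>. norm x * norm (D T \<omega> *v y))"
    by (intro integrable_mult_right integrable_norm DT_int)
  show "AE \<omega> in M. (\<lambda>k. indicator A \<omega> * (x \<bullet> trunc y (real k) \<omega>)) \<longlonglongrightarrow> indicator A \<omega> * (x \<bullet> (D T \<omega> *v y))"
  proof (rule AE_I2)
    fix \<omega>
    have "\<forall>\<^sub>F k in sequentially. indicator A \<omega> * (x \<bullet> trunc y (real k) \<omega>) = indicator A \<omega> * (x \<bullet> (D T \<omega> *v y))"
      using trunc_eventually[of y \<omega>] by eventually_elim simp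
    then show "(\<lambda>k. indicator A \<omega> * (x \<bullet> trunc y (real k) \<omega>)) \<longlonglongrightarrow> indicator A \<omega> * (x \<bullet> (D T \<omega> *v y))"
      by (rule tendsto_eventually)
  qed
  show "AE \<omega> in M. norm (indicator A \<omega> * (x \<bullet> trunc y (real k) \<omega>)) \<le> norm x * norm (D T \<omega> *v y)" for k
  proof (rule AE_I2)
    fix \<omega>
    have "norm (indicator A \<omega> * (x \<bullet> trunc y (real k) \<omega>)) \<le> \<bar>x \<bullet> trunc y (real k) \<omega>\<bar>"
      by (simp add: indicator_def)
    also have "\<dots> \<le> norm x * norm (trunc y (real k) \<omega>)" by (rule Cauchy_Schwarz_ineq2)
    also have "\<dots> \<le> norm x * norm (D T \<omega> *v y)" by (intro mult_left_mono) (simp_all add: trunc_def)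
    finally show "norm (indicator A \<omega> * (x \<bullet> trunc y (real k) \<omega>)) \<le> norm x * norm (D T \<omega> *v y)" .
  qed
qed

lemma cexp_trunc_error:
  assumes r: "0 \<le> r" "r \<le> T"
  shows "integrable M (\<lambda>\<omega>. (norm (cexp (trunc y K) r \<omega> - D r \<omega> *v y))\<^sup>2)"
    "expectation (\<lambda>\<omega>. (norm (cexp (trunc y K) r \<omega> - D r \<omega> *v y))\<^sup>2) \<le> trunc_error y K"
proof -
  let ?U = "\<lambda>\<omega>. trunc y K \<omega> - D T \<omega> *v y"
  have U: "integrable M ?U" by (rule Bochner_Integration.integrable_diff[OF trunc_int DT_int])
  note C = cexp_contraction[OF U trunc_diff_sq_int r(2)]
  have eq: "AE \<omega> in M. (norm (cexp ?U r \<omega>))\<^sup>2 = (norm (cexp (trunc y K) r \<omega> - D r \<omega> *v y))\<^sup>2"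
    using cexp_diff[OF trunc_int[of y K] DT_int[of y] r(2)] D_cexp[OF r, of y] by eventually_elim simp
  have m1: "(\<lambda>\<omega>. (norm (cexp (trunc y K) r \<omega> - D r \<omega> *v y))\<^sup>2) \<in> borel_measurable M"
    by (intro borel_measurable_power measurable_compose[OF _ borel_measurable_norm] borel_measurable_diff
        cexp_measurable r borel_measurable_integrable[OF D_vec_int])
  note m2 = borel_measurable_integrable[OF C(1)]
  show "integrable M (\<lambda>\<omega>. (norm (cexp (trunc y K) r \<omega> - D r \<omega> *v y))\<^sup>2)"
    using integrable_cong_AE[OF m2 m1 eq] C(1) by blast
  show "expectation (\<lambda>\<omega>. (norm (cexp (trunc y K) r \<omega> - D r \<omega> *v y))\<^sup>2) \<le> trunc_error y K"
    unfolding integral_cong_AE[OF m2 m1 eq, symmetric] trunc_error_def by (rule C(2))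
qed

text \<open>Since \<open>Y R\<^sup>-\<^sup>1 N = N\<close> for \<open>R = Y\<close>, the drift in the optimal direction is \<open>\<langle>N\<^sub>r, \<eta>\<^sub>r\<^sup>-\<^sup>1 N\<^sub>r\<rangle>\<close>. Up to the error of
  truncation, this is \<open>\<langle>D\<^sub>r y, \<eta>\<^sub>r\<^sup>-\<^sup>1 D\<^sub>r y\<rangle> = \<langle>D\<^sub>r y, E[\<eta>\<^sub>r]\<^sup>-\<^sup>1 y\<rangle>\<close>, which is linear in \<open>D\<^sub>r\<close>. Its mean over \<open>A\<close> is
  therefore \<open>\<langle>w, E[\<eta>\<^sub>r]\<^sup>-\<^sup>1 y\<rangle>\<close>, and the integral over \<open>r\<close> is \<open>\<langle>w, G(t) y\<rangle> = \<langle>w, x\<rangle>\<close>.\<close>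

lemma trunc_dual_bound:
  assumes S: "supersolution_process M W T \<eta> Y Z I \<delta>" and t: "0 \<le> t" "t < T" and A: "A \<in> sets (F t)"
    and k: "0 < \<kappa>" and y: "G t *v y = x"
  defines "w \<equiv> LINT \<omega>|M. indicator A \<omega> *\<^sub>R (D t \<omega> *v y)"
  shows "expectation (\<lambda>\<omega>. indicator A \<omega> * (2 * (x \<bullet> trunc y (real K) \<omega>) - x \<bullet> (Y t \<omega> *v x)))
    \<le> (1 + \<kappa>) * (w \<bullet> x) + (1 + 1/\<kappa>) / \<delta> * trunc_error y (real K) * (T - t)"
proof -
  interpret S: supersolution_process M W T \<eta> Y Z I \<delta> by (rule S)
  have c: "0 < \<delta> / (4 * T)" using delta T_pos by simp
  interpret D: dual_bound M W T \<eta> Y Z I \<delta> 0 "\<delta> / (4 * T)" "real K" t "trunc y (real K)" A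
    by unfold_locales (use c S.Y_coercive trunc_M trunc_bound t A in simp_all)
  have R: "D.R r \<omega> = Y r \<omega>" for r \<omega> by (simp add: D.R_def)
  let ?C = "(1 + 1/\<kappa>) / \<delta>"
  have C: "0 \<le> ?C" using k delta by simp
  let ?b = "\<lambda>r. (1 + \<kappa>) * (w \<bullet> (minv r *v y)) + ?C * trunc_error y (real K)"
  have e: "0 \<le> trunc_error y (real K)" unfolding trunc_error_def by simp
  have mean: "integrable M (\<lambda>\<omega>. indicator A \<omega> * ((D r \<omega> *v y) \<bullet> (minv r *v y)))"
    "expectation (\<lambda>\<omega>. indicator A \<omega> * ((D r \<omega> *v y) \<bullet> (minv r *v y))) = w \<bullet> (minv r *v y)" if r: "t \<le> r" "r \<le> T" for r
    using D_mean[OF t(1) r A, of "minv r *v y" y] unfolding w_def inner_commute[of "minv r *v y"] by simp_all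
  have b_nonneg: "0 \<le> ?b r" if r: "r \<in> {t..T}" for r
  proof -
    have "0 \<le> expectation (\<lambda>\<omega>. indicator A \<omega> * ((D r \<omega> *v y) \<bullet> (minv r *v y)))"
      by (rule integral_nonneg_AE, rule AE_I2) (use r t D_inverse_form(2)[of r] in simp)
    then have "0 \<le> w \<bullet> (minv r *v y)" using mean(2)[of r] r by simp
    then show ?thesis using k C e by (intro add_nonneg_nonneg mult_nonneg_nonneg) simp_all
  qed
  have i1: "set_integrable lborel {t..T} (\<lambda>r. (1 + \<kappa>) * (w \<bullet> (minv r *v y)))"
    by (rule set_integrable_mult_right) (use minv_inner_integrable in simp)
  have i2: "set_integrable lborel {t..T} (\<lambda>r. ?C * trunc_error y (real K))"
    unfolding set_integrable_def by (intro integrable_scaleR_left integrable_real_indicator) (simp_all add: emeasure_lborel_Icc_eq)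
  have b_int: "set_integrable lborel {t..T} ?b" by (rule set_integral_add(1)[OF i1 i2])
  have b: "(\<integral>\<^sup>+\<omega>. ennreal (indicator A \<omega> * D.X r \<omega> (D.p r \<omega>)) \<partial>M) \<le> ennreal (?b r)" if r: "t \<le> r" "r < T" for r
  proof -
    have r': "0 \<le> r" "r \<le> T" using r t by auto
    let ?e = "\<lambda>\<omega>. (norm (cexp (trunc y (real K)) r \<omega> - D r \<omega> *v y))\<^sup>2"
    let ?h = "\<lambda>\<omega>. (1 + \<kappa>) * (indicator A \<omega> * ((D r \<omega> *v y) \<bullet> (minv r *v y))) + ?C * (indicator A \<omega> * ?e \<omega>)"
    note e_int = cexp_trunc_error[OF r', of y "real K"]
    have Ae_int: "integrable M (\<lambda>\<omega>. indicator A \<omega> * ?e \<omega>)"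
      using integrable_mult_indicator[OF D.AM e_int(1)] by simp
    have h_int: "integrable M ?h"
      by (intro Bochner_Integration.integrable_add integrable_mult_right mean(1) Ae_int r r')
    have h_nonneg: "AE \<omega> in M. 0 \<le> ?h \<omega>"
      by (rule AE_I2) (use D_inverse_form(2)[OF r'] k C in \<open>intro add_nonneg_nonneg mult_nonneg_nonneg; simp\<close>)
    have "AE \<omega> in M. ennreal (indicator A \<omega> * D.X r \<omega> (D.p r \<omega>)) \<le> ennreal (?h \<omega>)"
      using D.p_eq[OF r'(1) r(2)] D.R_coercive' eta_coercive AE_space
    proof eventually_elim
      case (elim \<omega>)
      let ?N = "cexp (trunc y (real K)) r \<omega>" and ?a = "D r \<omega> *v y"
      have Rc: "coercive (\<delta> / (4 * T)) (Y r \<omega>)" using elim(2) r r' unfolding R by blast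
      have "Y r \<omega> *v D.p r \<omega> = ?N"
        unfolding elim(1) R by (rule spd_mult_inv(1)[OF coercive_spd[OF c Rc]])
      then have "D.X r \<omega> (D.p r \<omega>) = (?a + (?N - ?a)) \<bullet> (matrix_inv (\<eta> r \<omega>) *v (?a + (?N - ?a)))"
        unfolding D.X_def by simp
      also have "\<dots> \<le> (1 + \<kappa>) * (?a \<bullet> (matrix_inv (\<eta> r \<omega>) *v ?a)) + (1 + 1/\<kappa>) * ((?N - ?a) \<bullet> (matrix_inv (\<eta> r \<omega>) *v (?N - ?a)))"
        by (rule psd_young[OF spd_imp_psd[OF spd_matrix_inv[OF eta_spd[OF r' elim(4)]]] k])
      also have "\<dots> \<le> (1 + \<kappa>) * (?a \<bullet> (minv r *v y)) + (1 + 1/\<kappa>) * (?e \<omega> / \<delta>)"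
        unfolding D_inverse_form(1)[OF r' elim(4)]
        by (intro add_left_mono mult_left_mono coercive_quad_inv[OF delta]) (use elim(3) r' k in simp_all)
      finally have le: "D.X r \<omega> (D.p r \<omega>) \<le> (1 + \<kappa>) * (?a \<bullet> (minv r *v y)) + ?C * ?e \<omega>" by simp
      show ?case
        by (rule ennreal_leI, cases "\<omega> \<in> A") (use le in simp_all)
    qed
    then have "(\<integral>\<^sup>+\<omega>. ennreal (indicator A \<omega> * D.X r \<omega> (D.p r \<omega>)) \<partial>M) \<le> (\<integral>\<^sup>+\<omega>. ennreal (?h \<omega>) \<partial>M)"
      by (rule nn_integral_mono_AE)
    also have "\<dots> = ennreal (expectation ?h)" by (rule nn_integral_eq_integral[OF h_int h_nonneg])
    also have "\<dots> \<le> ennreal (?b r)"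
    proof (rule ennreal_leI)
      have "expectation ?h = (1 + \<kappa>) * (w \<bullet> (minv r *v y)) + ?C * expectation (\<lambda>\<omega>. indicator A \<omega> * ?e \<omega>)"
        using mean[OF r(1) r'(2)] Ae_int by (subst Bochner_Integration.integral_add) simp_all
      moreover have "expectation (\<lambda>\<omega>. indicator A \<omega> * ?e \<omega>) \<le> expectation ?e"
        by (rule integral_mono_AE[OF Ae_int e_int(1)]) (simp add: indicator_def)
      ultimately show "expectation ?h \<le> ?b r"
        using mult_left_mono[OF order_trans[OF _ e_int(2)] C] by simp
    qed
    finally show ?thesis .
  qed
  have "expectation (\<lambda>\<omega>. indicator A \<omega> * (2 * (x \<bullet> trunc y (real K) \<omega>) - x \<bullet> (Y t \<omega> *v x))) \<le> (LINT r:{t..T}|lborel. ?b r)"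
    using D.dual_inequality[OF b_int b_nonneg b, of x] unfolding R .
  also have "\<dots> = (1 + \<kappa>) * (w \<bullet> x) + ?C * trunc_error y (real K) * (T - t)"
  proof -
    have "(LINT r:{t..T}|lborel. ?b r) = (1 + \<kappa>) * (LINT r:{t..T}|lborel. w \<bullet> (minv r *v y)) + (LINT r:{t..T}|lborel. ?C * trunc_error y (real K))"
      unfolding set_integral_add(2)[OF i1 i2] by simp
    also have "(LINT r:{t..T}|lborel. w \<bullet> (minv r *v y)) = w \<bullet> x" unfolding G_inner[symmetric] y ..
    also have "(LINT r:{t..T}|lborel. ?C * trunc_error y (real K)) = ?C * trunc_error y (real K) * (T - t)"
      using t unfolding set_lebesgue_integral_def by simp
    finally show ?thesis .
  qed
  finally show ?thesis .
qed

text \<open>First the truncation is removed, then \<open>\<kappa>\<close> tends to zero.\<close>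

lemma supersolution_mean_lower_bound:
  assumes S: "supersolution_process M W T \<eta> Y Z I \<delta>" and t: "0 \<le> t" "t < T" and A: "A \<in> sets (F t)"
  shows "expectation (\<lambda>\<omega>. indicator A \<omega> * (x \<bullet> (D t \<omega> *v (matrix_inv (G t) *v x))))
    \<le> expectation (\<lambda>\<omega>. indicator A \<omega> * (x \<bullet> (Y t \<omega> *v x)))"
proof -
  interpret S: supersolution_process M W T \<eta> Y Z I \<delta> by (rule S)
  have tT: "t \<le> T" using t by simp
  have AM: "A \<in> sets M" using A sets_F_M[OF tT] by auto
  define y where "y = matrix_inv (G t) *v x"
  have y: "G t *v y = x" unfolding y_def by (rule spd_mult_inv(1)[OF G_spd[OF t]])
  define w where "w = (LINT \<omega>|M. indicator A \<omega> *\<^sub>R (D t \<omega> *v y))"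
  let ?Q = "expectation (\<lambda>\<omega>. indicator A \<omega> * (x \<bullet> (Y t \<omega> *v x)))"
  have Q_int: "integrable M (\<lambda>\<omega>. indicator A \<omega> * (x \<bullet> (Y t \<omega> *v x)))"
    by (rule S.quad_Y_integrable[OF t, where B="norm x" and p="\<lambda>_. x"]) (simp_all add: AM)
  have wx: "expectation (\<lambda>\<omega>. indicator A \<omega> * (x \<bullet> (D r \<omega> *v y))) = w \<bullet> x" if "t \<le> r" "r \<le> T" for r
    using D_mean(2)[OF t(1) that A, of x y] unfolding w_def by (simp add: inner_commute)
  have tr_int: "integrable M (\<lambda>\<omega>. indicator A \<omega> * (x \<bullet> trunc y (real K) \<omega>))" for K
    using integrable_mult_indicator[OF AM integrable_inner_right[OF trunc_int[of y "real K"], of x]] by simp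
  have bound: "2 * (w \<bullet> x) - ?Q \<le> (1 + \<kappa>) * (w \<bullet> x)" if k: "0 < \<kappa>" for \<kappa>
  proof -
    have le: "2 * expectation (\<lambda>\<omega>. indicator A \<omega> * (x \<bullet> trunc y (real K) \<omega>)) - ?Q
        \<le> (1 + \<kappa>) * (w \<bullet> x) + (1 + 1/\<kappa>) / \<delta> * trunc_error y (real K) * (T - t)" for K
    proof -
      have eq: "indicator A \<omega> * (2 * (x \<bullet> trunc y (real K) \<omega>) - x \<bullet> (Y t \<omega> *v x))
        = 2 * (indicator A \<omega> * (x \<bullet> trunc y (real K) \<omega>)) - indicator A \<omega> * (x \<bullet> (Y t \<omega> *v x))" for \<omega>
        by (simp add: algebra_simps)
      have "2 * expectation (\<lambda>\<omega>. indicator A \<omega> * (x \<bullet> trunc y (real K) \<omega>)) - ?Q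
        = expectation (\<lambda>\<omega>. 2 * (indicator A \<omega> * (x \<bullet> trunc y (real K) \<omega>)) - indicator A \<omega> * (x \<bullet> (Y t \<omega> *v x)))"
        using tr_int Q_int by (subst Bochner_Integration.integral_diff) simp_all
      then show ?thesis
        using trunc_dual_bound[OF S t A k y, of K] unfolding eq w_def by simp
    qed
    have l1: "(\<lambda>K. 2 * expectation (\<lambda>\<omega>. indicator A \<omega> * (x \<bullet> trunc y (real K) \<omega>)) - ?Q) \<longlonglongrightarrow> 2 * (w \<bullet> x) - ?Q"
      using trunc_mean_tendsto[OF AM, of x y] unfolding wx[OF tT order_refl] by (intro tendsto_intros)
    have l2: "(\<lambda>K. (1 + \<kappa>) * (w \<bullet> x) + (1 + 1/\<kappa>) / \<delta> * trunc_error y (real K) * (T - t))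
        \<longlonglongrightarrow> (1 + \<kappa>) * (w \<bullet> x) + (1 + 1/\<kappa>) / \<delta> * 0 * (T - t)"
      by (intro tendsto_intros trunc_error_tendsto_0)
    show ?thesis using LIMSEQ_le[OF l1 l2] le by simp
  qed
  have "2 * (w \<bullet> x) - ?Q \<le> w \<bullet> x"
  proof (rule field_le_epsilon)
    fix e :: real assume e: "0 < e"
    define \<kappa> where "\<kappa> = e / (\<bar>w \<bullet> x\<bar> + 1)"
    have k: "0 < \<kappa>" unfolding \<kappa>_def using e by simp
    have "\<kappa> * (w \<bullet> x) \<le> \<kappa> * (\<bar>w \<bullet> x\<bar> + 1)" using k by (intro mult_left_mono) simp_all
    also have "\<dots> = e" unfolding \<kappa>_def by simp
    finally show "2 * (w \<bullet> x) - ?Q \<le> w \<bullet> x + e" using bound[OF k] by (simp add: algebra_simps)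
  qed
  then show ?thesis using wx[OF order_refl tT] unfolding y_def by simp
qed

theorem inv_int_inv_cond_exp_minimal:
  assumes S: "supersolution_process M W T \<eta> Y Z I \<delta>" and S': "supersolution_process M W T \<eta> Y' Z' I' \<delta>"
    and Y: "inv_int_inv_cond_exp M W T \<eta> Y"
  shows "AE \<omega> in M. \<forall>t\<in>{0..<T}. loewner_le (Y t \<omega>) (Y' t \<omega>)"
proof -
  interpret S: supersolution_process M W T \<eta> Y Z I \<delta> by (rule S)
  interpret S': supersolution_process M W T \<eta> Y' Z' I' \<delta> by (rule S')
  have "AE \<omega> in M. \<forall>t x. 0 \<le> t \<and> t < T \<longrightarrow> 0 \<le> x \<bullet> ((Y' t \<omega> - Y t \<omega>) *v x)"
  proof (rule AE_quad_nonneg_all)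
    fix t x assume t: "0 \<le> t" "t < T"
    have tT: "t \<le> T" using t by simp
    let ?f = "\<lambda>\<omega>. x \<bullet> (Y t \<omega> *v x) - x \<bullet> (Y' t \<omega> *v x)"
    have q: "integrable M (\<lambda>\<omega>. indicator A \<omega> * (x \<bullet> (Y t \<omega> *v x)))"
      "integrable M (\<lambda>\<omega>. indicator A \<omega> * (x \<bullet> (Y' t \<omega> *v x)))" if A: "A \<in> sets M" for A
      by (rule S.quad_Y_integrable[OF t, where B="norm x" and p="\<lambda>_. x"]
          S'.quad_Y_integrable[OF t, where B="norm x" and p="\<lambda>_. x"]; simp add: A)+
    have f_F: "?f \<in> borel_measurable (F t)"
      by (intro borel_measurable_diff borel_measurable_inner borel_measurable_const borel_measurable_mult_vec S.Y_F S'.Y_F t)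
    have "integrable M (\<lambda>\<omega>. indicator (space M) \<omega> * (x \<bullet> (Y t \<omega> *v x)) - indicator (space M) \<omega> * (x \<bullet> (Y' t \<omega> *v x)))"
      by (rule Bochner_Integration.integrable_diff[OF q]) simp_all
    also have "?this \<longleftrightarrow> integrable M ?f" by (rule Bochner_Integration.integrable_cong) auto
    finally have f_int: "integrable M ?f" .
    have "AE \<omega> in M. ?f \<omega> \<le> 0"
    proof (rule AE_le_of_expectations[OF tT f_F f_int])
      fix A assume A: "A \<in> sets (F t)"
      have AM: "A \<in> sets M" using A sets_F_M[OF tT] by auto
      have "expectation (\<lambda>\<omega>. indicator A \<omega> * ?f \<omega>)
        = expectation (\<lambda>\<omega>. indicator A \<omega> * (x \<bullet> (Y t \<omega> *v x)) - indicator A \<omega> * (x \<bullet> (Y' t \<omega> *v x)))"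
        by (simp add: algebra_simps)
      also have "\<dots> = expectation (\<lambda>\<omega>. indicator A \<omega> * (x \<bullet> (Y t \<omega> *v x))) - expectation (\<lambda>\<omega>. indicator A \<omega> * (x \<bullet> (Y' t \<omega> *v x)))"
        by (rule Bochner_Integration.integral_diff[OF q[OF AM]])
      also have "expectation (\<lambda>\<omega>. indicator A \<omega> * (x \<bullet> (Y t \<omega> *v x))) = expectation (\<lambda>\<omega>. indicator A \<omega> * (x \<bullet> (D t \<omega> *v (matrix_inv (G t) *v x))))"
      proof (rule integral_cong_AE)
        show "(\<lambda>\<omega>. indicator A \<omega> * (x \<bullet> (Y t \<omega> *v x))) \<in> borel_measurable M"
          by (rule borel_measurable_integrable[OF q(1)[OF AM]])
        show "(\<lambda>\<omega>. indicator A \<omega> * (x \<bullet> (D t \<omega> *v (matrix_inv (G t) *v x)))) \<in> borel_measurable M"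
          by (rule borel_measurable_integrable[OF D_mean(1)[OF t(1) order_refl tT A]])
        show "AE \<omega> in M. indicator A \<omega> * (x \<bullet> (Y t \<omega> *v x)) = indicator A \<omega> * (x \<bullet> (D t \<omega> *v (matrix_inv (G t) *v x)))"
          using inv_int_inv_cond_exp_eq[OF Y t] by eventually_elim (simp add: matrix_vector_mul_assoc)
      qed
      finally show "expectation (\<lambda>\<omega>. indicator A \<omega> * ?f \<omega>) \<le> 0 * prob A"
        using supersolution_mean_lower_bound[OF S' t A, of x] by simp
    qed
    then show "AE \<omega> in M. 0 \<le> x \<bullet> ((Y' t \<omega> - Y t \<omega>) *v x)"
      by eventually_elim (simp add: matrix_vector_mult_diff_rdistrib inner_diff_right)
  next
    show "AE \<omega> in M. \<forall>S. 0 \<le> S \<and> S < T \<longrightarrow> continuous_on {0..S} (\<lambda>t. Y' t \<omega> - Y t \<omega>)"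
      using S.Y_continuous S'.Y_continuous
    proof eventually_elim
      case (elim \<omega>)
      then show ?case by (intro allI impI continuous_on_diff) simp_all
    qed
  qed
  then show ?thesis using AE_space
  proof eventually_elim
    case (elim \<omega>)
    show ?case
      unfolding loewner_le_def psd_def
    proof (intro ballI conjI allI)
      fix t assume t: "t \<in> {0..<T}"
      have "transpose (Y t \<omega>) = Y t \<omega>" "transpose (Y' t \<omega>) = Y' t \<omega>"
        using S.Y_psd[of t \<omega>] S'.Y_psd[of t \<omega>] t elim(2) by (simp_all add: psd_def sym_mat_def)
      then show "sym_mat (Y' t \<omega> - Y t \<omega>)"
        unfolding sym_mat_def by (simp add: vec_eq_iff transpose_def)
      show "0 \<le> x \<bullet> ((Y' t \<omega> - Y t \<omega>) *v x)" for x using elim(1) t by simp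
    qed
  qed
qed

end

section \<open>The control problem\<close>

context brownian
begin

abbreviation P :: "(real \<times> 'a) measure" where "P \<equiv> lborel \<Otimes>\<^sub>M M"

lemma AE_P_of_AE_M:
  assumes "AE \<omega> in M. Q \<omega>"
  shows "AE z in P. Q (snd z)"
proof -
  obtain N where N: "N \<in> null_sets M" "{\<omega> \<in> space M. \<not> Q \<omega>} \<subseteq> N"
    using assms by (auto simp: eventually_ae_filter)
  have "emeasure P (UNIV \<times> N) = emeasure lborel (UNIV :: real set) * emeasure M N"
    by (rule emeasure_pair_measure_Times) (use N in \<open>auto simp: null_sets_def\<close>)
  then have "UNIV \<times> N \<in> null_sets P" using N(1) by (auto simp: null_sets_def intro!: pair_measureI)
  then show ?thesis by (rule AE_I') (use N(2) in \<open>auto simp: space_pair_measure\<close>)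
qed

end

text \<open>The candidate \<open>u\<close> is prescribed on \<open>[t, T]\<close>; its values at other times are arbitrary.\<close>

locale control_problem = multiplicative_increments M W T \<eta> \<delta>
  for M :: "'a measure" and W T and \<eta> :: "real \<Rightarrow> 'a \<Rightarrow> real^'n^'n" and \<delta> +
  fixes \<theta> :: "'a \<Rightarrow> real^'n^'n" and t :: real and x :: "real^'n" and u :: "real \<Rightarrow> 'a \<Rightarrow> real^'n"
  assumes theta: "\<theta> \<in> borel_measurable (F T)"
    and t: "0 \<le> t" "t < T"
    and u_eq: "\<And>s \<omega>. s \<in> {t..T} \<Longrightarrow> u s \<omega> = minv s *v (matrix_inv (G t) *v x)"
begin

definition y :: "real^'n" where "y = matrix_inv (G t) *v x"

lemma Gy: "G t *v y = x"
  unfolding y_def by (rule spd_mult_inv(1)[OF G_spd[OF t]])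

lemma u_eq': "s \<in> {t..T} \<Longrightarrow> u s \<omega> = minv s *v y"
  using u_eq unfolding y_def .

abbreviation Adm :: "(real \<Rightarrow> 'a \<Rightarrow> real^'n) set" where "Adm \<equiv> admissible M W T t x"

text \<open>Extended by zero in time, controls and \<open>\<eta>\<close> become functions on the product space \<open>P\<close>.\<close>

definition ext :: "(real \<Rightarrow> 'a \<Rightarrow> real^'n) \<Rightarrow> real \<times> 'a \<Rightarrow> real^'n" where
  "ext w z = indicator {t..T} (fst z) *\<^sub>R w (fst z) (snd z)"

definition eta_ext :: "real \<times> 'a \<Rightarrow> real^'n^'n" where
  "eta_ext z = indicator {0..T} (fst z) *\<^sub>R \<eta> (fst z) (snd z)"

definition cost_density :: "(real \<Rightarrow> 'a \<Rightarrow> real^'n) \<Rightarrow> real \<times> 'a \<Rightarrow> real" where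
  "cost_density w z = ext w z \<bullet> (eta_ext z *v ext w z)"

definition running_cost :: "(real \<Rightarrow> 'a \<Rightarrow> real^'n) \<Rightarrow> 'a \<Rightarrow> ennreal" where
  "running_cost w \<omega> = (\<integral>\<^sup>+s. ennreal (cost_density w (s, \<omega>)) \<partial>lborel)"

definition energy :: "(real \<Rightarrow> 'a \<Rightarrow> real^'n) \<Rightarrow> 'a set \<Rightarrow> ennreal" where
  "energy w A = (\<integral>\<^sup>+\<omega>. indicator A \<omega> * running_cost w \<omega> \<partial>M)"

lemma ext_measurable: "prog_measurable F {t..T} w \<Longrightarrow> ext w \<in> borel_measurable P"
  using prog_measurable_joint[of "{t..T}" w T "{t..T}"] t unfolding ext_def[abs_def] case_prod_beta
  by (simp add: Int_absorb2 atLeastAtMost_def)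

lemma eta_ext_measurable: "eta_ext \<in> borel_measurable P"
  using eta_joint unfolding eta_ext_def[abs_def] case_prod_beta .

lemma cost_density_measurable: "prog_measurable F {t..T} w \<Longrightarrow> cost_density w \<in> borel_measurable P"
  unfolding cost_density_def[abs_def]
  by (intro borel_measurable_inner borel_measurable_mult_vec eta_ext_measurable ext_measurable)

lemma eta_ext_psd: "z \<in> space P \<Longrightarrow> psd (eta_ext z)"
proof (cases "fst z \<in> {0..T}")
  case True
  assume "z \<in> space P"
  then show ?thesis using True eta_spd[of "fst z" "snd z"]
    by (auto simp: eta_ext_def space_pair_measure intro: spd_imp_psd)
next
  case False
  then show ?thesis by (simp add: eta_ext_def psd_def sym_mat_def transpose_def vec_eq_iff)
qed

lemma cost_density_nonneg: "z \<in> space P \<Longrightarrow> 0 \<le> cost_density w z"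
  unfolding cost_density_def by (rule psd_quad_nonneg[OF eta_ext_psd])

lemma cost_density_eq: "s \<in> {t..T} \<Longrightarrow> cost_density w (s, \<omega>) = w s \<omega> \<bullet> (\<eta> s \<omega> *v w s \<omega>)"
  using t by (simp add: cost_density_def ext_def eta_ext_def)

lemma running_cost_eq: "(\<integral>\<^sup>+s\<in>{t..T}. ennreal (w s \<omega> \<bullet> (\<eta> s \<omega> *v w s \<omega>)) \<partial>lborel) = running_cost w \<omega>"
  unfolding running_cost_def
proof (rule nn_integral_cong)
  fix s show "ennreal (w s \<omega> \<bullet> (\<eta> s \<omega> *v w s \<omega>)) * indicator {t..T} s = ennreal (cost_density w (s, \<omega>))"
  proof (cases "s \<in> {t..T}")
    case True then show ?thesis by (simp add: cost_density_eq)
  next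
    case False then show ?thesis by (simp add: cost_density_def ext_def)
  qed
qed

sublocale pair: pair_sigma_finite lborel M ..

lemma running_cost_measurable: assumes "prog_measurable F {t..T} w" shows "running_cost w \<in> borel_measurable M"
proof -
  have "(\<lambda>z. ennreal (cost_density w (snd z, fst z))) \<in> borel_measurable (M \<Otimes>\<^sub>M lborel)"
    using measurable_compose[OF measurable_pair_swap' measurable_compose[OF cost_density_measurable[OF assms] measurable_ennreal]]
    by (simp add: case_prod_beta)
  then show ?thesis
    unfolding running_cost_def[abs_def]
    using lborel.borel_measurable_nn_integral_fst[of "\<lambda>z. ennreal (cost_density w (snd z, fst z))" M] by simp
qed

lemma energy_P:
  assumes w: "prog_measurable F {t..T} w" and A: "A \<in> sets M"
  shows "energy w A = (\<integral>\<^sup>+z. ennreal (indicator A (snd z) * cost_density w z) \<partial>P)"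
proof -
  have m: "(\<lambda>z. ennreal (indicator A (snd z) * cost_density w z)) \<in> borel_measurable P"
    by (intro measurable_compose[OF _ measurable_ennreal] borel_measurable_times cost_density_measurable w
        measurable_compose[OF measurable_snd] borel_measurable_indicator A)
  have "(\<integral>\<^sup>+z. ennreal (indicator A (snd z) * cost_density w z) \<partial>P) = (\<integral>\<^sup>+\<omega>. \<integral>\<^sup>+s. ennreal (indicator A \<omega> * cost_density w (s, \<omega>)) \<partial>lborel \<partial>M)"
    using pair.nn_integral_snd[OF m] by simp
  also have "\<dots> = energy w A"
    unfolding energy_def running_cost_def
    by (rule nn_integral_cong) (simp add: indicator_def)
  finally show ?thesis ..
qed

lemma admissibleD:
  assumes "w \<in> Adm"
  shows "prog_measurable F {t..T} w" "AE \<omega> in M. set_integrable lborel {t..T} (\<lambda>s. w s \<omega>)"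
    "AE \<omega> in M. state_process t x w T \<omega> = 0"
  using assms unfolding admissible_def by blast+

lemma state_measurable: assumes "prog_measurable F {t..T} w" shows "state_process t x w T \<in> borel_measurable M"
proof -
  have m: "(\<lambda>z. ext w (snd z, fst z)) \<in> borel_measurable (M \<Otimes>\<^sub>M lborel)"
    using measurable_compose[OF measurable_pair_swap' ext_measurable[OF assms]]
    by (simp add: case_prod_beta)
  have "(\<lambda>\<omega>. LINT s|lborel. ext w (s, \<omega>)) \<in> borel_measurable M"
    by (rule lborel.borel_measurable_lebesgue_integral) (use m in \<open>simp add: case_prod_beta\<close>)
  then have "(\<lambda>\<omega>. x - (LINT s|lborel. ext w (s, \<omega>))) \<in> borel_measurable M"
    by (rule borel_measurable_diff[OF borel_measurable_const])
  then show ?thesis unfolding state_process_def[abs_def] set_lebesgue_integral_def ext_def by simp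
qed

lemma cost_F: "cost M W T \<eta> \<theta> t x w \<in> borel_measurable (F t)"
  unfolding cost_def[abs_def] by (rule borel_measurable_nn_cond_exp)

lemma cost_eq:
  assumes w: "w \<in> Adm"
  shows "AE \<omega> in M. cost M W T \<eta> \<theta> t x w \<omega> = nn_cond_exp M (F t) (running_cost w) \<omega>"
proof -
  interpret t: sigma_finite_subalgebra M "F t" by (rule sigma_finite_F) (use t in simp)
  note w' = admissibleD[OF w]
  have thM: "\<theta> \<in> borel_measurable M" by (rule measurable_F_M[OF theta order_refl])
  show ?thesis unfolding cost_def running_cost_eq
  proof (rule t.nn_cond_exp_cong)
    show "AE \<omega> in M. running_cost w \<omega> + ennreal (state_process t x w T \<omega> \<bullet> (\<theta> \<omega> *v state_process t x w T \<omega>)) = running_cost w \<omega>"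
      using w'(3) by eventually_elim simp
    show "(\<lambda>\<omega>. running_cost w \<omega> + ennreal (state_process t x w T \<omega> \<bullet> (\<theta> \<omega> *v state_process t x w T \<omega>))) \<in> borel_measurable M"
      by (intro borel_measurable_add running_cost_measurable w' measurable_compose[OF _ measurable_ennreal]
          borel_measurable_inner borel_measurable_mult_vec state_measurable thM)
    show "running_cost w \<in> borel_measurable M" by (rule running_cost_measurable[OF w'(1)])
  qed
qed

lemma energy_cost:
  assumes w: "w \<in> Adm" and A: "A \<in> sets (F t)"
  shows "energy w A = (\<integral>\<^sup>+\<omega>. indicator A \<omega> * cost M W T \<eta> \<theta> t x w \<omega> \<partial>M)"
proof -
  interpret t: sigma_finite_subalgebra M "F t" by (rule sigma_finite_F) (use t in simp)
  have "energy w A = (\<integral>\<^sup>+\<omega>. indicator A \<omega> * nn_cond_exp M (F t) (running_cost w) \<omega> \<partial>M)"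
    unfolding energy_def
    by (rule t.nn_cond_exp_intg[symmetric]) (use A running_cost_measurable[OF admissibleD(1)[OF w]] in simp_all)
  also have "\<dots> = (\<integral>\<^sup>+\<omega>. indicator A \<omega> * cost M W T \<eta> \<theta> t x w \<omega> \<partial>M)"
    by (rule nn_integral_cong_AE) (use cost_eq[OF w] in eventually_elim, simp)
  finally show ?thesis .
qed

lemma u_prog: "prog_measurable F {t..T} u"
  unfolding prog_measurable_def
proof
  fix r assume r: "r \<in> {t..T}"
  have "(\<lambda>z. minv (fst z) *v y) \<in> borel_measurable (restrict_space borel ({t..T} \<inter> {..r}) \<Otimes>\<^sub>M F r)"
    by (rule measurable_compose[OF measurable_fst measurable_restrict_space1[OF minv_vec_measurable]])
  also have "?this \<longleftrightarrow> (\<lambda>(s, \<omega>). u s \<omega>) \<in> borel_measurable (restrict_space borel ({t..T} \<inter> {..r}) \<Otimes>\<^sub>M F r)"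
    by (rule measurable_cong) (auto simp: space_pair_measure space_restrict_space u_eq')
  finally show "(\<lambda>(s, \<omega>). u s \<omega>) \<in> borel_measurable (restrict_space borel ({t..T} \<inter> {..r}) \<Otimes>\<^sub>M F r)" .
qed

lemma u_integral:
  shows "set_integrable lborel {t..T} (\<lambda>s. u s \<omega>)" "(LINT s:{t..T}|lborel. u s \<omega>) = x"
proof -
  have "set_integrable lborel {t..T} (\<lambda>s. u s \<omega>) \<longleftrightarrow> set_integrable lborel {t..T} (\<lambda>s. minv s *v y)"
    by (rule set_integrable_cong) (simp_all add: u_eq')
  then show "set_integrable lborel {t..T} (\<lambda>s. u s \<omega>)" using minv_vec_integrable by simp
  have "(LINT s:{t..T}|lborel. u s \<omega>) = (LINT s:{t..T}|lborel. minv s *v y)"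
    by (rule set_lebesgue_integral_cong) (simp_all add: u_eq')
  then show "(LINT s:{t..T}|lborel. u s \<omega>) = x" unfolding G_vec[symmetric] Gy .
qed

lemma u_admissible: "u \<in> Adm"
  unfolding admissible_def state_process_def using u_prog u_integral by simp

text \<open>By Tonelli, the energy is the integral over \<open>s\<close> of the means of \<open>\<langle>D\<^sub>s y, E[\<eta>\<^sub>s]\<^sup>-\<^sup>1 y\<rangle>\<close>. These are linear in
  the mean of \<open>D\<^sub>s y\<close>, which does not depend on \<open>s\<close>.\<close>

lemma energy_u:
  assumes A: "A \<in> sets (F t)"
  shows "energy u A = ennreal (expectation (\<lambda>\<omega>. indicator A \<omega> * (x \<bullet> (D t \<omega> *v y))))"
    "0 \<le> expectation (\<lambda>\<omega>. indicator A \<omega> * (x \<bullet> (D t \<omega> *v y)))"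
proof -
  have tT: "t \<le> T" using t by simp
  have AM: "A \<in> sets M" using A sets_F_M[OF tT] by auto
  define w where "w = (LINT \<omega>|M. indicator A \<omega> *\<^sub>R (D t \<omega> *v y))"
  have mean: "integrable M (\<lambda>\<omega>. indicator A \<omega> * ((D s \<omega> *v y) \<bullet> (minv s *v y)))"
    "expectation (\<lambda>\<omega>. indicator A \<omega> * ((D s \<omega> *v y) \<bullet> (minv s *v y))) = w \<bullet> (minv s *v y)" if s: "s \<in> {t..T}" for s
    using D_mean[OF t(1) _ _ A, of s "minv s *v y" y] s unfolding w_def inner_commute[of "minv s *v y"] by simp_all
  have nn: "0 \<le> indicator A \<omega> * ((D s \<omega> *v y) \<bullet> (minv s *v y))" if "s \<in> {t..T}" "\<omega> \<in> space M" for s \<omega>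
    using D_inverse_form(2)[of s \<omega> y] that t by simp
  have w_nn: "0 \<le> w \<bullet> (minv s *v y)" if s: "s \<in> {t..T}" for s
    unfolding mean(2)[OF s, symmetric] by (rule integral_nonneg_AE, rule AE_I2) (rule nn[OF s])
  have inner: "(\<integral>\<^sup>+\<omega>. ennreal (indicator A (snd (s, \<omega>)) * cost_density u (s, \<omega>)) \<partial>M)
      = ennreal (indicator {t..T} s *\<^sub>R (w \<bullet> (minv s *v y)))" for s
  proof (cases "s \<in> {t..T}")
    case True
    have "(\<integral>\<^sup>+\<omega>. ennreal (indicator A (snd (s, \<omega>)) * cost_density u (s, \<omega>)) \<partial>M)
      = (\<integral>\<^sup>+\<omega>. ennreal (indicator A \<omega> * ((D s \<omega> *v y) \<bullet> (minv s *v y))) \<partial>M)"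
      by (rule nn_integral_cong)
         (use True t in \<open>simp add: cost_density_eq u_eq' D_vec minv_eq inner_commute\<close>)
    also have "\<dots> = ennreal (w \<bullet> (minv s *v y))"
      unfolding mean(2)[OF True, symmetric]
      by (rule nn_integral_eq_integral[OF mean(1)[OF True]]) (rule AE_I2, rule nn[OF True])
    finally show ?thesis using True by simp
  next
    case False
    then show ?thesis by (simp add: cost_density_def ext_def)
  qed
  have m: "(\<lambda>z. ennreal (indicator A (snd z) * cost_density u z)) \<in> borel_measurable P"
    by (intro measurable_compose[OF _ measurable_ennreal] borel_measurable_times cost_density_measurable u_prog
        measurable_compose[OF measurable_snd] borel_measurable_indicator AM)
  have "energy u A = (\<integral>\<^sup>+s. ennreal (indicator {t..T} s *\<^sub>R (w \<bullet> (minv s *v y))) \<partial>lborel)"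
    unfolding energy_P[OF u_prog AM] nn_integral_fst[OF m, symmetric] inner ..
  also have "\<dots> = ennreal (LINT s:{t..T}|lborel. w \<bullet> (minv s *v y))"
    unfolding set_lebesgue_integral_def
  proof (rule nn_integral_eq_integral)
    show "integrable lborel (\<lambda>s. indicator {t..T} s *\<^sub>R (w \<bullet> (minv s *v y)))"
      using minv_inner_integrable unfolding set_integrable_def .
    show "AE s in lborel. 0 \<le> indicator {t..T} s *\<^sub>R (w \<bullet> (minv s *v y))"
      by (rule AE_I2) (use w_nn in \<open>simp add: indicator_def\<close>)
  qed
  also have "(LINT s:{t..T}|lborel. w \<bullet> (minv s *v y)) = w \<bullet> x" unfolding G_inner[symmetric] Gy ..
  also have wx: "w \<bullet> x = expectation (\<lambda>\<omega>. indicator A \<omega> * (x \<bullet> (D t \<omega> *v y)))"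
    using D_mean(2)[OF t(1) order_refl tT A, of x y] unfolding w_def by (simp add: inner_commute)
  finally show "energy u A = ennreal (expectation (\<lambda>\<omega>. indicator A \<omega> * (x \<bullet> (D t \<omega> *v y))))" .
  have "0 \<le> (LINT s:{t..T}|lborel. w \<bullet> (minv s *v y))"
    unfolding set_lebesgue_integral_def by (rule integral_nonneg_AE, rule AE_I2) (use w_nn in \<open>simp add: indicator_def\<close>)
  then show "0 \<le> expectation (\<lambda>\<omega>. indicator A \<omega> * (x \<bullet> (D t \<omega> *v y)))"
    unfolding G_inner[symmetric] Gy wx .
qed

lemma cost_u: "AE \<omega> in M. cost M W T \<eta> \<theta> t x u \<omega> = ennreal (x \<bullet> (D t \<omega> *v y))"
proof -
  have tT: "t \<le> T" using t by simp
  interpret t: sigma_finite_subalgebra M "F t" by (rule sigma_finite_F[OF tT])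
  let ?f = "\<lambda>\<omega>. x \<bullet> (D t \<omega> *v y)"
  have f_F: "?f \<in> borel_measurable (F t)"
    by (intro borel_measurable_inner borel_measurable_const borel_measurable_mult_vec D_F t tT)
  have f_int: "integrable M ?f" by (rule integrable_inner_right) (rule D_vec_int[OF t(1) tT])
  have "AE \<omega> in M. - ?f \<omega> \<le> 0"
  proof (rule AE_le_of_expectations[OF tT])
    show "(\<lambda>\<omega>. - ?f \<omega>) \<in> borel_measurable (F t)" using f_F by (rule borel_measurable_uminus)
    show "integrable M (\<lambda>\<omega>. - ?f \<omega>)" using f_int by simp
    show "expectation (\<lambda>\<omega>. indicator A \<omega> * - ?f \<omega>) \<le> 0 * prob A" if "A \<in> sets (F t)" for A
      using energy_u(2)[OF that] by simp
  qed
  then have nonneg: "AE \<omega> in M. 0 \<le> ?f \<omega>" by simp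
  have "AE \<omega> in M. ennreal (?f \<omega>) = nn_cond_exp M (F t) (running_cost u) \<omega>"
  proof (rule t.nn_cond_exp_charact)
    fix A assume A: "A \<in> sets (F t)"
    have AM: "A \<in> sets M" using A sets_F_M[OF tT] by auto
    have "(\<integral>\<^sup>+\<omega>\<in>A. running_cost u \<omega> \<partial>M) = energy u A" unfolding energy_def by (simp add: mult.commute)
    also have "\<dots> = (\<integral>\<^sup>+\<omega>. ennreal (indicator A \<omega> * ?f \<omega>) \<partial>M)"
      unfolding energy_u(1)[OF A]
      by (rule nn_integral_eq_integral[symmetric, OF D_mean(1)[OF t(1) order_refl tT A]])
         (use nonneg in eventually_elim, simp)
    also have "\<dots> = (\<integral>\<^sup>+\<omega>\<in>A. ennreal (?f \<omega>) \<partial>M)" by (rule nn_integral_cong) (simp add: indicator_def)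
    finally show "(\<integral>\<^sup>+\<omega>\<in>A. running_cost u \<omega> \<partial>M) = (\<integral>\<^sup>+\<omega>\<in>A. ennreal (?f \<omega>) \<partial>M)" .
  qed (use running_cost_measurable[OF u_prog] measurable_compose[OF f_F measurable_ennreal] in simp_all)
  then show ?thesis using cost_eq[OF u_admissible] by eventually_elim simp
qed

text \<open>The process \<open>\<eta>\<^sub>s u\<^sub>s = D\<^sub>s y\<close> is the martingale with terminal value \<open>N = D\<^sub>T y\<close>. Once it is replaced by \<open>N\<close>,
  the time integral falls on \<open>w - u\<close> alone, and it vanishes, as both controls steer \<open>x\<close> to zero.\<close>

lemma cross_term_zero:
  assumes w: "w \<in> Adm" and A: "A \<in> sets (F t)"
    and sq: "integrable P (\<lambda>z. indicator A (snd z) * (norm (ext (\<lambda>s \<omega>. w s \<omega> - u s \<omega>) z))\<^sup>2)"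
    and k: "integrable P (\<lambda>z. indicator A (snd z) * (ext (\<lambda>s \<omega>. w s \<omega> - u s \<omega>) z \<bullet> (eta_ext z *v ext u z)))"
  shows "(\<integral>z. indicator A (snd z) * (ext (\<lambda>s \<omega>. w s \<omega> - u s \<omega>) z \<bullet> (eta_ext z *v ext u z)) \<partial>P) = 0"
proof -
  define h where "h = (\<lambda>s \<omega>. w s \<omega> - u s \<omega>)"
  define N where "N \<omega> = D T \<omega> *v y" for \<omega>
  let ?k = "\<lambda>z. indicator A (snd z) * (ext h z \<bullet> (eta_ext z *v ext u z))"
  let ?l = "\<lambda>z. indicator A (snd z) * (ext h z \<bullet> N (snd z))"
  let ?m = "\<lambda>z. indicator A (snd z) * (norm (ext h z))\<^sup>2 + indicator {t..T} (fst z) * (norm (N (snd z)))\<^sup>2"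
  have tT: "t \<le> T" using t by simp
  have AM: "A \<in> sets M" using A sets_F_M[OF tT] by auto
  note w' = admissibleD[OF w]
  have N_int: "integrable M N" unfolding N_def by (rule DT_int)
  have N_M: "N \<in> borel_measurable M" by (rule borel_measurable_integrable[OF N_int])
  have ext_h: "ext h z = ext w z - ext u z" for z by (simp add: ext_def h_def scaleR_diff_right)
  have h_P: "ext h \<in> borel_measurable P"
    unfolding ext_h[abs_def] by (intro borel_measurable_diff ext_measurable w' u_prog)
  have A_P: "(\<lambda>z. indicator A (snd z) :: real) \<in> borel_measurable P"
    by (rule measurable_compose[OF measurable_snd borel_measurable_indicator[OF AM]])
  have N_P: "(\<lambda>z. N (snd z)) \<in> borel_measurable P" by (rule measurable_compose[OF measurable_snd N_M])
  have m_int: "integrable P ?m"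
  proof (rule Bochner_Integration.integrable_add)
    show "integrable P (\<lambda>z. indicator A (snd z) * (norm (ext h z))\<^sup>2)" using sq unfolding h_def .
    show "integrable P (\<lambda>z. indicator {t..T} (fst z) * (norm (N (snd z)))\<^sup>2)"
    proof (rule pair.Fubini_integrable)
      have NN: "integrable M (\<lambda>\<omega>. (norm (N \<omega>))\<^sup>2)" unfolding N_def by (rule D_T_sq)
      have "(\<lambda>z. indicator {t..T} (fst z) :: real) \<in> borel_measurable P"
        by (rule measurable_compose[OF measurable_fst]) simp
      then show "(\<lambda>z. indicator {t..T} (fst z) * (norm (N (snd z)))\<^sup>2) \<in> borel_measurable P"
        by (intro borel_measurable_times borel_measurable_power measurable_compose[OF N_P borel_measurable_norm])
      show "AE s in lborel. integrable M (\<lambda>\<omega>. indicator {t..T} (fst (s, \<omega>)) * (norm (N (snd (s, \<omega>))))\<^sup>2)"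
        using NN by simp
      have "integrable lborel (\<lambda>s. indicator {t..T} s * expectation (\<lambda>\<omega>. (norm (N \<omega>))\<^sup>2))"
        by (intro integrable_mult_left integrable_real_indicator) (simp_all add: emeasure_lborel_Icc_eq)
      then show "integrable lborel (\<lambda>s. \<integral>\<omega>. norm (indicator {t..T} (fst (s, \<omega>)) * (norm (N (snd (s, \<omega>))))\<^sup>2) \<partial>M)"
        by (simp add: abs_mult)
    qed
  qed
  have l_int: "integrable P ?l"
  proof (rule Bochner_Integration.integrable_bound[OF m_int])
    show "?l \<in> borel_measurable P" by (intro borel_measurable_times A_P borel_measurable_inner h_P N_P)
    show "AE z in P. norm (?l z) \<le> norm (?m z)"
    proof (rule AE_I2)
      fix z
      show "norm (?l z) \<le> norm (?m z)"
      proof (cases "fst z \<in> {t..T} \<and> snd z \<in> A")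
        case True
        have "\<bar>ext h z \<bullet> N (snd z)\<bar> \<le> norm (ext h z) * norm (N (snd z))" by (rule Cauchy_Schwarz_ineq2)
        also have "\<dots> \<le> (norm (ext h z))\<^sup>2 + (norm (N (snd z)))\<^sup>2"
          using sum_squares_bound[of "norm (ext h z)" "norm (N (snd z))"]
            mult_nonneg_nonneg[OF norm_ge_zero[of "ext h z"] norm_ge_zero[of "N (snd z)"]] by linarith
        finally show ?thesis using True by simp
      next
        case False
        then have l0: "?l z = 0" by (auto simp: ext_def)
        show ?thesis unfolding l0 by simp
      qed
    qed
  qed
  text \<open>At almost every time \<open>s\<close>, \<open>\<eta>\<^sub>s u\<^sub>s = E[N | F\<^sub>s]\<close> may be replaced by \<open>N\<close>.\<close>
  have slice: "AE s in lborel. (\<integral>\<omega>. ?k (s, \<omega>) \<partial>M) = (\<integral>\<omega>. ?l (s, \<omega>) \<partial>M)"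
    using pair.AE_integrable_fst'[OF m_int]
  proof eventually_elim
    case (elim s)
    show ?case
    proof (cases "s \<in> {t..T}")
      case True
      then have s: "0 \<le> s" "t \<le> s" "s \<le> T" using t by auto
      let ?f = "\<lambda>\<omega>. indicator A \<omega> *\<^sub>R h s \<omega>"
      have hs_F: "h s \<in> borel_measurable (F s)"
        using prog_measurable_adapted[OF w'(1) True] prog_measurable_adapted[OF u_prog True]
        unfolding h_def by (rule borel_measurable_diff)
      have f_F: "?f \<in> borel_measurable (F s)"
        using A sets_F_mono[OF s(2)] by (intro borel_measurable_scaleR borel_measurable_indicator hs_F) auto
      have f_M: "?f \<in> borel_measurable M" by (rule measurable_F_M[OF f_F s(3)])
      have fi: "integrable M (\<lambda>\<omega>. ?f \<omega> $ i * N \<omega> $ i)" for i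
      proof (rule Bochner_Integration.integrable_bound[OF elim])
        show "(\<lambda>\<omega>. ?f \<omega> $ i * N \<omega> $ i) \<in> borel_measurable M"
          by (intro borel_measurable_times borel_measurable_vec_nth f_M N_M)
        show "AE \<omega> in M. norm (?f \<omega> $ i * N \<omega> $ i) \<le> norm (?m (s, \<omega>))"
        proof (rule AE_I2)
          fix \<omega>
          have "\<bar>h s \<omega> $ i * N \<omega> $ i\<bar> \<le> norm (h s \<omega>) * norm (N \<omega>)"
            unfolding abs_mult by (intro mult_mono component_le_norm_cart) simp_all
          also have "\<dots> \<le> (norm (h s \<omega>))\<^sup>2 + (norm (N \<omega>))\<^sup>2"
            using sum_squares_bound[of "norm (h s \<omega>)" "norm (N \<omega>)"]
              mult_nonneg_nonneg[OF norm_ge_zero[of "h s \<omega>"] norm_ge_zero[of "N \<omega>"]] by linarith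
          finally show "norm (?f \<omega> $ i * N \<omega> $ i) \<le> norm (?m (s, \<omega>))"
            using True by (simp add: indicator_def ext_def)
        qed
      qed
      have "(\<integral>\<omega>. ?k (s, \<omega>) \<partial>M) = expectation (\<lambda>\<omega>. ?f \<omega> \<bullet> (D s \<omega> *v y))"
        by (rule Bochner_Integration.integral_cong) (use True s in \<open>simp_all add: ext_def eta_ext_def u_eq' D_vec minv_eq\<close>)
      also have "\<dots> = expectation (\<lambda>\<omega>. ?f \<omega> \<bullet> cexp N s \<omega>)"
      proof (rule integral_cong_AE)
        show "(\<lambda>\<omega>. ?f \<omega> \<bullet> (D s \<omega> *v y)) \<in> borel_measurable M"
          by (intro borel_measurable_inner f_M borel_measurable_integrable[OF D_vec_int] s)
        show "(\<lambda>\<omega>. ?f \<omega> \<bullet> cexp N s \<omega>) \<in> borel_measurable M"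
          by (intro borel_measurable_inner f_M cexp_measurable s)
        show "AE \<omega> in M. ?f \<omega> \<bullet> (D s \<omega> *v y) = ?f \<omega> \<bullet> cexp N s \<omega>"
          using D_cexp[OF s(1,3), of y] unfolding N_def by eventually_elim simp
      qed
      also have "\<dots> = expectation (\<lambda>\<omega>. ?f \<omega> \<bullet> N \<omega>)"
        by (rule cexp_inner_integrable[OF N_int s(3) f_F fi])
      also have "\<dots> = (\<integral>\<omega>. ?l (s, \<omega>) \<partial>M)"
        by (rule Bochner_Integration.integral_cong) (use True in \<open>simp_all add: ext_def\<close>)
      finally show ?thesis .
    next
      case False
      then show ?thesis by (simp add: ext_def)
    qed
  qed
  have l_int': "integrable P (\<lambda>(s, \<omega>). indicator A \<omega> * (ext h (s, \<omega>) \<bullet> N \<omega>))"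
    using l_int by (simp add: case_prod_unfold)
  have kP: "integrable P ?k" using k unfolding h_def .
  have "(\<integral>z. ?k z \<partial>P) = (\<integral>s. \<integral>\<omega>. ?k (s, \<omega>) \<partial>M \<partial>lborel)" by (rule pair.integral_fst'[OF kP, symmetric])
  also have "\<dots> = (\<integral>s. \<integral>\<omega>. ?l (s, \<omega>) \<partial>M \<partial>lborel)"
    by (rule integral_cong_AE[OF _ _ slice])
       (rule borel_measurable_integrable[OF pair.integrable_fst'[OF kP]] borel_measurable_integrable[OF pair.integrable_fst'[OF l_int]])+
  also have "\<dots> = (\<integral>z. ?l z \<partial>P)" by (rule pair.integral_fst'[OF l_int])
  also have "\<dots> = (\<integral>\<omega>. \<integral>s. ?l (s, \<omega>) \<partial>lborel \<partial>M)"
    using pair.integral_snd[OF l_int'] by (simp add: case_prod_unfold)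
  also have "\<dots> = (\<integral>\<omega>. 0 \<partial>M)"
  proof (rule integral_cong_AE)
    show "(\<lambda>\<omega>. \<integral>s. ?l (s, \<omega>) \<partial>lborel) \<in> borel_measurable M"
      using borel_measurable_integrable[OF pair.integrable_snd[OF l_int']] by simp
    show "AE \<omega> in M. (\<integral>s. ?l (s, \<omega>) \<partial>lborel) = 0"
      using w'(2,3)
    proof eventually_elim
      case (elim \<omega>)
      have wi: "integrable lborel (\<lambda>s. indicator {t..T} s *\<^sub>R w s \<omega>)" using elim(1) unfolding set_integrable_def .
      have ui: "integrable lborel (\<lambda>s. indicator {t..T} s *\<^sub>R u s \<omega>)" using u_integral(1) unfolding set_integrable_def .
      have hi: "integrable lborel (\<lambda>s. ext h (s, \<omega>))"
        unfolding ext_h using wi ui by (simp add: ext_def)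
      have "(\<integral>s. ext h (s, \<omega>) \<partial>lborel) = (LINT s:{t..T}|lborel. w s \<omega>) - (LINT s:{t..T}|lborel. u s \<omega>)"
        unfolding ext_h set_lebesgue_integral_def using wi ui by (simp add: ext_def)
      also have "\<dots> = 0" using elim(2) u_integral(2) unfolding state_process_def by simp
      finally have z: "(\<integral>s. ext h (s, \<omega>) \<partial>lborel) = 0" .
      have "(\<integral>s. ?l (s, \<omega>) \<partial>lborel) = indicator A \<omega> * (\<integral>s. ext h (s, \<omega>) \<bullet> N \<omega> \<partial>lborel)" by simp
      also have "(\<integral>s. ext h (s, \<omega>) \<bullet> N \<omega> \<partial>lborel) = (\<integral>s. ext h (s, \<omega>) \<partial>lborel) \<bullet> N \<omega>"
        by (rule integral_inner_left) (rule hi)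
      finally show "(\<integral>s. ?l (s, \<omega>) \<partial>lborel) = 0" using z by simp
    qed
  qed simp
  finally show ?thesis unfolding h_def by simp
qed

lemma energy_decomposition:
  assumes w: "w \<in> Adm" and A: "A \<in> sets (F t)" and fin: "energy w A < \<infinity>"
  shows "energy w A = energy u A + energy (\<lambda>s \<omega>. w s \<omega> - u s \<omega>) A"
proof -
  define h where "h = (\<lambda>s \<omega>. w s \<omega> - u s \<omega>)"
  have tT: "t \<le> T" using t by simp
  have AM: "A \<in> sets M" using A sets_F_M[OF tT] by auto
  note w' = admissibleD[OF w]
  have ext_h: "ext h z = ext w z - ext u z" for z by (simp add: ext_def h_def scaleR_diff_right)
  have h_P: "ext h \<in> borel_measurable P"
    unfolding ext_h[abs_def] by (intro borel_measurable_diff ext_measurable w' u_prog)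
  have A_P: "(\<lambda>z. indicator A (snd z) :: real) \<in> borel_measurable P"
    by (rule measurable_compose[OF measurable_snd borel_measurable_indicator[OF AM]])
  let ?a = "\<lambda>v z. indicator A (snd z) * cost_density v z"
  let ?k = "\<lambda>z. indicator A (snd z) * (ext h z \<bullet> (eta_ext z *v ext u z))"
  have a_nonneg: "0 \<le> ?a v z" if "z \<in> space P" for v z using cost_density_nonneg[OF that] by simp
  have dens_h_P: "cost_density h \<in> borel_measurable P"
    unfolding cost_density_def[abs_def] by (intro borel_measurable_inner borel_measurable_mult_vec eta_ext_measurable h_P)
  have a_int: "integrable P (?a v)" if v: "prog_measurable F {t..T} v" "energy v A < \<infinity>" for v
  proof (rule integrableI_nonneg)
    show "?a v \<in> borel_measurable P" by (intro borel_measurable_times A_P cost_density_measurable v)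
    show "AE z in P. 0 \<le> ?a v z" by (rule AE_I2, rule a_nonneg)
    show "(\<integral>\<^sup>+z. ennreal (?a v z) \<partial>P) < \<infinity>" using v(2) unfolding energy_P[OF v(1) AM] .
  qed
  have energy_int: "energy v A = ennreal (\<integral>z. ?a v z \<partial>P)" if v: "prog_measurable F {t..T} v" "integrable P (?a v)" for v
    unfolding energy_P[OF v(1) AM]
    by (rule nn_integral_eq_integral[OF v(2)]) (rule AE_I2, rule a_nonneg)
  have aw: "integrable P (?a w)" by (rule a_int[OF w'(1) fin])
  have au: "integrable P (?a u)" by (rule a_int[OF u_prog]) (simp add: energy_u(1)[OF A])
  have sym: "ext u z \<bullet> (eta_ext z *v ext h z) = ext h z \<bullet> (eta_ext z *v ext u z)" if "z \<in> space P" for z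
    using eta_ext_psd[OF that] sym_mat_inner[of "eta_ext z" "ext u z" "ext h z"] by (simp add: psd_def inner_commute)
  have split: "cost_density w z = cost_density u z + cost_density h z + 2 * (ext h z \<bullet> (eta_ext z *v ext u z))" if "z \<in> space P" for z
  proof -
    have "ext w z = ext u z + ext h z" by (simp add: ext_h)
    then show ?thesis unfolding cost_density_def
      using sym[OF that] by (simp add: matrix_vector_right_distrib inner_add_left inner_add_right)
  qed
  \<comment> \<open>The energy of \<open>h\<close> is at most twice the sum of the energies of \<open>w\<close> and \<open>u\<close>.\<close>
  have ah: "integrable P (?a h)"
  proof (rule Bochner_Integration.integrable_bound)
    show "integrable P (\<lambda>z. 2 * ?a w z + 2 * ?a u z)"
      by (intro Bochner_Integration.integrable_add integrable_mult_right aw au)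
    show "?a h \<in> borel_measurable P" by (intro borel_measurable_times A_P dens_h_P)
    show "AE z in P. norm (?a h z) \<le> norm (2 * ?a w z + 2 * ?a u z)"
    proof (rule AE_I2)
      fix z assume z: "z \<in> space P"
      have "cost_density h z \<le> 2 * cost_density w z + 2 * cost_density u z"
        using psd_young[OF eta_ext_psd[OF z] zero_less_one, of "ext w z" "- ext u z"]
        unfolding cost_density_def ext_h using matrix_vector_mult_diff_distrib[of "eta_ext z" 0 "ext u z"] by simp
      then have "?a h z \<le> 2 * ?a w z + 2 * ?a u z" by (simp add: indicator_def)
      then show "norm (?a h z) \<le> norm (2 * ?a w z + 2 * ?a u z)" using a_nonneg[OF z, of h] by simp
    qed
  qed
  have k_eq: "?k z = (?a w z - ?a u z - ?a h z) / 2" if "z \<in> space P" for z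
    using split[OF that] by (simp add: algebra_simps)
  have k_int: "integrable P ?k"
  proof -
    have "integrable P (\<lambda>z. (?a w z - ?a u z - ?a h z) / 2)"
      by (intro integrable_divide Bochner_Integration.integrable_diff aw au ah)
    also have "?this \<longleftrightarrow> integrable P ?k"
      by (rule Bochner_Integration.integrable_cong[OF refl]) (rule k_eq[symmetric])
    finally show ?thesis .
  qed
  have sq_int: "integrable P (\<lambda>z. indicator A (snd z) * (norm (ext h z))\<^sup>2)"
  proof (rule Bochner_Integration.integrable_bound)
    show "integrable P (\<lambda>z. ?a h z / \<delta>)" using ah by (rule integrable_divide)
    show "(\<lambda>z. indicator A (snd z) * (norm (ext h z))\<^sup>2) \<in> borel_measurable P"
      by (intro borel_measurable_times A_P borel_measurable_power measurable_compose[OF h_P borel_measurable_norm])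
    show "AE z in P. norm (indicator A (snd z) * (norm (ext h z))\<^sup>2) \<le> norm (?a h z / \<delta>)"
      using AE_P_of_AE_M[OF eta_coercive] AE_space
    proof eventually_elim
      case (elim z)
      have "\<delta> * (norm (ext h z))\<^sup>2 \<le> cost_density h z"
      proof (cases "fst z \<in> {t..T}")
        case True
        then have "fst z \<in> {0..T}" using t by auto
        then show ?thesis using elim(1) by (simp add: coercive_def cost_density_def eta_ext_def)
      next
        case False
        then show ?thesis by (simp add: cost_density_def ext_def)
      qed
      then have "(norm (ext h z))\<^sup>2 \<le> cost_density h z / \<delta>" using delta by (simp add: field_simps)
      then have "indicator A (snd z) * (norm (ext h z))\<^sup>2 \<le> ?a h z / \<delta>" by (simp add: indicator_def)
      also have "\<dots> \<le> norm (?a h z / \<delta>)" unfolding real_norm_def by (rule abs_ge_self)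
      finally show ?case by simp
    qed
  qed
  have k0: "(\<integral>z. ?k z \<partial>P) = 0"
    using cross_term_zero[OF w A] sq_int k_int unfolding h_def by simp
  have "(\<integral>z. ?k z \<partial>P) = (\<integral>z. (?a w z - ?a u z - ?a h z) / 2 \<partial>P)"
    by (rule Bochner_Integration.integral_cong[OF refl]) (rule k_eq)
  also have "\<dots> = ((\<integral>z. ?a w z \<partial>P) - (\<integral>z. ?a u z \<partial>P) - (\<integral>z. ?a h z \<partial>P)) / 2"
    using aw au ah by simp
  finally have sum: "(\<integral>z. ?a w z \<partial>P) = (\<integral>z. ?a u z \<partial>P) + (\<integral>z. ?a h z \<partial>P)" using k0 by simp
  have h_prog: "prog_measurable F {t..T} h"
    using w'(1) u_prog unfolding prog_measurable_def h_def case_prod_beta by (auto intro!: borel_measurable_diff)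
  have "0 \<le> (\<integral>z. ?a v z \<partial>P)" for v by (rule integral_nonneg_AE, rule AE_I2, rule a_nonneg)
  then have "energy w A = energy u A + energy h A"
    unfolding energy_int[OF w'(1) aw] energy_int[OF u_prog au] energy_int[OF h_prog ah] sum by (simp add: ennreal_plus)
  then show ?thesis unfolding h_def .
qed

text \<open>On the event \<open>B\<close> where \<open>w\<close> is cheaper than \<open>u\<close> the energy of \<open>w\<close> is finite, so it exceeds that of \<open>u\<close>
  by the energy of the difference.\<close>

lemma cost_u_le:
  assumes w: "w \<in> Adm"
  shows "AE \<omega> in M. cost M W T \<eta> \<theta> t x u \<omega> \<le> cost M W T \<eta> \<theta> t x w \<omega>"
proof (rule ccontr)
  assume neg: "\<not> ?thesis"
  let ?Ju = "cost M W T \<eta> \<theta> t x u" and ?Jw = "cost M W T \<eta> \<theta> t x w"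
  have tT: "t \<le> T" using t by simp
  define B where "B = {\<omega> \<in> space (F t). ?Jw \<omega> < ?Ju \<omega>}"
  have B: "B \<in> sets (F t)" unfolding B_def by (rule borel_measurable_less[OF cost_F cost_F])
  have BM: "B \<in> sets M" using B sets_F_M[OF tT] by auto
  have meas: "(\<lambda>\<omega>. indicator B \<omega> * cost M W T \<eta> \<theta> t x v \<omega>) \<in> borel_measurable M" for v
    by (intro borel_measurable_times_ennreal borel_measurable_indicator BM measurable_F_M[OF cost_F tT])
  have le: "indicator B \<omega> * ?Jw \<omega> \<le> indicator B \<omega> * ?Ju \<omega>" for \<omega>
    by (auto simp: B_def indicator_def)
  have "energy w B \<le> energy u B"
    unfolding energy_cost[OF w B] energy_cost[OF u_admissible B] by (rule nn_integral_mono) (rule le)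
  also have "\<dots> < \<infinity>" unfolding energy_u(1)[OF B] by simp
  finally have fin: "energy w B < \<infinity>" .
  have "energy w B < energy u B"
    unfolding energy_cost[OF w B] energy_cost[OF u_admissible B]
  proof (rule nn_integral_less[OF meas meas])
    show "(\<integral>\<^sup>+\<omega>. indicator B \<omega> * ?Jw \<omega> \<partial>M) \<noteq> \<infinity>" using fin unfolding energy_cost[OF w B] by simp
    show "AE \<omega> in M. indicator B \<omega> * ?Jw \<omega> \<le> indicator B \<omega> * ?Ju \<omega>" by (rule AE_I2) (rule le)
    show "\<not> (AE \<omega> in M. indicator B \<omega> * ?Ju \<omega> \<le> indicator B \<omega> * ?Jw \<omega>)"
    proof
      assume "AE \<omega> in M. indicator B \<omega> * ?Ju \<omega> \<le> indicator B \<omega> * ?Jw \<omega>"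
      then have "AE \<omega> in M. ?Ju \<omega> \<le> ?Jw \<omega>" using AE_space
      proof eventually_elim
        case (elim \<omega>)
        show ?case
        proof (rule ccontr)
          assume "\<not> ?case"
          then have "\<omega> \<in> B" using elim(2) by (simp add: B_def not_le)
          then show False using elim(1) \<open>\<not> ?case\<close> by simp
        qed
      qed
      then show False using neg by blast
    qed
  qed
  also have "\<dots> \<le> energy w B" unfolding energy_decomposition[OF w B fin] by simp
  finally show False by simp
qed

lemma value_eq: "AE \<omega> in M. value_fn M W T \<eta> \<theta> t x \<omega> = cost M W T \<eta> \<theta> t x u \<omega>"
  unfolding value_fn_def
proof (rule ess_inf_unique)
  have "cost M W T \<eta> \<theta> t x u \<in> borel_measurable M" by (rule measurable_F_M[OF cost_F]) (use t in simp)
  then show "is_ess_inf M (cost M W T \<eta> \<theta> t x ` Adm) (cost M W T \<eta> \<theta> t x u)"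
    unfolding is_ess_inf_def using cost_u_le u_admissible by auto
qed

text \<open>Equal finite energies leave no energy for the difference.\<close>

lemma optimal_unique:
  assumes "optimal_control M W T \<eta> \<theta> t x w"
  shows "AE (s, \<omega>) in restrict_space lborel {t..T} \<Otimes>\<^sub>M M. w s \<omega> = u s \<omega>"
proof -
  have w: "w \<in> Adm" and opt: "AE \<omega> in M. cost M W T \<eta> \<theta> t x w \<omega> = value_fn M W T \<eta> \<theta> t x \<omega>"
    using assms unfolding optimal_control_def by simp_all
  define h where "h = (\<lambda>s \<omega>. w s \<omega> - u s \<omega>)"
  note w' = admissibleD[OF w]
  have sp: "space M \<in> sets (F t)" using sets.top[of "F t"] by simp
  have eq: "energy w (space M) = energy u (space M)"
    unfolding energy_cost[OF w sp] energy_cost[OF u_admissible sp]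
    by (rule nn_integral_cong_AE) (use opt value_eq in eventually_elim, simp)
  have fin: "energy u (space M) < \<infinity>" unfolding energy_u(1)[OF sp] by simp
  have "energy u (space M) = energy u (space M) + energy h (space M)"
    using energy_decomposition[OF w sp] fin unfolding eq h_def by simp
  then have zero: "energy h (space M) = 0" 
    using fin ennreal_add_left_cancel[of "energy u (space M)" 0 "energy h (space M)"] by auto
  have h_prog: "prog_measurable F {t..T} h"
    using w'(1) u_prog unfolding prog_measurable_def h_def case_prod_beta by (auto intro!: borel_measurable_diff)
  have ext_h: "ext h z = ext w z - ext u z" for z by (simp add: ext_def h_def scaleR_diff_right)
  have "AE z in P. ennreal (indicator (space M) (snd z) * cost_density h z) = 0"
    using zero unfolding energy_P[OF h_prog sets.top]
    by (subst (asm) nn_integral_0_iff_AE)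
       (intro measurable_compose[OF _ measurable_ennreal] borel_measurable_times cost_density_measurable[OF h_prog]
        measurable_compose[OF measurable_snd] borel_measurable_indicator sets.top)
  then have AE: "AE z in P. ext w z = ext u z" using AE_space
  proof eventually_elim
    case (elim z)
    have z: "snd z \<in> space M" using elim(2) by (auto simp: space_pair_measure)
    show ?case
    proof (cases "fst z \<in> {t..T}")
      case True
      then have s: "0 \<le> fst z" "fst z \<le> T" using t by auto
      have "cost_density h z = 0" using elim z cost_density_nonneg[OF elim(2), of h] by (simp add: ennreal_eq_0_iff)
      then have "ext h z \<bullet> (\<eta> (fst z) (snd z) *v ext h z) = 0" using s by (simp add: cost_density_def eta_ext_def)
      then have "ext h z = 0" using eta_spd[OF s z] unfolding spd_def by (metis less_irrefl)
      then show ?thesis unfolding ext_h by simp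
    next
      case False
      then show ?thesis by (simp add: ext_def)
    qed
  qed
  let ?R = "restrict_space lborel {t..T}"
  have sf: "sigma_finite_measure ?R" by (rule sigma_finite_measure_restrict_space) (simp_all add: sigma_finite_lborel)
  interpret R: pair_sigma_finite ?R M unfolding pair_sigma_finite_def using sf sigma_finite_measure_axioms by simp
  have slices: "AE s in ?R. AE \<omega> in M. ext w (s, \<omega>) = ext u (s, \<omega>)"
    using pair.AE_pair[OF AE] by (subst AE_restrict_space_iff) (auto elim: eventually_mono)
  have "(\<lambda>s. s) \<in> measurable ?R lborel" by (rule measurable_restrict_space1) simp
  from measurable_Pair[OF measurable_compose[OF measurable_fst this] measurable_snd]
  have id: "(\<lambda>z. z) \<in> measurable (?R \<Otimes>\<^sub>M M) P" by simp
  have "{z \<in> space (?R \<Otimes>\<^sub>M M). ext w z = ext u z} \<in> sets (?R \<Otimes>\<^sub>M M)"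
  proof -
    have "(\<lambda>z. norm (ext w z - ext u z)) \<in> borel_measurable (?R \<Otimes>\<^sub>M M)"
      by (rule measurable_compose[OF borel_measurable_diff[OF measurable_compose[OF id ext_measurable[OF w'(1)]]
            measurable_compose[OF id ext_measurable[OF u_prog]]] borel_measurable_norm])
    then have "{z \<in> space (?R \<Otimes>\<^sub>M M). norm (ext w z - ext u z) = 0} \<in> sets (?R \<Otimes>\<^sub>M M)"
      by (rule borel_measurable_eq) simp
    then show ?thesis by (simp only: norm_eq_zero right_minus_eq)
  qed
  from R.AE_pair_measure[OF this slices]
  have "AE z in ?R \<Otimes>\<^sub>M M. ext w z = ext u z" .
  then show ?thesis using AE_space
    by eventually_elim (auto simp: ext_def space_pair_measure space_restrict_space)
qed

theorem optimal_control_deterministic: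
  "unique_optimal_control M W T \<eta> \<theta> t x u"
  "AE \<omega> in M. value_fn M W T \<eta> \<theta> t x \<omega> = ennreal (x \<bullet> (D t \<omega> *v (matrix_inv (G t) *v x)))"
proof -
  have "AE \<omega> in M. cost M W T \<eta> \<theta> t x u \<omega> = value_fn M W T \<eta> \<theta> t x \<omega>"
    using value_eq by eventually_elim simp
  then show "unique_optimal_control M W T \<eta> \<theta> t x u"
    unfolding unique_optimal_control_def optimal_control_def using u_admissible
    by (auto intro: optimal_unique[unfolded optimal_control_def])
  show "AE \<omega> in M. value_fn M W T \<eta> \<theta> t x \<omega> = ennreal (x \<bullet> (D t \<omega> *v (matrix_inv (G t) *v x)))"
    using value_eq cost_u by eventually_elim (simp add: y_def)
qed

end

section \<open>Optimal control and minimal supersolution\<close>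

lemma supersolution_imp_process:
  fixes \<eta> Y Z :: "real \<Rightarrow> 'a \<Rightarrow> real^'n^'n"
  assumes "multiplicative_increments M W T \<eta> \<delta>" and S: "supersolution M W T \<eta> \<theta> Y Z"
  shows "\<exists>I. supersolution_process M W T \<eta> Y Z I \<delta>"
proof -
  interpret multiplicative_increments M W T \<eta> \<delta> by fact
  have 1: "prog_measurable F {0..<T} Y" "prog_measurable F {0..<T} Z"
    "\<forall>t\<in>{0..<T}. \<forall>\<omega>\<in>space M. psd (Y t \<omega>) \<and> sym_mat (Z t \<omega>)"
    and sup: "\<forall>t\<in>{0..<T}. (\<integral>\<^sup>+\<omega>. (SUP s\<in>{0..t}. ennreal ((norm (Y s \<omega>))\<^sup>2))
            + (\<integral>\<^sup>+s\<in>{0..t}. ennreal ((norm (Z s \<omega>))\<^sup>2) \<partial>lborel) \<partial>M) < \<infinity>"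
    and ex: "\<exists>I. ito_integral M W T Z I \<and>
        (AE \<omega> in M. \<forall>s t. 0 \<le> s \<and> s \<le> t \<and> t < T \<longrightarrow>
           set_integrable lborel {s..t} (\<lambda>r. Y r \<omega> ** matrix_inv (\<eta> r \<omega>) ** Y r \<omega>) \<and>
           Y t \<omega> - Y s \<omega> = (LINT r:{s..t}|lborel. Y r \<omega> ** matrix_inv (\<eta> r \<omega>) ** Y r \<omega>)
                            + (I t \<omega> - I s \<omega>))"
    and terminal: "\<forall>\<psi>. (\<forall>t\<in>{0..T}. \<psi> t \<in> borel_measurable M) \<and>
          (AE \<omega> in M. ((\<lambda>t. \<psi> t \<omega>) \<longlongrightarrow> \<psi> T \<omega>) (at_left T)) \<longrightarrow>
        (AE \<omega> in M.
           (\<psi> T \<omega> \<noteq> 0 \<longrightarrow>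
              Liminf (at_left T) (\<lambda>t. ereal (\<psi> t \<omega> \<bullet> (Y t \<omega> *v \<psi> t \<omega>))) = \<infinity>) \<and>
           (\<psi> T \<omega> = 0 \<longrightarrow>
              Liminf (at_left T) (\<lambda>t. ereal (\<psi> t \<omega> \<bullet> (Y t \<omega> *v \<psi> t \<omega>)))
                \<ge> ereal (\<psi> T \<omega> \<bullet> (\<theta> \<omega> *v \<psi> T \<omega>))))"
    using S unfolding supersolution_def by - (elim conjE, assumption)+
  obtain I where I: "ito_integral M W T Z I"
    "AE \<omega> in M. \<forall>s t. 0 \<le> s \<and> s \<le> t \<and> t < T \<longrightarrow>
           set_integrable lborel {s..t} (\<lambda>r. Y r \<omega> ** matrix_inv (\<eta> r \<omega>) ** Y r \<omega>) \<and>
           Y t \<omega> - Y s \<omega> = (LINT r:{s..t}|lborel. Y r \<omega> ** matrix_inv (\<eta> r \<omega>) ** Y r \<omega>)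
                            + (I t \<omega> - I s \<omega>)"
    using ex by (elim exE conjE) (rule that)
  have sing: "singular_at M T Y"
    unfolding singular_at_def
  proof (intro allI impI)
    fix \<psi> :: "real \<Rightarrow> 'a \<Rightarrow> real^'n"
    assume "(\<forall>t\<in>{0..T}. \<psi> t \<in> borel_measurable M) \<and> (AE \<omega> in M. ((\<lambda>t. \<psi> t \<omega>) \<longlongrightarrow> \<psi> T \<omega>) (at_left T))"
    from terminal[rule_format, OF this]
    show "AE \<omega> in M. \<psi> T \<omega> \<noteq> 0 \<longrightarrow> Liminf (at_left T) (\<lambda>t. ereal (\<psi> t \<omega> \<bullet> (Y t \<omega> *v \<psi> t \<omega>))) = \<infinity>"
      by eventually_elim (rule conjunct1)
  qed
  have "supersolution_process M W T \<eta> Y Z I \<delta>"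
  proof unfold_locales
    show "0 < \<delta>" by (rule delta)
    show "prog_measurable F {0..T} \<eta>" by (rule eta_prog)
    show "spd (\<eta> t \<omega>)" if "0 \<le> t" "t \<le> T" "\<omega> \<in> space M" for t \<omega> by (rule eta_spd[OF that])
    show "AE \<omega> in M. \<forall>t\<in>{0..T}. coercive \<delta> (\<eta> t \<omega>)" by (rule eta_coercive)
    show "prog_measurable F {0..<T} Y" "prog_measurable F {0..<T} Z" by (rule 1)+
    show "psd (Y t \<omega>)" if "0 \<le> t" "t < T" "\<omega> \<in> space M" for t \<omega> using 1(3) that by simp
    show "(\<integral>\<^sup>+\<omega>. (SUP s\<in>{0..t}. ennreal ((norm (Y s \<omega>))\<^sup>2)) \<partial>M) < \<infinity>" if t: "0 \<le> t" "t < T" for t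
    proof (rule le_less_trans)
      show "(\<integral>\<^sup>+\<omega>. (SUP s\<in>{0..t}. ennreal ((norm (Y s \<omega>))\<^sup>2)) \<partial>M)
        \<le> (\<integral>\<^sup>+\<omega>. (SUP s\<in>{0..t}. ennreal ((norm (Y s \<omega>))\<^sup>2))
            + (\<integral>\<^sup>+s\<in>{0..t}. ennreal ((norm (Z s \<omega>))\<^sup>2) \<partial>lborel) \<partial>M)"
        by (rule nn_integral_mono) simp
    qed (use sup t in simp)
    show "ito_integral M W T Z I" by (rule I(1))
  qed (rule I(2) sing)+
  then show ?thesis by (intro exI[of _ I])
qed

theorem proposition4p6:
  fixes M :: "'a measure"
    and W :: "real \<Rightarrow> 'a \<Rightarrow> real"
    and T :: real
    and \<eta> Y Z :: "real \<Rightarrow> 'a \<Rightarrow> real^'n^'n"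
    and \<theta> :: "'a \<Rightarrow> real^'n^'n"
  assumes prob: "prob_space M"
    and T: "0 < T"
    and W: "brownian_motion M T W"
    and eta_prog: "prog_measurable (bm_filtration M W) {0..T} \<eta>"
    and eta_spd: "\<forall>t\<in>{0..T}. \<forall>\<omega>\<in>space M. spd (\<eta> t \<omega>)"
    and theta_meas: "\<theta> \<in> borel_measurable (bm_filtration M W T)"
    and theta_psd: "\<forall>\<omega>\<in>space M. psd (\<theta> \<omega>)"
    and eta_lower: "\<exists>\<delta>>0. AE \<omega> in M. \<forall>t\<in>{0..T}. loewner_le (\<delta> *\<^sub>R mat 1) (\<eta> t \<omega>)"
    and eta_int: "\<forall>s t. 0 \<le> s \<and> s \<le> t \<and> t \<le> T \<longrightarrow>
        (\<integral>\<^sup>+\<omega>. ennreal (norm (\<eta> t \<omega>)) \<partial>M) < \<infinity> \<and>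
        (\<integral>\<^sup>+\<omega>. ennreal (norm (matrix_inv (\<eta> s \<omega>) ** \<eta> t \<omega>)) \<partial>M) < \<infinity>"
    and eta_sq_int: "(\<integral>\<^sup>+\<omega>. ennreal ((norm (\<eta> T \<omega>))\<^sup>2)
        + (\<integral>\<^sup>+r\<in>{0..T}. ennreal ((norm (\<eta> r \<omega>))\<^sup>2 + norm (matrix_inv (\<eta> r \<omega>))) \<partial>lborel) \<partial>M) < \<infinity>"
    and eta_umi: "uncorrelated_mult_increments M W T \<eta>"
    and YZ: "supersolution M W T \<eta> \<theta> Y Z"
    and Y: "inv_int_inv_cond_exp M W T \<eta> Y"
  shows "(\<forall>x. \<forall>t\<in>{0..<T}.
            unique_optimal_control M W T \<eta> \<theta> t x
              (\<lambda>s \<omega>. matrix_inv (LINT \<omega>'|M. \<eta> s \<omega>') *v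
                 (matrix_inv (LINT r:{t..T}|lborel. matrix_inv (LINT \<omega>'|M. \<eta> r \<omega>')) *v x)) \<and>
            (AE \<omega> in M. value_fn M W T \<eta> \<theta> t x \<omega> = ennreal (x \<bullet> (Y t \<omega> *v x)))) \<and>
         minimal_supersolution M W T \<eta> \<theta> Y Z"
proof -
  obtain \<delta> where \<delta>: "0 < \<delta>" "AE \<omega> in M. \<forall>t\<in>{0..T}. loewner_le (\<delta> *\<^sub>R mat 1) (\<eta> t \<omega>)"
    using eta_lower by blast
  interpret prob_space M by (rule prob)
  interpret brownian M W T by unfold_locales (use T W in simp_all)
  have coer: "AE \<omega> in M. \<forall>t\<in>{0..T}. coercive \<delta> (\<eta> t \<omega>)"
    using \<delta>(2) AE_space
  proof eventually_elim
    case (elim \<omega>)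
    show ?case
    proof
      fix t assume t: "t \<in> {0..T}"
      show "coercive \<delta> (\<eta> t \<omega>)"
        by (rule loewner_le_coercive[OF spd_sym]) (use elim t eta_spd in auto)
    qed
  qed
  have eta_M: "\<eta> t \<in> borel_measurable M" if "0 \<le> t" "t \<le> T" for t
    by (rule measurable_F_M[OF prog_measurable_adapted[OF eta_prog] that(2)]) (use that in simp)
  interpret multiplicative_increments M W T \<eta> \<delta>
  proof unfold_locales
    show "0 < \<delta>" by (rule \<delta>(1))
    show "prog_measurable F {0..T} \<eta>" by (rule eta_prog)
    show "spd (\<eta> t \<omega>)" if "0 \<le> t" "t \<le> T" "\<omega> \<in> space M" for t \<omega> using eta_spd that by simp
    show "AE \<omega> in M. \<forall>t\<in>{0..T}. coercive \<delta> (\<eta> t \<omega>)" by (rule coer)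
    show "integrable M (\<eta> t)" if t: "0 \<le> t" "t \<le> T" for t
      by (rule integrableI_bounded[OF eta_M[OF t]]) (use eta_int t in blast)
    show "integrable M (\<lambda>\<omega>. matrix_inv (\<eta> s \<omega>) ** \<eta> t \<omega>)" if st: "0 \<le> s" "s \<le> t" "t \<le> T" for s t
      by (rule integrableI_bounded)
         (use eta_int st in \<open>auto intro!: borel_measurable_mult_matrix borel_measurable_matrix_inv eta_M\<close>)
    show "integrable M (\<lambda>\<omega>. (norm (\<eta> T \<omega>))\<^sup>2)"
    proof (rule integrableI_nonneg)
      show "(\<lambda>\<omega>. (norm (\<eta> T \<omega>))\<^sup>2) \<in> borel_measurable M"
        using T by (intro borel_measurable_power measurable_compose[OF eta_M borel_measurable_norm]) simp_all
      show "(\<integral>\<^sup>+\<omega>. ennreal ((norm (\<eta> T \<omega>))\<^sup>2) \<partial>M) < \<infinity>"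
        by (rule le_less_trans[OF nn_integral_mono eta_sq_int]) simp
    qed simp
    show "uncorrelated_mult_increments M W T \<eta>" by (rule eta_umi)
  qed
  have MI: "multiplicative_increments M W T \<eta> \<delta>" by unfold_locales
  show ?thesis
  proof (intro conjI allI ballI)
    fix x :: "real^'n" and t assume t: "t \<in> {0..<T}"
    let ?u = "\<lambda>s \<omega>. matrix_inv (LINT \<omega>'|M. \<eta> s \<omega>') *v
                 (matrix_inv (LINT r:{t..T}|lborel. matrix_inv (LINT \<omega>'|M. \<eta> r \<omega>')) *v x)"
    have minv: "matrix_inv (LINT \<omega>'|M. \<eta> r \<omega>') = minv r" if "r \<in> {t..T}" for r
      using that t minv_eq[of r] unfolding mbar_def by simp
    have G: "(LINT r:{t..T}|lborel. matrix_inv (LINT \<omega>'|M. \<eta> r \<omega>')) = G t"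
      unfolding G_def by (rule set_lebesgue_integral_cong) (simp_all add: minv)
    interpret control_problem M W T \<eta> \<delta> \<theta> t x ?u
      by unfold_locales (use theta_meas t minv in \<open>simp_all add: G\<close>)
    show "unique_optimal_control M W T \<eta> \<theta> t x ?u" by (rule optimal_control_deterministic(1))
    have t': "0 \<le> t" "t < T" using t by simp_all
    show "AE \<omega> in M. value_fn M W T \<eta> \<theta> t x \<omega> = ennreal (x \<bullet> (Y t \<omega> *v x))"
      using optimal_control_deterministic(2) inv_int_inv_cond_exp_eq[OF Y t']
      by eventually_elim (simp add: matrix_vector_mul_assoc)
  next
    obtain I where S: "supersolution_process M W T \<eta> Y Z I \<delta>" using supersolution_imp_process[OF MI YZ] ..
    show "minimal_supersolution M W T \<eta> \<theta> Y Z"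
      unfolding minimal_supersolution_def
    proof (intro conjI allI impI)
      show "supersolution M W T \<eta> \<theta> Y Z" by (rule YZ)
      fix Y' Z' assume "supersolution M W T \<eta> \<theta> Y' Z'"
      then obtain I' where S': "supersolution_process M W T \<eta> Y' Z' I' \<delta>" using supersolution_imp_process[OF MI] by blast
      show "AE \<omega> in M. \<forall>t\<in>{0..<T}. loewner_le (Y t \<omega>) (Y' t \<omega>)"
        by (rule inv_int_inv_cond_exp_minimal[OF S S' Y])
    qed
  qed
qed

end
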